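(* Assume (FR), (NR) and (NS). Then: (i) the map sending the class of $M\in F$ to the class of $(\rho_1(M),\rho_2(M),\rho_3(M),\rho_4(M))$ induces an injective morphism $\mathcal F\to\mathcal S_{\underline A}$ and a bijection $\mathcal F\to\mathcal S^*_{\underline A}:=\mathcal S_{\underline A}\setminus\mathcal X$; (ii) the morphism $\mathcal F\to\mathcal S^*_{\underline A}$ is an isomorphism of algebraic varieties; (iii) the geometric quotient $\mathcal F$ is smooth; (iv) the algebraic variety $\mathcal S^*_{\underline A}$ is separated.
   Context: Conventions. Varieties are algebraic varieties over $\mathbf C$: reduced, not necessarily affine, irreducible or separated. Fix $q\in\mathbf C^*$, $|q|<1$; for $c,d\in\mathbf C^*$ write $c\equiv d$ iff $c/d\in q^{\mathbf Z}$. Parameters: $\rho_1,\rho_2,\sigma_1,\sigma_2,x_1,\dots,x_4\in\mathbf C^*$, with conditions: (NR) $\rho_1\not\equiv\rho_2$, $\sigma_1\not\equiv\sigma_2$, and $x_k\not\equiv x_l$ for $k\ne l$; (FR) $x_1x_2x_3x_4=\rho_1\rho_2/(\sigma_1\sigma_2)$; (NS) $\rho_i/\sigma_j\not\equiv x_kx_l$ for all $i,j\in\{1,2\}$, $k\neq l$. $V_{i,j}:=\{m\in\mathcal O(\mathbf C^* )\mid m(qx)=(\rho_i/\sigma_j)x^{-2}m(x)\}$ (dimension 2), $V:=\prod_{i,j\in\{1,2\}}V_{i,j}$ (elements are $2\times 2$ matrices $M=(m_{i,j})$), $V^{( * )}:=\prod(V_{i,j}\setminus\{0\})$. The torus $H:=(D_2(\mathbf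 C)\times D_2(\mathbf C))/\mathbf C^*(I_2,I_2)$ ($D_2(\mathbf C)$: invertible diagonal matrices) acts by $(\Gamma,\Delta).M=\Gamma M\Delta^{-1}$, and $V^{( * )}$ has a geometric quotient $V^{( * )}/H$. $F:=\{M\in V\mid\det M\not\equiv0,\ \det M(x_k)=0,\ k=1,\dots,4\}\subset V^{( * )}$, and $\mathcal F\subset V^{( * )}/H$ is its image, a subvariety; $F\to\mathcal F$ is a geometric quotient. (The letters $\rho_k$ below, $k=1,\dots,4$, denote maps or coordinates on $\mathbf P^1(\mathbf C)=\mathbf C\cup\{\infty\}$, not the parameters $\rho_1,\rho_2$.) For $M\in V$ such that $M(x_k)$ has rank 1 for all $k$, let $\rho_k(M)\in\mathbf P^1(\mathbf C)$ be the common value of $m_{i,2}(x_k)/m_{i,1}(x_k)$, $i=1,2$ (omitting an index $i$ for which the $i$-th row of $M(x_k)$ vanishes). This applies to all $M\in F$ and also to all $M\in V^{( * )}$ with $\det M\equiv0$. $\Theta_4:=\{0,\infty\}^4\subset(\mathbf P^1(\mathbf C))^4$ is the set of fixed points of the diagonal $\mathbf C^*$-action $\lambda.(\rho_k)=(\lambda\rho_k)$; $\mathcal K_4:=\left((\mathbf P^1(\mathbf C))^4\setminus\Theta_4\right)/\mathbf C^*$ is the (non separated) geometric quotient, obtained by gluing the projective spaces $(U_p\setminus\{p\})/\mathbf C^*\simeq\mathbf P^3(\mathbf C)$, $p\in\Theta_4$, where $U_p\simeq\mathbf C^4$ is the open set of points with no coordinate $k$ equal to the element of $\{0,\infty\}$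 other than $p_k$. For $M\in F$, $(\rho_k(M))_k\notin\Theta_4$. For $j=1,2$ define $\lambda_{1,j},\mu_{1,j},\lambda'_{1,j},\mu'_{1,j}\in\mathbf C^*$ by $m(x_3)=\lambda_{1,j}m(x_1)+\mu_{1,j}m(x_2)$ and $m(x_4)=\lambda'_{1,j}m(x_1)+\mu'_{1,j}m(x_2)$ for all $m\in V_{1,j}$. Let $\underline A=(A,B,C,D,E,F_0)$ be the coefficients of the quadratic form in $(\rho_1,\dots,\rho_4)$ $$\Phi_{\underline A}=(\lambda_{1,2}\rho_1-\lambda_{1,1}\rho_3)(\mu'_{1,2}\rho_2-\mu'_{1,1}\rho_4)-(\lambda'_{1,2}\rho_1-\lambda'_{1,1}\rho_4)(\mu_{1,2}\rho_2-\mu_{1,1}\rho_3)$$ $$=A\rho_1\rho_2+B\rho_3\rho_4+C\rho_1\rho_3-D\rho_1\rho_4-E\rho_2\rho_3+F_0\rho_2\rho_4.$$ $S_{\underline A}\subset(\mathbf P^1(\mathbf C))^4$ is the closed hypersurface defined by the multihomogenization of $\Phi_{\underline A}$ (degree 1 in each pair of homogeneous coordinates $[\rho_k^x:\rho_k^y]$, $\rho_k=\rho_k^x/\rho_k^y$); it is $\mathbf C^*$-invariant, and $\mathcal S_{\underline A}$ is the image of $S_{\underline A}\setminus\Theta_4$ in $\mathcal K_4$. $X$ is the Zariski closure in $(\mathbf P^1(\mathbf C))^4$ of $\{(\rho_k(M))_k\mid M\in V^{( * )},\ \det M\equiv0\}$; it is $\mathbf C^*$-invariant and contained in $S_{\underline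 A}$; $\mathcal X:=(X\setminus\Theta_4)/\mathbf C^*\subset\mathcal K_4$. *)

theory Defs
  imports "HOL-Complex_Analysis.Complex_Analysis"
begin

(* keeps "$" for vector components only *)
no_notation fps_nth (infixl "$" 75)

section \<open>Spaces with functions and algebraic varieties over the complex numbers\<close>

text \<open>
  Reduced varieties over an algebraically closed field are treated in the classical way, as
  topological spaces equipped with a sheaf of complex-valued functions (Serre, Springer, Kempf).
  No separation, irreducibility or affineness is built in.

  In \<open>regular X U f\<close> only the values of \<open>f\<close> on the open set \<open>U\<close> matter.
\<close>

record 'a fn_space =
  zariski :: "'a topology"
  regular :: "'a set \<Rightarrow> ('a \<Rightarrow> complex) \<Rightarrow> bool"

abbreviation points :: "('a, 'r) fn_space_scheme \<Rightarrow> 'a set" where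
  "points X \<equiv> topspace (zariski X)"

inductive_set generated_algebra :: "('a \<Rightarrow> complex) set \<Rightarrow> ('a \<Rightarrow> complex) set"
  for G :: "('a \<Rightarrow> complex) set"
where
  gen: "g \<in> G \<Longrightarrow> g \<in> generated_algebra G"
| const: "(\<lambda>_. c) \<in> generated_algebra G"
| add: "f \<in> generated_algebra G \<Longrightarrow> g \<in> generated_algebra G \<Longrightarrow> (\<lambda>x. f x + g x) \<in> generated_algebra G"
| mult: "f \<in> generated_algebra G \<Longrightarrow> g \<in> generated_algebra G \<Longrightarrow> (\<lambda>x. f x * g x) \<in> generated_algebra G"

text \<open>The space on \<open>S\<close> whose principal open sets and whose local fractions come from the algebra \<open>A\<close>.\<close>

definition algebra_space :: "'a set \<Rightarrow> ('a \<Rightarrow> complex) set \<Rightarrow> 'a fn_space" where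
  "algebra_space S A =
     (let T = topology_generated_by {{x \<in> S. h x \<noteq> 0} | h. h \<in> A} in
      \<lparr> zariski = T,
        regular = (\<lambda>U f. openin T U \<and>
          (\<forall>x\<in>U. \<exists>g\<in>A. \<exists>h\<in>A. h x \<noteq> 0 \<and> (\<forall>y\<in>U. h y \<noteq> 0 \<longrightarrow> f y = g y / h y))) \<rparr>)"

text \<open>Affine \<open>n\<close>-space; points are sequences vanishing from index \<open>n\<close> on, so that \<open>n\<close> can be a
  natural number rather than a type.\<close>

definition polynomial_functions :: "nat \<Rightarrow> ((nat \<Rightarrow> complex) \<Rightarrow> complex) set" where
  "polynomial_functions n = generated_algebra {(\<lambda>z. z i) | i. i < n}"

definition affine_space :: "nat \<Rightarrow> (nat \<Rightarrow> complex) fn_space" where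
  "affine_space n = algebra_space {z. \<forall>i\<ge>n. z i = 0} (polynomial_functions n)"

text \<open>The induced structure on a (locally closed) subset: regular functions are the functions that are
  locally restrictions of regular functions of the ambient space.\<close>

definition subspace_of :: "'a fn_space \<Rightarrow> 'a set \<Rightarrow> 'a fn_space" where
  "subspace_of X Y =
     (let T = subtopology (zariski X) Y in
      \<lparr> zariski = T,
        regular = (\<lambda>U f. openin T U \<and>
          (\<forall>x\<in>U. \<exists>W g. x \<in> W \<and> regular X W g \<and> (\<forall>y\<in>U \<inter> W. f y = g y))) \<rparr>)"

text \<open>Final structure along a map \<open>p\<close>: the quotient topology, and as regular functions those whose
  pullback is regular. For \<open>p\<close> the map sending a point to its orbit under a group, the
  pullbacks are exactly the invariant regular functions on saturated open sets, so that this is the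
  geometric quotient.\<close>

definition quotient_topology :: "'a topology \<Rightarrow> ('a \<Rightarrow> 'b) \<Rightarrow> 'b topology" where
  "quotient_topology T p =
     topology (\<lambda>U. U \<subseteq> p ` topspace T \<and> openin T {x \<in> topspace T. p x \<in> U})"

lemma openin_quotient_topology:
  "openin (quotient_topology T p) U \<longleftrightarrow>
     U \<subseteq> p ` topspace T \<and> openin T {x \<in> topspace T. p x \<in> U}"
proof -
  let ?P = "\<lambda>U. {x \<in> topspace T. p x \<in> U}"
  have inter: "?P (S \<inter> S') = ?P S \<inter> ?P S'" for S S'
    by blast
  have union: "?P (\<Union>K) = \<Union>(?P ` K)" for K
    by blast
  have "istopology (\<lambda>U. U \<subseteq> p ` topspace T \<and> openin T (?P U))"
    unfolding istopology_def inter union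
    by (intro conjI allI impI openin_Int openin_Union Union_least; blast)
  then show ?thesis
    by (simp add: quotient_topology_def topology_inverse')
qed

definition quotient_space :: "'a fn_space \<Rightarrow> ('a \<Rightarrow> 'b) \<Rightarrow> 'b fn_space" where
  "quotient_space X p =
     (let T = quotient_topology (zariski X) p in
      \<lparr> zariski = T,
        regular = (\<lambda>U f. openin T U \<and> regular X {x \<in> points X. p x \<in> U} (\<lambda>x. f (p x))) \<rparr>)"

text \<open>The product of copies of \<open>X\<close> indexed by the type \<open>'n\<close>. Note that its topology is in general finer
  than the product topology: basic open sets are nonvanishing loci of sums of products of functions
  regular on the factors of an open box.\<close>

definition box_functions :: "'a fn_space \<Rightarrow> ('n::finite \<Rightarrow> 'a set) \<Rightarrow> ('a^'n \<Rightarrow> complex) set" where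
  "box_functions X U = generated_algebra {(\<lambda>x. f (x$i)) | i f. regular X (U i) f}"

definition power_space :: "'a fn_space \<Rightarrow> ('a^'n::finite) fn_space" where
  "power_space X =
     (let T = topology_generated_by
            {{x. (\<forall>i. x$i \<in> U i) \<and> h x \<noteq> 0} | U h.
               (\<forall>i. openin (zariski X) (U i)) \<and> h \<in> box_functions X U} in
      \<lparr> zariski = T,
        regular = (\<lambda>W f. openin T W \<and>
          (\<forall>x\<in>W. \<exists>U. (\<forall>i. openin (zariski X) (U i)) \<and> (\<forall>i. x$i \<in> U i) \<and>
             (\<exists>g\<in>box_functions X U. \<exists>h\<in>box_functions X U. h x \<noteq> 0 \<and>
                (\<forall>y\<in>W. (\<forall>i. y$i \<in> U i) \<and> h y \<noteq> 0 \<longrightarrow> f y = g y / h y)))) \<rparr>)"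

definition fn_space_morphism :: "'a fn_space \<Rightarrow> 'b fn_space \<Rightarrow> ('a \<Rightarrow> 'b) \<Rightarrow> bool" where
  "fn_space_morphism X Y \<phi> \<longleftrightarrow>
     continuous_map (zariski X) (zariski Y) \<phi> \<and>
     (\<forall>U f. regular Y U f \<longrightarrow> regular X {x \<in> points X. \<phi> x \<in> U} (\<lambda>x. f (\<phi> x)))"

definition fn_space_isomorphism :: "'a fn_space \<Rightarrow> 'b fn_space \<Rightarrow> ('a \<Rightarrow> 'b) \<Rightarrow> bool" where
  "fn_space_isomorphism X Y \<phi> \<longleftrightarrow> fn_space_morphism X Y \<phi> \<and>
     (\<exists>\<psi>. fn_space_morphism Y X \<psi> \<and>
        (\<forall>x\<in>points X. \<psi> (\<phi> x) = x) \<and> (\<forall>y\<in>points Y. \<phi> (\<psi> y) = y))"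

definition is_sheaf :: "'a fn_space \<Rightarrow> bool" where
  "is_sheaf X \<longleftrightarrow> (\<forall>U f. regular X U f \<longleftrightarrow> openin (zariski X) U \<and>
     (\<forall>x\<in>U. \<exists>W g. x \<in> W \<and> regular X W g \<and> (\<forall>y\<in>U \<inter> W. f y = g y)))"

definition affine_variety :: "'a fn_space \<Rightarrow> bool" where
  "affine_variety X \<longleftrightarrow>
     (\<exists>n Z \<phi>. closedin (zariski (affine_space n)) Z \<and>
        fn_space_isomorphism X (subspace_of (affine_space n) Z) \<phi>)"

definition algebraic_variety :: "'a fn_space \<Rightarrow> bool" where
  "algebraic_variety X \<longleftrightarrow> is_sheaf X \<and>
     (\<exists>\<U>. finite \<U> \<and> \<Union>\<U> = points X \<and>
        (\<forall>U\<in>\<U>. openin (zariski X) U \<and> affine_variety (subspace_of X U)))"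

definition variety_morphism :: "'a fn_space \<Rightarrow> 'b fn_space \<Rightarrow> ('a \<Rightarrow> 'b) \<Rightarrow> bool" where
  "variety_morphism X Y \<phi> \<longleftrightarrow>
     algebraic_variety X \<and> algebraic_variety Y \<and> fn_space_morphism X Y \<phi>"

definition variety_isomorphism :: "'a fn_space \<Rightarrow> 'b fn_space \<Rightarrow> ('a \<Rightarrow> 'b) \<Rightarrow> bool" where
  "variety_isomorphism X Y \<phi> \<longleftrightarrow>
     algebraic_variety X \<and> algebraic_variety Y \<and> fn_space_isomorphism X Y \<phi>"

definition separated_variety :: "'a fn_space \<Rightarrow> bool" where
  "separated_variety X \<longleftrightarrow> algebraic_variety X \<and>
     closedin (zariski (power_space X :: ('a^2) fn_space)) {d. d$1 \<in> points X \<and> d$2 = d$1}"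

text \<open>Smoothness in the Jacobian form: near the point, the variety is isomorphic to an open piece of
  the locus \<open>f\<^sub>0 = \<dots> = f\<^sub>c\<^sub>-\<^sub>1 = 0\<close> in affine \<open>n\<close>-space, where the \<open>c\<close> differentials are linearly
  independent at the point.\<close>

definition smooth_at_point :: "'a fn_space \<Rightarrow> 'a \<Rightarrow> bool" where
  "smooth_at_point X x \<longleftrightarrow>
     (\<exists>U n c W (f :: nat \<Rightarrow> (nat \<Rightarrow> complex) \<Rightarrow> complex) \<phi>.
        openin (zariski X) U \<and> x \<in> U \<and>
        openin (zariski (affine_space n)) W \<and>
        (\<forall>i<c. f i \<in> polynomial_functions n) \<and>
        fn_space_isomorphism (subspace_of X U)
          (subspace_of (affine_space n) {z \<in> W. \<forall>i<c. f i z = 0}) \<phi> \<and>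
        (\<forall>a :: nat \<Rightarrow> complex.
           (\<forall>j<n. (\<Sum>i<c. a i * deriv (\<lambda>t. f i ((\<phi> x)(j := t))) (\<phi> x j)) = 0)
             \<longrightarrow> (\<forall>i<c. a i = 0)))"

definition smooth_variety :: "'a fn_space \<Rightarrow> bool" where
  "smooth_variety X \<longleftrightarrow> algebraic_variety X \<and> (\<forall>x\<in>points X. smooth_at_point X x)"


section \<open>The spaces of matrices and their quotients\<close>

definition q_equiv :: "complex \<Rightarrow> complex \<Rightarrow> complex \<Rightarrow> bool" where
  "q_equiv q c d \<longleftrightarrow> (\<exists>n::int. c / d = q powi n)"

text \<open>Functions on the punctured plane are represented by functions on the plane with value 0 at 0.\<close>

definition V_entry :: "complex \<Rightarrow> complex^2 \<Rightarrow> complex^2 \<Rightarrow> 2 \<Rightarrow> 2 \<Rightarrow> (complex \<Rightarrow> complex) set" where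
  "V_entry q \<rho> \<sigma> i j =
     {m. m holomorphic_on (UNIV - {0}) \<and> m 0 = 0 \<and>
         (\<forall>x. x \<noteq> 0 \<longrightarrow> m (q * x) = (\<rho>$i / \<sigma>$j) * x powi (-2) * m x)}"

type_synonym fn_matrix = "(complex \<Rightarrow> complex)^2^2"

definition at_point :: "fn_matrix \<Rightarrow> complex \<Rightarrow> complex^2^2" where
  "at_point M x = (\<chi> i j. (M$i$j) x)"

definition V_set :: "complex \<Rightarrow> complex^2 \<Rightarrow> complex^2 \<Rightarrow> fn_matrix set" where
  "V_set q \<rho> \<sigma> = {M. \<forall>i j. M$i$j \<in> V_entry q \<rho> \<sigma> i j}"

definition linear_functionals :: "fn_matrix set \<Rightarrow> (fn_matrix \<Rightarrow> complex) set" where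
  "linear_functionals W =
     {l. \<forall>M\<in>W. \<forall>N\<in>W. \<forall>a b.
        l (\<chi> i j. (\<lambda>x. a * (M$i$j) x + b * (N$i$j) x)) = a * l M + b * l N}"

text \<open>The finite-dimensional vector space \<open>V\<close> as an affine space, in a coordinate-free way.\<close>

definition V_space :: "complex \<Rightarrow> complex^2 \<Rightarrow> complex^2 \<Rightarrow> fn_matrix fn_space" where
  "V_space q \<rho> \<sigma> =
     algebra_space (V_set q \<rho> \<sigma>) (generated_algebra (linear_functionals (V_set q \<rho> \<sigma>)))"

definition V_star :: "complex \<Rightarrow> complex^2 \<Rightarrow> complex^2 \<Rightarrow> fn_matrix set" where
  "V_star q \<rho> \<sigma> = {M \<in> V_set q \<rho> \<sigma>. \<forall>i j. M$i$j \<noteq> (\<lambda>_. 0)}"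

definition D2 :: "(complex^2^2) set" where
  "D2 = {\<Gamma>. invertible \<Gamma> \<and> (\<forall>i j. i \<noteq> j \<longrightarrow> \<Gamma>$i$j = 0)}"

text \<open>The subgroup of pairs of equal scalar matrices acts trivially, so orbits of the product
  \<open>D2 \<times> D2\<close> are orbits of the torus \<open>H\<close>.\<close>

definition H_action :: "complex^2^2 \<Rightarrow> complex^2^2 \<Rightarrow> fn_matrix \<Rightarrow> fn_matrix" where
  "H_action \<Gamma> \<Delta> M = (\<chi> i j. (\<lambda>x. (\<Gamma> ** at_point M x ** matrix_inv \<Delta>)$i$j))"

definition H_orbit :: "fn_matrix \<Rightarrow> fn_matrix set" where
  "H_orbit M = {H_action \<Gamma> \<Delta> M | \<Gamma> \<Delta>. \<Gamma> \<in> D2 \<and> \<Delta> \<in> D2}"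

definition V_star_mod_H :: "complex \<Rightarrow> complex^2 \<Rightarrow> complex^2 \<Rightarrow> fn_matrix set fn_space" where
  "V_star_mod_H q \<rho> \<sigma> = quotient_space (subspace_of (V_space q \<rho> \<sigma>) (V_star q \<rho> \<sigma>)) H_orbit"

definition F_set :: "complex \<Rightarrow> complex^2 \<Rightarrow> complex^2 \<Rightarrow> complex^4 \<Rightarrow> fn_matrix set" where
  "F_set q \<rho> \<sigma> x =
     {M \<in> V_set q \<rho> \<sigma>. (\<exists>z. z \<noteq> 0 \<and> det (at_point M z) \<noteq> 0) \<and> (\<forall>k. det (at_point M (x$k)) = 0)}"

definition F_variety ::
  "complex \<Rightarrow> complex^2 \<Rightarrow> complex^2 \<Rightarrow> complex^4 \<Rightarrow> fn_matrix set fn_space" where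
  "F_variety q \<rho> \<sigma> x = subspace_of (V_star_mod_H q \<rho> \<sigma>) (H_orbit ` F_set q \<rho> \<sigma> x)"


section \<open>The projective line and the quotient of its fourth power\<close>

datatype proj1 = Fin complex | Infty

text \<open>The point of the projective line with homogeneous coordinates \<open>[u : v]\<close>, that is, \<open>u/v\<close>.\<close>

definition ratio :: "complex \<Rightarrow> complex \<Rightarrow> proj1" where
  "ratio u v = (if v = 0 then Infty else Fin (u / v))"

definition P1 :: "proj1 fn_space" where
  "P1 = quotient_space (subspace_of (affine_space 2) {z. (z 0, z 1) \<noteq> (0, 0)})
          (\<lambda>z. ratio (z 0) (z 1))"

definition P1_4 :: "(proj1^4) fn_space" where
  "P1_4 = power_space P1"

definition Theta4 :: "(proj1^4) set" where
  "Theta4 = {r. \<forall>k. r$k \<in> {Fin 0, Infty}}"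

fun scale :: "complex \<Rightarrow> proj1 \<Rightarrow> proj1" where
  "scale t (Fin z) = Fin (t * z)"
| "scale t Infty = Infty"

definition torus_orbit :: "proj1^4 \<Rightarrow> (proj1^4) set" where
  "torus_orbit r = {(\<chi> k. scale t (r$k)) | t. t \<noteq> 0}"

definition K4 :: "(proj1^4) set fn_space" where
  "K4 = quotient_space (subspace_of P1_4 (UNIV - Theta4)) torus_orbit"

definition rho_coord :: "complex \<Rightarrow> fn_matrix \<Rightarrow> proj1" where
  "rho_coord a M =
     (THE r. \<forall>i. at_point M a $ i \<noteq> 0 \<longrightarrow> r = ratio (at_point M a $ i $ 2) (at_point M a $ i $ 1))"

definition rho_map :: "complex^4 \<Rightarrow> fn_matrix \<Rightarrow> proj1^4" where
  "rho_map x M = (\<chi> k. rho_coord (x$k) M)"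


section \<open>The hypersurface and the exceptional locus\<close>

text \<open>The pair \<open>(s, t)\<close> with \<open>m c = s * m a + t * m b\<close> for all \<open>m\<close> in the space \<open>W\<close>.\<close>

definition interpolation :: "(complex \<Rightarrow> complex) set \<Rightarrow> complex \<Rightarrow> complex \<Rightarrow> complex \<Rightarrow> complex \<times> complex" where
  "interpolation W a b c = (THE p. \<forall>m\<in>W. m c = fst p * m a + snd p * m b)"

text \<open>In the following, \<open>l\<close>, \<open>m\<close>, \<open>l'\<close>, \<open>m'\<close> stand for the vectors, indexed by \<open>j\<close>, of the constants
  \<open>\<lambda>\<^sub>1\<^sub>j\<close>, \<open>\<mu>\<^sub>1\<^sub>j\<close>, \<open>\<lambda>'\<^sub>1\<^sub>j\<close>, \<open>\<mu>'\<^sub>1\<^sub>j\<close>. The quadratic form \<open>\<Phi>\<close> is given by its defining product expression; the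
  lemma \<open>Phi_expand\<close> confirms its coefficients.\<close>

definition Phi :: "complex^2 \<Rightarrow> complex^2 \<Rightarrow> complex^2 \<Rightarrow> complex^2 \<Rightarrow> complex^4 \<Rightarrow> complex" where
  "Phi l m l' m' r =
     (l$2 * r$1 - l$1 * r$3) * (m'$2 * r$2 - m'$1 * r$4) -
     (l'$2 * r$1 - l'$1 * r$4) * (m$2 * r$2 - m$1 * r$3)"

record quad_coeffs =
  cA :: complex
  cB :: complex
  cC :: complex
  cD :: complex
  cE :: complex
  cF :: complex

definition Phi_coeffs :: "complex^2 \<Rightarrow> complex^2 \<Rightarrow> complex^2 \<Rightarrow> complex^2 \<Rightarrow> quad_coeffs" where
  "Phi_coeffs l m l' m' =
     \<lparr> cA = l$2 * m'$2 - l'$2 * m$2,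
       cB = l$1 * m'$1 - l'$1 * m$1,
       cC = l'$2 * m$1,
       cD = l$2 * m'$1,
       cE = l$1 * m'$2,
       cF = l'$1 * m$2 \<rparr>"

lemma Phi_expand:
  "Phi l m l' m' r =
     (let A = Phi_coeffs l m l' m' in
      cA A * r$1 * r$2 + cB A * r$3 * r$4 + cC A * r$1 * r$3
      - cD A * r$1 * r$4 - cE A * r$2 * r$3 + cF A * r$2 * r$4)"
  by (simp add: Phi_def Phi_coeffs_def Let_def algebra_simps)

text \<open>Multihomogenization, of degree 1 in each pair \<open>(X$k, Y$k)\<close>.\<close>

definition Phi_hom :: "quad_coeffs \<Rightarrow> complex^4 \<Rightarrow> complex^4 \<Rightarrow> complex" where
  "Phi_hom A X Y =
     cA A * X$1 * X$2 * Y$3 * Y$4 + cB A * Y$1 * Y$2 * X$3 * X$4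
     + cC A * X$1 * Y$2 * X$3 * Y$4 - cD A * X$1 * Y$2 * Y$3 * X$4
     - cE A * Y$1 * X$2 * X$3 * Y$4 + cF A * Y$1 * X$2 * Y$3 * X$4"

lemma Phi_hom_dehomogenize:
  assumes "\<And>k. Y$k \<noteq> 0"
  shows "Phi_hom (Phi_coeffs l m l' m') X Y =
    Y$1 * Y$2 * Y$3 * Y$4 * Phi l m l' m' (\<chi> k. X$k / Y$k)"
  using assms[of 1] assms[of 2] assms[of 3] assms[of 4]
  by (simp add: Phi_hom_def Phi_expand Let_def field_simps)

definition S_hypersurface :: "quad_coeffs \<Rightarrow> (proj1^4) set" where
  "S_hypersurface A =
     {r. \<forall>X Y. (\<forall>k. (X$k, Y$k) \<noteq> (0, 0) \<and> r$k = ratio (X$k) (Y$k)) \<longrightarrow> Phi_hom A X Y = 0}"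

definition A_coeffs :: "complex \<Rightarrow> complex^2 \<Rightarrow> complex^2 \<Rightarrow> complex^4 \<Rightarrow> quad_coeffs" where
  "A_coeffs q \<rho> \<sigma> x =
     (let p = (\<lambda>j. interpolation (V_entry q \<rho> \<sigma> 1 j) (x$1) (x$2) (x$3));
          p' = (\<lambda>j. interpolation (V_entry q \<rho> \<sigma> 1 j) (x$1) (x$2) (x$4))
      in Phi_coeffs (\<chi> j. fst (p j)) (\<chi> j. snd (p j)) (\<chi> j. fst (p' j)) (\<chi> j. snd (p' j)))"

definition X_closure :: "complex \<Rightarrow> complex^2 \<Rightarrow> complex^2 \<Rightarrow> complex^4 \<Rightarrow> (proj1^4) set" where
  "X_closure q \<rho> \<sigma> x =
     zariski P1_4 closure_of
       (rho_map x ` {M \<in> V_star q \<rho> \<sigma>. \<forall>z. z \<noteq> 0 \<longrightarrow> det (at_point M z) = 0})"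

definition S_quotient :: "complex \<Rightarrow> complex^2 \<Rightarrow> complex^2 \<Rightarrow> complex^4 \<Rightarrow> (proj1^4) set set" where
  "S_quotient q \<rho> \<sigma> x = torus_orbit ` (S_hypersurface (A_coeffs q \<rho> \<sigma> x) - Theta4)"

definition X_quotient :: "complex \<Rightarrow> complex^2 \<Rightarrow> complex^2 \<Rightarrow> complex^4 \<Rightarrow> (proj1^4) set set" where
  "X_quotient q \<rho> \<sigma> x = torus_orbit ` (X_closure q \<rho> \<sigma> x - Theta4)"

definition S_variety :: "complex \<Rightarrow> complex^2 \<Rightarrow> complex^2 \<Rightarrow> complex^4 \<Rightarrow> (proj1^4) set fn_space" where
  "S_variety q \<rho> \<sigma> x = subspace_of K4 (S_quotient q \<rho> \<sigma> x)"

definition S_star_variety :: "complex \<Rightarrow> complex^2 \<Rightarrow> complex^2 \<Rightarrow> complex^4 \<Rightarrow> (proj1^4) set fn_space" where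
  "S_star_variety q \<rho> \<sigma> x = subspace_of K4 (S_quotient q \<rho> \<sigma> x - X_quotient q \<rho> \<sigma> x)"

end

theory Submission
  imports Defs
begin

text \<open>
  A matrix \<open>M\<close> of the family is recovered from the kernels of the four matrices \<open>M(x\<^sub>k)\<close>. Write
  \<open>\<rho>\<^sub>k = X\<^sub>k / Y\<^sub>k\<close>. A row \<open>f = (f\<^sub>1, f\<^sub>2)\<close> of index \<open>i\<close> is compatible with these kernel coordinates iff
  \<open>X\<^sub>k f\<^sub>1(x\<^sub>k) = Y\<^sub>k f\<^sub>2(x\<^sub>k)\<close> for all \<open>k\<close>: four linear conditions on a space of dimension four. Using the
  interpolation at \<open>x\<^sub>1\<close> and \<open>x\<^sub>2\<close>, which (NS) makes possible, the vanishing of the determinant of this system is for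
  \<open>i = 1\<close> precisely the equation \<open>\<Phi> = 0\<close> (\<open>exists_sol_iff\<close>, \<open>Phi_hom_eq\<close>). Two facts about theta functions make
  everything work.

  First, duality (\<open>fourth_condition\<close>, \<open>Phi_transfer\<close>): the determinant of a row of index 1 and a row of index 2 is a
  section of degree 4 whose zeros, by (FR), have the product \<open>x\<^sub>1 x\<^sub>2 x\<^sub>3 x\<^sub>4\<close> modulo powers of \<open>q\<close>. If it vanishes
  at three of the points, it vanishes at the fourth. So \<open>\<Phi> = 0\<close> also decides the solvability of row 2.

  Second, uniqueness (\<open>sol_unique\<close>): outside \<open>\<Theta>\<^sub>4\<close> each row is determined up to a factor. For two solutions of the same
  row have a determinant with a multiplier that excludes four zeros at the \<open>x\<^sub>k\<close>, hence determinant 0, and the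
  inequivalence of \<open>\<sigma>\<^sub>1\<close> and \<open>\<sigma>\<^sub>2\<close> then forces them to be proportional.

  Thus a point of the hypersurface determines a matrix up to scaling its rows, and scaling the coordinates amounts to
  scaling the columns; this gives injectivity (\<open>rho_map_injective\<close>). It remains to see when the determinant of this
  matrix is not identically 0. It is a constant multiple of one fixed product of theta functions, so that its value at
  one auxiliary point \<open>x0\<close> decides. If it is 0, the matrix is degenerate, unless one of its entries is 0; in the
  latter case all coordinates but one are 0, or all but one are infinite, and such points are limits of kernel coordinates
  of degenerate matrices of rank one (\<open>pattern_in_closure\<close>). Hence the image of the family is the complement of
  the exceptional locus (\<open>S_minus_X_iff\<close>, \<open>Sstar_eq\<close>).

  For the geometry, \<open>K4\<close> is covered by charts which are slices \<open>z\<^sub>k = 1\<close> in affine four-space (\<open>chart_isomorphism\<close>).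
  In one direction the kernel coordinates are quotients of entries of a row, and they descend to the quotient by the
  torus. In the other direction Cramer's rule gives matrices which are polynomial in chart coordinates, and which
  are correct where their determinant at \<open>x0\<close> does not vanish (\<open>solmat_in_F\<close>). So both maps are morphisms
  (\<open>phi_iso\<close>). Smoothness holds because \<open>\<Phi>\<close> is affine in each coordinate and some coordinate line through a given point
  of the image, transversal to the slice, is not contained in the hypersurface (\<open>transversal_direction\<close>). Separatedness
  holds because lying in the same orbit of the torus is a closed condition on pairs of matrices without zero entries
  (\<open>orbit_tests_complete\<close>), and locally the points of the image lift to such matrices.
\<close>

section \<open>Ringed spaces of functions\<close>

text \<open>The properties of sheaves of functions that the arguments use. They hold for algebra spaces and powers, and pass to
  subspaces and to quotients.\<close>

locale ringed_space =
  fixes X :: "'a fn_space"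
  assumes sheaf: "is_sheaf X"
    and const: "openin (zariski X) U \<Longrightarrow> regular X U (\<lambda>_. c)"
    and add: "regular X U f \<Longrightarrow> regular X U g \<Longrightarrow> regular X U (\<lambda>x. f x + g x)"
    and mult: "regular X U f \<Longrightarrow> regular X U g \<Longrightarrow> regular X U (\<lambda>x. f x * g x)"
    and nonzero_open: "regular X U f \<Longrightarrow> openin (zariski X) {x \<in> U. f x \<noteq> 0}"
    and inverse: "regular X U f \<Longrightarrow> regular X {x \<in> U. f x \<noteq> 0} (\<lambda>x. inverse (f x))"
begin

lemma regular_open: "regular X U f \<Longrightarrow> openin (zariski X) U"
  using sheaf unfolding is_sheaf_def by blast

lemma regular_local:
  assumes "openin (zariski X) U"
    and "\<And>x. x \<in> U \<Longrightarrow> \<exists>W g. x \<in> W \<and> regular X W g \<and> (\<forall>y\<in>U \<inter> W. f y = g y)"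
  shows "regular X U f"
  using sheaf assms unfolding is_sheaf_def by blast

lemma restrict: "regular X U f \<Longrightarrow> openin (zariski X) V \<Longrightarrow> V \<subseteq> U \<Longrightarrow> regular X V f"
  by (rule regular_local, assumption, rule exI[of _ U], rule exI[of _ f]) blast

lemma restrict_Int:
  assumes "regular X U f" "openin (zariski X) V"
  shows "regular X (U \<inter> V) f"
  by (rule restrict[OF assms(1) openin_Int[OF regular_open[OF assms(1)] assms(2)]]) blast

lemma regular_cong:
  assumes "regular X U f" "\<And>x. x \<in> U \<Longrightarrow> f x = g x"
  shows "regular X U g"
  by (rule regular_local[OF regular_open[OF assms(1)]], rule exI[of _ U], rule exI[of _ f])
     (simp add: assms)

lemma divide:
  assumes "regular X U f" "regular X U g"
  shows "regular X {x \<in> U. g x \<noteq> 0} (\<lambda>x. f x / g x)"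
proof -
  have "regular X {x \<in> U. g x \<noteq> 0} f"
    using assms restrict nonzero_open by (metis (no_types, lifting) mem_Collect_eq subsetI)
  from mult[OF this inverse[OF assms(2)]] show ?thesis by (simp add: field_simps)
qed

lemma divide_nonzero:
  assumes "regular X U f" "regular X U g" "\<And>x. x \<in> U \<Longrightarrow> g x \<noteq> 0"
  shows "regular X U (\<lambda>x. f x / g x)"
proof -
  have "{x \<in> U. g x \<noteq> 0} = U" using assms(3) by blast
  then show ?thesis using divide[OF assms(1,2)] by simp
qed

lemma generated:
  assumes "f \<in> generated_algebra G" "openin (zariski X) U"
    and "\<And>g. g \<in> G \<Longrightarrow> regular X U (\<lambda>x. g (\<psi> x))"
  shows "regular X U (\<lambda>x. f (\<psi> x))"
  using assms(1) by induction (simp_all add: assms const add mult)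

end

text \<open>A family stable under intersection, such as that of the principal open sets, is a basis and not only a subbasis.\<close>

lemma openin_generated_iff:
  assumes "\<And>a b. a \<in> B \<Longrightarrow> b \<in> B \<Longrightarrow> a \<inter> b \<in> B"
  shows "openin (topology_generated_by B) U \<longleftrightarrow> (\<forall>x\<in>U. \<exists>b\<in>B. x \<in> b \<and> b \<subseteq> U)"
proof
  assume "openin (topology_generated_by B) U"
  then have "generate_topology_on B U" by (simp add: openin_topology_generated_by_iff)
  then show "\<forall>x\<in>U. \<exists>b\<in>B. x \<in> b \<and> b \<subseteq> U"
  proof induction
    case (Int a b)
    show ?case
    proof
      fix x assume "x \<in> a \<inter> b"
      then obtain c d where "c \<in> B" "d \<in> B" "x \<in> c" "x \<in> d" "c \<subseteq> a" "d \<subseteq> b"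
        using Int by blast
      then show "\<exists>c\<in>B. x \<in> c \<and> c \<subseteq> a \<inter> b" using assms[of c d] by blast
    qed
  next
    case (UN K)
    show ?case
    proof
      fix x assume "x \<in> \<Union>K"
      then obtain k where k: "k \<in> K" "x \<in> k" by blast
      then obtain b where "b \<in> B" "x \<in> b" "b \<subseteq> k" using UN.IH[OF k(1)] by blast
      then show "\<exists>b\<in>B. x \<in> b \<and> b \<subseteq> \<Union>K" using k by (intro bexI[of _ b]) auto
    qed
  next
    case (Basis s)
    then show ?case by auto
  qed simp
next
  assume *: "\<forall>x\<in>U. \<exists>b\<in>B. x \<in> b \<and> b \<subseteq> U"
  have "U = \<Union>{b \<in> B. b \<subseteq> U}" using * by blast
  moreover have "openin (topology_generated_by B) (\<Union>{b \<in> B. b \<subseteq> U})"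
    by (rule openin_Union) (auto simp: topology_generated_by_Basis)
  ultimately show "openin (topology_generated_by B) U" by simp
qed

text \<open>Algebra spaces and powers of spaces are both built from local fractions: over each member \<open>D i\<close> of
  a family of sets closed under intersection there is an algebra \<open>A i\<close> of functions, growing as
  \<open>D i\<close> shrinks. Treating this common pattern once avoids proving the sheaf axioms twice.\<close>

definition fraction_space ::
  "'i set \<Rightarrow> ('i \<Rightarrow> 'a set) \<Rightarrow> ('i \<Rightarrow> ('a \<Rightarrow> complex) set) \<Rightarrow> 'a fn_space" where
  "fraction_space I D A =
     (let T = topology_generated_by {{x \<in> D i. h x \<noteq> 0} | i h. i \<in> I \<and> h \<in> A i} in
      \<lparr> zariski = T,
        regular = (\<lambda>W f. openin T W \<and>
          (\<forall>x\<in>W. \<exists>i\<in>I. x \<in> D i \<and> (\<exists>g\<in>A i. \<exists>h\<in>A i. h x \<noteq> 0 \<and>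
             (\<forall>y\<in>W. y \<in> D i \<and> h y \<noteq> 0 \<longrightarrow> f y = g y / h y)))) \<rparr>)"

locale fraction_data =
  fixes I :: "'i set" and D :: "'i \<Rightarrow> 'a set" and A :: "'i \<Rightarrow> ('a \<Rightarrow> complex) set"
  assumes A_const: "i \<in> I \<Longrightarrow> (\<lambda>_. c) \<in> A i"
    and A_add: "i \<in> I \<Longrightarrow> f \<in> A i \<Longrightarrow> g \<in> A i \<Longrightarrow> (\<lambda>x. f x + g x) \<in> A i"
    and A_mult: "i \<in> I \<Longrightarrow> f \<in> A i \<Longrightarrow> g \<in> A i \<Longrightarrow> (\<lambda>x. f x * g x) \<in> A i"
    and refine: "i \<in> I \<Longrightarrow> j \<in> I \<Longrightarrow> \<exists>k\<in>I. D k = D i \<inter> D j \<and> A i \<subseteq> A k \<and> A j \<subseteq> A k"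
begin

lemma openin_fraction_space:
  "openin (zariski (fraction_space I D A)) U \<longleftrightarrow>
     (\<forall>x\<in>U. \<exists>i\<in>I. \<exists>h\<in>A i. x \<in> D i \<and> h x \<noteq> 0 \<and> (\<forall>y\<in>D i. h y \<noteq> 0 \<longrightarrow> y \<in> U))"
proof -
  let ?B = "{{x \<in> D i. h x \<noteq> 0} | i h. i \<in> I \<and> h \<in> A i}"
  have "a \<inter> b \<in> ?B" if "a \<in> ?B" "b \<in> ?B" for a b
  proof -
    obtain i h j h' where 1: "a = {x \<in> D i. h x \<noteq> 0}" "i \<in> I" "h \<in> A i"
      "b = {x \<in> D j. h' x \<noteq> 0}" "j \<in> I" "h' \<in> A j" using \<open>a \<in> ?B\<close> \<open>b \<in> ?B\<close> by blast
    obtain k where k: "k \<in> I" "D k = D i \<inter> D j" "A i \<subseteq> A k" "A j \<subseteq> A k" using refine[OF 1(2,5)] by blast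
    have "(\<lambda>x. h x * h' x) \<in> A k" by (rule A_mult) (use 1 k in auto)
    moreover have "a \<inter> b = {x \<in> D k. h x * h' x \<noteq> 0}" using 1 k by auto
    ultimately show ?thesis using k(1) by (intro CollectI exI[of _ k] exI[of _ "\<lambda>x. h x * h' x"]) simp
  qed
  then have "openin (topology_generated_by ?B) U \<longleftrightarrow> (\<forall>x\<in>U. \<exists>b\<in>?B. x \<in> b \<and> b \<subseteq> U)"
    by (rule openin_generated_iff)
  also have "\<dots> \<longleftrightarrow> (\<forall>x\<in>U. \<exists>i\<in>I. \<exists>h\<in>A i. x \<in> D i \<and> h x \<noteq> 0 \<and> (\<forall>y\<in>D i. h y \<noteq> 0 \<longrightarrow> y \<in> U))"
  proof (intro ball_cong refl iffI)
    fix x assume "\<exists>b\<in>?B. x \<in> b \<and> b \<subseteq> U"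
    then obtain i h where 1: "i \<in> I" "h \<in> A i" "x \<in> {x \<in> D i. h x \<noteq> 0}" "{x \<in> D i. h x \<noteq> 0} \<subseteq> U" by auto
    show "\<exists>i\<in>I. \<exists>h\<in>A i. x \<in> D i \<and> h x \<noteq> 0 \<and> (\<forall>y\<in>D i. h y \<noteq> 0 \<longrightarrow> y \<in> U)"
      by (intro bexI[OF _ 1(1)] bexI[OF _ 1(2)]) (use 1 in auto)
  next
    fix x assume "\<exists>i\<in>I. \<exists>h\<in>A i. x \<in> D i \<and> h x \<noteq> 0 \<and> (\<forall>y\<in>D i. h y \<noteq> 0 \<longrightarrow> y \<in> U)"
    then obtain i h where 1: "i \<in> I" "h \<in> A i" "x \<in> D i" "h x \<noteq> 0" "\<forall>y\<in>D i. h y \<noteq> 0 \<longrightarrow> y \<in> U" by auto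
    then have "{x \<in> D i. h x \<noteq> 0} \<in> ?B" by (intro CollectI exI[of _ i] exI[of _ h]) simp
    then show "\<exists>b\<in>?B. x \<in> b \<and> b \<subseteq> U" by (rule rev_bexI) (use 1 in auto)
  qed
  finally show ?thesis by (simp add: fraction_space_def Let_def)
qed

lemma openin_fraction_spaceE:
  assumes "openin (zariski (fraction_space I D A)) U" "x \<in> U"
  obtains i h where "i \<in> I" "h \<in> A i" "x \<in> D i" "h x \<noteq> 0" "\<forall>y\<in>D i. h y \<noteq> 0 \<longrightarrow> y \<in> U"
  by (insert bspec[OF iffD1[OF openin_fraction_space assms(1)] assms(2)], elim bexE conjE, intro that; assumption)

lemma points_fraction_space: "points (fraction_space I D A) = (\<Union>i\<in>I. D i)"
proof -
  let ?B = "{{x \<in> D i. h x \<noteq> 0} | i h. i \<in> I \<and> h \<in> A i}"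
  have "D i \<in> ?B" if "i \<in> I" for i
    by (intro CollectI exI[of _ i] exI[of _ "\<lambda>_. 1"]) (simp add: that A_const)
  then have "(\<Union>i\<in>I. D i) \<subseteq> \<Union>?B" by (intro UN_least Union_upper)
  moreover have "\<Union>?B \<subseteq> (\<Union>i\<in>I. D i)" by auto
  ultimately have "\<Union>?B = (\<Union>i\<in>I. D i)" by simp
  then show ?thesis by (simp add: fraction_space_def Let_def topology_generated_by_topspace)
qed

lemma regular_fraction_space:
  "regular (fraction_space I D A) W f \<longleftrightarrow> openin (zariski (fraction_space I D A)) W \<and>
     (\<forall>x\<in>W. \<exists>i\<in>I. x \<in> D i \<and> (\<exists>g\<in>A i. \<exists>h\<in>A i. h x \<noteq> 0 \<and>
             (\<forall>y\<in>W. y \<in> D i \<and> h y \<noteq> 0 \<longrightarrow> f y = g y / h y)))"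
  by (simp add: fraction_space_def Let_def)

lemma regular_fraction_spaceE:
  assumes "regular (fraction_space I D A) W f" "x \<in> W"
  obtains i g h where "i \<in> I" "g \<in> A i" "h \<in> A i" "x \<in> D i" "h x \<noteq> 0"
    "\<forall>y\<in>W. y \<in> D i \<and> h y \<noteq> 0 \<longrightarrow> f y = g y / h y"
  by (insert bspec[OF conjunct2[OF iffD1[OF regular_fraction_space assms(1)]] assms(2)],
      elim bexE conjE, intro that; assumption)

text \<open>Shrinking the domain of a fraction: the denominator may be made to vanish outside any given
  open neighbourhood of the point.\<close>

lemma shrink_fraction:
  assumes "openin (zariski (fraction_space I D A)) W" "x \<in> W"
    and "i \<in> I" "g \<in> A i" "h \<in> A i" "x \<in> D i" "h x \<noteq> 0"
  obtains k g' h' where "k \<in> I" "g' \<in> A k" "h' \<in> A k" "x \<in> D k" "h' x \<noteq> 0" "D k \<subseteq> D i"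
    "g \<in> A k" "h \<in> A k"
    "\<forall>y\<in>D k. h' y \<noteq> 0 \<longrightarrow> y \<in> W \<and> h y \<noteq> 0 \<and> g' y / h' y = g y / h y"
proof -
  obtain j h1 where 1: "j \<in> I" "h1 \<in> A j" "x \<in> D j" "h1 x \<noteq> 0" "\<forall>y\<in>D j. h1 y \<noteq> 0 \<longrightarrow> y \<in> W"
    using assms(1,2) by (rule openin_fraction_spaceE)
  obtain k where k: "k \<in> I" "D k = D i \<inter> D j" "A i \<subseteq> A k" "A j \<subseteq> A k"
    using refine[OF assms(3) 1(1)] by blast
  have 2: "g \<in> A k" "h \<in> A k" "h1 \<in> A k" "x \<in> D k" "D k \<subseteq> D i" using k assms 1 by auto
  show ?thesis
    by (rule that[OF k(1) A_mult[OF k(1) 2(1,3)] A_mult[OF k(1) 2(2,3)] 2(4) _ 2(5) 2(1,2)])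
       (use k(2) assms(7) 1(4,5) in auto)
qed

lemma fraction_algebra_regular:
  assumes "i \<in> I" "f \<in> A i"
  shows "regular (fraction_space I D A) (D i) f"
proof -
  have "openin (zariski (fraction_space I D A)) (D i)"
    unfolding openin_fraction_space
    by (intro ballI bexI[OF _ assms(1)] bexI[OF _ A_const[OF assms(1), of 1]]) auto
  then show ?thesis
    unfolding regular_fraction_space
    by (intro conjI ballI bexI[OF _ assms(1)] bexI[OF _ A_const[OF assms(1), of 1]] bexI[OF _ assms(2)]) auto
qed

lemma regular_fraction_nbhdE:
  assumes "regular (fraction_space I D A) U f" "x \<in> U"
  obtains i g h where "i \<in> I" "g \<in> A i" "h \<in> A i" "x \<in> D i" "h x \<noteq> 0"
    "\<forall>y\<in>D i. h y \<noteq> 0 \<longrightarrow> y \<in> U \<and> f y = g y / h y"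
proof -
  from assms obtain i g h where 1: "i \<in> I" "g \<in> A i" "h \<in> A i" "x \<in> D i" "h x \<noteq> 0"
    "\<forall>y\<in>U. y \<in> D i \<and> h y \<noteq> 0 \<longrightarrow> f y = g y / h y" by (rule regular_fraction_spaceE)
  have "openin (zariski (fraction_space I D A)) U" using assms(1) by (simp add: regular_fraction_space)
  from this \<open>x \<in> U\<close> 1(1-5) obtain k g' h' where
    2: "k \<in> I" "g' \<in> A k" "h' \<in> A k" "x \<in> D k" "h' x \<noteq> 0" "D k \<subseteq> D i" "g \<in> A k" "h \<in> A k"
    "\<forall>y\<in>D k. h' y \<noteq> 0 \<longrightarrow> y \<in> U \<and> h y \<noteq> 0 \<and> g' y / h' y = g y / h y"
    by (rule shrink_fraction)
  show ?thesis
  proof (rule that[OF 2(1-5)], intro ballI impI)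
    fix y assume "y \<in> D k" "h' y \<noteq> 0"
    then have "y \<in> U \<and> h y \<noteq> 0 \<and> g' y / h' y = g y / h y" using 2(9) by blast
    then show "y \<in> U \<and> f y = g' y / h' y"
      using 1(6) \<open>y \<in> D k\<close> 2(6) by (metis subsetD)
  qed
qed

lemma regular_fraction_nbhdE2:
  assumes "regular (fraction_space I D A) U f" "regular (fraction_space I D A) U f'" "x \<in> U"
  obtains k g h g' h' where "k \<in> I" "g \<in> A k" "h \<in> A k" "g' \<in> A k" "h' \<in> A k" "x \<in> D k"
    "h x \<noteq> 0" "h' x \<noteq> 0" "\<forall>y\<in>D k. h y \<noteq> 0 \<longrightarrow> f y = g y / h y"
    "\<forall>y\<in>D k. h' y \<noteq> 0 \<longrightarrow> f' y = g' y / h' y"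
proof -
  from assms(1,3) obtain i g h where 1: "i \<in> I" "g \<in> A i" "h \<in> A i" "x \<in> D i" "h x \<noteq> 0"
    "\<forall>y\<in>D i. h y \<noteq> 0 \<longrightarrow> y \<in> U \<and> f y = g y / h y" by (rule regular_fraction_nbhdE)
  from assms(2,3) obtain j g' h' where 2: "j \<in> I" "g' \<in> A j" "h' \<in> A j" "x \<in> D j" "h' x \<noteq> 0"
    "\<forall>y\<in>D j. h' y \<noteq> 0 \<longrightarrow> y \<in> U \<and> f' y = g' y / h' y" by (rule regular_fraction_nbhdE)
  obtain k where k: "k \<in> I" "D k = D i \<inter> D j" "A i \<subseteq> A k" "A j \<subseteq> A k" using refine[OF 1(1) 2(1)] by blast
  have 3: "g \<in> A k" "h \<in> A k" "g' \<in> A k" "h' \<in> A k" "x \<in> D k" using 1(2-4) 2(2-4) k by auto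
  show ?thesis
    by (rule that[OF k(1) 3 1(5) 2(5)]; use 1(6) 2(6) k(2) in blast)
qed

lemma regular_fraction_spaceI:
  assumes "openin (zariski (fraction_space I D A)) U"
    and "\<And>x. x \<in> U \<Longrightarrow> \<exists>i\<in>I. \<exists>g\<in>A i. \<exists>h\<in>A i. x \<in> D i \<and> h x \<noteq> 0 \<and>
      (\<forall>y\<in>D i. y \<in> U \<longrightarrow> h y \<noteq> 0 \<longrightarrow> f y = g y / h y)"
  shows "regular (fraction_space I D A) U f"
  unfolding regular_fraction_space
proof (intro conjI ballI assms(1))
  fix x assume "x \<in> U"
  obtain i g h where 1: "i \<in> I" "g \<in> A i" "h \<in> A i" "x \<in> D i" "h x \<noteq> 0"
    "\<forall>y\<in>D i. y \<in> U \<longrightarrow> h y \<noteq> 0 \<longrightarrow> f y = g y / h y"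
    by (insert assms(2)[OF \<open>x \<in> U\<close>], elim bexE conjE, intro that; assumption)
  show "\<exists>i\<in>I. x \<in> D i \<and> (\<exists>g\<in>A i. \<exists>h\<in>A i. h x \<noteq> 0 \<and>
           (\<forall>y\<in>U. y \<in> D i \<and> h y \<noteq> 0 \<longrightarrow> f y = g y / h y))"
    by (intro bexI[OF _ 1(1)] bexI[OF _ 1(2)] bexI[OF _ 1(3)] conjI) (use 1(4-6) in auto)
qed

lemma ringed_fraction_space: "ringed_space (fraction_space I D A)"
proof
  let ?X = "fraction_space I D A"
  let ?op = "openin (zariski ?X)"
  have open_reg: "?op U" if "regular ?X U f" for U f using that by (simp add: regular_fraction_space)
  show "is_sheaf ?X" unfolding is_sheaf_def
  proof (intro allI iffI)
    fix U f assume "regular ?X U f"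
    then show "?op U \<and> (\<forall>x\<in>U. \<exists>W g. x \<in> W \<and> regular ?X W g \<and> (\<forall>y\<in>U \<inter> W. f y = g y))"
      using open_reg by blast
  next
    fix U f assume *: "?op U \<and> (\<forall>x\<in>U. \<exists>W g. x \<in> W \<and> regular ?X W g \<and> (\<forall>y\<in>U \<inter> W. f y = g y))"
    show "regular ?X U f"
    proof (rule regular_fraction_spaceI)
      fix x assume "x \<in> U"
      then obtain W g' where W: "x \<in> W" "regular ?X W g'" "\<forall>y\<in>U \<inter> W. f y = g' y" using * by blast
      from W(2,1) obtain i g h where 1: "i \<in> I" "g \<in> A i" "h \<in> A i" "x \<in> D i" "h x \<noteq> 0"
        "\<forall>y\<in>D i. h y \<noteq> 0 \<longrightarrow> y \<in> W \<and> g' y = g y / h y" by (rule regular_fraction_nbhdE)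
      show "\<exists>i\<in>I. \<exists>g\<in>A i. \<exists>h\<in>A i. x \<in> D i \<and> h x \<noteq> 0 \<and>
          (\<forall>y\<in>D i. y \<in> U \<longrightarrow> h y \<noteq> 0 \<longrightarrow> f y = g y / h y)"
        by (intro bexI[OF _ 1(1)] bexI[OF _ 1(2)] bexI[OF _ 1(3)] conjI ballI impI 1(4,5))
           (use 1(6) W(3) in simp)
    qed (use * in blast)
  qed
next
  let ?X = "fraction_space I D A"
  let ?op = "openin (zariski ?X)"
  have open_reg: "?op U" if "regular ?X U f" for U f using that by (simp add: regular_fraction_space)
  fix U c assume U: "?op U"
  show "regular ?X U (\<lambda>_. c)"
  proof (rule regular_fraction_spaceI[OF U])
    fix x assume "x \<in> U"
    with U obtain i where 1: "i \<in> I" "x \<in> D i" by (rule openin_fraction_spaceE)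
    show "\<exists>i\<in>I. \<exists>g\<in>A i. \<exists>h\<in>A i. x \<in> D i \<and> h x \<noteq> 0 \<and>
          (\<forall>y\<in>D i. y \<in> U \<longrightarrow> h y \<noteq> 0 \<longrightarrow> c = g y / h y)"
      by (intro bexI[OF _ 1(1)] bexI[OF _ A_const[OF 1(1), of c]] bexI[OF _ A_const[OF 1(1), of 1]])
         (simp add: 1)
  qed
next
  let ?X = "fraction_space I D A"
  fix U f f' assume r: "regular ?X U f" "regular ?X U f'"
  then have U: "openin (zariski ?X) U" by (simp add: regular_fraction_space)
  show "regular ?X U (\<lambda>x. f x + f' x)"
  proof (rule regular_fraction_spaceI[OF U])
    fix x assume "x \<in> U"
    with r obtain k g h g' h' where 1: "k \<in> I" "g \<in> A k" "h \<in> A k" "g' \<in> A k" "h' \<in> A k"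
      "x \<in> D k" "h x \<noteq> 0" "h' x \<noteq> 0" "\<forall>y\<in>D k. h y \<noteq> 0 \<longrightarrow> f y = g y / h y"
      "\<forall>y\<in>D k. h' y \<noteq> 0 \<longrightarrow> f' y = g' y / h' y" by (rule regular_fraction_nbhdE2)
    note 2 = A_add[OF 1(1) A_mult[OF 1(1,2,5)] A_mult[OF 1(1,4,3)]] A_mult[OF 1(1,3,5)]
    show "\<exists>i\<in>I. \<exists>g\<in>A i. \<exists>h\<in>A i. x \<in> D i \<and> h x \<noteq> 0 \<and>
          (\<forall>y\<in>D i. y \<in> U \<longrightarrow> h y \<noteq> 0 \<longrightarrow> f y + f' y = g y / h y)"
      by (intro bexI[OF _ 1(1)] bexI[OF _ 2(1)] bexI[OF _ 2(2)]) (use 1(6-10) in \<open>simp add: field_simps\<close>)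
  qed
next
  let ?X = "fraction_space I D A"
  fix U f f' assume r: "regular ?X U f" "regular ?X U f'"
  then have U: "openin (zariski ?X) U" by (simp add: regular_fraction_space)
  show "regular ?X U (\<lambda>x. f x * f' x)"
  proof (rule regular_fraction_spaceI[OF U])
    fix x assume "x \<in> U"
    with r obtain k g h g' h' where 1: "k \<in> I" "g \<in> A k" "h \<in> A k" "g' \<in> A k" "h' \<in> A k"
      "x \<in> D k" "h x \<noteq> 0" "h' x \<noteq> 0" "\<forall>y\<in>D k. h y \<noteq> 0 \<longrightarrow> f y = g y / h y"
      "\<forall>y\<in>D k. h' y \<noteq> 0 \<longrightarrow> f' y = g' y / h' y" by (rule regular_fraction_nbhdE2)
    note 2 = A_mult[OF 1(1,2,4)] A_mult[OF 1(1,3,5)]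
    show "\<exists>i\<in>I. \<exists>g\<in>A i. \<exists>h\<in>A i. x \<in> D i \<and> h x \<noteq> 0 \<and>
          (\<forall>y\<in>D i. y \<in> U \<longrightarrow> h y \<noteq> 0 \<longrightarrow> f y * f' y = g y / h y)"
      by (intro bexI[OF _ 1(1)] bexI[OF _ 2(1)] bexI[OF _ 2(2)]) (use 1(6-10) in simp)
  qed
next
  let ?X = "fraction_space I D A"
  fix U f assume r: "regular ?X U f"
  show nz: "openin (zariski ?X) {x \<in> U. f x \<noteq> 0}"
    unfolding openin_fraction_space
  proof
    fix x assume x: "x \<in> {x \<in> U. f x \<noteq> 0}"
    then have "x \<in> U" by simp
    with r obtain i g h where 1: "i \<in> I" "g \<in> A i" "h \<in> A i" "x \<in> D i" "h x \<noteq> 0"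
      "\<forall>y\<in>D i. h y \<noteq> 0 \<longrightarrow> y \<in> U \<and> f y = g y / h y" by (rule regular_fraction_nbhdE)
    have "f x = g x / h x" using 1(4-6) by blast
    then have "g x * h x \<noteq> 0" using x 1(5) by auto
    then show "\<exists>i\<in>I. \<exists>h\<in>A i. x \<in> D i \<and> h x \<noteq> 0 \<and> (\<forall>y\<in>D i. h y \<noteq> 0 \<longrightarrow> y \<in> {x \<in> U. f x \<noteq> 0})"
      by (intro bexI[OF _ 1(1)] bexI[OF _ A_mult[OF 1(1-3)]]) (use 1(4-6) in simp)
  qed
  show "regular ?X {x \<in> U. f x \<noteq> 0} (\<lambda>x. inverse (f x))"
  proof (rule regular_fraction_spaceI[OF nz])
    fix x assume x: "x \<in> {x \<in> U. f x \<noteq> 0}"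
    then have "x \<in> U" by simp
    with r obtain i g h where 1: "i \<in> I" "g \<in> A i" "h \<in> A i" "x \<in> D i" "h x \<noteq> 0"
      "\<forall>y\<in>D i. h y \<noteq> 0 \<longrightarrow> y \<in> U \<and> f y = g y / h y" by (rule regular_fraction_nbhdE)
    have "f x = g x / h x" using 1(4-6) by blast
    then have "g x \<noteq> 0" using x by auto
    then show "\<exists>i\<in>I. \<exists>g\<in>A i. \<exists>h\<in>A i. x \<in> D i \<and> h x \<noteq> 0 \<and>
          (\<forall>y\<in>D i. y \<in> {x \<in> U. f x \<noteq> 0} \<longrightarrow> h y \<noteq> 0 \<longrightarrow> inverse (f y) = g y / h y)"
      by (intro bexI[OF _ 1(1)] bexI[OF _ A_mult[OF 1(1,3,3)]] bexI[OF _ A_mult[OF 1(1-3)]])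
         (use 1(4-6) in simp)
  qed
qed

text \<open>A map into a space of fractions is tested on the generating data \<open>D i\<close>, \<open>A i\<close> only.\<close>

lemma morphism_into_fraction_space:
  assumes Z: "ringed_space Z" and into: "\<And>z. z \<in> points Z \<Longrightarrow> \<exists>i\<in>I. \<psi> z \<in> D i"
    and op: "\<And>i. i \<in> I \<Longrightarrow> openin (zariski Z) {z \<in> points Z. \<psi> z \<in> D i}"
    and reg: "\<And>i a. i \<in> I \<Longrightarrow> a \<in> A i \<Longrightarrow> regular Z {z \<in> points Z. \<psi> z \<in> D i} (\<lambda>z. a (\<psi> z))"
  shows "fn_space_morphism Z (fraction_space I D A) \<psi>"
proof -
  interpret Z: ringed_space Z by fact
  let ?X = "fraction_space I D A"
  have pre: "openin (zariski Z) {z \<in> points Z. \<psi> z \<in> U}" if "openin (zariski ?X) U" for U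
  proof (subst openin_subopen, intro ballI)
    fix z assume z: "z \<in> {z \<in> points Z. \<psi> z \<in> U}"
    then have "\<psi> z \<in> U" by simp
    with that obtain i h where 1: "i \<in> I" "h \<in> A i" "\<psi> z \<in> D i" "h (\<psi> z) \<noteq> 0" "\<forall>y\<in>D i. h y \<noteq> 0 \<longrightarrow> y \<in> U"
      by (rule openin_fraction_spaceE)
    show "\<exists>T. openin (zariski Z) T \<and> z \<in> T \<and> T \<subseteq> {z \<in> points Z. \<psi> z \<in> U}"
      by (rule exI, rule conjI[OF Z.nonzero_open[OF reg[OF 1(1,2)]]]) (use 1 z in auto)
  qed
  have "continuous_map (zariski Z) (zariski ?X) \<psi>"
    using pre into by (auto simp: continuous_map_def points_fraction_space)
  moreover have "regular Z {z \<in> points Z. \<psi> z \<in> W} (\<lambda>z. f (\<psi> z))" if r: "regular ?X W f" for W f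
  proof (rule Z.regular_local)
    show op: "openin (zariski Z) {z \<in> points Z. \<psi> z \<in> W}"
      using pre r by (simp add: regular_fraction_space)
    fix z assume z: "z \<in> {z \<in> points Z. \<psi> z \<in> W}"
    then have "\<psi> z \<in> W" by simp
    with r obtain i g h where 1: "i \<in> I" "g \<in> A i" "h \<in> A i" "\<psi> z \<in> D i" "h (\<psi> z) \<noteq> 0"
      "\<forall>y\<in>W. y \<in> D i \<and> h y \<noteq> 0 \<longrightarrow> f y = g y / h y" by (rule regular_fraction_spaceE)
    show "\<exists>V g. z \<in> V \<and> regular Z V g \<and> (\<forall>y\<in>{z \<in> points Z. \<psi> z \<in> W} \<inter> V. f (\<psi> y) = g y)"
      by (rule exI, rule exI, rule conjI[OF _ conjI[OF Z.divide[OF reg[OF 1(1,2)] reg[OF 1(1,3)]]]])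
         (use 1 z in auto)
  qed
  ultimately show ?thesis unfolding fn_space_morphism_def by blast
qed

end

lemma algebra_space_eq_fraction_space:
  "algebra_space S A = fraction_space {()} (\<lambda>_. S) (\<lambda>_. A)"
proof -
  let ?B = "{{x \<in> S. h x \<noteq> 0} | h. h \<in> A}"
  have eq: "{{x \<in> S. h x \<noteq> 0} | (i::unit) h. i \<in> {()} \<and> h \<in> A} = ?B" by blast
  have sub: "U \<subseteq> S" if "openin (topology_generated_by ?B) U" for U
  proof -
    have "U \<subseteq> \<Union>?B" using openin_subset[OF that] by (simp add: topology_generated_by_topspace)
    then show ?thesis by blast
  qed
  have *: "(openin (topology_generated_by ?B) U \<and>
         (\<forall>x\<in>U. \<exists>g\<in>A. \<exists>h\<in>A. h x \<noteq> 0 \<and> (\<forall>y\<in>U. h y \<noteq> 0 \<longrightarrow> f y = g y / h y))) \<longleftrightarrow>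
      (openin (topology_generated_by ?B) U \<and>
         (\<forall>x\<in>U. \<exists>i\<in>{()}. x \<in> S \<and> (\<exists>g\<in>A. \<exists>h\<in>A. h x \<noteq> 0 \<and>
            (\<forall>y\<in>U. y \<in> S \<and> h y \<noteq> 0 \<longrightarrow> f y = g y / h y))))" for U f
  proof (rule conj_cong[OF refl])
    assume "openin (topology_generated_by ?B) U"
    then have "U \<subseteq> S" by (rule sub)
    then have 1: "(\<forall>y\<in>U. y \<in> S \<and> h y \<noteq> 0 \<longrightarrow> f y = g y / h y) \<longleftrightarrow> (\<forall>y\<in>U. h y \<noteq> 0 \<longrightarrow> f y = g y / h y)" for g h
      by blast
    show "(\<forall>x\<in>U. \<exists>g\<in>A. \<exists>h\<in>A. h x \<noteq> 0 \<and> (\<forall>y\<in>U. h y \<noteq> 0 \<longrightarrow> f y = g y / h y)) \<longleftrightarrow>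
      (\<forall>x\<in>U. \<exists>i\<in>{()}. x \<in> S \<and> (\<exists>g\<in>A. \<exists>h\<in>A. h x \<noteq> 0 \<and>
            (\<forall>y\<in>U. y \<in> S \<and> h y \<noteq> 0 \<longrightarrow> f y = g y / h y)))"
      unfolding 1 by (rule ball_cong[OF refl]) (use \<open>U \<subseteq> S\<close> in simp, blast?)
  qed
  show ?thesis unfolding algebra_space_def fraction_space_def Let_def eq * ..
qed

lemma fraction_data_algebra: "fraction_data {()} (\<lambda>_. S) (\<lambda>_. generated_algebra G)"
  by unfold_locales
    (simp_all add: generated_algebra.const generated_algebra.add generated_algebra.mult)

lemma ringed_algebra_space: "ringed_space (algebra_space S (generated_algebra G))"
  unfolding algebra_space_eq_fraction_space
  by (rule fraction_data.ringed_fraction_space[OF fraction_data_algebra])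

lemma points_algebra_space: "points (algebra_space S (generated_algebra G)) = S"
  unfolding algebra_space_eq_fraction_space
  unfolding fraction_data.points_fraction_space[OF fraction_data_algebra] by simp

lemma regular_algebra_space:
  "a \<in> generated_algebra G \<Longrightarrow> regular (algebra_space S (generated_algebra G)) S a"
  unfolding algebra_space_eq_fraction_space
  by (rule fraction_data.fraction_algebra_regular[OF fraction_data_algebra]) simp_all

lemma openin_algebra_space:
  "openin (zariski (algebra_space S (generated_algebra G))) U \<longleftrightarrow>
   (\<forall>x\<in>U. \<exists>h\<in>generated_algebra G. x \<in> S \<and> h x \<noteq> 0 \<and> (\<forall>y\<in>S. h y \<noteq> 0 \<longrightarrow> y \<in> U))"
  unfolding algebra_space_eq_fraction_space
  unfolding fraction_data.openin_fraction_space[OF fraction_data_algebra] by simp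

text \<open>It suffices that generators of the algebra pull back to regular functions.\<close>

lemma morphism_into_algebra_space:
  assumes "ringed_space Z" "\<And>z. z \<in> points Z \<Longrightarrow> \<psi> z \<in> S"
    and "\<And>g. g \<in> G \<Longrightarrow> regular Z (points Z) (\<lambda>z. g (\<psi> z))"
  shows "fn_space_morphism Z (algebra_space S (generated_algebra G)) \<psi>"
proof -
  have eq: "{z \<in> points Z. \<psi> z \<in> S} = points Z" using assms(2) by blast
  have gen: "regular Z (points Z) (\<lambda>z. a (\<psi> z))" if "a \<in> generated_algebra G" for a
    by (rule ringed_space.generated[OF assms(1) that openin_topspace assms(3)])
  show ?thesis unfolding algebra_space_eq_fraction_space
    by (rule fraction_data.morphism_into_fraction_space[OF fraction_data_algebra assms(1)])
       (simp_all add: eq assms(2) gen)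
qed

lemma box_functions_mono:
  fixes U V :: "'n::finite \<Rightarrow> 'a set"
  assumes "ringed_space X" "\<And>i. openin (zariski X) (V i)" "\<And>i. V i \<subseteq> U i"
  shows "box_functions X U \<subseteq> box_functions X V"
proof
  fix f assume "f \<in> box_functions X U"
  then show "f \<in> box_functions X V" unfolding box_functions_def
  proof induction
    case (gen g)
    then obtain i f where "g = (\<lambda>x. f (x$i))" "regular X (U i) f" by blast
    then show ?case using ringed_space.restrict[OF assms(1)] assms(2,3)
      by (intro generated_algebra.gen) blast
  qed (simp_all add: generated_algebra.const generated_algebra.add generated_algebra.mult)
qed

lemma power_space_eq_fraction_space:
  "(power_space X :: ('a^'n::finite) fn_space) =
     fraction_space {U. \<forall>i. openin (zariski X) (U i)} (\<lambda>U. {x. \<forall>i. x$i \<in> U i}) (box_functions X)"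
  unfolding power_space_def fraction_space_def Let_def by simp

lemma fraction_data_power:
  assumes "ringed_space X"
  shows "fraction_data {U. \<forall>i. openin (zariski X) (U i)} (\<lambda>U. {x::'a^'n::finite. \<forall>i. x$i \<in> U i}) (box_functions X)"
proof
  fix U V assume *: "U \<in> {U. \<forall>i::'n. openin (zariski X) (U i)}" "V \<in> {U. \<forall>i::'n. openin (zariski X) (U i)}"
  show "\<exists>k\<in>{U. \<forall>i. openin (zariski X) (U i)}.
          {x. \<forall>i. x $ i \<in> k i} = {x. \<forall>i. x $ i \<in> U i} \<inter> {x::'a^'n. \<forall>i. x $ i \<in> V i} \<and>
          box_functions X U \<subseteq> box_functions X k \<and> box_functions X V \<subseteq> box_functions X k"
    by (rule bexI[of _ "\<lambda>i. U i \<inter> V i"], intro conjI box_functions_mono[OF assms])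
       (use * in auto)
qed (simp_all add: box_functions_def generated_algebra.const generated_algebra.add generated_algebra.mult)

lemma ringed_power_space: "ringed_space X \<Longrightarrow> ringed_space (power_space X)"
  unfolding power_space_eq_fraction_space
  by (rule fraction_data.ringed_fraction_space[OF fraction_data_power])

lemma points_power_space:
  assumes "ringed_space X"
  shows "points (power_space X :: ('a^'n::finite) fn_space) = {x. \<forall>i. x$i \<in> points X}"
  unfolding power_space_eq_fraction_space fraction_data.points_fraction_space[OF fraction_data_power[OF assms]]
proof (rule equalityI; rule subsetI)
  fix x :: "'a^'n" assume "x \<in> (\<Union>U\<in>{U. \<forall>i. openin (zariski X) (U i)}. {x. \<forall>i. x$i \<in> U i})"
  then show "x \<in> {x. \<forall>i. x$i \<in> points X}" using openin_subset by blast
next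
  fix x :: "'a^'n" assume "x \<in> {x. \<forall>i. x$i \<in> points X}"
  then show "x \<in> (\<Union>U\<in>{U. \<forall>i. openin (zariski X) (U i)}. {x. \<forall>i. x$i \<in> U i})"
    by (intro UN_I[of "\<lambda>_. points X"]) auto
qed

text \<open>These functions are used to separate a pair of distinct points from the diagonal.\<close>

lemma regular_box_function:
  assumes "ringed_space X" "\<And>i. openin (zariski X) (U i)" "h \<in> box_functions X U"
  shows "regular (power_space X :: ('a^'n::finite) fn_space) {x. \<forall>i. x$i \<in> U i} h"
  unfolding power_space_eq_fraction_space
  by (rule fraction_data.fraction_algebra_regular[OF fraction_data_power[OF assms(1)]]) (simp_all add: assms)

lemma fn_space_morphism_regular:
  "fn_space_morphism X Y \<phi> \<Longrightarrow> regular Y U f \<Longrightarrow> regular X {x \<in> points X. \<phi> x \<in> U} (\<lambda>x. f (\<phi> x))"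
  unfolding fn_space_morphism_def by blast

lemma fn_space_morphism_open:
  "fn_space_morphism X Y \<phi> \<Longrightarrow> openin (zariski Y) U \<Longrightarrow> openin (zariski X) {x \<in> points X. \<phi> x \<in> U}"
  unfolding fn_space_morphism_def continuous_map_def by blast

lemma fn_space_morphism_into:
  "fn_space_morphism X Y \<phi> \<Longrightarrow> x \<in> points X \<Longrightarrow> \<phi> x \<in> points Y"
  unfolding fn_space_morphism_def continuous_map_def by blast

lemma fn_space_morphismI:
  assumes "\<And>x. x \<in> points X \<Longrightarrow> \<phi> x \<in> points Y"
    and "\<And>U. openin (zariski Y) U \<Longrightarrow> openin (zariski X) {x \<in> points X. \<phi> x \<in> U}"
    and "\<And>U f. regular Y U f \<Longrightarrow> regular X {x \<in> points X. \<phi> x \<in> U} (\<lambda>x. f (\<phi> x))"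
  shows "fn_space_morphism X Y \<phi>"
  using assms unfolding fn_space_morphism_def continuous_map_def by blast

lemma fn_space_morphism_compose:
  assumes "fn_space_morphism X Y \<phi>" "fn_space_morphism Y Z \<psi>"
  shows "fn_space_morphism X Z (\<lambda>x. \<psi> (\<phi> x))"
proof (rule fn_space_morphismI)
  have eq: "{x \<in> points X. \<psi> (\<phi> x) \<in> U} = {x \<in> points X. \<phi> x \<in> {y \<in> points Y. \<psi> y \<in> U}}" for U
    using fn_space_morphism_into[OF assms(1)] by blast
  fix U f assume "regular Z U f"
  from fn_space_morphism_regular[OF assms(1) fn_space_morphism_regular[OF assms(2) this]]
  show "regular X {x \<in> points X. \<psi> (\<phi> x) \<in> U} (\<lambda>x. f (\<psi> (\<phi> x)))" unfolding eq .
next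
  have eq: "{x \<in> points X. \<psi> (\<phi> x) \<in> U} = {x \<in> points X. \<phi> x \<in> {y \<in> points Y. \<psi> y \<in> U}}" for U
    using fn_space_morphism_into[OF assms(1)] by blast
  fix U assume "openin (zariski Z) U"
  from fn_space_morphism_open[OF assms(1) fn_space_morphism_open[OF assms(2) this]]
  show "openin (zariski X) {x \<in> points X. \<psi> (\<phi> x) \<in> U}" unfolding eq .
qed (use fn_space_morphism_into assms in metis)

lemma fn_space_morphism_cong:
  assumes "ringed_space X" "fn_space_morphism X Y \<phi>" "\<And>x. x \<in> points X \<Longrightarrow> \<phi> x = \<psi> x"
  shows "fn_space_morphism X Y \<psi>"
proof (rule fn_space_morphismI)
  have eq: "{x \<in> points X. \<psi> x \<in> U} = {x \<in> points X. \<phi> x \<in> U}" for U using assms(3) by auto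
  show "openin (zariski X) {x \<in> points X. \<psi> x \<in> U}" if "openin (zariski Y) U" for U
    unfolding eq using fn_space_morphism_open[OF assms(2) that] .
  show "regular X {x \<in> points X. \<psi> x \<in> U} (\<lambda>x. f (\<psi> x))" if "regular Y U f" for U f
    unfolding eq
    by (rule ringed_space.regular_cong[OF assms(1) fn_space_morphism_regular[OF assms(2) that]])
       (use assms(3) in auto)
qed (use fn_space_morphism_into[OF assms(2)] assms(3) in force)

lemma morphism_into_power_space:
  fixes \<psi> :: "'z \<Rightarrow> 'a^'n::finite"
  assumes Z: "ringed_space Z" and X: "ringed_space X"
    and m: "\<And>i. fn_space_morphism Z X (\<lambda>z. \<psi> z $ i)"
  shows "fn_space_morphism Z (power_space X) \<psi>"
proof -
  interpret Z: ringed_space Z by fact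
  have op: "openin (zariski Z) {z \<in> points Z. \<psi> z \<in> {x. \<forall>i. x$i \<in> U i}}"
    if "\<forall>i. openin (zariski X) (U i)" for U :: "'n \<Rightarrow> 'a set"
  proof -
    have "openin (zariski Z) (\<Inter>i\<in>UNIV. {z \<in> points Z. \<psi> z $ i \<in> U i})"
      using fn_space_morphism_open[OF m] that by (intro openin_INT2) auto
    also have "(\<Inter>i\<in>UNIV. {z \<in> points Z. \<psi> z $ i \<in> U i}) = {z \<in> points Z. \<psi> z \<in> {x. \<forall>i. x$i \<in> U i}}" by auto
    finally show ?thesis .
  qed
  show ?thesis unfolding power_space_eq_fraction_space
  proof (rule fraction_data.morphism_into_fraction_space[OF fraction_data_power[OF X] Z])
    fix z assume "z \<in> points Z"
    then show "\<exists>U\<in>{U. \<forall>i. openin (zariski X) (U i)}. \<psi> z \<in> {x. \<forall>i. x$i \<in> U i}"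
      using fn_space_morphism_into[OF m] by (intro bexI[of _ "\<lambda>_. points X"]) auto
  next
    fix U :: "'n \<Rightarrow> 'a set" and a assume U: "U \<in> {U. \<forall>i. openin (zariski X) (U i)}" and a: "a \<in> box_functions X U"
    show "regular Z {z \<in> points Z. \<psi> z \<in> {x. \<forall>i. x$i \<in> U i}} (\<lambda>z. a (\<psi> z))"
      using a unfolding box_functions_def
    proof (rule Z.generated)
      fix g assume "g \<in> {(\<lambda>x. f (x$i)) | i f. regular X (U i) f}"
      then obtain i f where g: "g = (\<lambda>x. f (x$i))" "regular X (U i) f" by blast
      show "regular Z {z \<in> points Z. \<psi> z \<in> {x. \<forall>i. x$i \<in> U i}} (\<lambda>z. g (\<psi> z))"
        unfolding g(1) by (rule Z.restrict[OF fn_space_morphism_regular[OF m g(2)] op]) (use U in auto)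
    qed (rule op, use U in blast)
  qed (rule op, blast)
qed

lemma power_space_projection:
  assumes "ringed_space X"
  shows "fn_space_morphism (power_space X :: ('a^'n::finite) fn_space) X (\<lambda>x. x$i)"
proof -
  interpret P: ringed_space "power_space X :: ('a^'n) fn_space" by (rule ringed_power_space[OF assms])
  have reg: "regular (power_space X) {x \<in> points (power_space X). x$i \<in> U} (\<lambda>x::'a^'n. f (x$i))" if "regular X U f" for U f
  proof -
    let ?U = "\<lambda>j. if j = i then U else points X"
    have "U \<subseteq> points X" using openin_subset ringed_space.regular_open[OF assms that] by blast
    then have eq: "{x \<in> points (power_space X). x$i \<in> U} = {x::'a^'n. \<forall>j. x$j \<in> ?U j}"
      using points_power_space[OF assms, where 'n='n] by (auto split: if_splits)
    have "regular (power_space X) {x::'a^'n. \<forall>j. x$j \<in> ?U j} (\<lambda>x. f (x$i))"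
      by (rule regular_box_function[OF assms])
         (use that ringed_space.regular_open[OF assms that] in \<open>auto simp: box_functions_def intro!: generated_algebra.gen exI[of _ i]\<close>)
    then show ?thesis unfolding eq .
  qed
  show ?thesis
  proof (rule fn_space_morphismI)
    fix U assume "openin (zariski X) U"
    from P.regular_open[OF reg[OF ringed_space.const[OF assms this]]]
    show "openin (zariski (power_space X)) {x \<in> points (power_space X). x$i \<in> U}" .
  next
    fix x assume "x \<in> points (power_space X :: ('a^'n) fn_space)"
    then show "x $ i \<in> points X" by (simp add: points_power_space[OF assms])
  qed (rule reg)
qed

section \<open>Subspaces, quotients and isomorphisms\<close>

lemma openin_subspace_of:
  "openin (zariski (subspace_of X Y)) U \<longleftrightarrow> (\<exists>W. openin (zariski X) W \<and> U = W \<inter> Y)"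
  by (simp add: subspace_of_def Let_def openin_subtopology)

lemma points_subspace_of: "points (subspace_of X Y) = points X \<inter> Y"
  by (simp add: subspace_of_def Let_def)

lemma regular_subspace_of:
  "regular (subspace_of X Y) U f \<longleftrightarrow> openin (zariski (subspace_of X Y)) U \<and>
     (\<forall>x\<in>U. \<exists>W g. x \<in> W \<and> regular X W g \<and> (\<forall>y\<in>U \<inter> W. f y = g y))"
  by (simp add: subspace_of_def Let_def)

lemma regular_subspace_ofE:
  assumes "regular (subspace_of X Y) U f" "x \<in> U"
  obtains W g where "x \<in> W" "regular X W g" "\<forall>y\<in>U \<inter> W. f y = g y"
  using assms unfolding regular_subspace_of by blast

context ringed_space
begin

text \<open>The topology and the sheaf of a subspace are described by ambient open sets separately. Here one ambient open
  set \<open>W\<close> serves both purposes: \<open>g\<close> extends \<open>f\<close> on it, and it meets \<open>Y\<close> inside \<open>U\<close>.\<close>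

lemma regular_subspace_nbhdE:
  assumes "regular (subspace_of X Y) U f" "x \<in> U"
  obtains W g where "x \<in> W" "x \<in> Y" "regular X W g" "W \<inter> Y \<subseteq> U" "\<forall>y\<in>W \<inter> Y. f y = g y"
proof -
  from assms obtain W g where 1: "x \<in> W" "regular X W g" "\<forall>y\<in>U \<inter> W. f y = g y"
    by (rule regular_subspace_ofE)
  have "openin (zariski (subspace_of X Y)) U" using assms(1) by (simp add: regular_subspace_of)
  then obtain O' where 2: "openin (zariski X) O'" "U = O' \<inter> Y" unfolding openin_subspace_of by blast
  show ?thesis
    by (rule that[OF _ _ restrict_Int[OF 1(2) 2(1)]]) (use 1 2 assms(2) in auto)
qed

lemma regular_subspaceI:
  assumes "\<And>x. x \<in> U \<Longrightarrow> \<exists>W g. x \<in> W \<and> x \<in> Y \<and> regular X W g \<and> W \<inter> Y \<subseteq> U \<and> (\<forall>y\<in>W \<inter> Y. f y = g y)"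
  shows "regular (subspace_of X Y) U f"
proof -
  have "openin (zariski (subspace_of X Y)) U"
  proof (subst openin_subopen, intro ballI)
    fix x assume "x \<in> U"
    from assms[OF this] obtain W g where "x \<in> W" "x \<in> Y" "regular X W g" "W \<inter> Y \<subseteq> U" by (elim exE conjE)
    then show "\<exists>T. openin (zariski (subspace_of X Y)) T \<and> x \<in> T \<and> T \<subseteq> U"
      unfolding openin_subspace_of by (intro exI[of _ "W \<inter> Y"] conjI exI[of _ W] regular_open) auto
  qed
  moreover have "\<exists>W g. x \<in> W \<and> regular X W g \<and> (\<forall>y\<in>U \<inter> W. f y = g y)" if "x \<in> U" for x
  proof -
    from assms[OF that] obtain W g where *: "x \<in> W" "x \<in> Y" "regular X W g" "W \<inter> Y \<subseteq> U"
      "\<forall>y\<in>W \<inter> Y. f y = g y" by (elim exE conjE)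
    have "U \<subseteq> Y" using calculation unfolding openin_subspace_of by blast
    show ?thesis by (rule exI[of _ W], rule exI[of _ g]) (use * \<open>U \<subseteq> Y\<close> in auto)
  qed
  ultimately show ?thesis unfolding regular_subspace_of by blast
qed

lemma regular_restrict_subspace:
  assumes "regular X W g"
  shows "regular (subspace_of X Y) (W \<inter> Y) g"
  by (rule regular_subspaceI, rule exI[of _ W], rule exI[of _ g]) (use assms in auto)

lemma ringed_subspace: "ringed_space (subspace_of X Y)"
proof
  let ?S = "subspace_of X Y"
  have op: "openin (zariski ?S) U" if "regular ?S U f" for U f
    using that unfolding regular_subspace_of by blast
  show "is_sheaf ?S" unfolding is_sheaf_def
  proof (intro allI iffI)
    fix U f assume *: "regular ?S U f"
    show "openin (zariski ?S) U \<and> (\<forall>x\<in>U. \<exists>W g. x \<in> W \<and> regular ?S W g \<and> (\<forall>y\<in>U \<inter> W. f y = g y))"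
    proof (intro conjI ballI op[OF *])
      fix x assume "x \<in> U"
      then show "\<exists>W g. x \<in> W \<and> regular ?S W g \<and> (\<forall>y\<in>U \<inter> W. f y = g y)"
        by (intro exI[of _ U] exI[of _ f]) (simp add: *)
    qed
  next
    fix U f assume *: "openin (zariski ?S) U \<and> (\<forall>x\<in>U. \<exists>W g. x \<in> W \<and> regular ?S W g \<and> (\<forall>y\<in>U \<inter> W. f y = g y))"
    then obtain O' where O': "openin (zariski X) O'" "U = O' \<inter> Y" unfolding openin_subspace_of by blast
    show "regular ?S U f"
    proof (rule regular_subspaceI)
      fix x assume "x \<in> U"
      from bspec[OF conjunct2[OF *] this] obtain W g where
        W: "x \<in> W" "regular ?S W g" "\<forall>y\<in>U \<inter> W. f y = g y" by (elim exE conjE)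
      from W(2,1) obtain V h where V: "x \<in> V" "x \<in> Y" "regular X V h" "V \<inter> Y \<subseteq> W" "\<forall>y\<in>V \<inter> Y. g y = h y"
        by (rule regular_subspace_nbhdE)
      show "\<exists>W g. x \<in> W \<and> x \<in> Y \<and> regular X W g \<and> W \<inter> Y \<subseteq> U \<and> (\<forall>y\<in>W \<inter> Y. f y = g y)"
        by (rule exI[of _ "V \<inter> O'"], rule exI[of _ h], intro conjI restrict_Int V(3) O'(1))
           (use V W(1,3) O'(2) \<open>x \<in> U\<close> in auto)
    qed
  qed
next
  let ?S = "subspace_of X Y"
  fix U c assume "openin (zariski ?S) U"
  then obtain O' where O': "openin (zariski X) O'" "U = O' \<inter> Y" unfolding openin_subspace_of by blast
  show "regular ?S U (\<lambda>_. c)" unfolding O'(2) by (rule regular_restrict_subspace[OF const[OF O'(1)]])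
next
  let ?S = "subspace_of X Y"
  fix U f g assume *: "regular ?S U f" "regular ?S U g"
  have **: "\<exists>W f' g'. x \<in> W \<and> x \<in> Y \<and> regular X W f' \<and> regular X W g' \<and> W \<inter> Y \<subseteq> U \<and>
     (\<forall>y\<in>W \<inter> Y. f y = f' y) \<and> (\<forall>y\<in>W \<inter> Y. g y = g' y)" if "x \<in> U" for x
  proof -
    from *(1) that obtain W f' where 1: "x \<in> W" "x \<in> Y" "regular X W f'" "W \<inter> Y \<subseteq> U" "\<forall>y\<in>W \<inter> Y. f y = f' y"
      by (rule regular_subspace_nbhdE)
    from *(2) that obtain V g' where 2: "x \<in> V" "x \<in> Y" "regular X V g'" "V \<inter> Y \<subseteq> U" "\<forall>y\<in>V \<inter> Y. g y = g' y"
      by (rule regular_subspace_nbhdE)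
    have 3: "regular X (W \<inter> V) f'" by (rule restrict_Int[OF 1(3) regular_open[OF 2(3)]])
    have 4: "regular X (W \<inter> V) g'" using restrict_Int[OF 2(3) regular_open[OF 1(3)]] by (simp add: Int_commute)
    show ?thesis by (rule exI[of _ "W \<inter> V"], rule exI[of _ f'], rule exI[of _ g'], intro conjI 3 4) (use 1 2 in auto)
  qed
  show "regular ?S U (\<lambda>x. f x + g x)"
  proof (rule regular_subspaceI)
    fix x assume "x \<in> U"
    from **[OF this] obtain W f' g' where 1: "x \<in> W" "x \<in> Y" "regular X W f'" "regular X W g'" "W \<inter> Y \<subseteq> U"
     "\<forall>y\<in>W \<inter> Y. f y = f' y" "\<forall>y\<in>W \<inter> Y. g y = g' y" by (elim exE conjE)
    show "\<exists>W h. x \<in> W \<and> x \<in> Y \<and> regular X W h \<and> W \<inter> Y \<subseteq> U \<and> (\<forall>y\<in>W \<inter> Y. f y + g y = h y)"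
      by (rule exI[of _ W], rule exI[of _ "\<lambda>x. f' x + g' x"], intro conjI add 1(1-5)) (use 1(6,7) in auto)
  qed
  show "regular ?S U (\<lambda>x. f x * g x)"
  proof (rule regular_subspaceI)
    fix x assume "x \<in> U"
    from **[OF this] obtain W f' g' where 1: "x \<in> W" "x \<in> Y" "regular X W f'" "regular X W g'" "W \<inter> Y \<subseteq> U"
     "\<forall>y\<in>W \<inter> Y. f y = f' y" "\<forall>y\<in>W \<inter> Y. g y = g' y" by (elim exE conjE)
    show "\<exists>W h. x \<in> W \<and> x \<in> Y \<and> regular X W h \<and> W \<inter> Y \<subseteq> U \<and> (\<forall>y\<in>W \<inter> Y. f y * g y = h y)"
      by (rule exI[of _ W], rule exI[of _ "\<lambda>x. f' x * g' x"], intro conjI mult 1(1-5)) (use 1(6,7) in auto)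
  qed
next
  let ?S = "subspace_of X Y"
  fix U f assume *: "regular ?S U f"
  show reg: "regular ?S {x \<in> U. f x \<noteq> 0} (\<lambda>x. inverse (f x))"
  proof (rule regular_subspaceI)
    fix x assume x: "x \<in> {x \<in> U. f x \<noteq> 0}"
    then have "x \<in> U" by simp
    with * obtain W g where 1: "x \<in> W" "x \<in> Y" "regular X W g" "W \<inter> Y \<subseteq> U" "\<forall>y\<in>W \<inter> Y. f y = g y"
      by (rule regular_subspace_nbhdE)
    show "\<exists>W h. x \<in> W \<and> x \<in> Y \<and> regular X W h \<and> W \<inter> Y \<subseteq> {x \<in> U. f x \<noteq> 0} \<and> (\<forall>y\<in>W \<inter> Y. inverse (f y) = h y)"
      by (rule exI[of _ "{y \<in> W. g y \<noteq> 0}"], rule exI[of _ "\<lambda>y. inverse (g y)"], intro conjI inverse 1(3))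
         (use 1(1,2,4,5) x in auto)
  qed
  then show "openin (zariski ?S) {x \<in> U. f x \<noteq> 0}" unfolding regular_subspace_of by blast
qed

lemma subspace_of_subspace:
  assumes "B \<subseteq> A"
  shows "subspace_of (subspace_of X A) B = subspace_of X B"
proof -
  have top: "subtopology (zariski (subspace_of X A)) B = subtopology (zariski X) B"
    using assms by (simp add: subspace_of_def Let_def subtopology_subtopology Int_absorb1)
  have "regular (subspace_of (subspace_of X A) B) U f \<longleftrightarrow> regular (subspace_of X B) U f" for U f
  proof
    assume *: "regular (subspace_of (subspace_of X A) B) U f"
    show "regular (subspace_of X B) U f"
    proof (rule regular_subspaceI)
      fix x assume "x \<in> U"
      with * obtain W g where 1: "x \<in> W" "x \<in> B" "regular (subspace_of X A) W g" "W \<inter> B \<subseteq> U" "\<forall>y\<in>W \<inter> B. f y = g y"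
        by (rule ringed_space.regular_subspace_nbhdE[OF ringed_subspace])
      from 1(3,1) obtain V h where 2: "x \<in> V" "x \<in> A" "regular X V h" "V \<inter> A \<subseteq> W" "\<forall>y\<in>V \<inter> A. g y = h y"
        by (rule regular_subspace_nbhdE)
      show "\<exists>W g. x \<in> W \<and> x \<in> B \<and> regular X W g \<and> W \<inter> B \<subseteq> U \<and> (\<forall>y\<in>W \<inter> B. f y = g y)"
      proof (rule exI[of _ V], rule exI[of _ h], intro conjI ballI)
        fix y assume y: "y \<in> V \<inter> B"
        then have "y \<in> V \<inter> A" "y \<in> W \<inter> B" using 2(4) assms by auto
        then show "f y = h y" using 1(5) 2(5) by simp
      qed (use 1 2 assms in auto)
    qed
  next
    assume *: "regular (subspace_of X B) U f"
    show "regular (subspace_of (subspace_of X A) B) U f"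
    proof (rule ringed_space.regular_subspaceI[OF ringed_subspace])
      fix x assume "x \<in> U"
      with * obtain W g where 1: "x \<in> W" "x \<in> B" "regular X W g" "W \<inter> B \<subseteq> U" "\<forall>y\<in>W \<inter> B. f y = g y"
        by (rule regular_subspace_nbhdE)
      show "\<exists>W g. x \<in> W \<and> x \<in> B \<and> regular (subspace_of X A) W g \<and> W \<inter> B \<subseteq> U \<and> (\<forall>y\<in>W \<inter> B. f y = g y)"
        by (rule exI[of _ "W \<inter> A"], rule exI[of _ g], intro conjI regular_restrict_subspace 1(3))
           (use 1 assms in auto)
    qed
  qed
  then have "regular (subspace_of (subspace_of X A) B) = regular (subspace_of X B)" by (intro ext)
  then show ?thesis using top by (simp add: subspace_of_def[of _ B] Let_def)
qed

lemma regular_open_subspace: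
  assumes "openin (zariski X) A"
  shows "regular (subspace_of X A) U f \<longleftrightarrow> U \<subseteq> A \<and> regular X U f"
proof
  assume *: "regular (subspace_of X A) U f"
  then have "openin (zariski (subspace_of X A)) U" by (simp add: regular_subspace_of)
  then have "openin (zariski X) U" "U \<subseteq> A" using assms unfolding openin_subspace_of by blast+
  moreover have "regular X U f"
  proof (rule regular_local[OF \<open>openin (zariski X) U\<close>])
    fix x assume "x \<in> U"
    with * show "\<exists>W g. x \<in> W \<and> regular X W g \<and> (\<forall>y\<in>U \<inter> W. f y = g y)"
      unfolding regular_subspace_of by simp
  qed
  ultimately show "U \<subseteq> A \<and> regular X U f" by blast
next
  assume "U \<subseteq> A \<and> regular X U f"
  then show "regular (subspace_of X A) U f" using regular_restrict_subspace[of U f A] by (simp add: Int_absorb2)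
qed

lemma openin_open_subspace:
  "openin (zariski X) A \<Longrightarrow> openin (zariski (subspace_of X A)) U \<longleftrightarrow> U \<subseteq> A \<and> openin (zariski X) U"
  unfolding openin_subspace_of by (metis inf.absorb1 inf_le2 openin_Int)

lemma subspace_inclusion: "fn_space_morphism (subspace_of X Y) X (\<lambda>x. x)"
proof (rule fn_space_morphismI)
  have eq: "{x \<in> points (subspace_of X Y). x \<in> U} = U \<inter> Y" if "openin (zariski X) U" for U
    using openin_subset[OF that] by (auto simp: points_subspace_of)
  show "openin (zariski (subspace_of X Y)) {x \<in> points (subspace_of X Y). x \<in> U}" if "openin (zariski X) U" for U
    unfolding eq[OF that] openin_subspace_of using that by blast
  show "regular (subspace_of X Y) {x \<in> points (subspace_of X Y). x \<in> U} f" if "regular X U f" for U f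
    unfolding eq[OF regular_open[OF that]] by (rule regular_restrict_subspace[OF that])
qed (simp add: points_subspace_of)

lemma ringed_quotient: "ringed_space (quotient_space X p)"
proof -
  have op: "openin (zariski (quotient_space X p)) U \<longleftrightarrow> U \<subseteq> p ` points X \<and> openin (zariski X) {x \<in> points X. p x \<in> U}" for U
    by (simp add: quotient_space_def Let_def openin_quotient_topology)
  have reg: "regular (quotient_space X p) U f \<longleftrightarrow> U \<subseteq> p ` points X \<and> regular X {x \<in> points X. p x \<in> U} (\<lambda>x. f (p x))" for U f
    using regular_open by (auto simp: quotient_space_def Let_def openin_quotient_topology)
  show ?thesis
  proof
    show "is_sheaf (quotient_space X p)" unfolding is_sheaf_def
    proof (intro allI iffI)
      fix U f assume *: "regular (quotient_space X p) U f"
      then have "openin (zariski (quotient_space X p)) U"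
        unfolding op using iffD1[OF reg *] regular_open[OF conjunct2[OF iffD1[OF reg *]]] by simp
      then show "openin (zariski (quotient_space X p)) U \<and>
        (\<forall>x\<in>U. \<exists>W g. x \<in> W \<and> regular (quotient_space X p) W g \<and> (\<forall>y\<in>U \<inter> W. f y = g y))"
      proof (intro conjI ballI)
        fix x assume "x \<in> U"
        then show "\<exists>W g. x \<in> W \<and> regular (quotient_space X p) W g \<and> (\<forall>y\<in>U \<inter> W. f y = g y)"
          by (intro exI[of _ U] exI[of _ f]) (simp add: *)
      qed
    next
      fix U f assume *: "openin (zariski (quotient_space X p)) U \<and>
        (\<forall>x\<in>U. \<exists>W g. x \<in> W \<and> regular (quotient_space X p) W g \<and> (\<forall>y\<in>U \<inter> W. f y = g y))"
      have "regular X {x \<in> points X. p x \<in> U} (\<lambda>x. f (p x))"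
      proof (rule regular_local)
        show "openin (zariski X) {x \<in> points X. p x \<in> U}" using * op by blast
        fix x assume x: "x \<in> {x \<in> points X. p x \<in> U}"
        then have "p x \<in> U" by simp
        from bspec[OF conjunct2[OF *] this] obtain W g where
          W: "p x \<in> W" "regular (quotient_space X p) W g" "\<forall>y\<in>U \<inter> W. f y = g y" by (elim exE conjE)
        show "\<exists>V h. x \<in> V \<and> regular X V h \<and> (\<forall>y\<in>{x \<in> points X. p x \<in> U} \<inter> V. f (p y) = h y)"
          by (rule exI[of _ "{x \<in> points X. p x \<in> W}"], rule exI[of _ "\<lambda>x. g (p x)"]) (use W x reg in auto)
      qed
      moreover have "U \<subseteq> p ` points X" using conjunct1[OF *] unfolding op by simp
      ultimately show "regular (quotient_space X p) U f" unfolding reg by simp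
    qed
  next
    fix U and f :: "_ \<Rightarrow> complex"
    have eq: "{x \<in> {x \<in> points X. p x \<in> U}. f (p x) \<noteq> 0} = {x \<in> points X. p x \<in> {x \<in> U. f x \<noteq> 0}}" by blast
    assume *: "regular (quotient_space X p) U f"
    then have r: "regular X {x \<in> points X. p x \<in> U} (\<lambda>x. f (p x))" "U \<subseteq> p ` points X" unfolding reg by simp_all
    show "openin (zariski (quotient_space X p)) {x \<in> U. f x \<noteq> 0}"
      using nonzero_open[OF r(1)] r(2) unfolding eq op by auto
    show "regular (quotient_space X p) {x \<in> U. f x \<noteq> 0} (\<lambda>x. inverse (f x))"
      using inverse[OF r(1)] r(2) unfolding eq reg by auto
  qed (simp_all add: reg op add mult const)
qed

lemma points_quotient_space: "points (quotient_space X p) = p ` points X"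
proof -
  have "openin (zariski (quotient_space X p)) (p ` points X)"
  proof -
    have "{x \<in> points X. p x \<in> p ` points X} = points X" by blast
    then show ?thesis by (simp add: quotient_space_def Let_def openin_quotient_topology)
  qed
  moreover have "U \<subseteq> p ` points X" if "openin (zariski (quotient_space X p)) U" for U
    using that by (simp add: quotient_space_def Let_def openin_quotient_topology)
  ultimately show ?thesis by (metis openin_subset openin_topspace subset_antisym)
qed

lemma quotient_projection: "fn_space_morphism X (quotient_space X p) p"
  unfolding fn_space_morphism_def continuous_map_def points_quotient_space
  by (auto simp: quotient_space_def Let_def openin_quotient_topology)

text \<open>The final structure on the quotient makes descent automatic: openness and regularity on the quotient are tested
  upstairs. This is how maps out of \<open>K4\<close> and out of \<open>V_star_mod_H\<close> are shown to be morphisms.\<close>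

lemma morphism_from_quotient:
  assumes O': "openin (zariski (quotient_space X p)) O'"
    and m: "fn_space_morphism (subspace_of X {x \<in> points X. p x \<in> O'}) Y (\<lambda>x. \<psi> (p x))"
  shows "fn_space_morphism (subspace_of (quotient_space X p) O') Y \<psi>"
proof -
  let ?Q = "quotient_space X p"
  let ?P = "{x \<in> points X. p x \<in> O'}"
  interpret Q: ringed_space ?Q by (rule ringed_quotient)
  have oP: "openin (zariski X) ?P" "O' \<subseteq> p ` points X" using O'
    by (simp_all add: quotient_space_def Let_def openin_quotient_topology)
  have pts: "points (subspace_of ?Q O') = O'" using openin_subset[OF O'] by (auto simp: points_subspace_of)
  have ptsP: "points (subspace_of X ?P) = ?P" by (auto simp: points_subspace_of)
  have eq: "{x \<in> points X. p x \<in> {x \<in> O'. \<psi> x \<in> U}} = {x \<in> ?P. \<psi> (p x) \<in> U}" for U by blast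
  show ?thesis
  proof (rule fn_space_morphismI, unfold pts)
    fix x assume "x \<in> O'"
    then obtain y where "y \<in> ?P" "x = p y" using oP by blast
    then show "\<psi> x \<in> points Y" using fn_space_morphism_into[OF m] ptsP by blast
  next
    fix U assume "openin (zariski Y) U"
    from fn_space_morphism_open[OF m this] have "openin (zariski X) {x \<in> ?P. \<psi> (p x) \<in> U}"
      unfolding ptsP openin_open_subspace[OF oP(1)] by blast
    then have "openin (zariski ?Q) {x \<in> O'. \<psi> x \<in> U}" using oP(2)
      unfolding quotient_space_def Let_def fn_space.simps openin_quotient_topology eq by auto
    then show "openin (zariski (subspace_of ?Q O')) {x \<in> O'. \<psi> x \<in> U}"
      unfolding Q.openin_open_subspace[OF O'] by blast
  next
    fix U f assume "regular Y U f"
    from fn_space_morphism_regular[OF m this] have r: "regular X {x \<in> ?P. \<psi> (p x) \<in> U} (\<lambda>x. f (\<psi> (p x)))"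
      unfolding ptsP regular_open_subspace[OF oP(1)] by blast
    then have "regular ?Q {x \<in> O'. \<psi> x \<in> U} (\<lambda>x. f (\<psi> x))" using oP(2) regular_open[OF r]
      unfolding quotient_space_def Let_def fn_space.simps openin_quotient_topology eq by auto
    then show "regular (subspace_of ?Q O') {x \<in> O'. \<psi> x \<in> U} (\<lambda>x. f (\<psi> x))"
      unfolding Q.regular_open_subspace[OF O'] by blast
  qed
qed

end

lemma morphism_into_subspace:
  assumes X: "ringed_space X" and Z: "ringed_space Z" and m: "fn_space_morphism Z X \<psi>"
    and into: "\<And>z. z \<in> points Z \<Longrightarrow> \<psi> z \<in> Y"
  shows "fn_space_morphism Z (subspace_of X Y) \<psi>"
proof (rule fn_space_morphismI)
  interpret X: ringed_space X by fact
  interpret Z: ringed_space Z by fact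
  have pre: "openin (zariski Z) {z \<in> points Z. \<psi> z \<in> U}" if U: "openin (zariski (subspace_of X Y)) U" for U
  proof -
    from U obtain W where W: "openin (zariski X) W" "U = W \<inter> Y" unfolding openin_subspace_of by blast
    have "{z \<in> points Z. \<psi> z \<in> U} = {z \<in> points Z. \<psi> z \<in> W}" using W(2) into by blast
    then show ?thesis using fn_space_morphism_open[OF m W(1)] by simp
  qed
  then show "openin (zariski Z) {z \<in> points Z. \<psi> z \<in> U}" if "openin (zariski (subspace_of X Y)) U" for U
    using that .
  show "regular Z {z \<in> points Z. \<psi> z \<in> U} (\<lambda>z. f (\<psi> z))" if r: "regular (subspace_of X Y) U f" for U f
  proof (rule Z.regular_local)
    show "openin (zariski Z) {z \<in> points Z. \<psi> z \<in> U}"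
      using pre r unfolding regular_subspace_of by simp
    fix z assume z: "z \<in> {z \<in> points Z. \<psi> z \<in> U}"
    then have "\<psi> z \<in> U" by simp
    with r obtain W g where W: "\<psi> z \<in> W" "regular X W g" "\<forall>y\<in>U \<inter> W. f y = g y" by (rule regular_subspace_ofE)
    show "\<exists>V h. z \<in> V \<and> regular Z V h \<and> (\<forall>y\<in>{z \<in> points Z. \<psi> z \<in> U} \<inter> V. f (\<psi> y) = h y)"
      by (rule exI[of _ "{z \<in> points Z. \<psi> z \<in> W}"], rule exI[of _ "\<lambda>z. g (\<psi> z)"],
          intro conjI fn_space_morphism_regular[OF m W(2)]) (use W z in auto)
  qed
qed (use fn_space_morphism_into[OF m] into in \<open>simp add: points_subspace_of\<close>)

lemma morphism_restrict:
  assumes "ringed_space X" "fn_space_morphism X Y \<phi>"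
  shows "fn_space_morphism (subspace_of X T) Y \<phi>"
  using fn_space_morphism_compose[OF ringed_space.subspace_inclusion[OF assms(1)] assms(2)] .

text \<open>Morphisms are glued from an open cover of the source. The map is given globally beforehand, so no compatibility has to
  be checked.\<close>

lemma morphism_local:
  assumes Z: "ringed_space Z" and Y: "ringed_space Y"
    and loc: "\<And>z. z \<in> points Z \<Longrightarrow> \<exists>W. openin (zariski Z) W \<and> z \<in> W \<and> fn_space_morphism (subspace_of Z W) Y \<psi>"
  shows "fn_space_morphism Z Y \<psi>"
proof (rule fn_space_morphismI)
  interpret Z: ringed_space Z by fact
  have piece: "z \<in> points (subspace_of Z W)" if "z \<in> W" "openin (zariski Z) W" for z W
    using that openin_subset[OF that(2)] by (auto simp: points_subspace_of)
  show "\<psi> z \<in> points Y" if "z \<in> points Z" for z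
  proof -
    from loc[OF that] obtain W where W: "openin (zariski Z) W" "z \<in> W" "fn_space_morphism (subspace_of Z W) Y \<psi>"
      by blast
    show ?thesis by (rule fn_space_morphism_into[OF W(3) piece[OF W(2,1)]])
  qed
  show pre: "openin (zariski Z) {z \<in> points Z. \<psi> z \<in> U}" if "openin (zariski Y) U" for U
  proof (subst openin_subopen, intro ballI)
    fix z assume z: "z \<in> {z \<in> points Z. \<psi> z \<in> U}"
    then have "z \<in> points Z" by simp
    from loc[OF this] obtain W where W: "openin (zariski Z) W" "z \<in> W" "fn_space_morphism (subspace_of Z W) Y \<psi>"
      by blast
    have "openin (zariski Z) {z \<in> points (subspace_of Z W). \<psi> z \<in> U}"
      using fn_space_morphism_open[OF W(3) that] unfolding Z.openin_open_subspace[OF W(1)] by blast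
    then show "\<exists>T. openin (zariski Z) T \<and> z \<in> T \<and> T \<subseteq> {z \<in> points Z. \<psi> z \<in> U}"
      by (intro exI[of _ "{z \<in> points (subspace_of Z W). \<psi> z \<in> U}"] conjI)
         (use z piece[OF W(2,1)] in \<open>auto simp: points_subspace_of\<close>)
  qed
  show "regular Z {z \<in> points Z. \<psi> z \<in> U} (\<lambda>z. f (\<psi> z))" if r: "regular Y U f" for U f
  proof (rule Z.regular_local[OF pre[OF ringed_space.regular_open[OF Y r]]])
    fix z assume z: "z \<in> {z \<in> points Z. \<psi> z \<in> U}"
    then have "z \<in> points Z" by simp
    from loc[OF this] obtain W where W: "openin (zariski Z) W" "z \<in> W" "fn_space_morphism (subspace_of Z W) Y \<psi>"
      by blast
    have "regular Z {z \<in> points (subspace_of Z W). \<psi> z \<in> U} (\<lambda>z. f (\<psi> z))"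
      using fn_space_morphism_regular[OF W(3) r] unfolding Z.regular_open_subspace[OF W(1)] by blast
    then show "\<exists>V h. z \<in> V \<and> regular Z V h \<and> (\<forall>y\<in>{z \<in> points Z. \<psi> z \<in> U} \<inter> V. f (\<psi> y) = h y)"
      by (intro exI[of _ "{z \<in> points (subspace_of Z W). \<psi> z \<in> U}"] exI[of _ "\<lambda>z. f (\<psi> z)"] conjI)
         (use z piece[OF W(2,1)] in \<open>auto simp: points_subspace_of\<close>)
  qed
qed

text \<open>An isomorphism together with its inverse. Keeping the inverse explicit lets isomorphisms be restricted and composed.\<close>

definition inverse_isomorphisms :: "'a fn_space \<Rightarrow> 'b fn_space \<Rightarrow> ('a \<Rightarrow> 'b) \<Rightarrow> ('b \<Rightarrow> 'a) \<Rightarrow> bool" where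
  "inverse_isomorphisms X Y \<phi> \<psi> \<longleftrightarrow> fn_space_morphism X Y \<phi> \<and> fn_space_morphism Y X \<psi> \<and>
     (\<forall>x\<in>points X. \<psi> (\<phi> x) = x) \<and> (\<forall>y\<in>points Y. \<phi> (\<psi> y) = y)"

lemma fn_space_isomorphism_iff: "fn_space_isomorphism X Y \<phi> \<longleftrightarrow> (\<exists>\<psi>. inverse_isomorphisms X Y \<phi> \<psi>)"
  unfolding fn_space_isomorphism_def inverse_isomorphisms_def by auto

lemma inverse_isomorphisms_sym: "inverse_isomorphisms X Y \<phi> \<psi> \<Longrightarrow> inverse_isomorphisms Y X \<psi> \<phi>"
  unfolding inverse_isomorphisms_def by blast

lemma inverse_isomorphisms_compose:
  assumes "inverse_isomorphisms X Y \<phi> \<psi>" "inverse_isomorphisms Y Z \<phi>' \<psi>'"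
  shows "inverse_isomorphisms X Z (\<lambda>x. \<phi>' (\<phi> x)) (\<lambda>z. \<psi> (\<psi>' z))"
proof -
  have m: "fn_space_morphism X Y \<phi>" "fn_space_morphism Y X \<psi>" "fn_space_morphism Y Z \<phi>'" "fn_space_morphism Z Y \<psi>'"
    using assms unfolding inverse_isomorphisms_def by simp_all
  then show ?thesis unfolding inverse_isomorphisms_def
    by (intro conjI ballI fn_space_morphism_compose[OF m(1,3)] fn_space_morphism_compose[OF m(4,2)])
       (use assms fn_space_morphism_into[OF m(1)] fn_space_morphism_into[OF m(4)] in
         \<open>simp_all add: inverse_isomorphisms_def\<close>)
qed

lemma inverse_isomorphisms_restrict:
  assumes X: "ringed_space X" and Y: "ringed_space Y" and iso: "inverse_isomorphisms X Y \<phi> \<psi>"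
    and T: "\<And>x. x \<in> points X \<Longrightarrow> x \<in> T \<longleftrightarrow> \<phi> x \<in> T'"
  shows "inverse_isomorphisms (subspace_of X T) (subspace_of Y T') \<phi> \<psi>"
proof -
  have m: "fn_space_morphism X Y \<phi>" "fn_space_morphism Y X \<psi>" and
    inv: "\<And>x. x \<in> points X \<Longrightarrow> \<psi> (\<phi> x) = x" "\<And>y. y \<in> points Y \<Longrightarrow> \<phi> (\<psi> y) = y"
    using iso unfolding inverse_isomorphisms_def by blast+
  have T2: "\<psi> y \<in> T" if "y \<in> points Y" "y \<in> T'" for y
    using T[OF fn_space_morphism_into[OF m(2) that(1)]] inv(2)[OF that(1)] that(2) by simp
  have "fn_space_morphism (subspace_of X T) (subspace_of Y T') \<phi>"
    by (rule morphism_into_subspace[OF Y ringed_space.ringed_subspace[OF X] morphism_restrict[OF X m(1)]])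
       (use T in \<open>auto simp: points_subspace_of\<close>)
  moreover have "fn_space_morphism (subspace_of Y T') (subspace_of X T) \<psi>"
    by (rule morphism_into_subspace[OF X ringed_space.ringed_subspace[OF Y] morphism_restrict[OF Y m(2)]])
       (use T2 in \<open>auto simp: points_subspace_of\<close>)
  ultimately show ?thesis unfolding inverse_isomorphisms_def by (simp add: points_subspace_of inv)
qed

lemma affine_variety_iso:
  assumes "inverse_isomorphisms X Y \<phi> \<psi>" "affine_variety Y"
  shows "affine_variety X"
proof -
  from assms(2) obtain n Z \<phi>' where 1: "closedin (zariski (affine_space n)) Z"
    "fn_space_isomorphism Y (subspace_of (affine_space n) Z) \<phi>'"
    unfolding affine_variety_def by (elim exE conjE)
  from 1(2) obtain \<psi>' where 2: "inverse_isomorphisms Y (subspace_of (affine_space n) Z) \<phi>' \<psi>'"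
    unfolding fn_space_isomorphism_iff by (elim exE)
  have "fn_space_isomorphism X (subspace_of (affine_space n) Z) (\<lambda>x. \<phi>' (\<phi> x))"
    unfolding fn_space_isomorphism_iff by (rule exI, rule inverse_isomorphisms_compose[OF assms(1) 2])
  then show ?thesis unfolding affine_variety_def
    by - (rule exI[of _ n], rule exI[of _ Z], rule exI[of _ "\<lambda>x. \<phi>' (\<phi> x)"], rule conjI[OF 1(1)])
qed

lemma algebraic_varietyI:
  assumes "ringed_space X" "finite I" "\<And>i. i \<in> I \<Longrightarrow> openin (zariski X) (U i)"
    and "\<And>x. x \<in> points X \<Longrightarrow> \<exists>i\<in>I. x \<in> U i"
    and "\<And>i. i \<in> I \<Longrightarrow> affine_variety (subspace_of X (U i))"
  shows "algebraic_variety X"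
proof -
  have "\<Union>(U ` I) = points X"
  proof (rule equalityI)
    show "\<Union>(U ` I) \<subseteq> points X" by (intro UN_least openin_subset assms(3))
    show "points X \<subseteq> \<Union>(U ` I)" using assms(4) by auto
  qed
  moreover have "\<forall>W\<in>U ` I. openin (zariski X) W \<and> affine_variety (subspace_of X W)" using assms(3,5) by simp
  ultimately show ?thesis unfolding algebraic_variety_def
    by (intro conjI ringed_space.sheaf[OF assms(1)] exI[of _ "U ` I"] finite_imageI assms(2))
qed

lemma inverse_isomorphisms_preimage:
  assumes X: "ringed_space X" and Y: "ringed_space Y" and iso: "inverse_isomorphisms X Y \<phi> \<psi>"
    and U: "openin (zariski Y) U"
  shows "openin (zariski X) {x \<in> points X. \<phi> x \<in> U}"
    and "inverse_isomorphisms (subspace_of X {x \<in> points X. \<phi> x \<in> U}) (subspace_of Y U) \<phi> \<psi>"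
proof -
  show "openin (zariski X) {x \<in> points X. \<phi> x \<in> U}"
    using fn_space_morphism_open[OF conjunct1[OF iso[unfolded inverse_isomorphisms_def]] U] .
  show "inverse_isomorphisms (subspace_of X {x \<in> points X. \<phi> x \<in> U}) (subspace_of Y U) \<phi> \<psi>"
    by (rule inverse_isomorphisms_restrict[OF X Y iso]) simp
qed

lemma algebraic_variety_iso:
  assumes X: "ringed_space X" and Y: "ringed_space Y" and iso: "inverse_isomorphisms X Y \<phi> \<psi>"
    and alg: "algebraic_variety Y"
  shows "algebraic_variety X"
proof -
  from alg obtain \<U> where U: "finite \<U>" "\<Union>\<U> = points Y"
    "\<forall>U\<in>\<U>. openin (zariski Y) U \<and> affine_variety (subspace_of Y U)"
    unfolding algebraic_variety_def by blast
  show ?thesis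
  proof (rule algebraic_varietyI[OF X U(1), where U = "\<lambda>U. {x \<in> points X. \<phi> x \<in> U}"])
    fix U assume "U \<in> \<U>"
    then have "openin (zariski Y) U" "affine_variety (subspace_of Y U)" using U(3) by blast+
    then show "openin (zariski X) {x \<in> points X. \<phi> x \<in> U}" "affine_variety (subspace_of X {x \<in> points X. \<phi> x \<in> U})"
      using inverse_isomorphisms_preimage(1)[OF X Y iso]
        affine_variety_iso[OF inverse_isomorphisms_preimage(2)[OF X Y iso]] by simp_all
  next
    fix x assume "x \<in> points X"
    then have "\<phi> x \<in> points Y"
      using fn_space_morphism_into[OF conjunct1[OF iso[unfolded inverse_isomorphisms_def]]] by simp
    then show "\<exists>U\<in>\<U>. x \<in> {x \<in> points X. \<phi> x \<in> U}" using U(2) \<open>x \<in> points X\<close> by blast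
  qed
qed

text \<open>Smoothness is transported along isomorphisms: compose the local model with the isomorphism.\<close>

lemma smooth_at_point_iso:
  assumes X: "ringed_space X" and Y: "ringed_space Y" and iso: "inverse_isomorphisms X Y \<phi> \<psi>"
    and x: "x \<in> points X" and sm: "smooth_at_point Y (\<phi> x)"
  shows "smooth_at_point X x"
proof -
  from sm obtain U n c W f \<eta> where 1: "openin (zariski Y) U" "\<phi> x \<in> U"
    "openin (zariski (affine_space n)) W" "\<forall>i<c. f i \<in> polynomial_functions n"
    "fn_space_isomorphism (subspace_of Y U) (subspace_of (affine_space n) {z \<in> W. \<forall>i<c. f i z = 0}) \<eta>"
    "\<forall>a :: nat \<Rightarrow> complex. (\<forall>j<n. (\<Sum>i<c. a i * deriv (\<lambda>t. f i ((\<eta> (\<phi> x))(j := t))) (\<eta> (\<phi> x) j)) = 0)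
             \<longrightarrow> (\<forall>i<c. a i = 0)"
    unfolding smooth_at_point_def by (elim exE conjE)
  from 1(5) obtain \<eta>' where \<eta>': "inverse_isomorphisms (subspace_of Y U) (subspace_of (affine_space n) {z \<in> W. \<forall>i<c. f i z = 0}) \<eta> \<eta>'"
    unfolding fn_space_isomorphism_iff by (elim exE)
  have 2: "fn_space_isomorphism (subspace_of X {x \<in> points X. \<phi> x \<in> U}) (subspace_of (affine_space n) {z \<in> W. \<forall>i<c. f i z = 0}) (\<lambda>x. \<eta> (\<phi> x))"
    unfolding fn_space_isomorphism_iff
    by (rule exI, rule inverse_isomorphisms_compose[OF inverse_isomorphisms_preimage(2)[OF X Y iso 1(1)] \<eta>'])
  show ?thesis unfolding smooth_at_point_def
    by (rule exI[of _ "{x \<in> points X. \<phi> x \<in> U}"], rule exI[of _ n], rule exI[of _ c], rule exI[of _ W], rule exI[of _ f],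
        rule exI[of _ "\<lambda>x. \<eta> (\<phi> x)"], intro conjI inverse_isomorphisms_preimage(1)[OF X Y iso 1(1)] 1(3,4,6) 2)
       (use x 1(2) in simp)
qed

section \<open>Affine space\<close>

lemma ringed_affine_space: "ringed_space (affine_space n)"
  unfolding affine_space_def polynomial_functions_def by (rule ringed_algebra_space)

lemma points_affine_space: "points (affine_space n) = {z. \<forall>i\<ge>n. z i = 0}"
  unfolding affine_space_def polynomial_functions_def by (rule points_algebra_space)

lemma polynomial_regular: "f \<in> polynomial_functions n \<Longrightarrow> regular (affine_space n) (points (affine_space n)) f"
  unfolding points_affine_space unfolding affine_space_def polynomial_functions_def by (rule regular_algebra_space)

lemma polynomial_coord: "i < n \<Longrightarrow> (\<lambda>z. z i) \<in> polynomial_functions n"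
  unfolding polynomial_functions_def by (rule generated_algebra.gen) auto

lemma polynomial_const: "(\<lambda>_. c) \<in> polynomial_functions n"
  unfolding polynomial_functions_def by (rule generated_algebra.const)

lemma polynomial_add: "f \<in> polynomial_functions n \<Longrightarrow> g \<in> polynomial_functions n \<Longrightarrow> (\<lambda>z. f z + g z) \<in> polynomial_functions n"
  unfolding polynomial_functions_def by (rule generated_algebra.add)

lemma polynomial_mult: "f \<in> polynomial_functions n \<Longrightarrow> g \<in> polynomial_functions n \<Longrightarrow> (\<lambda>z. f z * g z) \<in> polynomial_functions n"
  unfolding polynomial_functions_def by (rule generated_algebra.mult)

lemma polynomial_diff: "f \<in> polynomial_functions n \<Longrightarrow> g \<in> polynomial_functions n \<Longrightarrow> (\<lambda>z. f z - g z) \<in> polynomial_functions n"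
  using polynomial_add[OF _ polynomial_mult[OF polynomial_const[of "-1"]], of f n g] by simp

lemmas polynomial_intros = polynomial_const polynomial_add polynomial_diff polynomial_mult

lemma polynomial_induct [consumes 1, case_names coord const add mult]:
  assumes "f \<in> polynomial_functions n" "\<And>i. i < n \<Longrightarrow> P (\<lambda>z. z i)" "\<And>c. P (\<lambda>_. c)"
    "\<And>f g. f \<in> polynomial_functions n \<Longrightarrow> g \<in> polynomial_functions n \<Longrightarrow> P f \<Longrightarrow> P g \<Longrightarrow> P (\<lambda>z. f z + g z)"
    "\<And>f g. f \<in> polynomial_functions n \<Longrightarrow> g \<in> polynomial_functions n \<Longrightarrow> P f \<Longrightarrow> P g \<Longrightarrow> P (\<lambda>z. f z * g z)"
  shows "P f"
  using assms(1) unfolding polynomial_functions_def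
proof induction
  case (gen g)
  then show ?case using assms(2) by auto
qed (use assms(3-5) in \<open>simp_all add: polynomial_functions_def\<close>)

lemma morphism_into_affine_space:
  assumes "ringed_space Z" "\<And>z i. z \<in> points Z \<Longrightarrow> i \<ge> n \<Longrightarrow> \<psi> z i = 0"
    and "\<And>i. i < n \<Longrightarrow> regular Z (points Z) (\<lambda>z. \<psi> z i)"
  shows "fn_space_morphism Z (affine_space n) \<psi>"
  unfolding affine_space_def polynomial_functions_def
  by (rule morphism_into_algebra_space[OF assms(1)]) (use assms(2,3) in auto)

lemma polynomial_pullback:
  assumes "ringed_space Z" "f \<in> polynomial_functions n" "openin (zariski Z) U"
    and "\<And>i. i < n \<Longrightarrow> regular Z U (\<lambda>z. \<psi> z i)"
  shows "regular Z U (\<lambda>z. f (\<psi> z))"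
  by (rule ringed_space.generated[OF assms(1) assms(2)[unfolded polynomial_functions_def] assms(3)])
     (use assms(4) in auto)

lemma openin_polynomial_nonzero:
  assumes "h \<in> polynomial_functions n"
  shows "openin (zariski (affine_space n)) {z \<in> points (affine_space n). h z \<noteq> 0}"
  by (rule ringed_space.nonzero_open[OF ringed_affine_space polynomial_regular[OF assms]])

lemma closedin_zero_locus:
  assumes "E \<subseteq> polynomial_functions n"
  shows "closedin (zariski (affine_space n)) {z \<in> points (affine_space n). \<forall>P\<in>E. P z = 0}"
proof -
  have "openin (zariski (affine_space n)) (\<Union>P\<in>E. {z \<in> points (affine_space n). P z \<noteq> 0})"
    by (rule openin_Union) (use assms openin_polynomial_nonzero in blast)
  moreover have "points (affine_space n) - {z \<in> points (affine_space n). \<forall>P\<in>E. P z = 0} =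
      (\<Union>P\<in>E. {z \<in> points (affine_space n). P z \<noteq> 0})" by blast
  ultimately show ?thesis unfolding closedin_def by auto
qed

text \<open>The Rabinowitsch trick: the part of a closed set where \<open>h\<close> does not vanish is isomorphic to a closed set with one
  more coordinate, which takes the value \<open>1 / h\<close>.\<close>

lemma affine_variety_principal:
  assumes E: "E \<subseteq> polynomial_functions n" and h: "h \<in> polynomial_functions n"
  shows "affine_variety (subspace_of (affine_space n) {z. (\<forall>i\<ge>n. z i = 0) \<and> (\<forall>P\<in>E. P z = 0) \<and> h z \<noteq> 0})"
proof -
  let ?A = "affine_space n" and ?B = "affine_space (Suc n)"
  let ?T = "{z. (\<forall>i\<ge>n. z i = 0) \<and> (\<forall>P\<in>E. P z = 0) \<and> h z \<noteq> 0}"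
  let ?t = "\<lambda>z::nat \<Rightarrow> complex. z(n := 0)"
  define E' where "E' = insert (\<lambda>z. h (?t z) * z n - 1) ((\<lambda>P z. P (?t z)) ` E)"
  let ?Z = "{z \<in> points ?B. \<forall>P\<in>E'. P z = 0}"
  have trunc: "(\<lambda>z. P (?t z)) \<in> polynomial_functions (Suc n)" if "P \<in> polynomial_functions n" for P
    using that
  proof (induction rule: polynomial_induct)
    case (coord i)
    then show ?case using polynomial_coord[of i "Suc n"] by simp
  qed (simp_all add: polynomial_intros)
  have "E' \<subseteq> polynomial_functions (Suc n)" unfolding E'_def
    using E by (auto intro!: polynomial_diff polynomial_mult polynomial_const polynomial_coord trunc h)
  then have closed: "closedin (zariski ?B) ?Z" by (rule closedin_zero_locus)
  interpret A: ringed_space ?A by (rule ringed_affine_space)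
  interpret B: ringed_space ?B by (rule ringed_affine_space)
  interpret T: ringed_space "subspace_of ?A ?T" by (rule A.ringed_subspace)
  interpret Z: ringed_space "subspace_of ?B ?Z" by (rule B.ringed_subspace)
  have ptsT: "points (subspace_of ?A ?T) = ?T" by (auto simp: points_subspace_of points_affine_space)
  have ptsZ: "points (subspace_of ?B ?Z) = ?Z" by (auto simp: points_subspace_of)
  let ?\<phi> = "\<lambda>z. z(n := 1 / h z)"
  have polyT: "regular (subspace_of ?A ?T) ?T P" if "P \<in> polynomial_functions n" for P
    using A.regular_restrict_subspace[OF polynomial_regular[OF that], of ?T] ptsT
    by (simp add: points_subspace_of)
  have polyZ: "regular (subspace_of ?B ?Z) ?Z P" if "P \<in> polynomial_functions (Suc n)" for P
    using B.regular_restrict_subspace[OF polynomial_regular[OF that], of ?Z] ptsZ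
    by (simp add: points_subspace_of)
  have "fn_space_morphism (subspace_of ?A ?T) ?B ?\<phi>"
  proof (rule morphism_into_affine_space[OF T.ringed_space_axioms], unfold ptsT)
    fix i assume "i < Suc n"
    then consider "i = n" | "i < n" by linarith
    then show "regular (subspace_of ?A ?T) ?T (\<lambda>z. (?\<phi> z) i)"
    proof cases
      case 1
      have "regular (subspace_of ?A ?T) ?T (\<lambda>z. 1 / h z)"
        by (rule T.divide_nonzero[OF polyT[OF polynomial_const] polyT[OF h]]) simp
      then show ?thesis using 1 by simp
    next
      case 2
      then show ?thesis using polyT[OF polynomial_coord[OF 2]] by simp
    qed
  qed simp
  moreover have t\<phi>: "?t (?\<phi> z) = z" if "z \<in> ?T" for z using that by auto
  moreover have "?\<phi> z \<in> ?Z" if "z \<in> ?T" for z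
    using that t\<phi>[OF that] by (auto simp: points_affine_space E'_def)
  ultimately have 1: "fn_space_morphism (subspace_of ?A ?T) (subspace_of ?B ?Z) ?\<phi>"
    by (intro morphism_into_subspace B.ringed_space_axioms T.ringed_space_axioms) (simp_all add: ptsT)
  have "fn_space_morphism (subspace_of ?B ?Z) ?A ?t"
  proof (rule morphism_into_affine_space[OF Z.ringed_space_axioms], unfold ptsZ)
    fix i assume "i < n"
    then show "regular (subspace_of ?B ?Z) ?Z (\<lambda>z. (?t z) i)" using polyZ[OF polynomial_coord[of i "Suc n"]] by simp
  qed (auto simp: points_affine_space)
  moreover have tZ: "?t z \<in> ?T" if "z \<in> ?Z" for z
    using that by (auto simp: points_affine_space E'_def)
  ultimately have 2: "fn_space_morphism (subspace_of ?B ?Z) (subspace_of ?A ?T) ?t"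
    by (intro morphism_into_subspace A.ringed_space_axioms Z.ringed_space_axioms) (simp_all only: ptsZ)
  have 3: "?\<phi> (?t z) = z" if "z \<in> ?Z" for z
  proof -
    have "h (?t z) * z n = 1" using that by (auto simp: E'_def)
    then have "1 / h (?t z) = z n" by (metis mult_zero_left nonzero_eq_divide_eq zero_neq_one mult.commute)
    then show ?thesis by auto
  qed
  have "inverse_isomorphisms (subspace_of ?A ?T) (subspace_of ?B ?Z) ?\<phi> ?t"
    unfolding inverse_isomorphisms_def ptsT ptsZ using 1 2 3 t\<phi> by blast
  then have "fn_space_isomorphism (subspace_of ?A ?T) (subspace_of ?B ?Z) ?\<phi>"
    unfolding fn_space_isomorphism_iff by (rule exI[of _ ?t])
  then show ?thesis unfolding affine_variety_def
    by - (rule exI[of _ "Suc n"], rule exI[of _ ?Z], rule exI[of _ ?\<phi>], rule conjI[OF closed])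
qed

section \<open>The projective line and the charts of the quotient of its fourth power\<close>

lemma regular_quotient_space:
  assumes "ringed_space X"
  shows "regular (quotient_space X p) U f \<longleftrightarrow>
    U \<subseteq> p ` points X \<and> regular X {x \<in> points X. p x \<in> U} (\<lambda>x. f (p x))"
  using ringed_space.regular_open[OF assms] by (auto simp: quotient_space_def Let_def openin_quotient_topology)

lemma openin_quotient_space:
  "openin (zariski (quotient_space X p)) U \<longleftrightarrow>
    U \<subseteq> p ` points X \<and> openin (zariski X) {x \<in> points X. p x \<in> U}"
  by (simp add: quotient_space_def Let_def openin_quotient_topology)

abbreviation punctured_plane :: "(nat \<Rightarrow> complex) fn_space" where
  "punctured_plane \<equiv> subspace_of (affine_space 2) {z. (z 0, z 1) \<noteq> (0, 0)}"

lemma ringed_punctured_plane: "ringed_space punctured_plane"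
  by (rule ringed_space.ringed_subspace[OF ringed_affine_space])

lemma points_punctured_plane: "points punctured_plane = {z. (\<forall>i\<ge>2. z i = 0) \<and> (z 0, z 1) \<noteq> (0, 0)}"
  by (auto simp: points_subspace_of points_affine_space)

lemma ringed_P1: "ringed_space P1"
  unfolding P1_def by (rule ringed_space.ringed_quotient[OF ringed_punctured_plane])

text \<open>The projective line is the quotient of the punctured plane, so homogeneous coordinates without common zero give a
  morphism.\<close>

lemma morphism_into_P1:
  assumes Z: "ringed_space Z" and a: "regular Z (points Z) a" and b: "regular Z (points Z) b"
    and nz: "\<And>z. z \<in> points Z \<Longrightarrow> (a z, b z) \<noteq> (0, 0)"
  shows "fn_space_morphism Z P1 (\<lambda>z. ratio (a z) (b z))"
proof -
  let ?\<psi> = "\<lambda>z i::nat. if i = 0 then a z else if i = 1 then b z else 0"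
  have "fn_space_morphism Z (affine_space 2) ?\<psi>"
  proof (rule morphism_into_affine_space[OF Z])
    fix i :: nat assume "i < 2"
    then consider "i = 0" | "i = 1" by linarith
    then show "regular Z (points Z) (\<lambda>z. ?\<psi> z i)" by cases (simp_all add: a b)
  qed auto
  then have "fn_space_morphism Z punctured_plane ?\<psi>"
    by (rule morphism_into_subspace[OF ringed_affine_space Z]) (use nz in auto)
  then have "fn_space_morphism Z P1 (\<lambda>z. ratio (?\<psi> z 0) (?\<psi> z 1))"
    unfolding P1_def
    by (rule fn_space_morphism_compose[OF _ ringed_space.quotient_projection[OF ringed_punctured_plane]])
  then show ?thesis by simp
qed

lemma ratio_surj: "(\<lambda>z. ratio (z 0) (z 1)) ` points punctured_plane = UNIV"
proof -
  have "\<exists>z\<in>points punctured_plane. r = ratio (z 0) (z 1)" for r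
  proof (cases r)
    case (Fin x)
    then show ?thesis unfolding points_punctured_plane
      by (intro bexI[of _ "\<lambda>i. if i = 0 then x else if i = 1 then 1 else 0"])
         (simp_all add: ratio_def)
  next
    case Infty
    then show ?thesis unfolding points_punctured_plane
      by (intro bexI[of _ "\<lambda>i. if i = 0 then 1 else 0"]) (simp_all add: ratio_def)
  qed
  then show ?thesis by auto
qed

lemma points_P1: "points P1 = UNIV"
  unfolding P1_def ringed_space.points_quotient_space[OF ringed_punctured_plane] by (rule ratio_surj)

text \<open>The two affine coordinates of a point, with junk value 0 where they are infinite.\<close>

fun val :: "proj1 \<Rightarrow> complex" where
  "val (Fin z) = z"
| "val Infty = 0"

fun inval :: "proj1 \<Rightarrow> complex" where
  "inval (Fin z) = 1 / z"
| "inval Infty = 0"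

lemma punctured_plane_coord:
  assumes "i < 2"
  shows "regular punctured_plane (points punctured_plane) (\<lambda>z. z i)"
  using ringed_space.regular_restrict_subspace[OF ringed_affine_space polynomial_regular[OF polynomial_coord[OF assms]]]
  unfolding points_subspace_of .

lemma regular_val: "regular P1 {r. r \<noteq> Infty} val"
proof -
  interpret R: ringed_space punctured_plane by (rule ringed_punctured_plane)
  have eq: "{z \<in> points punctured_plane. ratio (z 0) (z 1) \<in> {r. r \<noteq> Infty}} = {z \<in> points punctured_plane. z 1 \<noteq> 0}"
    by (auto simp: ratio_def)
  have "regular punctured_plane {z \<in> points punctured_plane. z 1 \<noteq> 0} (\<lambda>z. z 0 / z 1)"
    by (rule R.divide[OF punctured_plane_coord punctured_plane_coord]) simp_all
  then have "regular punctured_plane {z \<in> points punctured_plane. z 1 \<noteq> 0} (\<lambda>z. val (ratio (z 0) (z 1)))"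
    by (rule R.regular_cong) (simp add: ratio_def)
  then show ?thesis
    unfolding P1_def regular_quotient_space[OF ringed_punctured_plane] eq ratio_surj by simp
qed

lemma regular_inval: "regular P1 {r. r \<noteq> Fin 0} inval"
proof -
  interpret R: ringed_space punctured_plane by (rule ringed_punctured_plane)
  have eq: "{z \<in> points punctured_plane. ratio (z 0) (z 1) \<in> {r. r \<noteq> Fin 0}} = {z \<in> points punctured_plane. z 0 \<noteq> 0}"
    unfolding points_punctured_plane by (auto simp: ratio_def)
  have "regular punctured_plane {z \<in> points punctured_plane. z 0 \<noteq> 0} (\<lambda>z. z 1 / z 0)"
    by (rule R.divide[OF punctured_plane_coord punctured_plane_coord]) simp_all
  then have "regular punctured_plane {z \<in> points punctured_plane. z 0 \<noteq> 0} (\<lambda>z. inval (ratio (z 0) (z 1)))"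
    by (rule R.regular_cong) (simp add: ratio_def)
  then show ?thesis
    unfolding P1_def regular_quotient_space[OF ringed_punctured_plane] eq ratio_surj by simp
qed

lemma ringed_P1_4: "ringed_space P1_4"
  unfolding P1_4_def by (rule ringed_power_space[OF ringed_P1])

lemma points_P1_4: "points P1_4 = UNIV"
  unfolding P1_4_def by (simp add: points_power_space[OF ringed_P1] points_P1)

lemma P1_4_projection: "fn_space_morphism P1_4 P1 (\<lambda>r. r$l)"
  unfolding P1_4_def by (rule power_space_projection[OF ringed_P1])

lemma regular_P1_4_val: "regular P1_4 {r. r$l \<noteq> Infty} (\<lambda>r. val (r$l))"
  using fn_space_morphism_regular[OF P1_4_projection regular_val] unfolding points_P1_4 by simp

lemma regular_P1_4_inval: "regular P1_4 {r. r$l \<noteq> Fin 0} (\<lambda>r. inval (r$l))"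
  using fn_space_morphism_regular[OF P1_4_projection regular_inval] unfolding points_P1_4 by simp

definition tscale :: "complex \<Rightarrow> proj1^4 \<Rightarrow> proj1^4" where
  "tscale t r = (\<chi> k. scale t (r$k))"

lemma scale_scale: "scale s (scale t r) = scale (s * t) r"
  by (cases r) auto

lemma scale_1 [simp]: "scale 1 r = r"
  by (cases r) auto

lemma tscale_nth [simp]: "tscale t r $ k = scale t (r$k)"
  by (simp add: tscale_def)

lemma tscale_tscale: "tscale s (tscale t r) = tscale (s * t) r"
  by (simp add: vec_eq_iff scale_scale)

lemma tscale_1 [simp]: "tscale 1 r = r"
  by (simp add: vec_eq_iff)

lemma torus_orbit_eq: "torus_orbit r = {tscale t r | t. t \<noteq> 0}"
  by (simp add: torus_orbit_def tscale_def)

lemma torus_orbit_tscale: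
  assumes "t \<noteq> 0"
  shows "torus_orbit (tscale t r) = torus_orbit r"
proof -
  have "\<exists>s'. tscale s (tscale t r) = tscale s' r \<and> s' \<noteq> 0" if "s \<noteq> 0" for s
    using that assms by (intro exI[of _ "s * t"]) (simp add: tscale_tscale)
  moreover have "\<exists>s'. tscale s r = tscale s' (tscale t r) \<and> s' \<noteq> 0" if "s \<noteq> 0" for s
    using that assms by (intro exI[of _ "s / t"]) (simp add: tscale_tscale)
  ultimately show ?thesis unfolding torus_orbit_eq by auto
qed

lemma torus_orbit_eqD:
  assumes "torus_orbit r = torus_orbit r'"
  obtains t where "t \<noteq> 0" "r' = tscale t r"
proof -
  have "r' = tscale 1 r'" by simp
  then have "r' \<in> torus_orbit r'" unfolding torus_orbit_eq by (metis (mono_tags, lifting) mem_Collect_eq zero_neq_one)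
  then show ?thesis using that assms unfolding torus_orbit_eq by blast
qed

lemma scale_eq_iff:
  "t \<noteq> 0 \<Longrightarrow> scale t r = Infty \<longleftrightarrow> r = Infty"
  "t \<noteq> 0 \<Longrightarrow> scale t r = Fin 0 \<longleftrightarrow> r = Fin 0"
  by (cases r; simp)+

lemma tscale_Theta4: "t \<noteq> 0 \<Longrightarrow> tscale t r \<in> Theta4 \<longleftrightarrow> r \<in> Theta4"
  by (simp add: Theta4_def scale_eq_iff)

abbreviation P1_4_free :: "(proj1^4) fn_space" where
  "P1_4_free \<equiv> subspace_of P1_4 (UNIV - Theta4)"

lemma ringed_P1_4_free: "ringed_space P1_4_free"
  by (rule ringed_space.ringed_subspace[OF ringed_P1_4])

lemma points_P1_4_free: "points P1_4_free = UNIV - Theta4"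
  by (simp add: points_subspace_of points_P1_4)

lemma ringed_K4: "ringed_space K4"
  unfolding K4_def by (rule ringed_space.ringed_quotient[OF ringed_P1_4_free])

lemma points_K4: "points K4 = torus_orbit ` (UNIV - Theta4)"
  unfolding K4_def ringed_space.points_quotient_space[OF ringed_P1_4_free] points_P1_4_free ..

text \<open>Coordinates of affine four-space are numbered from 0.\<close>

definition idx :: "4 \<Rightarrow> nat" where
  "idx k = (if k = 1 then 0 else if k = 2 then 1 else if k = 3 then 2 else 3)"

definition xdi :: "nat \<Rightarrow> 4" where
  "xdi i = (if i = 0 then 1 else if i = 1 then 2 else if i = 2 then 3 else 4)"

lemma idx_less [simp]: "idx k < 4"
  by (simp add: idx_def)

lemma xdi_idx [simp]: "xdi (idx k) = k"
  using exhaust_4[of k] by (auto simp: xdi_def idx_def)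

lemma idx_xdi: "i < 4 \<Longrightarrow> idx (xdi i) = i"
  by (auto simp: xdi_def idx_def)

lemma idx_eq_iff [simp]: "idx k = idx l \<longleftrightarrow> k = l"
  by (metis xdi_idx)

text \<open>The slice \<open>z\<^sub>k = 1\<close> meets each orbit of the torus with \<open>z\<^sub>k \<noteq> 0\<close> once. It is isomorphic to affine
  three-space; keeping all four coordinates makes the formulas symmetric.\<close>

definition chart_dom :: "4 \<Rightarrow> (nat \<Rightarrow> complex) set" where
  "chart_dom k = {z. (\<forall>i\<ge>4. z i = 0) \<and> z (idx k) = 1}"

text \<open>The set \<open>e\<close> records the coordinates that are taken at infinity: there \<open>z\<^sub>l\<close> is the inverse of the \<open>l\<close>-th coordinate.\<close>

definition chart_pt :: "4 set \<Rightarrow> (nat \<Rightarrow> complex) \<Rightarrow> proj1^4" where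
  "chart_pt e z = (\<chi> l. if l \<in> e then ratio 1 (z (idx l)) else Fin (z (idx l)))"

definition chart :: "4 set \<Rightarrow> (nat \<Rightarrow> complex) \<Rightarrow> (proj1^4) set" where
  "chart e z = torus_orbit (chart_pt e z)"

text \<open>The points with \<open>k\<close>-th coordinate different from 0 and infinity at which the affine coordinates selected by \<open>e\<close> are
  finite. For \<open>l\<close> in \<open>e\<close> the torus acts on the coordinate \<open>z\<^sub>l\<close> by the inverse character.\<close>

definition chart_box :: "4 \<Rightarrow> 4 set \<Rightarrow> (proj1^4) set" where
  "chart_box k e = {r. r$k \<noteq> Fin 0 \<and> r$k \<noteq> Infty \<and> (\<forall>l. r$l \<noteq> (if l \<in> e then Fin 0 else Infty))}"

text \<open>The affine coordinates of the point of the orbit of \<open>r\<close> whose \<open>k\<close>-th coordinate is 1.\<close>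

definition chart_coord :: "4 \<Rightarrow> 4 set \<Rightarrow> proj1^4 \<Rightarrow> nat \<Rightarrow> complex" where
  "chart_coord k e r = (\<lambda>i. if i < 4 then (if xdi i \<in> e then inval (r$xdi i) * val (r$k)
     else val (r$xdi i) * inval (r$k)) else 0)"

definition chart_inv :: "4 \<Rightarrow> 4 set \<Rightarrow> (proj1^4) set \<Rightarrow> nat \<Rightarrow> complex" where
  "chart_inv k e c = chart_coord k e (SOME r. r \<in> chart_box k e \<and> torus_orbit r = c)"

lemma chart_boxD:
  assumes "r \<in> chart_box k e"
  shows "r$k \<noteq> Fin 0" "r$k \<noteq> Infty" "l \<in> e \<Longrightarrow> r$l \<noteq> Fin 0" "l \<notin> e \<Longrightarrow> r$l \<noteq> Infty"
  using assms unfolding chart_box_def by (simp_all, metis+)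

lemma chart_box_not_Theta4: "r \<in> chart_box k e \<Longrightarrow> r \<notin> Theta4"
  by (auto simp: chart_box_def Theta4_def)

lemma chart_box_cover:
  assumes "r \<notin> Theta4"
  obtains k e where "r \<in> chart_box k e"
proof -
  from assms obtain k where "r$k \<noteq> Fin 0" "r$k \<noteq> Infty" unfolding Theta4_def by auto
  then have "r \<in> chart_box k {l. r$l = Infty}" by (auto simp: chart_box_def)
  then show ?thesis by (rule that)
qed

lemma val_inval: "r \<noteq> Fin 0 \<Longrightarrow> r \<noteq> Infty \<Longrightarrow> val r * inval r = 1"
  by (cases r) auto

lemma chart_pt_box: "z \<in> chart_dom k \<Longrightarrow> chart_pt e z \<in> chart_box k e"
  by (auto simp: chart_pt_def chart_box_def chart_dom_def ratio_def)

lemma chart_coord_dom: "r \<in> chart_box k e \<Longrightarrow> chart_coord k e r \<in> chart_dom k"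
  using val_inval[of "r$k"] by (auto simp: chart_coord_def chart_dom_def chart_box_def mult.commute)

lemma chart_coord_chart_pt:
  assumes "z \<in> chart_dom k"
  shows "chart_coord k e (chart_pt e z) = z"
proof
  fix i
  have k1: "z (idx k) = 1" using assms by (simp add: chart_dom_def)
  show "chart_coord k e (chart_pt e z) i = z i"
  proof (cases "i < 4")
    case True
    then show ?thesis using k1
      by (simp add: chart_coord_def chart_pt_def ratio_def idx_xdi)
  next
    case False
    then show ?thesis using assms by (simp add: chart_coord_def chart_dom_def)
  qed
qed

lemma chart_pt_chart_coord:
  assumes "r \<in> chart_box k e"
  shows "chart_pt e (chart_coord k e r) = tscale (inval (r$k)) r"
proof -
  obtain a where a: "r$k = Fin a" "a \<noteq> 0" using assms by (cases "r$k") (auto simp: chart_box_def)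
  have "chart_pt e (chart_coord k e r) $ l = scale (inval (r$k)) (r$l)" for l
  proof (cases "r$l")
    case (Fin b)
    moreover have "l \<in> e \<Longrightarrow> b \<noteq> 0" using chart_boxD(3)[OF assms] Fin by metis
    ultimately show ?thesis using a by (auto simp: chart_pt_def chart_coord_def ratio_def)
  next
    case Infty
    moreover have "l \<in> e" using chart_boxD(4)[OF assms] Infty by metis
    ultimately show ?thesis using a by (simp add: chart_pt_def chart_coord_def ratio_def)
  qed
  then show ?thesis by (simp add: vec_eq_iff)
qed

lemma chart_coord_tscale:
  assumes "r \<in> chart_box k e" "t \<noteq> 0"
  shows "tscale t r \<in> chart_box k e" "chart_coord k e (tscale t r) = chart_coord k e r"
proof -
  have "tscale t r $ l \<noteq> (if l \<in> e then Fin 0 else Infty)" for l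
    using chart_boxD(3,4)[OF assms(1), of l] assms(2) by (cases "l \<in> e") (simp_all add: scale_eq_iff)
  then show "tscale t r \<in> chart_box k e"
    using chart_boxD(1,2)[OF assms(1)] assms(2) unfolding chart_box_def by (simp add: scale_eq_iff)
  have v: "val (scale t s) = t * val s" "inval (scale t s) = inval s / t" for s by (cases s; simp)+
  show "chart_coord k e (tscale t r) = chart_coord k e r"
    using assms(2) by (auto simp: chart_coord_def v)
qed

lemma chart_inv_orbit:
  assumes "r \<in> chart_box k e"
  shows "chart_inv k e (torus_orbit r) = chart_coord k e r"
proof -
  let ?s = "SOME s. s \<in> chart_box k e \<and> torus_orbit s = torus_orbit r"
  have s: "?s \<in> chart_box k e \<and> torus_orbit ?s = torus_orbit r"
    by (rule someI[of _ r]) (simp add: assms)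
  then obtain t where "t \<noteq> 0" "?s = tscale t r" using torus_orbit_eqD[of r ?s] by metis
  then show ?thesis unfolding chart_inv_def using chart_coord_tscale(2)[OF assms] by simp
qed

lemma chart_inv_chart: "z \<in> chart_dom k \<Longrightarrow> chart_inv k e (chart e z) = z"
  unfolding chart_def by (simp add: chart_inv_orbit chart_pt_box chart_coord_chart_pt)

lemma chart_chart_inv:
  assumes "c \<in> torus_orbit ` chart_box k e"
  shows "chart_inv k e c \<in> chart_dom k" "chart e (chart_inv k e c) = c"
proof -
  from assms obtain r where r: "r \<in> chart_box k e" "c = torus_orbit r" by blast
  show "chart_inv k e c \<in> chart_dom k" using r by (simp add: chart_inv_orbit chart_coord_dom)
  have "inval (r$k) \<noteq> 0" using r(1) by (cases "r$k") (auto simp: chart_box_def)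
  then show "chart e (chart_inv k e c) = c"
    using r by (simp add: chart_inv_orbit chart_def chart_pt_chart_coord torus_orbit_tscale)
qed

lemma chart_pt_morphism: "fn_space_morphism (affine_space 4) P1_4 (chart_pt e)"
  unfolding P1_4_def
proof (rule morphism_into_power_space[OF ringed_affine_space ringed_P1])
  fix l
  have c: "regular (affine_space 4) (points (affine_space 4)) (\<lambda>z. z (idx l))"
    by (rule polynomial_regular[OF polynomial_coord]) simp
  have o: "regular (affine_space 4) (points (affine_space 4)) (\<lambda>z. 1)"
    by (rule polynomial_regular[OF polynomial_const])
  show "fn_space_morphism (affine_space 4) P1 (\<lambda>z. chart_pt e z $ l)"
  proof (cases "l \<in> e")
    case True
    then show ?thesis using morphism_into_P1[OF ringed_affine_space o c] by (simp add: chart_pt_def)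
  next
    case False
    have "Fin a = ratio a 1" for a by (simp add: ratio_def)
    then show ?thesis using False morphism_into_P1[OF ringed_affine_space c o] by (simp add: chart_pt_def)
  qed
qed

lemma openin_chart_box: "openin (zariski P1_4) (chart_box k e)"
proof -
  interpret P: ringed_space P1_4 by (rule ringed_P1_4)
  have 1: "openin (zariski P1_4) {r. r$l \<noteq> Infty}" for l by (rule P.regular_open[OF regular_P1_4_val])
  have 2: "openin (zariski P1_4) {r. r$l \<noteq> Fin 0}" for l by (rule P.regular_open[OF regular_P1_4_inval])
  have "openin (zariski P1_4) (\<Inter>l\<in>UNIV. {r. r$l \<noteq> (if l \<in> e then Fin 0 else Infty)})"
    by (rule openin_INT2) (use 1 2 in auto)
  then have "openin (zariski P1_4) ({r. r$k \<noteq> Fin 0} \<inter> {r. r$k \<noteq> Infty} \<inter> (\<Inter>l\<in>UNIV. {r. r$l \<noteq> (if l \<in> e then Fin 0 else Infty)}))"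
    by (intro openin_Int 1 2)
  moreover have "{r. r$k \<noteq> Fin 0} \<inter> {r. r$k \<noteq> Infty} \<inter> (\<Inter>l\<in>UNIV. {r. r$l \<noteq> (if l \<in> e then Fin 0 else Infty)}) = chart_box k e"
    unfolding chart_box_def by blast
  ultimately show ?thesis by simp
qed

lemma chart_coord_morphism: "fn_space_morphism (subspace_of P1_4 (chart_box k e)) (affine_space 4) (chart_coord k e)"
proof -
  interpret P: ringed_space P1_4 by (rule ringed_P1_4)
  note op = openin_chart_box[of k e]
  have pts: "points (subspace_of P1_4 (chart_box k e)) = chart_box k e" by (simp add: points_subspace_of points_P1_4)
  show ?thesis
  proof (rule morphism_into_affine_space[OF P.ringed_subspace], unfold pts P.regular_open_subspace[OF op])
    fix i :: nat assume i: "i < 4"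
    have k: "regular P1_4 (chart_box k e) (\<lambda>r. val (r$k))" "regular P1_4 (chart_box k e) (\<lambda>r. inval (r$k))"
      by (rule P.restrict[OF regular_P1_4_val op], use chart_boxD(2) in blast,
          rule P.restrict[OF regular_P1_4_inval op], use chart_boxD(1) in blast)
    show "chart_box k e \<subseteq> chart_box k e \<and> regular P1_4 (chart_box k e) (\<lambda>r. chart_coord k e r i)"
    proof (cases "xdi i \<in> e")
      case True
      have "regular P1_4 (chart_box k e) (\<lambda>r. inval (r$xdi i))"
        by (rule P.restrict[OF regular_P1_4_inval op]) (use True chart_boxD(3) in blast)
      from P.mult[OF this k(1)] show ?thesis using i True by (simp add: chart_coord_def)
    next
      case False
      have "regular P1_4 (chart_box k e) (\<lambda>r. val (r$xdi i))"
        by (rule P.restrict[OF regular_P1_4_val op]) (use False chart_boxD(4) in blast)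
      from P.mult[OF this k(2)] show ?thesis using i False by (simp add: chart_coord_def)
    qed
  qed (simp add: chart_coord_def)
qed

lemma preimage_chart_box:
  "{r \<in> points P1_4_free. torus_orbit r \<in> torus_orbit ` chart_box k e} = chart_box k e"
proof -
  have "r \<in> chart_box k e" if eq: "torus_orbit r = torus_orbit s" and s: "s \<in> chart_box k e" for r s
  proof -
    from torus_orbit_eqD[OF eq[symmetric]] obtain t where "t \<noteq> 0" "r = tscale t s" by blast
    then show ?thesis using chart_coord_tscale(1)[OF s] by simp
  qed
  then show ?thesis using chart_box_not_Theta4 unfolding points_P1_4_free by blast
qed

lemma openin_chart_image: "openin (zariski K4) (torus_orbit ` chart_box k e)"
  unfolding K4_def openin_quotient_space
  unfolding preimage_chart_box
  unfolding points_P1_4_free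
proof (rule conjI)
  show "torus_orbit ` chart_box k e \<subseteq> torus_orbit ` (UNIV - Theta4)"
    using chart_box_not_Theta4 by blast
  have "chart_box k e = chart_box k e \<inter> (UNIV - Theta4)" using chart_box_not_Theta4 by blast
  then show "openin (zariski P1_4_free) (chart_box k e)"
    unfolding openin_subspace_of using openin_chart_box[of k e] by (intro exI[of _ "chart_box k e"] conjI)
qed

text \<open>The slice is a section of the quotient map over the image of \<open>chart_box k e\<close>: the coordinates \<open>chart_coord\<close> are
  invariant, so they descend to the quotient. As \<open>k\<close> and \<open>e\<close> vary, these open sets cover \<open>K4\<close>.\<close>

lemma chart_isomorphism:
  "inverse_isomorphisms (subspace_of (affine_space 4) (chart_dom k))
     (subspace_of K4 (torus_orbit ` chart_box k e)) (chart e) (chart_inv k e)"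
proof -
  interpret A: ringed_space "affine_space 4" by (rule ringed_affine_space)
  interpret P: ringed_space P1_4 by (rule ringed_P1_4)
  interpret F: ringed_space P1_4_free by (rule ringed_P1_4_free)
  interpret K: ringed_space K4 by (rule ringed_K4)
  let ?D = "subspace_of (affine_space 4) (chart_dom k)"
  let ?C = "torus_orbit ` chart_box k e"
  have ptsD: "points ?D = chart_dom k" by (auto simp: points_subspace_of points_affine_space chart_dom_def)
  have ptsC: "points (subspace_of K4 ?C) = ?C"
    using openin_subset[OF openin_chart_image[of k e]] by (auto simp: points_subspace_of)
  have "fn_space_morphism ?D P1_4_free (chart_pt e)"
    by (rule morphism_into_subspace[OF ringed_P1_4 A.ringed_subspace morphism_restrict[OF ringed_affine_space chart_pt_morphism]])
       (use chart_pt_box chart_box_not_Theta4 ptsD in blast)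
  then have "fn_space_morphism ?D K4 (chart e)"
    unfolding chart_def[abs_def] K4_def by (rule fn_space_morphism_compose[OF _ F.quotient_projection])
  then have 1: "fn_space_morphism ?D (subspace_of K4 ?C) (chart e)"
    by (rule morphism_into_subspace[OF ringed_K4 A.ringed_subspace]) (auto simp: ptsD chart_def chart_pt_box)
  have "subspace_of P1_4_free (chart_box k e) = subspace_of P1_4 (chart_box k e)"
    by (rule P.subspace_of_subspace) (use chart_box_not_Theta4 in blast)
  then have "fn_space_morphism (subspace_of P1_4_free (chart_box k e)) (affine_space 4) (chart_coord k e)"
    using chart_coord_morphism by simp
  then have "fn_space_morphism (subspace_of P1_4_free (chart_box k e)) (affine_space 4) (\<lambda>r. chart_inv k e (torus_orbit r))"
    by (rule fn_space_morphism_cong[OF F.ringed_subspace]) (simp add: points_subspace_of chart_inv_orbit)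
  then have "fn_space_morphism (subspace_of K4 ?C) (affine_space 4) (chart_inv k e)"
    unfolding K4_def
    by (intro F.morphism_from_quotient) (simp_all only: preimage_chart_box openin_chart_image K4_def[symmetric])
  then have 2: "fn_space_morphism (subspace_of K4 ?C) ?D (chart_inv k e)"
    by (rule morphism_into_subspace[OF ringed_affine_space K.ringed_subspace]) (simp add: ptsC chart_chart_inv)
  show ?thesis unfolding inverse_isomorphisms_def ptsD ptsC
    using 1 2 by (simp add: chart_inv_chart chart_chart_inv)
qed

text \<open>A subset \<open>T\<close> of the quotient is studied through its pieces: one piece lies in one chart and away from the zeros
  of one polynomial \<open>h\<close>.\<close>

lemma chart_piece:
  fixes k :: 4 and e :: "4 set" and T :: "(proj1^4) set set"
  assumes h: "h \<in> polynomial_functions 4"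
  defines "W \<equiv> {z \<in> chart_dom k. chart e z \<in> T \<and> h z \<noteq> 0}"
  shows "openin (zariski (subspace_of K4 T)) (chart e ` W)"
    and "inverse_isomorphisms (subspace_of K4 (chart e ` W)) (subspace_of (affine_space 4) W) (chart_inv k e) (chart e)"
proof -
  interpret A: ringed_space "affine_space 4" by (rule ringed_affine_space)
  interpret K: ringed_space K4 by (rule ringed_K4)
  let ?D = "subspace_of (affine_space 4) (chart_dom k)"
  let ?C = "torus_orbit ` chart_box k e"
  note iso = chart_isomorphism[of k e]
  have ptsD: "points ?D = chart_dom k" by (auto simp: points_subspace_of points_affine_space chart_dom_def)
  have ptsC: "points (subspace_of K4 ?C) = ?C"
    using openin_subset[OF openin_chart_image[of k e]] by (auto simp: points_subspace_of)
  have img: "chart e z \<in> ?C" if "z \<in> chart_dom k" for z using that chart_pt_box by (auto simp: chart_def)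
  have "fn_space_morphism (subspace_of K4 ?C) ?D (chart_inv k e)" using iso by (simp add: inverse_isomorphisms_def)
  from fn_space_morphism_compose[OF this A.subspace_inclusion]
  have "fn_space_morphism (subspace_of K4 ?C) (affine_space 4) (chart_inv k e)" .
  from fn_space_morphism_open[OF this openin_polynomial_nonzero[OF h]]
  have "openin (zariski K4) {c \<in> ?C. chart_inv k e c \<in> {z \<in> points (affine_space 4). h z \<noteq> 0}}"
    unfolding ptsC K.openin_open_subspace[OF openin_chart_image] by (rule conjunct2)
  moreover have "{c \<in> ?C. chart_inv k e c \<in> {z \<in> points (affine_space 4). h z \<noteq> 0}} \<inter> T = chart e ` W"
  proof (intro equalityI subsetI)
    fix c assume c: "c \<in> {c \<in> ?C. chart_inv k e c \<in> {z \<in> points (affine_space 4). h z \<noteq> 0}} \<inter> T"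
    then have "c = chart e (chart_inv k e c)" "chart_inv k e c \<in> W"
      using chart_chart_inv[of c k e] by (auto simp: W_def)
    then show "c \<in> chart e ` W" by (rule image_eqI)
  next
    fix c assume "c \<in> chart e ` W"
    then obtain z where "z \<in> W" "c = chart e z" by blast
    then show "c \<in> {c \<in> ?C. chart_inv k e c \<in> {z \<in> points (affine_space 4). h z \<noteq> 0}} \<inter> T"
      using img chart_inv_chart[of z k e] by (auto simp: W_def points_affine_space chart_dom_def)
  qed
  ultimately show "openin (zariski (subspace_of K4 T)) (chart e ` W)"
    unfolding openin_subspace_of
    by (intro exI[of _ "{c \<in> ?C. chart_inv k e c \<in> {z \<in> points (affine_space 4). h z \<noteq> 0}}"] conjI) simp_all
  have "inverse_isomorphisms (subspace_of ?D W) (subspace_of (subspace_of K4 ?C) (chart e ` W)) (chart e) (chart_inv k e)"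
  proof (rule inverse_isomorphisms_restrict[OF A.ringed_subspace K.ringed_subspace iso], unfold ptsD)
    fix z assume z: "z \<in> chart_dom k"
    show "z \<in> W \<longleftrightarrow> chart e z \<in> chart e ` W"
    proof
      assume "chart e z \<in> chart e ` W"
      then obtain w where w: "w \<in> W" "chart e z = chart e w" by blast
      then have "chart_inv k e (chart e z) = chart_inv k e (chart e w)" by simp
      then show "z \<in> W" using w(1) z by (simp add: chart_inv_chart W_def)
    qed simp
  qed
  moreover have "subspace_of ?D W = subspace_of (affine_space 4) W"
    by (rule A.subspace_of_subspace) (auto simp: W_def)
  moreover have "subspace_of (subspace_of K4 ?C) (chart e ` W) = subspace_of K4 (chart e ` W)"
    by (rule K.subspace_of_subspace) (auto simp: W_def intro: img)
  ultimately show "inverse_isomorphisms (subspace_of K4 (chart e ` W)) (subspace_of (affine_space 4) W) (chart_inv k e) (chart e)"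
    using inverse_isomorphisms_sym by metis
qed

text \<open>A subset that is locally given by polynomial equations and one inequation in the charts is a variety: the pieces are
  affine by the Rabinowitsch trick, and there are finitely many of them.\<close>

lemma K4_subspace_algebraic:
  assumes T: "T \<subseteq> points K4" and E: "\<And>e. E e \<subseteq> polynomial_functions 4"
    and H: "\<And>e. H e \<subseteq> polynomial_functions 4" "\<And>e. finite (H e)"
    and eqs: "\<And>k e h z. z \<in> chart_dom k \<Longrightarrow> h \<in> H e \<Longrightarrow> h z \<noteq> 0 \<Longrightarrow> chart e z \<in> T \<longleftrightarrow> (\<forall>P\<in>E e. P z = 0)"
    and cov: "\<And>k e z. z \<in> chart_dom k \<Longrightarrow> chart e z \<in> T \<Longrightarrow> \<exists>h\<in>H e. h z \<noteq> 0"
  shows "algebraic_variety (subspace_of K4 T)"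
proof -
  interpret A: ringed_space "affine_space 4" by (rule ringed_affine_space)
  interpret K: ringed_space K4 by (rule ringed_K4)
  let ?I = "\<Union>k\<in>(UNIV :: 4 set). \<Union>e\<in>UNIV. (\<lambda>h. (k, e, h)) ` H e"
  let ?W = "\<lambda>(k, e, h). {z \<in> chart_dom k. chart e z \<in> T \<and> h z \<noteq> 0}"
  let ?U = "\<lambda>(k, e, h). chart e ` {z \<in> chart_dom k. chart e z \<in> T \<and> h z \<noteq> 0}"
  have fin: "finite ?I" by (intro finite_UN_I finite_imageI H(2) finite)
  have piece: "openin (zariski (subspace_of K4 T)) (?U (k, e, h)) \<and> affine_variety (subspace_of (subspace_of K4 T) (?U (k, e, h)))"
    if h: "h \<in> H e" for k e h
  proof -
    have hp: "h \<in> polynomial_functions 4" using h H(1) by blast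
    let ?W = "{z \<in> chart_dom k. chart e z \<in> T \<and> h z \<noteq> 0}"
    let ?E = "insert (\<lambda>z. z (idx k) - 1) (E e)"
    have "?E \<subseteq> polynomial_functions 4"
      using E[of e] by (auto intro!: polynomial_diff polynomial_coord polynomial_const)
    from affine_variety_principal[OF this hp]
    have aff: "affine_variety (subspace_of (affine_space 4) {z. (\<forall>i\<ge>4. z i = 0) \<and> (\<forall>P\<in>?E. P z = 0) \<and> h z \<noteq> 0})" .
    have "?W = {z. (\<forall>i\<ge>4. z i = 0) \<and> (\<forall>P\<in>?E. P z = 0) \<and> h z \<noteq> 0}"
      using eqs[OF _ h] by (auto simp: chart_dom_def)
    then have "affine_variety (subspace_of K4 (chart e ` ?W))"
      using affine_variety_iso[OF chart_piece(2)[OF hp, where k=k and e=e and T=T]] aff by simp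
    moreover have "subspace_of (subspace_of K4 T) (chart e ` ?W) = subspace_of K4 (chart e ` ?W)"
      by (rule K.subspace_of_subspace) blast
    ultimately show ?thesis using chart_piece(1)[OF hp, where k=k and e=e and T=T] by simp
  qed
  show ?thesis
  proof (rule algebraic_varietyI[OF K.ringed_subspace fin, where U = ?U])
    fix i assume "i \<in> ?I"
    then obtain k e h where "i = (k, e, h)" "h \<in> H e" by blast
    with piece[OF this(2)] show "openin (zariski (subspace_of K4 T)) (?U i)" "affine_variety (subspace_of (subspace_of K4 T) (?U i))"
      by blast+
  next
    fix c assume "c \<in> points (subspace_of K4 T)"
    then have c: "c \<in> T" "c \<in> points K4" by (simp_all add: points_subspace_of)
    then obtain r where r: "r \<notin> Theta4" "c = torus_orbit r" unfolding points_K4 by blast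
    from chart_box_cover[OF r(1)] obtain k e where "r \<in> chart_box k e" .
    then have "c \<in> torus_orbit ` chart_box k e" using r by blast
    from chart_chart_inv[OF this] have z: "chart_inv k e c \<in> chart_dom k" "chart e (chart_inv k e c) = c" .
    then obtain h where h: "h \<in> H e" "h (chart_inv k e c) \<noteq> 0" using cov[OF z(1)] c by metis
    have "c \<in> ?U (k, e, h)" using z h c by (auto intro!: image_eqI[of _ _ "chart_inv k e c"])
    then show "\<exists>i\<in>?I. c \<in> ?U i" using h(1) by (intro bexI[of _ "(k, e, h)"]) auto
  qed
qed

section \<open>Theta functions\<close>

text \<open>For \<open>s = \<bar>q\<bar>\<close>: every point of the punctured unit disc is moved into the annulus \<open>\<bar>q\<bar> \<le> \<bar>y\<bar> \<le> 1\<close> by a power of \<open>q\<close>.\<close>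

lemma geometric_bracket:
  fixes s t :: real
  assumes "0 < s" "s < 1" "0 < t" "t \<le> 1"
  obtains k where "s ^ Suc k \<le> t" "t \<le> s ^ k"
proof -
  define k where "k = (LEAST k. s ^ Suc k \<le> t)"
  obtain n where "s ^ n < t" using real_arch_pow_inv[OF assms(3,2)] by blast
  moreover have "s ^ Suc n \<le> s ^ n" using assms by (simp add: mult_left_le_one_le)
  ultimately have "s ^ Suc n \<le> t" by linarith
  then have 1: "s ^ Suc k \<le> t" unfolding k_def by (rule LeastI)
  have "t \<le> s ^ k"
  proof (cases k)
    case 0
    then show ?thesis using assms by simp
  next
    case (Suc j)
    then have "\<not> s ^ Suc j \<le> t" using not_less_Least[of j "\<lambda>k. s ^ Suc k \<le> t"] unfolding k_def by simp
    then show ?thesis using Suc by simp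
  qed
  with 1 show ?thesis by (rule that)
qed

locale theta =
  fixes q :: complex
  assumes q0: "q \<noteq> 0" and q1: "norm q < 1"
begin

definition inv_power :: "nat \<Rightarrow> complex" where "inv_power n = 1 / q ^ n"

sublocale wp: weierstrass_product inv_power "\<lambda>_. 0"
proof
  show "inv_power n \<noteq> 0" for n by (simp add: inv_power_def q0)
  have "filterlim (\<lambda>n. q ^ n) (at 0) sequentially"
    unfolding filterlim_at using q0 by (auto intro!: LIMSEQ_power_zero q1)
  from filterlim_compose[OF filterlim_inverse_at_infinity this]
  show "filterlim inv_power at_infinity sequentially" by (simp add: inv_power_def[abs_def] inverse_eq_divide)
  fix r :: real
  have "summable (\<lambda>n. r * norm q ^ n)" using q1 by (intro summable_mult summable_geometric) simp
  then show "summable (\<lambda>n. (r / norm (inv_power n)) ^ Suc 0)" by (simp add: inv_power_def norm_divide norm_power)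
qed

text \<open>The Euler product \<open>(1 - z) (1 - q z) (1 - q\<^sup>2 z) \<dots>\<close>, as a Weierstrass product of genus 0 with zeros \<open>q\<^sup>-\<^sup>n\<close>.\<close>

definition P :: "complex \<Rightarrow> complex" where "P = wp.f"

lemma P_holomorphic: "P holomorphic_on A"
  unfolding P_def by (rule wp.holomorphic)

lemma P_zero: "P z = 0 \<longleftrightarrow> (\<exists>n. z = 1 / q ^ n)"
  unfolding P_def wp.zero by (auto simp: inv_power_def)

lemma P_shift: "P z = (1 - z) * P (q * z)"
proof -
  let ?f = "\<lambda>z n. 1 - z * q ^ n"
  have f: "weierstrass_factor 0 (z / inv_power n) = ?f z n" for z n by (simp add: weierstrass_factor_def inv_power_def)
  have conv: "convergent_prod (?f z)" for z using wp.convergent[of z] by (simp add: f)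
  have P: "P z = prodinf (?f z)" for z by (simp add: P_def wp.f_def f)
  show ?thesis
  proof (cases "z = 1")
    case True
    have "P 1 = 0" unfolding P_zero by (rule exI[of _ 0]) simp
    then show ?thesis using True by simp
  next
    case False
    have 1: "(\<Prod>n. ?f z (Suc n)) = prodinf (?f z) / ?f z 0"
      by (rule prodinf_split_head[OF conv]) (use False in simp)
    have 2: "(\<lambda>n. ?f z (Suc n)) = ?f (q * z)" by (intro ext) (simp add: mult_ac)
    have "P (q * z) = P z / (1 - z)" using 1 unfolding 2 P by simp
    then show ?thesis using False by (simp add: field_simps)
  qed
qed

text \<open>By the Jacobi triple product this is the Jacobi theta function up to a constant factor.\<close>

definition th :: "complex \<Rightarrow> complex" where "th x = P x * P (q / x)"

lemma P_compose:
  assumes "f holomorphic_on A"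
  shows "(\<lambda>x. P (f x)) holomorphic_on A"
  using holomorphic_on_compose_gen[OF assms P_holomorphic[of UNIV]] by (simp add: o_def)

lemma th_holomorphic:
  assumes "f holomorphic_on A" "\<And>x. x \<in> A \<Longrightarrow> f x \<noteq> 0"
  shows "(\<lambda>x. th (f x)) holomorphic_on A"
  unfolding th_def
  by (rule holomorphic_on_mult[OF P_compose[OF assms(1)] P_compose],
      rule holomorphic_on_divide[OF holomorphic_on_const assms]) 

lemma th_shift:
  assumes "x \<noteq> 0"
  shows "th (q * x) = - (1 / x) * th x"
proof -
  define R where "R = P (q * x) * P (q / x)"
  have 1: "th x = (1 - x) * R" unfolding th_def R_def by (subst P_shift[of x]) simp
  have 2: "th (q * x) = (1 - 1 / x) * R"
    unfolding th_def R_def using q0 by (subst P_shift[of "q / (q * x)"]) simp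
  show ?thesis unfolding 1 2 using assms by (simp add: field_simps)
qed

lemma th_zero:
  assumes "x \<noteq> 0"
  shows "th x = 0 \<longleftrightarrow> (\<exists>n::int. x = q powi n)"
proof
  assume "th x = 0"
  then consider n where "x = 1 / q ^ n" | n where "q / x = 1 / q ^ n" unfolding th_def by (auto simp: P_zero)
  then show "\<exists>n::int. x = q powi n"
  proof cases
    case 1
    then show ?thesis by (intro exI[of _ "- int n"]) (simp add: power_int_minus inverse_eq_divide)
  next
    case 2
    then have "x = q ^ Suc n" using assms q0 by (simp add: field_simps)
    then show ?thesis by (intro exI[of _ "int (Suc n)"]) (simp only: power_int_of_nat)
  qed
next
  assume "\<exists>n::int. x = q powi n"
  then obtain n :: int where n: "x = q powi n" by blast
  show "th x = 0"
  proof (cases "n \<le> 0")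
    case True
    then have "x = 1 / q ^ nat (- n)" using n by (simp add: power_int_def inverse_eq_divide power_one_over)
    then have "P x = 0" unfolding P_zero by blast
    then show ?thesis by (simp add: th_def)
  next
    case False
    then have "x = q ^ Suc (nat n - 1)" using n by (simp add: power_int_def)
    then have "q / x = 1 / q ^ (nat n - 1)" using q0 by simp
    then have "P (q / x) = 0" unfolding P_zero by blast
    then show ?thesis by (simp add: th_def)
  qed
qed

lemma th_1: "th 1 = 0"
  using th_zero[of 1] by (metis power_int_0_right zero_neq_one)

lemma th_differentiable: "x \<noteq> 0 \<Longrightarrow> th field_differentiable at x"
  using th_holomorphic[of "\<lambda>x. x" "UNIV - {0}"]
  by (auto intro!: holomorphic_on_imp_differentiable_at[of _ "UNIV - {0}"] simp: open_delete)

lemma th_deriv_shift: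
  assumes "x \<noteq> 0" "th x = 0"
  shows "deriv th (q * x) * q = - (1 / x) * deriv th x"
proof -
  have "((\<lambda>x. th (q * x)) has_field_derivative deriv th (q * x) * q) (at x)"
  proof -
    have "((\<lambda>x. q * x) has_field_derivative q) (at x)" by (auto intro!: derivative_eq_intros)
    moreover have "(th has_field_derivative deriv th (q * x)) (at (q * x))"
      using th_differentiable[of "q * x"] assms q0 by (simp add: DERIV_deriv_iff_field_differentiable)
    ultimately show ?thesis using DERIV_chain2[of th _ "\<lambda>x. q * x"] by blast
  qed
  moreover have "((\<lambda>x. th (q * x)) has_field_derivative - (1 / x) * deriv th x) (at x)"
  proof -
    have "(th has_field_derivative deriv th x) (at x)"
      using th_differentiable[of x] assms by (simp add: DERIV_deriv_iff_field_differentiable)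
    then have "((\<lambda>x. - (1 / x) * th x) has_field_derivative - (1 / x) * deriv th x) (at x)"
      using assms by (auto intro!: derivative_eq_intros simp: divide_simps)
    moreover have "eventually (\<lambda>y. y \<noteq> 0) (nhds x)"
      using assms by (intro t1_space_nhds) auto
    then have "eventually (\<lambda>y. - (1 / y) * th y = th (q * y)) (nhds x)"
      by eventually_elim (simp add: th_shift)
    ultimately show ?thesis using DERIV_cong_ev[OF refl _ refl, of "\<lambda>y. - (1 / y) * th y" "\<lambda>y. th (q * y)" x] by blast
  qed
  ultimately show ?thesis using DERIV_unique by blast
qed

text \<open>The functional equation carries the derivative at one zero to the next one up to a nonzero factor, so that only the
  zero at 1 has to be examined. There the factor \<open>1 - x\<close> of the product splits off.\<close>

lemma th_deriv_nonzero:
  assumes "x \<noteq> 0" "th x = 0"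
  shows "deriv th x \<noteq> 0"
proof -
  from assms obtain n :: int where n: "x = q powi n" using th_zero by blast
  have z: "q powi m \<noteq> 0" "th (q powi m) = 0" for m :: int using th_zero[of "q powi m"] q0 by auto
  have step: "deriv th (q powi (m + 1)) \<noteq> 0 \<longleftrightarrow> deriv th (q powi m) \<noteq> 0" for m :: int
  proof -
    have "q powi (m + 1) = q * q powi m" using q0 by (simp add: power_int_add_1)
    then show ?thesis using th_deriv_shift[OF z[of m]] q0 z(1)[of m] by auto
  qed
  have base: "deriv th 1 \<noteq> 0"
  proof -
    define g where "g = (\<lambda>x. P (q * x) * P (q / x))"
    have "g holomorphic_on UNIV - {0}" unfolding g_def
      by (intro holomorphic_on_mult P_compose holomorphic_intros) auto
    then have "g field_differentiable at 1"
      by (rule holomorphic_on_imp_differentiable_at) (auto simp: open_delete)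
    then obtain D where "(g has_field_derivative D) (at 1)" by (auto simp: field_differentiable_def)
    then have "((\<lambda>x. (1 - x) * g x) has_field_derivative - g 1) (at 1)"
      by (auto intro!: derivative_eq_intros)
    moreover have "th x = (1 - x) * g x" for x unfolding th_def g_def by (subst P_shift) simp
    then have "th = (\<lambda>x. (1 - x) * g x)" by (rule ext)
    ultimately have "deriv th 1 = - g 1" by (simp add: DERIV_imp_deriv)
    then have "deriv th 1 = - (P q * P q)" by (simp add: g_def)
    moreover have "P q \<noteq> 0"
    proof
      assume "P q = 0"
      then obtain n where "q = 1 / q ^ n" unfolding P_zero by blast
      then have "q ^ Suc n = 1" using q0 by (simp add: field_simps)
      then have "norm q ^ Suc n = 1" by (metis norm_one norm_power)
      then show False using power_Suc_less_one[of "norm q" n] q0 q1 by simp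
    qed
    ultimately show ?thesis by simp
  qed
  have "deriv th (q powi n) \<noteq> 0"
  proof (induction n rule: int_induct[of _ 0])
    case (step2 i)
    then show ?case using step[of "i - 1"] by simp
  qed (use base step in auto)
  then show ?thesis using n by simp
qed

text \<open>Functions on the punctured plane with multiplier \<open>d x\<^sup>e\<close> under \<open>x \<mapsto> q x\<close>, that is, sections of a line bundle of
  degree \<open>- e\<close> on the elliptic curve with parameter \<open>q\<close>. The parameter \<open>d\<close> fixes the product of the zeros,
  up to sign and modulo powers of \<open>q\<close>, and this is what all the vanishing statements below exploit.\<close>

definition quasi :: "complex \<Rightarrow> int \<Rightarrow> (complex \<Rightarrow> complex) \<Rightarrow> bool" where
  "quasi d e n \<longleftrightarrow> n holomorphic_on UNIV - {0} \<and> (\<forall>x. x \<noteq> 0 \<longrightarrow> n (q * x) = d * x powi e * n x)"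

definition qtriv :: "complex \<Rightarrow> bool" where "qtriv c \<longleftrightarrow> (\<exists>m::int. c = q powi m)"

lemma quasi_combination:
  "quasi d e f \<Longrightarrow> quasi d e g \<Longrightarrow> quasi d e (\<lambda>x. \<alpha> * f x + \<beta> * g x)"
  unfolding quasi_def by (auto intro!: holomorphic_intros simp: algebra_simps)

lemma quasi_mult:
  assumes "quasi d e f" "quasi d' e' g"
  shows "quasi (d * d') (e + e') (\<lambda>x. f x * g x)"
  using assms unfolding quasi_def by (auto intro!: holomorphic_intros simp: power_int_add)

lemma quasi_th:
  assumes "u \<noteq> 0"
  shows "quasi (- u) (- 1) (\<lambda>x. th (x / u))"
proof -
  have "th (q * x / u) = - u * inverse x * th (x / u)" if "x \<noteq> 0" for x
    using th_shift[of "x / u"] that assms by (simp add: field_simps)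
  then show ?thesis unfolding quasi_def using assms
    by (auto intro!: th_holomorphic holomorphic_intros simp: power_int_minus)
qed

text \<open>Functions of degree 0 are monomials, up to constants. As \<open>\<bar>\<kappa>\<bar> \<le> 1\<close>, such a function is bounded near 0 by its
  maximum on a fundamental annulus; as \<open>\<bar>\<kappa>\<bar> \<ge> \<bar>q\<bar>\<^sup>N\<close>, it grows at most like \<open>\<bar>x\<bar>\<^sup>N\<close> at infinity. So it is a
  polynomial, and comparing coefficients gives the last equation.\<close>

lemma quasi_0_polynomial:
  assumes h: "quasi \<kappa> 0 h" and k1: "norm \<kappa> \<le> 1" and kN: "norm q ^ N \<le> norm \<kappa>"
  obtains p :: "complex poly" where "degree p \<le> N" "\<And>x. x \<noteq> 0 \<Longrightarrow> h x = poly p x"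
    "\<And>k. coeff p k * q ^ k = \<kappa> * coeff p k"
proof -
  let ?s = "norm q"
  have s: "0 < ?s" "?s < 1" using q0 q1 by simp_all
  have hol: "h holomorphic_on UNIV - {0}" and per: "\<And>x. x \<noteq> 0 \<Longrightarrow> h (q * x) = \<kappa> * h x"
    using h unfolding quasi_def by simp_all
  have k0: "norm \<kappa> > 0" using kN s by (metis norm_ge_zero order_less_le zero_less_power order.strict_trans2)
  have iter: "h (q ^ k * x) = \<kappa> ^ k * h x" if "x \<noteq> 0" for k x
  proof (induction k)
    case (Suc k)
    have "h (q * (q ^ k * x)) = \<kappa> * h (q ^ k * x)" by (rule per) (use that q0 in simp)
    then show ?case using Suc by (simp add: mult_ac)
  qed simp
  let ?A = "cball 0 1 - ball 0 ?s :: complex set"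
  have "compact ?A" by (intro compact_diff compact_cball open_ball)
  moreover have "?A \<subseteq> UNIV - {0}" using s by auto
  then have "continuous_on ?A h" using holomorphic_on_imp_continuous_on[OF hol] continuous_on_subset by blast
  ultimately have "bounded (h ` ?A)" using compact_continuous_image compact_imp_bounded by blast
  then obtain B where B: "\<And>y. y \<in> ?A \<Longrightarrow> norm (h y) \<le> B" unfolding bounded_iff by blast
  have "norm (h 1) \<le> B" using s by (intro B) simp
  then have B0: "B \<ge> 0" using norm_ge_zero[of "h 1"] by linarith
  \<comment> \<open>every \<open>x\<close> in the disc is \<open>q\<^sup>k y\<close> with \<open>y\<close> in the annulus, and \<open>\<bar>\<kappa>\<^sup>k\<bar> \<le> 1\<close>\<close>
  have small: "norm (h x) \<le> B" if "x \<noteq> 0" "norm x \<le> 1" for x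
  proof -
    have np: "norm x > 0" and x1: "norm x \<le> 1" using that by simp_all
    obtain k where k: "?s ^ Suc k \<le> norm x" "norm x \<le> ?s ^ k"
      using geometric_bracket[OF s np x1] by blast
    define y where "y = x / q ^ k"
    have y: "y \<noteq> 0" "x = q ^ k * y" using that q0 by (simp_all add: y_def)
    have "norm y \<le> 1" "?s \<le> norm y"
      using k s by (simp_all add: y_def norm_divide norm_power divide_simps mult.commute)
    then have "norm (h y) \<le> B" by (intro B) simp
    moreover have "norm (h x) = norm \<kappa> ^ k * norm (h y)" unfolding y(2) iter[OF y(1)] by (simp add: norm_mult norm_power)
    moreover have "norm \<kappa> ^ k \<le> 1" using k1 by (simp add: power_le_one)
    ultimately show ?thesis using mult_left_le_one_le[of "norm (h y)" "norm \<kappa> ^ k"] by simp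
  qed
  \<comment> \<open>here \<open>x = q\<^sup>-\<^sup>k\<^sup>-\<^sup>1 z\<close> with \<open>z\<close> in the annulus, and \<open>\<bar>q\<^sup>-\<^sup>k\<bar> \<le> \<bar>x\<bar>\<close>\<close>
  have large: "norm (h x) \<le> B / ?s ^ N * norm x ^ N" if "norm x \<ge> 1" for x
  proof -
    have x: "x \<noteq> 0" using that by auto
    have np: "0 < 1 / norm x" "1 / norm x \<le> 1" using that x by auto
    obtain k where k: "?s ^ Suc k \<le> 1 / norm x" "1 / norm x \<le> ?s ^ k"
      using geometric_bracket[OF s np] by blast
    define y where "y = q ^ k * x"
    have xp: "norm x > 0" using x by simp
    have ny: "norm y = ?s ^ k * norm x" by (simp add: y_def norm_mult norm_power)
    have "1 \<le> norm y" using k(2) xp by (simp add: ny field_simps)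
    have "?s * norm y \<le> 1" using k(1) xp by (simp add: ny field_simps)
    define z where "z = q * y"
    have nz: "norm z = ?s * norm y" by (simp add: z_def norm_mult)
    have "norm z \<le> 1" "?s \<le> norm z" using \<open>1 \<le> norm y\<close> \<open>?s * norm y \<le> 1\<close> s nz by simp_all
    then have hz: "norm (h z) \<le> B" by (intro B) simp
    have "z = q ^ Suc k * x" by (simp add: z_def y_def mult_ac)
    then have "h z = \<kappa> ^ Suc k * h x" using iter[OF x, of "Suc k"] by simp
    then have "norm (h z) = norm \<kappa> ^ Suc k * norm (h x)" by (simp add: norm_mult norm_power)
    then have "norm (h x) = norm (h z) / norm \<kappa> ^ Suc k" using k0 by (simp add: field_simps)
    also have "\<dots> \<le> B / norm \<kappa> ^ Suc k" using hz k0 by (intro divide_right_mono) simp_all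
    also have "\<dots> \<le> B / (?s ^ N) ^ Suc k"
      using power_mono[OF kN, of "Suc k"] s k0 B0 by (intro divide_left_mono mult_pos_pos) simp_all
    also have "\<dots> = B / ?s ^ N * (1 / ?s ^ k) ^ N"
      using s by (simp add: power_divide power_mult[symmetric] mult.commute)
    also have "\<dots> \<le> B / ?s ^ N * norm x ^ N"
    proof (intro mult_left_mono power_mono)
      show "1 / ?s ^ k \<le> norm x" using k(2) xp s by (simp add: field_simps)
    qed (use B0 s in simp_all)
    finally show ?thesis .
  qed
  have "h \<in> O[at 0](\<lambda>_. 1)"
  proof (rule landau_o.bigI[of "B + 1"])
    have "eventually (\<lambda>x::complex. x \<in> ball 0 1 - {0}) (at 0)"
      by (rule eventually_at_in_open) simp_all
    then show "eventually (\<lambda>x. norm (h x) \<le> (B + 1) * norm (1::complex)) (at 0)"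
      by eventually_elim (use small in fastforce)
  qed (use B0 in simp)
  then obtain H where H: "H holomorphic_on UNIV" "\<forall>z\<in>UNIV - {0}. H z = h z"
    using holomorphic_on_extend[of h UNIV 0] hol by auto
  have "norm (H x) \<le> B / ?s ^ N * norm x ^ N" if "1 \<le> norm x" for x
  proof -
    have "x \<noteq> 0" using that by auto
    then have "H x = h x" using H(2) by simp
    then show ?thesis using large[OF that] by simp
  qed
  from Liouville_polynomial[OF H(1) this]
  have rescale: "H x = (\<Sum>k\<le>N. (deriv ^^ k) H 0 / fact k * x ^ k)" for x by blast
  define p where "p = (\<Sum>k\<le>N. monom ((deriv ^^ k) H 0 / fact k) k)"
  have pH: "poly p x = H x" for x by (simp add: p_def poly_sum poly_monom rescale[of x])
  have hp: "h x = poly p x" if "x \<noteq> 0" for x using that H(2) pH by auto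
  have deg: "degree p \<le> N" unfolding p_def
    by (rule degree_sum_le) (auto intro: order_trans[OF degree_monom_le])
  have "poly ([:0, 1:] * (p \<circ>\<^sub>p [:0, q:])) = poly ([:0, 1:] * smult \<kappa> p)"
  proof
    fix x
    show "poly ([:0, 1:] * (p \<circ>\<^sub>p [:0, q:])) x = poly ([:0, 1:] * smult \<kappa> p) x"
      using hp[of x] hp[of "q * x"] per[of x] q0 by (cases "x = 0") (simp_all add: poly_pcompose mult.commute)
  qed
  then have "p \<circ>\<^sub>p [:0, q:] = smult \<kappa> p"
    unfolding poly_eq_poly_eq_iff by (metis mult_cancel_left pCons_eq_0_iff one_neq_zero)
  then have "coeff (p \<circ>\<^sub>p [:0, q:]) k = \<kappa> * coeff p k" for k by simp
  then have "coeff p k * q ^ k = \<kappa> * coeff p k" for k by (simp add: coeff_pcompose_linear mult.commute)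
  with deg hp show ?thesis by (intro that)
qed

lemma quasi_0_const:
  assumes "quasi 1 0 h"
  obtains c where "\<And>x. x \<noteq> 0 \<Longrightarrow> h x = c"
proof -
  obtain p where p: "degree p \<le> 0" "\<And>x. x \<noteq> 0 \<Longrightarrow> h x = poly p x"
    by (rule quasi_0_polynomial[OF assms, of 0]) (simp, simp, blast)
  then obtain c where "p = [:c:]" by (metis degree_eq_zeroE le_zero_eq)
  then show ?thesis using p(2) that by simp
qed

text \<open>After multiplication by a power of \<open>x\<close> the multiplier has absolute value at most 1, and the function is a polynomial
  whose nonzero coefficients \<open>p\<^sub>k\<close> can only occur for \<open>q\<^sup>k\<close> equal to the multiplier.\<close>

lemma quasi_0_zero:
  assumes h: "quasi \<kappa> 0 h" and k: "\<not> qtriv \<kappa>" "\<kappa> \<noteq> 0" and x: "x \<noteq> 0"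
  shows "h x = 0"
proof -
  have s: "0 < norm q" "norm q < 1" using q0 q1 by simp_all
  obtain n where n: "norm q ^ n < 1 / norm \<kappa>" using real_arch_pow_inv[of "1 / norm \<kappa>" "norm q"] s k(2) by auto
  define \<kappa>' where "\<kappa>' = q ^ n * \<kappa>"
  have "norm \<kappa>' \<le> 1" using n k(2) by (simp add: \<kappa>'_def norm_mult norm_power field_simps)
  have "\<kappa>' \<noteq> 0" using k q0 by (simp add: \<kappa>'_def)
  then obtain N where N: "norm q ^ N < norm \<kappa>'" using real_arch_pow_inv[of "norm \<kappa>'" "norm q"] s by auto
  have h': "h holomorphic_on UNIV - {0}" "\<And>x. x \<noteq> 0 \<Longrightarrow> h (q * x) = \<kappa> * h x"
    using h unfolding quasi_def by simp_all
  have "quasi \<kappa>' 0 (\<lambda>x. x ^ n * h x)" unfolding quasi_def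
  proof (intro conjI allI impI)
    show "(\<lambda>x. x ^ n * h x) holomorphic_on UNIV - {0}" by (intro holomorphic_intros h'(1))
    show "(q * x) ^ n * h (q * x) = \<kappa>' * x powi 0 * (x ^ n * h x)" if "x \<noteq> 0" for x
      using h'(2)[OF that] by (simp add: \<kappa>'_def power_mult_distrib mult_ac)
  qed
  then obtain p where
    p: "\<And>x. x \<noteq> 0 \<Longrightarrow> x ^ n * h x = poly p x" "\<And>k. coeff p k * q ^ k = \<kappa>' * coeff p k"
    by (rule quasi_0_polynomial[OF _ \<open>norm \<kappa>' \<le> 1\<close> less_imp_le[OF N]]) blast
  have "coeff p m = 0" for m
  proof (rule ccontr)
    assume "coeff p m \<noteq> 0"
    then have "q ^ m = q ^ n * \<kappa>" using p(2)[of m] by (simp add: \<kappa>'_def)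
    then have "\<kappa> = q powi (int m - int n)" using q0 by (simp add: power_int_diff field_simps)
    then show False using k(1) unfolding qtriv_def by blast
  qed
  then have "p = 0" by (simp add: poly_eq_iff)
  then show ?thesis using p(1)[OF x] x by simp
qed

text \<open>A zero at \<open>u\<close> forces zeros at all \<open>u q\<^sup>m\<close>, which are the zeros of \<open>th (x / u)\<close>. These are simple, so the quotient
  extends holomorphically. The degree drops by 1.\<close>

lemma quasi_divide:
  assumes n: "quasi d e n" and u: "u \<noteq> 0" "n u = 0" and d: "d \<noteq> 0"
  obtains g where "quasi (- (d / u)) (e + 1) g" "\<And>x. x \<noteq> 0 \<Longrightarrow> n x = th (x / u) * g x"
proof -
  let ?S = "UNIV - {0 :: complex}" and ?t = "\<lambda>x. th (x / u)"
  have opS: "open ?S" by (simp add: open_delete)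
  have hol: "n holomorphic_on ?S" and per: "\<And>x. x \<noteq> 0 \<Longrightarrow> n (q * x) = d * x powi e * n x"
    using n unfolding quasi_def by simp_all
  have tq: "\<And>x. x \<noteq> 0 \<Longrightarrow> ?t (q * x) = - u * inverse x * ?t x" and th: "?t holomorphic_on ?S"
    using quasi_th[OF u(1)] unfolding quasi_def by (simp_all add: power_int_minus)
  have nz: "n (u * q powi m) = 0" for m :: int
  proof (induction m rule: int_induct[of _ 0])
    case (step1 i)
    have "u * q powi (i + 1) = q * (u * q powi i)" using q0 by (simp add: power_int_add_1)
    moreover have "n (q * (u * q powi i)) = 0" using step1 per[of "u * q powi i"] u q0 by simp
    ultimately show ?case by metis
  next
    case (step2 i)
    have "u * q powi i = q * (u * q powi (i - 1))" using q0 power_int_add_1[of q "i - 1"] by simp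
    then have "n (q * (u * q powi (i - 1))) = 0" using step2 by metis
    then show ?case using per[of "u * q powi (i - 1)"] u q0 d by simp
  qed (use u in simp)
  have tz: "n x = 0" if "?t x = 0" "x \<noteq> 0" for x
  proof -
    have "\<exists>m::int. x / u = q powi m" using that u th_zero[of "x / u"] by simp
    then obtain m :: int where "x / u = q powi m" by blast
    then have "x = u * q powi m" using u by (simp add: field_simps)
    then show ?thesis using nz by simp
  qed
  have td: "deriv ?t x \<noteq> 0" if "?t x = 0" "x \<noteq> 0" for x
  proof -
    have "(th has_field_derivative deriv th (x / u)) (at (x / u))"
      using th_differentiable[of "x / u"] that u by (simp add: DERIV_deriv_iff_field_differentiable)
    moreover have "((\<lambda>x. x / u) has_field_derivative 1 / u) (at x)" using u by (auto intro!: derivative_eq_intros)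
    ultimately have "(?t has_field_derivative deriv th (x / u) * (1 / u)) (at x)"
      using DERIV_chain2[of th _ "\<lambda>x. x / u"] by blast
    then show ?thesis using th_deriv_nonzero[of "x / u"] that u by (simp add: DERIV_imp_deriv)
  qed
  define f where "f = (\<lambda>x. n x / ?t x)"
  define g where "g = remove_sings f"
  have fana: "f analytic_on {x}" if "x \<noteq> 0" "?t x \<noteq> 0" for x
    unfolding f_def using that opS hol th
    by (intro analytic_on_divide) (auto simp: analytic_on_holomorphic intro!: exI[of _ ?S])
  have gf: "g x = f x" if "x \<noteq> 0" "?t x \<noteq> 0" for x
    unfolding g_def by (rule remove_sings_at_analytic[OF fana[OF that]])
  have iso: "eventually (\<lambda>y. y \<noteq> 0 \<and> ?t y \<noteq> 0) (at x)" if "x \<noteq> 0" for x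
  proof -
    have "eventually (\<lambda>y. y \<in> ?S) (at x)" using that opS by (intro eventually_at_in_open') auto
    moreover have "eventually (\<lambda>y. ?t y \<noteq> 0) (at x)"
    proof (cases "?t x = 0")
      case True
      have "(?t has_field_derivative deriv ?t x) (at x)"
        using holomorphic_derivI[OF th opS] that by simp
      then have "((\<lambda>y. (?t y - ?t x) / (y - x)) \<longlongrightarrow> deriv ?t x) (at x)"
        by (simp add: has_field_derivative_iff)
      from tendsto_imp_eventually_ne[OF this td[OF True that]] show ?thesis
        by eventually_elim (use True in auto)
    next
      case False
      have "isCont ?t x" using th opS that
        by (metis DiffI UNIV_I continuous_on_eq_continuous_at holomorphic_on_imp_continuous_on singletonD)
      then have "(?t \<longlongrightarrow> ?t x) (at x)" by (simp add: isCont_def)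
      then show ?thesis using False by (rule tendsto_imp_eventually_ne)
    qed
    ultimately show ?thesis by eventually_elim auto
  qed
  have "g analytic_on {x}" if x: "x \<noteq> 0" for x
  proof -
    obtain r where r: "r > 0" "\<And>y. y \<noteq> x \<Longrightarrow> dist y x < r \<Longrightarrow> y \<noteq> 0 \<and> ?t y \<noteq> 0"
      using iso[OF x] unfolding eventually_at by auto
    have rr: "y \<noteq> 0 \<and> ?t y \<noteq> 0" if "y \<in> ball x r - {x}" for y
      using r(2)[of y] that by (simp add: dist_commute)
    have "f holomorphic_on ball x r - {x}" unfolding f_def
      by (intro holomorphic_on_divide holomorphic_on_subset[OF hol] holomorphic_on_subset[OF th])
         (use rr in blast)+
    then have sing: "isolated_singularity_at f x"
      by (rule isolated_singularity_at_holomorphic) (use r in auto)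
    have "\<exists>c. f \<midarrow>x\<rightarrow> c"
    proof (cases "?t x = 0")
      case True
      have "f \<midarrow>x\<rightarrow> deriv n x / deriv ?t x" unfolding f_def
        by (rule lhopital_complex_simple[where f' = "deriv n x" and g' = "deriv ?t x"])
           (use holomorphic_derivI[OF hol opS] holomorphic_derivI[OF th opS] x True tz td in auto)
      then show ?thesis by blast
    next
      case False
      then have "isCont f x" using fana[OF x] analytic_at_imp_isCont by blast
      then show ?thesis by (auto simp: isCont_def)
    qed
    then show ?thesis unfolding g_def using remove_sings_analytic_at[OF sing] by blast
  qed
  then have ghol: "g holomorphic_on ?S"
    by (intro analytic_imp_holomorphic) (use analytic_on_analytic_at in blast)
  have good: "g (q * x) = - (d / u) * x powi (e + 1) * g x" if x: "x \<noteq> 0" "?t x \<noteq> 0" for x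
  proof -
    have "q * x \<noteq> 0" using x q0 by simp
    moreover have "?t (q * x) \<noteq> 0" using tq[OF x(1)] x u by simp
    ultimately have "g (q * x) = (d * x powi e * n x) / (- u * inverse x * ?t x)"
      using gf[of "q * x"] per[OF x(1)] tq[OF x(1)] by (simp add: f_def)
    also have "\<dots> = - (d / u) * x powi (e + 1) * (n x / ?t x)"
    proof -
      have "x powi (e + 1) = x * x powi e" using x by (simp add: power_int_add_1)
      then show ?thesis using x u by (simp only:) (simp add: divide_simps)
    qed
    finally show ?thesis using gf[OF x] by (simp add: f_def)
  qed
  have all: "g (q * x) = - (d / u) * x powi (e + 1) * g x" if x: "x \<noteq> 0" for x
  proof -
    define L where "L = (\<lambda>x. g (q * x) - - (d / u) * x powi (e + 1) * g x)"
    have A: "(\<lambda>x. g (q * x)) holomorphic_on ?S"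
    proof -
      have "(\<lambda>x. q * x) holomorphic_on ?S" by (intro holomorphic_intros)
      moreover have "(\<lambda>x. q * x) ` ?S \<subseteq> ?S" using q0 by auto
      ultimately show ?thesis using holomorphic_on_compose_gen[of "\<lambda>x. q * x" ?S g ?S] ghol
        unfolding o_def by blast
    qed
    have B: "(\<lambda>x. x powi (e + 1)) holomorphic_on ?S"
      by (rule holomorphic_on_power_int[OF _ holomorphic_on_ident]) simp
    have "L holomorphic_on ?S" unfolding L_def
      by (rule holomorphic_on_diff[OF A holomorphic_on_mult[OF holomorphic_on_mult[OF holomorphic_on_const B] ghol]])
    then have "continuous_on ?S L" by (rule holomorphic_on_imp_continuous_on)
    then have "isCont L x" using x continuous_on_eq_continuous_at[OF opS, of L] by blast
    then have 1: "(L \<longlongrightarrow> L x) (at x)" by (simp add: isCont_def)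
    have "eventually (\<lambda>y. 0 = L y) (at x)" using iso[OF x] by eventually_elim (simp add: good L_def)
    then have "(L \<longlongrightarrow> 0) (at x)" by (rule Lim_transform_eventually[OF tendsto_const])
    then have "L x = 0" using tendsto_unique[OF at_neq_bot 1] by blast
    then have "g (q * x) - - (d / u) * x powi (e + 1) * g x = 0" unfolding L_def .
    then show ?thesis unfolding right_minus_eq .
  qed
  show ?thesis
  proof (rule that)
    show "quasi (- (d / u)) (e + 1) g" unfolding quasi_def using ghol all by blast
    show "n x = ?t x * g x" if "x \<noteq> 0" for x
      using that tz gf[OF that] by (cases "?t x = 0") (simp_all add: f_def)
  qed
qed

subsection \<open>Sections of small degree\<close>

lemma qtriv_inverse: "qtriv (1 / c) \<longleftrightarrow> qtriv c"
  unfolding qtriv_def by (metis power_int_minus inverse_eq_divide inverse_inverse_eq)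

lemma qtriv_divide_commute: "qtriv (c / d) \<longleftrightarrow> qtriv (d / c)"
  using qtriv_inverse[of "c / d"] by simp

lemma th_ratio_zero: "x \<noteq> 0 \<Longrightarrow> u \<noteq> 0 \<Longrightarrow> th (x / u) = 0 \<longleftrightarrow> qtriv (x / u)"
  by (simp add: th_zero qtriv_def)

text \<open>Dividing out the zero leaves a function of degree 0 with nontrivial multiplier.\<close>

lemma degree1_vanish:
  assumes g: "quasi d (- 1) g" and d: "d \<noteq> 0" and v: "v \<noteq> 0" "g v = 0" "\<not> qtriv (- d / v)" and x: "x \<noteq> 0"
  shows "g x = 0"
proof -
  obtain h where h: "quasi (- (d / v)) 0 h" "\<And>x. x \<noteq> 0 \<Longrightarrow> g x = th (x / v) * h x"
    using quasi_divide[OF g v(1,2) d] by auto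
  have "h x = 0" by (rule quasi_0_zero[OF h(1) _ _ x]) (use v d in auto)
  then show ?thesis using h(2)[OF x] by simp
qed

lemma countable_qtriv_multiples: "countable {x. \<exists>m::int. x = c * q powi m}"
proof -
  have "{x. \<exists>m::int. x = c * q powi m} = range (\<lambda>m::int. c * q powi m)" by auto
  then show ?thesis by simp
qed

text \<open>The points equivalent to one of finitely many are countable.\<close>

lemma exists_inequivalent:
  assumes "finite S"
  obtains y where "y \<noteq> 0" "\<And>s. s \<in> S \<Longrightarrow> \<not> qtriv (y / s)"
proof -
  have "countable (insert 0 (\<Union>s\<in>S. {x. \<exists>m::int. x = s * q powi m}))"
    by (intro countable_insert countable_UN countable_finite[OF assms] countable_qtriv_multiples)
  moreover have "uncountable (ball (0::complex) 1)" by (rule uncountable_ball) simp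
  ultimately have "\<not> ball (0::complex) 1 \<subseteq> insert 0 (\<Union>s\<in>S. {x. \<exists>m::int. x = s * q powi m})"
    using countable_subset by blast
  then obtain y where y: "y \<notin> insert 0 (\<Union>s\<in>S. {x. \<exists>m::int. x = s * q powi m})" by blast
  show ?thesis
  proof (rule that[of y])
    fix s assume s: "s \<in> S"
    show "\<not> qtriv (y / s)"
    proof
      assume "qtriv (y / s)"
      then obtain m :: int where m: "y / s = q powi m" unfolding qtriv_def by blast
      then have "s \<noteq> 0" using q0 by auto
      then have "y = s * q powi m" using m by (simp add: field_simps)
      then show False using y s by blast
    qed
  qed (use y in blast)
qed

text \<open>The theta function with its zero at \<open>- d\<close> is a section of the same bundle. Subtracting a multiple of it from \<open>g\<close>
  produces a section with a zero at a wrong place, which must be 0; so \<open>g\<close> is a multiple of that theta function.\<close>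

lemma degree1_zero:
  assumes g: "quasi d (- 1) g" and d: "d \<noteq> 0"
  shows "g (- d) = 0"
proof -
  obtain c where "c \<noteq> 0" "\<And>s. s \<in> {1} \<Longrightarrow> \<not> qtriv (c / s)" using exists_inequivalent[of "{1}"] by blast
  then have c: "c \<noteq> 0" "\<not> qtriv c" by simp_all
  define v where "v = - d * c"
  let ?t = "\<lambda>x. th (x / (- d))"
  have t: "quasi d (- 1) ?t" using quasi_th[of "- d"] d by simp
  have v: "v \<noteq> 0" "?t v \<noteq> 0" using c d th_ratio_zero[of v "- d"] by (simp_all add: v_def)
  define h where "h = (\<lambda>x. 1 * g x + (- (g v / ?t v)) * ?t x)"
  have h: "quasi d (- 1) h" unfolding h_def by (rule quasi_combination[OF g t])
  have "h (- d) = 0"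
  proof (rule degree1_vanish[OF h d v(1)])
    show "h v = 0" using v by (simp add: h_def)
    show "\<not> qtriv (- d / v)" using c d qtriv_inverse[of c] by (simp add: v_def)
  qed (use d in simp)
  moreover have "?t (- d) = 0" using d by (simp add: th_1)
  ultimately show ?thesis by (simp add: h_def)
qed

lemma degree2_vanish:
  assumes m: "quasi c (- 2) m" and nz: "c \<noteq> 0" "a \<noteq> 0" "b \<noteq> 0" and z: "m a = 0" "m b = 0"
    and ab: "\<not> qtriv (b / a)" "\<not> qtriv (c / (a * b))" and x: "x \<noteq> 0"
  shows "m x = 0"
proof -
  obtain g where g: "quasi (- (c / a)) (- 1) g" "\<And>x. x \<noteq> 0 \<Longrightarrow> m x = th (x / a) * g x"
    using quasi_divide[OF m nz(2) z(1) nz(1)] by auto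
  have gb: "g b = 0" using g(2)[OF nz(3)] z(2) ab(1) th_ratio_zero[of b a] nz by simp
  have "g x = 0" by (rule degree1_vanish[OF g(1) _ nz(3) gb _ x]) (use nz ab in simp_all)
  then show ?thesis using g(2)[OF x] by simp
qed

text \<open>The two zeros of a section of degree 2 have the product \<open>c\<close>.\<close>

lemma degree2_second_zero:
  assumes m: "quasi c (- 2) m" and nz: "c \<noteq> 0" "y \<noteq> 0" and z: "m y = 0"
  shows "m (c / y) = 0"
proof -
  obtain g where g: "quasi (- (c / y)) (- 1) g" "\<And>x. x \<noteq> 0 \<Longrightarrow> m x = th (x / y) * g x"
    using quasi_divide[OF m nz(2) z nz(1)] by auto
  have "g (c / y) = 0" using degree1_zero[OF g(1)] nz by simp
  then show ?thesis using g(2)[of "c / y"] nz by simp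
qed

text \<open>The product of the theta functions with zeros at \<open>b\<close> and \<open>c / b\<close>, normalized at \<open>a\<close>. The value 0 at 0 is the convention
  for functions on the punctured plane.\<close>

lemma degree2_basis:
  assumes nz: "c \<noteq> 0" "a \<noteq> 0" "b \<noteq> 0" and ab: "\<not> qtriv (a / b)" "\<not> qtriv (c / (a * b))"
  obtains m where "quasi c (- 2) m" "m a = 1" "m b = 0" "m 0 = 0"
proof -
  define t where "t = (\<lambda>x. th (x / b) * th (x / (c / b)))"
  have t: "quasi c (- 2) t" unfolding t_def
    using quasi_mult[OF quasi_th[of b] quasi_th[of "c / b"]] nz by simp
  have "th (a / b) \<noteq> 0" using ab(1) nz by (simp add: th_ratio_zero)
  moreover have "th (a / (c / b)) \<noteq> 0" using ab(2) nz th_ratio_zero[of a "c / b"] qtriv_divide_commute[of "a * b" c] by simp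
  ultimately have ta: "t a \<noteq> 0" by (simp add: t_def)
  have tb: "t b = 0" using nz by (simp add: t_def th_1)
  show ?thesis
  proof (rule that[of "\<lambda>x. if x = 0 then 0 else t x / t a"])
    have "quasi c (- 2) (\<lambda>x. (1 / t a) * t x + 0 * t x)" by (rule quasi_combination[OF t t])
    then have 1: "(\<lambda>x. t x / t a) holomorphic_on UNIV - {0}" "\<And>x. x \<noteq> 0 \<Longrightarrow> t (q * x) / t a = c * x powi (- 2) * (t x / t a)"
      unfolding quasi_def by simp_all
    have "(\<lambda>x. if x = 0 then 0 else t x / t a) holomorphic_on UNIV - {0}"
      by (rule holomorphic_transform[OF 1(1)]) simp
    then show "quasi c (- 2) (\<lambda>x. if x = 0 then 0 else t x / t a)"
      unfolding quasi_def using 1(2) q0 by simp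
  qed (use ta tb nz in simp_all)
qed

lemma degree4_divide:
  assumes n: "quasi d (- 4) n" and nz: "d \<noteq> 0" "a \<noteq> 0" "b \<noteq> 0" "c \<noteq> 0"
    and z: "n a = 0" "n b = 0" "n c = 0"
    and ineq: "\<not> qtriv (b / a)" "\<not> qtriv (c / a)" "\<not> qtriv (c / b)"
  obtains g where "quasi (- (d / (a * b * c))) (- 1) g"
    "\<And>x. x \<noteq> 0 \<Longrightarrow> n x = th (x / a) * th (x / b) * th (x / c) * g x"
proof -
  obtain g1 where g1: "quasi (- (d / a)) (- 3) g1" "\<And>x. x \<noteq> 0 \<Longrightarrow> n x = th (x / a) * g1 x"
    using quasi_divide[OF n nz(2) z(1) nz(1)] by auto
  have z1: "g1 b = 0" "g1 c = 0" using g1(2)[of b] g1(2)[of c] z ineq nz by (simp_all add: th_ratio_zero)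
  have "- (d / a) \<noteq> 0" using nz by simp
  from quasi_divide[OF g1(1) nz(3) z1(1) this] obtain g2 where
    g2: "quasi (d / (a * b)) (- 2) g2" "\<And>x. x \<noteq> 0 \<Longrightarrow> g1 x = th (x / b) * g2 x" by auto
  have z2: "g2 c = 0" using g2(2)[of c] z1 ineq nz by (simp add: th_ratio_zero)
  have "d / (a * b) \<noteq> 0" using nz by simp
  from quasi_divide[OF g2(1) nz(4) z2 this] obtain g3 where
    g3: "quasi (- (d / (a * b * c))) (- 1) g3" "\<And>x. x \<noteq> 0 \<Longrightarrow> g2 x = th (x / c) * g3 x" by auto
  show ?thesis by (rule that[OF g3(1)]) (use g1(2) g2(2) g3(2) in simp)
qed

text \<open>Three zeros leave a section of degree 1, whose zero is determined by the multiplier.\<close>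

lemma degree4_fourth_zero:
  assumes n: "quasi d (- 4) n" and nz: "d \<noteq> 0" "a \<noteq> 0" "b \<noteq> 0" "c \<noteq> 0"
    and z: "n a = 0" "n b = 0" "n c = 0"
    and ineq: "\<not> qtriv (b / a)" "\<not> qtriv (c / a)" "\<not> qtriv (c / b)"
    and w: "d = a * b * c * w" "w \<noteq> 0"
  shows "n w = 0"
proof -
  obtain g where g: "quasi (- (d / (a * b * c))) (- 1) g"
    "\<And>x. x \<noteq> 0 \<Longrightarrow> n x = th (x / a) * th (x / b) * th (x / c) * g x"
    by (rule degree4_divide[OF n nz z ineq]) blast
  have "g w = 0" using degree1_zero[OF g(1)] nz w by simp
  then show ?thesis using g(2)[OF w(2)] by simp
qed

lemma degree4_form:
  assumes n: "quasi d (- 4) n" and nz: "d \<noteq> 0" "a \<noteq> 0" "b \<noteq> 0" "c \<noteq> 0" "w \<noteq> 0"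
    and z: "n a = 0" "n b = 0" "n c = 0" "n w = 0"
    and ineq: "\<not> qtriv (b / a)" "\<not> qtriv (c / a)" "\<not> qtriv (c / b)"
      "\<not> qtriv (w / a)" "\<not> qtriv (w / b)" "\<not> qtriv (w / c)"
  obtains g where "quasi (d / (a * b * c * w)) 0 g"
    "\<And>x. x \<noteq> 0 \<Longrightarrow> n x = th (x / a) * th (x / b) * th (x / c) * th (x / w) * g x"
proof -
  obtain g where g: "quasi (- (d / (a * b * c))) (- 1) g"
    "\<And>x. x \<noteq> 0 \<Longrightarrow> n x = th (x / a) * th (x / b) * th (x / c) * g x"
    by (rule degree4_divide[OF n nz(1-4) z(1-3) ineq(1-3)]) blast
  have gw: "g w = 0" using g(2)[of w] z ineq nz by (simp add: th_ratio_zero)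
  have "- (d / (a * b * c)) \<noteq> 0" using nz by simp
  from quasi_divide[OF g(1) nz(5) gw this] obtain h where
    h: "quasi (d / (a * b * c * w)) 0 h" "\<And>x. x \<noteq> 0 \<Longrightarrow> g x = th (x / w) * h x" by auto
  show ?thesis by (rule that[OF h(1)]) (use g(2) h(2) in simp)
qed

text \<open>The fixed points of \<open>y \<mapsto> c / y\<close> modulo powers of \<open>q\<close> are square roots of countably many numbers, so that they do
  not fill a ball. The involution \<open>y \<mapsto> c / y\<close> exchanges the two zeros of a section of degree 2.\<close>

lemma generic_nonzero:
  assumes m: "quasi c e m" and y0: "y0 \<noteq> 0" "m y0 \<noteq> 0" and c: "c \<noteq> 0"
  obtains y where "y \<noteq> 0" "m y \<noteq> 0" "\<not> qtriv (c / y / y)"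
proof -
  have "open (UNIV - {0 :: complex})" by (simp add: open_delete)
  then have "continuous_on (UNIV - {0}) m" "open (UNIV - {0 :: complex})"
    using m holomorphic_on_imp_continuous_on unfolding quasi_def by blast+
  then have op: "open ((UNIV - {0}) \<inter> m -` (- {0}))"
    by (intro continuous_open_preimage) auto
  moreover have "y0 \<in> (UNIV - {0}) \<inter> m -` (- {0})" using y0 by simp
  ultimately obtain r where r: "r > 0" "ball y0 r \<subseteq> (UNIV - {0}) \<inter> m -` (- {0})"
    using openE by blast
  have "countable ((\<lambda>w. csqrt w) ` {x. \<exists>m::int. x = c * q powi m} \<union> (\<lambda>w. - csqrt w) ` {x. \<exists>m::int. x = c * q powi m})"
    by (intro countable_Un countable_image countable_qtriv_multiples)
  moreover have "uncountable (ball y0 r)" using r(1) by (rule uncountable_ball)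
  ultimately have "\<not> ball y0 r \<subseteq> (\<lambda>w. csqrt w) ` {x. \<exists>m::int. x = c * q powi m} \<union> (\<lambda>w. - csqrt w) ` {x. \<exists>m::int. x = c * q powi m}"
    using countable_subset by blast
  then obtain y where y: "y \<in> ball y0 r"
    "y \<notin> (\<lambda>w. csqrt w) ` {x. \<exists>m::int. x = c * q powi m} \<union> (\<lambda>w. - csqrt w) ` {x. \<exists>m::int. x = c * q powi m}"
    by blast
  have "y \<in> (UNIV - {0}) \<inter> m -` (- {0})" using y(1) r(2) by (rule subsetD[rotated])
  then have yn: "y \<noteq> 0" "m y \<noteq> 0" by simp_all
  show ?thesis
  proof (rule that[OF yn])
    show "\<not> qtriv (c / y / y)"
    proof
      assume "qtriv (c / y / y)"
      then obtain m :: int where "c / y / y = q powi m" unfolding qtriv_def by blast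
      then have "y\<^sup>2 = c * q powi (- m)"
        using yn c q0 by (simp add: power_int_minus field_simps power2_eq_square)
      then have w: "y\<^sup>2 \<in> {x. \<exists>m::int. x = c * q powi m}" by (intro CollectI exI[of _ "- m"])
      have "(csqrt (y\<^sup>2))\<^sup>2 = y\<^sup>2" by (rule power2_csqrt)
      then consider "y = csqrt (y\<^sup>2)" | "y = - csqrt (y\<^sup>2)" unfolding power2_eq_iff by fastforce
      then show False
      proof cases
        case 1
        then show ?thesis using y(2) imageI[OF w, of csqrt] by simp
      next
        case 2
        then show ?thesis using y(2) imageI[OF w, of "\<lambda>w. - csqrt w"] by simp
      qed
    qed
  qed
qed

end

section \<open>Rows of matrices with prescribed kernels\<close>

lemma ratio_eq_iff:
  assumes "(X, Y) \<noteq> (0, 0)" "(X', Y') \<noteq> (0, 0)"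
  shows "ratio X Y = ratio X' Y' \<longleftrightarrow> X * Y' = X' * Y"
  using assms by (auto simp: ratio_def field_simps)

lemma proportional_pair:
  fixes X Y a b :: complex
  assumes "(X, Y) \<noteq> (0, 0)" "X * a = Y * b"
  obtains s where "a = s * Y" "b = s * X"
proof (cases "X = 0")
  case True
  then show ?thesis using assms that[of "a / Y"] by auto
next
  case False
  then show ?thesis using assms that[of "b / X"] by (auto simp: field_simps)
qed

text \<open>The conditions (FR), (NR) and (NS), with equivalence of \<open>c\<close> and \<open>d\<close> written as \<open>c / d\<close> being a power of \<open>q\<close>.\<close>

locale connection_setting = theta q for q :: complex +
  fixes \<rho> \<sigma> :: "complex^2" and x :: "complex^4"
  assumes rho_nz: "\<rho>$i \<noteq> 0" and sigma_nz: "\<sigma>$j \<noteq> 0" and x_nz: "x$k \<noteq> 0"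
    and FR: "x$1 * x$2 * x$3 * x$4 = (\<rho>$1 * \<rho>$2) / (\<sigma>$1 * \<sigma>$2)"
    and NR_rho: "\<not> qtriv (\<rho>$1 / \<rho>$2)" and NR_sigma: "\<not> qtriv (\<sigma>$1 / \<sigma>$2)"
    and NR_x: "k \<noteq> l \<Longrightarrow> \<not> qtriv (x$k / x$l)"
    and NS: "k \<noteq> l \<Longrightarrow> \<not> qtriv ((\<rho>$i / \<sigma>$j) / (x$k * x$l))"
begin

abbreviation c :: "2 \<Rightarrow> 2 \<Rightarrow> complex" where "c i j \<equiv> \<rho>$i / \<sigma>$j"
abbreviation V :: "2 \<Rightarrow> 2 \<Rightarrow> (complex \<Rightarrow> complex) set" where "V i j \<equiv> V_entry q \<rho> \<sigma> i j"

lemma V_iff: "m \<in> V i j \<longleftrightarrow> quasi (c i j) (- 2) m \<and> m 0 = 0"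
  unfolding V_entry_def quasi_def by auto

lemma c_nz: "c i j \<noteq> 0"
  by (simp add: rho_nz sigma_nz)

lemma rho_inequiv: "i \<noteq> i' \<Longrightarrow> \<not> qtriv (\<rho>$i / \<rho>$i')"
  using NR_rho qtriv_divide_commute exhaust_2[of i] exhaust_2[of i'] by metis

lemma sigma_inequiv: "j \<noteq> j' \<Longrightarrow> \<not> qtriv (\<sigma>$j / \<sigma>$j')"
  using NR_sigma qtriv_divide_commute exhaust_2[of j] exhaust_2[of j'] by metis

lemma V_combination:
  assumes "m \<in> V i j" "n \<in> V i j"
  shows "(\<lambda>z. s * m z + t * n z) \<in> V i j"
  using assms quasi_combination unfolding V_iff by simp

lemma V_zero: "(\<lambda>_. 0) \<in> V i j"
  unfolding V_iff quasi_def by simp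

text \<open>This is where (NS) enters: the two zeros of a nonzero element of \<open>V i j\<close> have product \<open>\<rho>\<^sub>i / \<sigma>\<^sub>j\<close>, so they are not
  \<open>x\<^sub>k\<close> and \<open>x\<^sub>l\<close>. Consequently evaluation at two of the points is an isomorphism from \<open>V i j\<close> to the plane.\<close>

lemma V_vanish:
  assumes "m \<in> V i j" "k \<noteq> l" "m (x$k) = 0" "m (x$l) = 0"
  shows "m z = 0"
proof (cases "z = 0")
  case True
  then show ?thesis using assms(1) by (simp add: V_iff)
next
  case False
  have "\<not> qtriv (x$l / x$k)" using NR_x[of l k] assms(2) by simp
  moreover have "quasi (c i j) (- 2) m" using assms(1) V_iff by blast
  ultimately show ?thesis
    using degree2_vanish[OF _ c_nz x_nz x_nz assms(3,4) _ NS[OF assms(2)] False] by blast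
qed

lemma basis_exists:
  assumes "k \<noteq> l"
  shows "\<exists>m\<in>V i j. m (x$k) = 1 \<and> m (x$l) = 0"
proof -
  obtain m where "quasi (c i j) (- 2) m" "m (x$k) = 1" "m (x$l) = 0" "m 0 = 0"
    by (rule degree2_basis[OF c_nz[of i j] x_nz[of k] x_nz[of l] NR_x[OF assms] NS[OF assms]]) blast
  then show ?thesis by (intro bexI[of _ m]) (simp_all add: V_iff)
qed

definition b :: "2 \<Rightarrow> 2 \<Rightarrow> 4 \<Rightarrow> 4 \<Rightarrow> complex \<Rightarrow> complex" where
  "b i j k l = (SOME m. m \<in> V i j \<and> m (x$k) = 1 \<and> m (x$l) = 0)"

lemma b_props:
  assumes "k \<noteq> l"
  shows "b i j k l \<in> V i j" "b i j k l (x$k) = 1" "b i j k l (x$l) = 0"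
proof -
  have "\<exists>m. m \<in> V i j \<and> m (x$k) = 1 \<and> m (x$l) = 0" using basis_exists[OF assms] by blast
  from someI_ex[OF this] show "b i j k l \<in> V i j" "b i j k l (x$k) = 1" "b i j k l (x$l) = 0"
    unfolding b_def by blast+
qed

abbreviation b1 :: "2 \<Rightarrow> 2 \<Rightarrow> complex \<Rightarrow> complex" where "b1 i j \<equiv> b i j 1 2"
abbreviation b2 :: "2 \<Rightarrow> 2 \<Rightarrow> complex \<Rightarrow> complex" where "b2 i j \<equiv> b i j 2 1"

lemma b12:
  "b1 i j \<in> V i j" "b1 i j (x$1) = 1" "b1 i j (x$2) = 0"
  "b2 i j \<in> V i j" "b2 i j (x$1) = 0" "b2 i j (x$2) = 1" "b1 i j 0 = 0" "b2 i j 0 = 0"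
  using b_props[of 1 2 i j] b_props[of 2 1 i j] V_iff by auto

lemma V_expand:
  assumes "m \<in> V i j"
  shows "m z = m (x$1) * b1 i j z + m (x$2) * b2 i j z"
proof -
  let ?n = "\<lambda>z. 1 * m z + (- 1) * (m (x$1) * b1 i j z + m (x$2) * b2 i j z)"
  have n: "?n \<in> V i j" by (intro V_combination assms b12)
  have "?n z = 0" by (rule V_vanish[OF n, of 1 2]) (simp_all add: b12)
  then show ?thesis by algebra
qed

lemma interpolation_eq: "interpolation (V i j) (x$1) (x$2) z = (b1 i j z, b2 i j z)"
  unfolding interpolation_def
proof (rule the_equality)
  show "\<forall>m\<in>V i j. m z = fst (b1 i j z, b2 i j z) * m (x$1) + snd (b1 i j z, b2 i j z) * m (x$2)"
    using V_expand by (auto simp: mult.commute)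
  fix p assume p: "\<forall>m\<in>V i j. m z = fst p * m (x$1) + snd p * m (x$2)"
  have "b1 i j z = fst p * b1 i j (x$1) + snd p * b1 i j (x$2)" "b2 i j z = fst p * b2 i j (x$1) + snd p * b2 i j (x$2)"
    using p b12(1)[of i j] b12(4)[of i j] by blast+
  then show "p = (b1 i j z, b2 i j z)" by (simp add: b12 prod_eq_iff)
qed

definition valid :: "complex^4 \<Rightarrow> complex^4 \<Rightarrow> bool" where
  "valid X Y \<longleftrightarrow> (\<forall>k. (X$k, Y$k) \<noteq> (0, 0))"

definition nonfixed :: "complex^4 \<Rightarrow> complex^4 \<Rightarrow> bool" where
  "nonfixed X Y \<longleftrightarrow> (\<exists>k. X$k \<noteq> 0 \<and> Y$k \<noteq> 0)"

text \<open>The row \<open>f\<close> at the point \<open>x\<^sub>k\<close> is orthogonal to the vector that corresponds to the coordinate \<open>\<rho>\<^sub>k = X\<^sub>k / Y\<^sub>k\<close>.\<close>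

definition sol_at :: "2 \<Rightarrow> complex^4 \<Rightarrow> complex^4 \<Rightarrow> 4 \<Rightarrow> (complex \<Rightarrow> complex)^2 \<Rightarrow> bool" where
  "sol_at i X Y k f \<longleftrightarrow> X$k * (f$1) (x$k) = Y$k * (f$2) (x$k)"

definition sol :: "2 \<Rightarrow> complex^4 \<Rightarrow> complex^4 \<Rightarrow> (complex \<Rightarrow> complex)^2 \<Rightarrow> bool" where
  "sol i X Y f \<longleftrightarrow> (\<forall>j. f$j \<in> V i j) \<and> (\<forall>k. sol_at i X Y k f)"

text \<open>The two coefficients of the condition at \<open>x\<^sub>k\<close> on a row that satisfies the conditions at \<open>x\<^sub>1\<close> and \<open>x\<^sub>2\<close>. For \<open>i = 1\<close> and
  \<open>k = 3, 4\<close> these are, up to sign, the linear forms whose products make up \<open>\<Phi>\<close>, since \<open>b1 1 j (x\<^sub>3)\<close> is \<open>\<lambda>\<^sub>1\<^sub>j\<close> and so on.\<close>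

definition lamform :: "2 \<Rightarrow> 4 \<Rightarrow> complex^4 \<Rightarrow> complex^4 \<Rightarrow> complex" where
  "lamform i k X Y = X$k * b1 i 1 (x$k) * Y$1 - Y$k * b1 i 2 (x$k) * X$1"

definition muform :: "2 \<Rightarrow> 4 \<Rightarrow> complex^4 \<Rightarrow> complex^4 \<Rightarrow> complex" where
  "muform i k X Y = X$k * b2 i 1 (x$k) * Y$2 - Y$k * b2 i 2 (x$k) * X$2"

text \<open>The general row satisfying the conditions at \<open>x\<^sub>1\<close> and \<open>x\<^sub>2\<close>: its values there are \<open>s (Y\<^sub>1, X\<^sub>1)\<close> and
  \<open>t (Y\<^sub>2, X\<^sub>2)\<close>.\<close>

definition kernel_row :: "2 \<Rightarrow> complex^4 \<Rightarrow> complex^4 \<Rightarrow> complex \<Rightarrow> complex \<Rightarrow> (complex \<Rightarrow> complex)^2" where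
  "kernel_row i X Y s t = (\<chi> j. (\<lambda>z. (s * (if j = 1 then Y$1 else X$1)) * b1 i j z + (t * (if j = 1 then Y$2 else X$2)) * b2 i j z))"

text \<open>The determinant of the two remaining conditions, those at \<open>x\<^sub>3\<close> and \<open>x\<^sub>4\<close>; for \<open>i = 1\<close> this is the multihomogenized
  \<open>\<Phi>\<close>.\<close>

definition Phi_i :: "2 \<Rightarrow> complex^4 \<Rightarrow> complex^4 \<Rightarrow> complex" where
  "Phi_i i X Y = lamform i 3 X Y * muform i 4 X Y - lamform i 4 X Y * muform i 3 X Y"

lemma row_nth: "kernel_row i X Y s t $ j = (\<lambda>z. (s * (if j = 1 then Y$1 else X$1)) * b1 i j z + (t * (if j = 1 then Y$2 else X$2)) * b2 i j z)"
  by (simp add: kernel_row_def)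

lemma row_V: "kernel_row i X Y s t $ j \<in> V i j"
  unfolding row_nth by (intro V_combination b12)

lemma row_values:
  "(kernel_row i X Y s t $ 1) (x$1) = s * Y$1" "(kernel_row i X Y s t $ 2) (x$1) = s * X$1"
  "(kernel_row i X Y s t $ 1) (x$2) = t * Y$2" "(kernel_row i X Y s t $ 2) (x$2) = t * X$2"
  by (simp_all add: row_nth b12)

lemma row_sol_at:
  "sol_at i X Y 1 (kernel_row i X Y s t)" "sol_at i X Y 2 (kernel_row i X Y s t)"
  "sol_at i X Y k (kernel_row i X Y s t) \<longleftrightarrow> s * lamform i k X Y + t * muform i k X Y = 0"
proof -
  show "sol_at i X Y 1 (kernel_row i X Y s t)" "sol_at i X Y 2 (kernel_row i X Y s t)"
    unfolding sol_at_def row_values by simp_all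
  have "X$k * (kernel_row i X Y s t $ 1) (x$k) - Y$k * (kernel_row i X Y s t $ 2) (x$k) = s * lamform i k X Y + t * muform i k X Y"
    by (simp add: row_nth lamform_def muform_def algebra_simps)
  then show "sol_at i X Y k (kernel_row i X Y s t) \<longleftrightarrow> s * lamform i k X Y + t * muform i k X Y = 0"
    unfolding sol_at_def by auto
qed

lemma all_4: "(\<forall>k::4. Q k) \<longleftrightarrow> Q 1 \<and> Q 2 \<and> Q 3 \<and> Q 4"
  using exhaust_4 by metis

lemma row_sol:
  "sol i X Y (kernel_row i X Y s t) \<longleftrightarrow> s * lamform i 3 X Y + t * muform i 3 X Y = 0 \<and> s * lamform i 4 X Y + t * muform i 4 X Y = 0"
  unfolding sol_def all_4
  using row_V[of i X Y s t] row_sol_at(1,2)[of i X Y s t] row_sol_at(3)[of i X Y 3 s t] row_sol_at(3)[of i X Y 4 s t]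
  by blast

lemma sol_row:
  assumes v: "valid X Y" and f: "sol i X Y f"
  obtains s t where "f = kernel_row i X Y s t"
proof -
  have k: "X$k * (f$1) (x$k) = Y$k * (f$2) (x$k)" "(X$k, Y$k) \<noteq> (0, 0)" for k
    using v f unfolding valid_def sol_def sol_at_def by blast+
  obtain s where s: "(f$1) (x$1) = s * Y$1" "(f$2) (x$1) = s * X$1" using proportional_pair[OF k(2,1)] by metis
  obtain t where t: "(f$1) (x$2) = t * Y$2" "(f$2) (x$2) = t * X$2" using proportional_pair[OF k(2,1)] by metis
  have fV: "f$j \<in> V i j" for j using f unfolding sol_def by blast
  have "f$j = kernel_row i X Y s t $ j" for j
  proof
    fix z
    show "(f$j) z = (kernel_row i X Y s t $ j) z"
      using V_expand[OF fV, of j z] s t exhaust_2[of j] by (auto simp: row_nth)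
  qed
  then have "f = kernel_row i X Y s t" by (simp add: vec_eq_iff)
  then show ?thesis by (rule that)
qed

lemma row_eq_0_iff:
  assumes v: "valid X Y"
  shows "kernel_row i X Y s t = (\<chi> j. (\<lambda>z. 0)) \<longleftrightarrow> s = 0 \<and> t = 0"
proof
  assume "kernel_row i X Y s t = (\<chi> j. (\<lambda>z. 0))"
  then have "(kernel_row i X Y s t $ j) z = 0" for j z by simp
  then have "s * Y$1 = 0" "s * X$1 = 0" "t * Y$2 = 0" "t * X$2 = 0" using row_values by metis+
  then show "s = 0 \<and> t = 0" using v unfolding valid_def by (metis mult_eq_0_iff)
qed (simp add: kernel_row_def vec_eq_iff fun_eq_iff)

text \<open>The values at \<open>x\<^sub>k\<close> and \<open>x\<^sub>l\<close> are coordinates on the two-dimensional space \<open>V i j\<close>, hence a nonzero element has a zero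
  at no more than one of the four points. This counting argument is used throughout.\<close>

lemma V_zero_unique:
  assumes "m \<in> V i j" "m \<noteq> (\<lambda>_. 0)" "m (x$k) = 0" "m (x$l) = 0"
  shows "k = l"
  using V_vanish[OF assms(1) _ assms(3,4)] assms(2) by blast

lemma row_zero_unique:
  assumes "\<And>j. f$j \<in> V i j" "f \<noteq> (\<chi> j. (\<lambda>z. 0))"
    and "(f$1) (x$k) = 0" "(f$2) (x$k) = 0" "(f$1) (x$l) = 0" "(f$2) (x$l) = 0"
  shows "k = l"
proof (rule ccontr)
  assume kl: "k \<noteq> l"
  have "(f$j) z = 0" for j z
    using V_vanish[OF assms(1) kl, of j z] assms(3-6) exhaust_2[of j] by auto
  then have "f = (\<chi> j. (\<lambda>z. 0))" by (simp add: vec_eq_iff fun_eq_iff)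
  then show False using assms(2) by simp
qed

text \<open>The determinant of two rows is a section of degree 4. If the rows have different indices, (FR) says that the
  bundle is that of the divisor \<open>x\<^sub>1 + x\<^sub>2 + x\<^sub>3 + x\<^sub>4\<close>; if they have the same index, it is a different one,
  because \<open>\<rho>\<^sub>1\<close> and \<open>\<rho>\<^sub>2\<close> are inequivalent.\<close>

definition wedge :: "(complex \<Rightarrow> complex)^2 \<Rightarrow> (complex \<Rightarrow> complex)^2 \<Rightarrow> complex \<Rightarrow> complex" where
  "wedge f g z = (f$1) z * (g$2) z - (f$2) z * (g$1) z"

lemma wedge_quasi:
  assumes "\<And>j. f$j \<in> V i j" "\<And>j. g$j \<in> V i' j"
  shows "quasi (\<rho>$i * \<rho>$i' / (\<sigma>$1 * \<sigma>$2)) (- 4) (wedge f g)"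
proof -
  let ?d = "\<rho>$i * \<rho>$i' / (\<sigma>$1 * \<sigma>$2)"
  have "quasi ?d (- 4) (\<lambda>z. (f$1) z * (g$2) z)"
    using quasi_mult[of "c i 1" "- 2" "f$1" "c i' 2" "- 2" "g$2"] assms(1)[of 1] assms(2)[of 2]
    by (simp add: V_iff)
  moreover have "quasi ?d (- 4) (\<lambda>z. (f$2) z * (g$1) z)"
    using quasi_mult[of "c i 2" "- 2" "f$2" "c i' 1" "- 2" "g$1"] assms(1)[of 2] assms(2)[of 1]
    by (simp add: V_iff mult.commute)
  ultimately have "quasi ?d (- 4) (\<lambda>z. 1 * ((f$1) z * (g$2) z) + (- 1) * ((f$2) z * (g$1) z))"
    by (rule quasi_combination)
  then show ?thesis by (simp add: wedge_def[abs_def])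
qed

lemma wedge_sol_at:
  assumes "valid X Y" "sol_at i X Y k f" "sol_at i' X Y k g"
  shows "wedge f g (x$k) = 0"
proof -
  have nz: "(X$k, Y$k) \<noteq> (0, 0)" using assms(1) by (simp add: valid_def)
  obtain s where "(f$1) (x$k) = s * Y$k" "(f$2) (x$k) = s * X$k"
    using proportional_pair[OF nz] assms(2) unfolding sol_at_def by metis
  moreover obtain t where "(g$1) (x$k) = t * Y$k" "(g$2) (x$k) = t * X$k"
    using proportional_pair[OF nz] assms(3) unfolding sol_at_def by metis
  ultimately show ?thesis by (simp add: wedge_def)
qed

lemma prod_x: "\<rho>$1 * \<rho>$2 / (\<sigma>$1 * \<sigma>$2) = x$1 * x$2 * x$3 * x$4"
  using FR by simp

lemma degree4_at_x:
  assumes n: "quasi d (- 4) n" and d: "d \<noteq> 0" and z: "\<And>k. n (x$k) = 0"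
  obtains g where "quasi (d / (x$1 * x$2 * x$3 * x$4)) 0 g"
    "\<And>y. y \<noteq> 0 \<Longrightarrow> n y = th (y / x$1) * th (y / x$2) * th (y / x$3) * th (y / x$4) * g y"
  by (rule degree4_form[OF n d x_nz[of 1] x_nz[of 2] x_nz[of 3] x_nz[of 4] z z z z
        NR_x NR_x NR_x NR_x NR_x NR_x]) simp_all

text \<open>The multiplier of the determinant differs from that of \<open>x\<^sub>1 + x\<^sub>2 + x\<^sub>3 + x\<^sub>4\<close> by \<open>\<rho>\<^sub>i / \<rho>\<^sub>i\<^sub>0\<close>, where \<open>i\<^sub>0\<close> is the
  other index, which is not a power of \<open>q\<close>; so four zeros at these points are too many.\<close>

lemma wedge_same_row:
  assumes v: "valid X Y" and f: "sol i X Y f" and g: "sol i X Y g"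
  shows "wedge f g z = 0"
proof (cases "z = 0")
  case True
  have "f$j \<in> V i j" for j using f by (simp add: sol_def)
  then show ?thesis using True V_iff by (simp add: wedge_def)
next
  case False
  let ?d = "\<rho>$i * \<rho>$i / (\<sigma>$1 * \<sigma>$2)"
  have d: "?d \<noteq> 0" using rho_nz sigma_nz by simp
  have n: "quasi ?d (- 4) (wedge f g)" by (rule wedge_quasi) (use f g in \<open>simp_all add: sol_def\<close>)
  have z: "wedge f g (x$k) = 0" for k using wedge_sol_at[OF v, of i k f i g] f g unfolding sol_def by blast
  obtain h where h: "quasi (?d / (x$1 * x$2 * x$3 * x$4)) 0 h"
    "\<And>y. y \<noteq> 0 \<Longrightarrow> wedge f g y = th (y / x$1) * th (y / x$2) * th (y / x$3) * th (y / x$4) * h y"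
    using degree4_at_x[OF n d z] by metis
  have "\<exists>i'. i' \<noteq> i \<and> \<rho>$i * \<rho>$i' = \<rho>$1 * \<rho>$2"
  proof (cases "i = 1")
    case True
    then show ?thesis by (intro exI[of _ 2]) simp
  next
    case False
    then have "i = 2" using exhaust_2[of i] by simp
    then show ?thesis by (intro exI[of _ 1]) simp
  qed
  then obtain i' where i': "i' \<noteq> i" "\<rho>$i * \<rho>$i' = \<rho>$1 * \<rho>$2" by blast
  \<comment> \<open>by (FR) the multiplier of the quotient is \<open>\<rho>\<^sub>i / \<rho>\<^sub>i\<^sub>0\<close>, where \<open>i\<^sub>0\<close> is the other index\<close>
  have "?d / (x$1 * x$2 * x$3 * x$4) = \<rho>$i / \<rho>$i'"
    unfolding FR i'(2)[symmetric] using rho_nz sigma_nz by (simp add: field_simps)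
  then have "h z = 0"
    using quasi_0_zero[OF h(1) _ _ False] rho_inequiv[OF i'(1)[symmetric]] rho_nz by simp
  then show ?thesis using h(2)[OF False] by simp
qed

text \<open>Consider the quotient \<open>g1 / f1 = g2 / f2\<close> of two rows with determinant 0 and let \<open>\<alpha>\<close> be its value at a generic point
  \<open>y\<close>. The section \<open>g1 - \<alpha> f1\<close> vanishes at \<open>y\<close>, hence also at \<open>c / y\<close> for the multiplier \<open>c\<close> of the first column; so
  \<open>g2 - \<alpha> f2\<close> vanishes at \<open>y\<close> and \<open>c / y\<close> too. But for the second column the zeros of a nonzero section are
  exchanged by a different involution, \<open>\<sigma>\<^sub>1\<close> and \<open>\<sigma>\<^sub>2\<close> being inequivalent.\<close>

lemma wedge_zero_proportional:
  assumes f: "f1 \<in> V i j" "f2 \<in> V i j'" and g: "g1 \<in> V i j" "g2 \<in> V i j'" and j: "j \<noteq> j'"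
    and f1: "f1 \<noteq> (\<lambda>_. 0)" and w: "\<And>z. f1 z * g2 z = f2 z * g1 z"
  obtains \<alpha> where "\<And>z. g2 z = \<alpha> * f2 z" "\<And>z. f2 z * (g1 z - \<alpha> * f1 z) = 0"
proof -
  have f1q: "quasi (c i j) (- 2) f1" and f10: "f1 0 = 0" using f(1) V_iff by auto
  obtain y0 where "f1 y0 \<noteq> 0" using f1 by blast
  then have y0: "y0 \<noteq> 0" "f1 y0 \<noteq> 0" using f10 by auto
  obtain y where y: "y \<noteq> 0" "f1 y \<noteq> 0" "\<not> qtriv (c i j / y / y)" by (rule generic_nonzero[OF f1q y0 c_nz])
  define \<alpha> where "\<alpha> = g1 y / f1 y"
  define h1 where "h1 = (\<lambda>z. 1 * g1 z + (- \<alpha>) * f1 z)"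
  define h2 where "h2 = (\<lambda>z. 1 * g2 z + (- \<alpha>) * f2 z)"
  have h: "h1 \<in> V i j" "h2 \<in> V i j'" unfolding h1_def h2_def using f g by (blast intro: V_combination)+
  have wh: "f1 z * h2 z = f2 z * h1 z" for z using w[of z] by (simp add: h1_def h2_def algebra_simps)
  have h1y: "h1 y = 0" using y by (simp add: h1_def \<alpha>_def)
  then have h2y: "h2 y = 0" using wh[of y] y by simp
  let ?y = "c i j / y"
  have yn: "?y \<noteq> 0" using c_nz y by simp
  have h1q: "quasi (c i j) (- 2) h1" using h(1) V_iff by blast
  have "h1 ?y = 0" by (rule degree2_second_zero[OF h1q c_nz y(1) h1y])
  moreover have "f1 ?y \<noteq> 0"
  proof
    assume "f1 ?y = 0"
    from degree2_second_zero[OF f1q c_nz yn this] show False using y c_nz[of i j] by simp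
  qed
  ultimately have h2y': "h2 ?y = 0" using wh[of ?y] by simp
  have "h2 z = 0" for z
  proof (cases "z = 0")
    case True
    then show ?thesis using h(2) V_iff by blast
  next
    case False
    have h2q: "quasi (c i j') (- 2) h2" using h(2) V_iff by blast
    have "c i j' / (y * ?y) = \<sigma>$j / \<sigma>$j'" using y rho_nz sigma_nz by (simp add: field_simps)
    then have "\<not> qtriv (c i j' / (y * ?y))" using sigma_inequiv[OF j] by simp
    from degree2_vanish[OF h2q c_nz y(1) yn h2y h2y' y(3) this False] show ?thesis .
  qed
  then have "g2 z = \<alpha> * f2 z" "f2 z * (g1 z - \<alpha> * f1 z) = 0" for z
    using wh[of z] by (simp_all add: h1_def h2_def)
  then show ?thesis by (rule that)
qed

lemma V_product_zero:
  assumes m: "m \<in> V i j" "m \<noteq> (\<lambda>_. 0)" and h: "h \<in> V i j'" and w: "\<And>z. m z * h z = 0" and j: "j \<noteq> j'"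
  shows "h z = 0"
proof -
  have mq: "quasi (c i j) (- 2) m" and m0: "m 0 = 0" using m(1) V_iff by auto
  obtain y0 where "m y0 \<noteq> 0" using m(2) by blast
  then have y0: "y0 \<noteq> 0" "m y0 \<noteq> 0" using m0 by auto
  obtain y where y: "y \<noteq> 0" "m y \<noteq> 0" "\<not> qtriv (c i j / y / y)" by (rule generic_nonzero[OF mq y0 c_nz])
  let ?y = "c i j / y"
  have yn: "?y \<noteq> 0" using c_nz y by simp
  have "m ?y \<noteq> 0"
  proof
    assume "m ?y = 0"
    from degree2_second_zero[OF mq c_nz yn this] show False using y c_nz[of i j] by simp
  qed
  then have hy: "h ?y = 0" "h y = 0" using w[of ?y] w[of y] y by simp_all
  show ?thesis
  proof (cases "z = 0")
    case True
    then show ?thesis using h V_iff by blast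
  next
    case False
    have hq: "quasi (c i j') (- 2) h" using h V_iff by blast
    have "c i j' / (y * ?y) = \<sigma>$j / \<sigma>$j'" using y rho_nz sigma_nz by (simp add: field_simps)
    then have "\<not> qtriv (c i j' / (y * ?y))" using sigma_inequiv[OF j] by simp
    from degree2_vanish[OF hq c_nz y(1) yn hy(2,1) y(3) this False] show ?thesis .
  qed
qed

lemma V_zero_line:
  assumes f: "f \<in> V i j" "f \<noteq> (\<lambda>_. 0)" and g: "g \<in> V i j" and k: "f (x$k) = 0" "g (x$k) = 0"
  obtains \<alpha> where "\<And>z. g z = \<alpha> * f z"
proof -
  obtain l where l: "l \<noteq> k" by (metis zero_neq_one)
  have fl: "f (x$l) \<noteq> 0" using V_zero_unique[OF f(1,2) k(1)] l by metis
  define \<alpha> where "\<alpha> = g (x$l) / f (x$l)"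
  let ?h = "\<lambda>z. 1 * g z + (- \<alpha>) * f z"
  have h: "?h \<in> V i j" by (intro V_combination f g)
  have hz: "?h z = 0" for z by (rule V_vanish[OF h l]) (use k fl in \<open>simp_all add: \<alpha>_def\<close>)
  have "g z = \<alpha> * f z" for z using hz[of z] by algebra
  then show ?thesis by (rule that)
qed

text \<open>Two solutions have zero determinant, hence they are proportional if \<open>f\<close> has no zero entry. If one entry of \<open>f\<close>
  is zero, the same entry of \<open>g\<close> is zero, and the other entries share a zero at a point whose coordinate is neither 0
  nor infinity. This is where fixed points have to be excluded.\<close>

lemma sol_unique:
  assumes v: "valid X Y" and nf: "nonfixed X Y" and f: "sol i X Y f" "f \<noteq> (\<chi> j. (\<lambda>z. 0))" and g: "sol i X Y g"
  obtains \<alpha> where "g = (\<chi> j. (\<lambda>z. \<alpha> * (f$j) z))"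
proof -
  have fV: "f$j \<in> V i j" and gV: "g$j \<in> V i j" for j using f g by (simp_all add: sol_def)
  have feq: "X$k * (f$1) (x$k) = Y$k * (f$2) (x$k)" and geq: "X$k * (g$1) (x$k) = Y$k * (g$2) (x$k)" for k
    using f g by (simp_all add: sol_def sol_at_def)
  have w: "(f$1) z * (g$2) z = (f$2) z * (g$1) z" for z
    using wedge_same_row[OF v f(1) g, of z] by (simp add: wedge_def)
  obtain k where k: "X$k \<noteq> 0" "Y$k \<noteq> 0" using nf unfolding nonfixed_def by blast
  have ne: "f$1 \<noteq> (\<lambda>_. 0) \<or> f$2 \<noteq> (\<lambda>_. 0)"
    using f(2) by (auto simp: vec_eq_iff forall_2)
  have "\<exists>\<alpha>. \<forall>z. (g$1) z = \<alpha> * (f$1) z \<and> (g$2) z = \<alpha> * (f$2) z"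
  proof (cases "f$1 = (\<lambda>_. 0)")
    case True
    then have f2: "f$2 \<noteq> (\<lambda>_. 0)" using ne by blast
    have "(f$2) z * (g$1) z = 0" for z using w[of z] True by simp
    then have g1: "(g$1) z = 0" for z using V_product_zero[OF fV f2 gV, of 1 z] by simp
    have "(f$2) (x$k) = 0" "(g$2) (x$k) = 0" using feq[of k] geq[of k] True g1 k by simp_all
    from V_zero_line[OF fV f2 gV this] obtain \<alpha> where "\<And>z. (g$2) z = \<alpha> * (f$2) z" by blast
    then show ?thesis using True g1 by (intro exI[of _ \<alpha>]) simp
  next
    case f1: False
    show ?thesis
    proof (cases "f$2 = (\<lambda>_. 0)")
      case True
      have "(f$1) z * (g$2) z = 0" for z using w[of z] True by simp
      then have g2: "(g$2) z = 0" for z using V_product_zero[OF fV f1 gV, of 2 z] by simp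
      have "(f$1) (x$k) = 0" "(g$1) (x$k) = 0" using feq[of k] geq[of k] True g2 k by simp_all
      from V_zero_line[OF fV f1 gV this] obtain \<alpha> where "\<And>z. (g$1) z = \<alpha> * (f$1) z" by blast
      then show ?thesis using True g2 by (intro exI[of _ \<alpha>]) simp
    next
      case f2: False
      obtain \<alpha> where \<alpha>: "\<And>z. (g$2) z = \<alpha> * (f$2) z" "\<And>z. (f$2) z * ((g$1) z - \<alpha> * (f$1) z) = 0"
        by (rule wedge_zero_proportional[OF fV[of 1] fV[of 2] gV gV _ f1 w]) (simp, blast)
      have h: "(\<lambda>z. 1 * (g$1) z + (- \<alpha>) * (f$1) z) \<in> V i 1" by (intro V_combination fV gV)
      have "1 * (g$1) z + (- \<alpha>) * (f$1) z = 0" for z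
        by (rule V_product_zero[OF fV[of 2] f2 h]) (use \<alpha>(2) in simp_all)
      then show ?thesis using \<alpha>(1) by (intro exI[of _ \<alpha>]) simp
    qed
  qed
  then obtain \<alpha> where \<alpha>: "\<And>z. (g$1) z = \<alpha> * (f$1) z \<and> (g$2) z = \<alpha> * (f$2) z" by blast
  have "g = (\<chi> j. (\<lambda>z. \<alpha> * (f$j) z))" using \<alpha> by (simp add: vec_eq_iff forall_2 fun_eq_iff)
  then show ?thesis by (rule that)
qed

text \<open>Serre duality in disguise: if row \<open>i\<close> has a solution \<open>f\<close> not vanishing at \<open>x\<^sub>k\<close>, then a row \<open>g\<close> of the other index
  that satisfies the three conditions away from \<open>k\<close> satisfies the fourth as well. Indeed the determinant
  \<open>wedge f g\<close> has degree 4 and vanishes at three of the points; by (FR) it vanishes at the fourth.\<close>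

lemma fourth_condition:
  assumes v: "valid X Y" and i: "i \<noteq> i'" and f: "sol i X Y f" and g: "\<And>j. g$j \<in> V i' j"
    and fk: "(f$1) (x$k) \<noteq> 0 \<or> (f$2) (x$k) \<noteq> 0" and gl: "\<And>l. l \<noteq> k \<Longrightarrow> sol_at i' X Y l g"
  shows "sol i' X Y g"
proof -
  have fV: "f$j \<in> V i j" for j using f by (simp add: sol_def)
  have rr: "\<rho>$i * \<rho>$i' = \<rho>$1 * \<rho>$2" using i exhaust_2[of i] exhaust_2[of i'] by auto
  have n: "quasi (\<rho>$1 * \<rho>$2 / (\<sigma>$1 * \<sigma>$2)) (- 4) (wedge f g)"
    using wedge_quasi[of f i g i'] fV g rr by simp
  have d: "\<rho>$1 * \<rho>$2 / (\<sigma>$1 * \<sigma>$2) \<noteq> 0" using rho_nz sigma_nz by simp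
  have z: "wedge f g (x$l) = 0" if "l \<noteq> k" for l
    using wedge_sol_at[OF v, of i l f i' g] f gl[OF that] unfolding sol_def by blast
  have four: "wedge f g (x$k) = 0" if "l1 \<noteq> k" "l2 \<noteq> k" "l3 \<noteq> k" "l1 \<noteq> l2" "l1 \<noteq> l3" "l2 \<noteq> l3"
    "x$1 * x$2 * x$3 * x$4 = x$l1 * x$l2 * x$l3 * x$k" for l1 l2 l3
    by (rule degree4_fourth_zero[OF n d x_nz[of l1] x_nz[of l2] x_nz[of l3] z z z NR_x NR_x NR_x])
       (use that prod_x x_nz in simp_all)
  have "wedge f g (x$k) = 0"
    using exhaust_4[of k] four[of 2 3 4] four[of 1 3 4] four[of 1 2 4] four[of 1 2 3] by (auto simp: mult_ac)
  moreover have nz: "(X$k, Y$k) \<noteq> (0, 0)" using v by (simp add: valid_def)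
  moreover obtain s where s: "(f$1) (x$k) = s * Y$k" "(f$2) (x$k) = s * X$k"
    using proportional_pair[OF nz] f unfolding sol_def sol_at_def by metis
  ultimately have "s * (Y$k * (g$2) (x$k) - X$k * (g$1) (x$k)) = 0" "s \<noteq> 0"
    using fk by (auto simp: wedge_def algebra_simps)
  then have "sol_at i' X Y k g" by (simp add: sol_at_def)
  then have "sol_at i' X Y l g" for l using gl by (cases "l = k") auto
  then show ?thesis using g by (simp add: sol_def)
qed

lemma two_equations:
  fixes p1 q1 p2 q2 :: complex
  shows "(\<exists>s t. (s, t) \<noteq> (0, 0) \<and> s * p1 + t * q1 = 0 \<and> s * p2 + t * q2 = 0) \<longleftrightarrow> p1 * q2 - p2 * q1 = 0"
proof
  assume "\<exists>s t. (s, t) \<noteq> (0, 0) \<and> s * p1 + t * q1 = 0 \<and> s * p2 + t * q2 = 0"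
  then obtain s t where st: "(s, t) \<noteq> (0, 0)" "s * p1 + t * q1 = 0" "s * p2 + t * q2 = 0" by blast
  have "s * (p1 * q2 - p2 * q1) = q2 * (s * p1 + t * q1) - q1 * (s * p2 + t * q2)"
    "t * (p1 * q2 - p2 * q1) = p1 * (s * p2 + t * q2) - p2 * (s * p1 + t * q1)" by (simp_all add: algebra_simps)
  then show "p1 * q2 - p2 * q1 = 0" using st by auto
next
  assume d: "p1 * q2 - p2 * q1 = 0"
  show "\<exists>s t. (s, t) \<noteq> (0, 0) \<and> s * p1 + t * q1 = 0 \<and> s * p2 + t * q2 = 0"
  proof (cases "(p1, q1) = (0, 0)")
    case False
    then show ?thesis using d by (intro exI[of _ q1] exI[of _ "- p1"]) (auto simp: algebra_simps)
  next
    case p1: True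
    show ?thesis
    proof (cases "(p2, q2) = (0, 0)")
      case False
      then show ?thesis using p1 by (intro exI[of _ q2] exI[of _ "- p2"]) auto
    next
      case True
      then show ?thesis using p1 by (intro exI[of _ 1] exI[of _ 0]) auto
    qed
  qed
qed

text \<open>After the conditions at \<open>x\<^sub>1\<close> and \<open>x\<^sub>2\<close> have been solved, two linear equations in the two unknowns \<open>s\<close>, \<open>t\<close> remain.\<close>

lemma exists_sol_iff:
  assumes v: "valid X Y"
  shows "(\<exists>f. sol i X Y f \<and> f \<noteq> (\<chi> j. (\<lambda>z. 0))) \<longleftrightarrow> Phi_i i X Y = 0"
proof -
  have "(\<exists>f. sol i X Y f \<and> f \<noteq> (\<chi> j. (\<lambda>z. 0))) \<longleftrightarrow> (\<exists>s t. (s, t) \<noteq> (0, 0) \<and> sol i X Y (kernel_row i X Y s t))"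
  proof
    assume "\<exists>f. sol i X Y f \<and> f \<noteq> (\<chi> j. (\<lambda>z. 0))"
    then obtain f where f: "sol i X Y f" "f \<noteq> (\<chi> j. (\<lambda>z. 0))" by blast
    obtain s t where "f = kernel_row i X Y s t" by (rule sol_row[OF v f(1)])
    then show "\<exists>s t. (s, t) \<noteq> (0, 0) \<and> sol i X Y (kernel_row i X Y s t)"
      using f row_eq_0_iff[OF v, of i s t] by (intro exI[of _ s] exI[of _ t]) auto
  next
    assume "\<exists>s t. (s, t) \<noteq> (0, 0) \<and> sol i X Y (kernel_row i X Y s t)"
    then show "\<exists>f. sol i X Y f \<and> f \<noteq> (\<chi> j. (\<lambda>z. 0))" using row_eq_0_iff[OF v, of i] by blast
  qed
  then show ?thesis unfolding row_sol two_equations Phi_i_def .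
qed

text \<open>The equation \<open>\<Phi> = 0\<close> is stated with row 1 only; it governs row 2 as well, because by duality three of the
  four conditions on row 2 imply the fourth.\<close>

lemma Phi_transfer:
  assumes v: "valid X Y" and i: "i \<noteq> i'" and P: "Phi_i i X Y = 0"
  shows "Phi_i i' X Y = 0"
proof -
  obtain f where f: "sol i X Y f" "f \<noteq> (\<chi> j. (\<lambda>z. 0))" using exists_sol_iff[OF v] P by blast
  have fV: "f$j \<in> V i j" for j using f by (simp add: sol_def)
  have "\<exists>k l. (k, l) \<in> {(3, 4), (4, 3::4)} \<and> ((f$1) (x$k) \<noteq> 0 \<or> (f$2) (x$k) \<noteq> 0)"
    using row_zero_unique[OF fV f(2), of 3 4] by auto
  then obtain k l where kl: "(k, l) \<in> {(3, 4), (4, 3::4)}" "(f$1) (x$k) \<noteq> 0 \<or> (f$2) (x$k) \<noteq> 0" by blast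
  obtain s t where st: "(s, t) \<noteq> (0, 0)" "s * lamform i' l X Y + t * muform i' l X Y = 0"
    using two_equations[of "lamform i' l X Y" "muform i' l X Y" "lamform i' l X Y" "muform i' l X Y"] by auto
  let ?g = "kernel_row i' X Y s t"
  have "sol i' X Y ?g"
  proof (rule fourth_condition[OF v i f(1) row_V kl(2)])
    fix m assume "m \<noteq> k"
    then have "m = 1 \<or> m = 2 \<or> m = l" using kl(1) exhaust_4[of m] by auto
    then show "sol_at i' X Y m ?g" using row_sol_at st(2) by blast
  qed
  then show ?thesis using exists_sol_iff[OF v, of i'] row_eq_0_iff[OF v, of i' s t] st(1) by blast
qed

text \<open>Cramer's rule: the equation at \<open>x\<^sub>k\<close> is solved by its coefficients crosswise, and on the hypersurface the other equation is
  proportional to it. The formula is polynomial in \<open>X\<close> and \<open>Y\<close>, but gives 0 where both coefficients vanish.\<close>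

definition solrow :: "2 \<Rightarrow> 4 \<Rightarrow> complex^4 \<Rightarrow> complex^4 \<Rightarrow> (complex \<Rightarrow> complex)^2" where
  "solrow i k X Y = kernel_row i X Y (muform i k X Y) (- lamform i k X Y)"

lemma solrow_sol:
  assumes "Phi_i i X Y = 0" "k \<in> {3, 4}"
  shows "sol i X Y (solrow i k X Y)"
proof -
  have "lamform i 3 X Y * muform i 4 X Y = lamform i 4 X Y * muform i 3 X Y" using assms(1) by (simp add: Phi_i_def)
  then show ?thesis using assms(2) unfolding solrow_def row_sol by (auto simp: mult.commute)
qed

text \<open>If both choices of \<open>k\<close> gave 0, all four coefficients would vanish and the solutions would form a plane, against
  uniqueness.\<close>

lemma solrow_nonzero:
  assumes v: "valid X Y" and nf: "nonfixed X Y"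
  obtains k where "k \<in> {3, 4}" "solrow i k X Y \<noteq> (\<chi> j. (\<lambda>z. 0))"
proof -
  have "\<exists>k\<in>{3, 4}. (muform i k X Y, lamform i k X Y) \<noteq> (0, 0)"
  proof (rule ccontr)
    assume "\<not> ?thesis"
    then have z: "muform i 3 X Y = 0" "lamform i 3 X Y = 0" "muform i 4 X Y = 0" "lamform i 4 X Y = 0" by auto
    then have s: "sol i X Y (kernel_row i X Y 1 0)" "sol i X Y (kernel_row i X Y 0 1)" by (simp_all add: row_sol)
    have ne: "kernel_row i X Y 1 0 \<noteq> (\<chi> j. (\<lambda>z. 0))" using row_eq_0_iff[OF v] by simp
    obtain \<alpha> where \<alpha>: "kernel_row i X Y 0 1 = (\<chi> j. (\<lambda>z. \<alpha> * (kernel_row i X Y 1 0 $ j) z))" by (rule sol_unique[OF v nf s(1) ne s(2)])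
    have "(kernel_row i X Y 0 1 $ j) (x$2) = \<alpha> * (kernel_row i X Y 1 0 $ j) (x$2)" for j
      using arg_cong[OF \<alpha>, of "\<lambda>f. (f$j) (x$2)"] by simp
    from this[of 1] this[of 2] have "Y$2 = 0" "X$2 = 0" by (simp_all add: row_values)
    then show False using v by (simp add: valid_def)
  qed
  then obtain k where k: "k \<in> {3, 4}" "(muform i k X Y, lamform i k X Y) \<noteq> (0, 0)" by blast
  have "solrow i k X Y \<noteq> (\<chi> j. (\<lambda>z. 0))" using k(2) unfolding solrow_def row_eq_0_iff[OF v] by auto
  with k(1) show ?thesis by (rule that)
qed

text \<open>If the line in direction \<open>l\<close> contained a second point of the hypersurface, a solution \<open>f\<^sub>0\<close> of row 1 over that point
  would satisfy the conditions of the first point except perhaps the one at \<open>x\<^sub>l\<close>. By duality with \<open>g\<close> it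
  satisfies that one too, so it is proportional to \<open>f\<close>; but \<open>f\<close> determines the \<open>l\<close>-th coordinate.\<close>

lemma line_not_in_hypersurface:
  assumes v: "valid X Y" and nf: "nonfixed X Y" and f: "sol 1 X Y f" "f \<noteq> (\<chi> j. (\<lambda>z. 0))" and g: "sol 2 X Y g"
    and fl: "(f$1) (x$l) \<noteq> 0 \<or> (f$2) (x$l) \<noteq> 0" and gl: "(g$1) (x$l) \<noteq> 0 \<or> (g$2) (x$l) \<noteq> 0"
    and v': "valid X' Y'" and same: "\<And>k. k \<noteq> l \<Longrightarrow> X'$k = X$k \<and> Y'$k = Y$k" and P: "Phi_i 1 X' Y' = 0"
  shows "X'$l * Y$l = X$l * Y'$l"
proof -
  obtain f' where f': "sol 1 X' Y' f'" "f' \<noteq> (\<chi> j. (\<lambda>z. 0))" using exists_sol_iff[OF v'] P by blast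
  have f'V: "f'$j \<in> V 1 j" for j using f' by (simp add: sol_def)
  have "sol_at 1 X Y k f'" if "k \<noteq> l" for k
  proof -
    have "sol_at 1 X' Y' k f'" using f'(1) by (simp add: sol_def)
    then show ?thesis unfolding sol_at_def using same[OF that] by simp
  qed
  then have "sol 1 X Y f'" by (intro fourth_condition[OF v _ g f'V gl]) simp_all
  then obtain \<alpha> where \<alpha>: "f' = (\<chi> j. (\<lambda>z. \<alpha> * (f$j) z))" by (rule sol_unique[OF v nf f])
  then have "\<alpha> \<noteq> 0" using f'(2) by (auto simp: vec_eq_iff)
  moreover have "X'$l * (f'$1) (x$l) = Y'$l * (f'$2) (x$l)" using f'(1) unfolding sol_def sol_at_def by blast
  then have "X'$l * (\<alpha> * (f$1) (x$l)) = Y'$l * (\<alpha> * (f$2) (x$l))" unfolding \<alpha> by simp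
  ultimately have 1: "X'$l * (f$1) (x$l) = Y'$l * (f$2) (x$l)" by (simp add: mult.left_commute)
  have nz: "(X$l, Y$l) \<noteq> (0, 0)" using v by (simp add: valid_def)
  obtain s where s: "(f$1) (x$l) = s * Y$l" "(f$2) (x$l) = s * X$l"
    using proportional_pair[OF nz] f unfolding sol_def sol_at_def by metis
  then have "s \<noteq> 0" using fl by auto
  moreover have "s * (X'$l * Y$l) = s * (X$l * Y'$l)" using 1 s by (simp add: algebra_simps)
  ultimately show ?thesis by simp
qed

end

section \<open>Matrices and the exceptional locus\<close>

context connection_setting
begin

lemma qtriv_quotient: "qtriv u \<Longrightarrow> qtriv v \<Longrightarrow> qtriv (u / v)"
  unfolding qtriv_def using q0 by (metis power_int_diff)

lemma other_points:
  obtains l1 l2 l3 where "l1 \<noteq> k" "l2 \<noteq> k" "l3 \<noteq> k" "l1 \<noteq> l2" "l1 \<noteq> l3" "l2 \<noteq> l3"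
    "x$1 * x$2 * x$3 * x$4 = x$l1 * x$l2 * x$l3 * x$k"
proof -
  consider "k = 1" | "k = 2" | "k = 3" | "k = 4" using exhaust_4 by blast
  then show ?thesis
  proof cases
    case 1
    show ?thesis by (rule that[of 2 3 4]) (simp_all add: 1)
  next
    case 2
    show ?thesis by (rule that[of 1 3 4]) (simp_all add: 2)
  next
    case 3
    show ?thesis by (rule that[of 1 2 4]) (simp_all add: 3)
  next
    case 4
    show ?thesis by (rule that[of 1 2 3]) (simp_all add: 4)
  qed
qed

text \<open>An auxiliary point at which the product of the theta functions with zeros at the \<open>x\<^sub>k\<close> does not vanish.\<close>

definition x0 :: complex where
  "x0 = (SOME y. y \<noteq> 0 \<and> (\<forall>k. \<not> qtriv (y / x$k)))"

lemma x0: "x0 \<noteq> 0" "\<not> qtriv (x0 / x$k)"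
proof -
  obtain y where "y \<noteq> 0" "\<And>s. s \<in> range (\<lambda>k. x$k) \<Longrightarrow> \<not> qtriv (y / s)"
    by (rule exists_inequivalent[of "range (\<lambda>k. x$k)"]) simp_all
  then have "\<exists>y. y \<noteq> 0 \<and> (\<forall>k. \<not> qtriv (y / x$k))" by blast
  from someI_ex[OF this] show "x0 \<noteq> 0" "\<not> qtriv (x0 / x$k)" unfolding x0_def by blast+
qed

lemma det_wedge: "det (at_point M z) = wedge (M$1) (M$2) z"
  by (simp add: det_2 at_point_def wedge_def)

text \<open>By (FR) the determinant vanishing at the four points is a constant multiple of the product of their theta functions,
  so that its value at the single auxiliary point \<open>x0\<close> decides whether it is zero.\<close>

lemma wedge_total:
  assumes fV: "\<And>j. f$j \<in> V 1 j" and gV: "\<And>j. g$j \<in> V 2 j" and z: "\<And>k. wedge f g (x$k) = 0"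
    and x0z: "wedge f g x0 = 0"
  shows "wedge f g y = 0"
proof (cases "y = 0")
  case True
  have "(f$j) 0 = 0" for j using fV V_iff by blast
  then show ?thesis using True by (simp add: wedge_def)
next
  case False
  let ?d = "\<rho>$1 * \<rho>$2 / (\<sigma>$1 * \<sigma>$2)"
  have n: "quasi ?d (- 4) (wedge f g)" by (rule wedge_quasi[OF fV gV])
  have d: "?d \<noteq> 0" using rho_nz sigma_nz by simp
  obtain h where h: "quasi (?d / (x$1 * x$2 * x$3 * x$4)) 0 h"
    "\<And>y. y \<noteq> 0 \<Longrightarrow> wedge f g y = th (y / x$1) * th (y / x$2) * th (y / x$3) * th (y / x$4) * h y"
    using degree4_at_x[OF n d z] by metis
  have "?d / (x$1 * x$2 * x$3 * x$4) = 1" using prod_x d by simp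
  with h(1) have "quasi 1 0 h" by metis
  then obtain \<kappa> where \<kappa>: "\<And>y. y \<noteq> 0 \<Longrightarrow> h y = \<kappa>" by (rule quasi_0_const) blast
  have "th (x0 / x$k) \<noteq> 0" for k using th_ratio_zero[OF x0(1) x_nz] x0(2) by simp
  then have "\<kappa> = 0" using h(2)[OF x0(1)] \<kappa>[OF x0(1)] x0z by simp
  then show ?thesis using h(2)[OF False] \<kappa>[OF False] by simp
qed

text \<open>If both rows vanish at \<open>x\<^sub>k\<close>, dividing them by the theta function with zero at \<open>x\<^sub>k\<close> leaves a matrix of sections of degree 1
  whose determinant \<open>w\<close> has degree 2 and still vanishes at the other three points. That is one zero too many, so
  \<open>w = 0\<close>. Sections of degree 1 have a known zero each, and comparing the zeros of both products in \<open>w\<close> shows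
  that one of the factors vanishes identically.\<close>

lemma common_zero_degenerate:
  assumes fV: "\<And>j. f$j \<in> V 1 j" and gV: "\<And>j. g$j \<in> V 2 j" and z: "\<And>k. wedge f g (x$k) = 0"
    and fk: "\<And>j. (f$j) (x$k) = 0" and gk: "\<And>j. (g$j) (x$k) = 0"
  shows "wedge f g y = 0" and "f$2 = (\<lambda>_. 0) \<or> g$1 = (\<lambda>_. 0)"
proof -
  let ?t = "\<lambda>z. th (z / x$k)"
  have "\<exists>h. quasi (- (c 1 j / x$k)) (- 1) h \<and> (\<forall>z. z \<noteq> 0 \<longrightarrow> (f$j) z = ?t z * h z)" for j
    using quasi_divide[of "c 1 j" "- 2" "f$j" "x$k"] fV[of j] fk[of j] x_nz c_nz[of 1 j]
    unfolding V_iff by (metis (no_types, lifting) add.commute minus_add_cancel one_add_one uminus_add_conv_diff minus_diff_eq diff_add_eq)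
  then obtain F where F: "\<And>j. quasi (- (c 1 j / x$k)) (- 1) (F j)" "\<And>j z. z \<noteq> 0 \<Longrightarrow> (f$j) z = ?t z * F j z"
    by metis
  have "\<exists>h. quasi (- (c 2 j / x$k)) (- 1) h \<and> (\<forall>z. z \<noteq> 0 \<longrightarrow> (g$j) z = ?t z * h z)" for j
    using quasi_divide[of "c 2 j" "- 2" "g$j" "x$k"] gV[of j] gk[of j] x_nz c_nz[of 2 j]
    unfolding V_iff by (metis (no_types, lifting) add.commute minus_add_cancel one_add_one uminus_add_conv_diff minus_diff_eq diff_add_eq)
  then obtain G where G: "\<And>j. quasi (- (c 2 j / x$k)) (- 1) (G j)" "\<And>j z. z \<noteq> 0 \<Longrightarrow> (g$j) z = ?t z * G j z"
    by metis
  let ?d = "\<rho>$1 * \<rho>$2 / (\<sigma>$1 * \<sigma>$2) / (x$k * x$k)"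
  \<comment> \<open>the determinant of the divided matrix, of degree 2\<close>
  define w where "w = (\<lambda>z. 1 * (F 1 z * G 2 z) + (- 1) * (F 2 z * G 1 z))"
  have d12: "- (c 1 1 / x$k) * - (c 2 2 / x$k) = ?d" "- (c 1 2 / x$k) * - (c 2 1 / x$k) = ?d"
    by (simp_all add: mult_ac)
  have "quasi ?d (- 1 + - 1) (\<lambda>z. F 1 z * G 2 z)" using quasi_mult[OF F(1)[of 1] G(1)[of 2]] unfolding d12 .
  moreover have "quasi ?d (- 1 + - 1) (\<lambda>z. F 2 z * G 1 z)" using quasi_mult[OF F(1)[of 2] G(1)[of 1]] unfolding d12 .
  moreover have "- 1 + - 1 = (- 2 :: int)" by simp
  ultimately have "quasi ?d (- 2) (\<lambda>z. F 1 z * G 2 z)" "quasi ?d (- 2) (\<lambda>z. F 2 z * G 1 z)" by metis+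
  then have wq: "quasi ?d (- 2) w" unfolding w_def by (rule quasi_combination)
  have d: "?d \<noteq> 0" using rho_nz sigma_nz x_nz by simp
  have ww: "wedge f g z = ?t z * ?t z * w z" if "z \<noteq> 0" for z
    unfolding wedge_def w_def F(2)[OF that] G(2)[OF that] by (simp add: algebra_simps)
  have wl: "w (x$l) = 0" if "l \<noteq> k" for l
  proof -
    have "?t (x$l) \<noteq> 0" using th_ratio_zero[OF x_nz x_nz] NR_x[OF that] by simp
    then show ?thesis using ww[OF x_nz[of l]] z[of l] by simp
  qed
  obtain l1 l2 l3 where l: "l1 \<noteq> k" "l2 \<noteq> k" "l3 \<noteq> k" "l1 \<noteq> l2" "l1 \<noteq> l3" "l2 \<noteq> l3"
    "x$1 * x$2 * x$3 * x$4 = x$l1 * x$l2 * x$l3 * x$k" by (rule other_points)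
  have "?d / (x$l1 * x$l2) = x$l3 / x$k" unfolding prod_x l(7) using x_nz by (simp add: field_simps)
  then have ineq: "\<not> qtriv (?d / (x$l1 * x$l2))" using NR_x[OF l(3)] by simp
  have ineq2: "\<not> qtriv (x$l2 / x$l1)" using NR_x[of l2 l1] l(4) by simp
  have w0: "w z = 0" if "z \<noteq> 0" for z
    by (rule degree2_vanish[OF wq d x_nz x_nz wl[OF l(1)] wl[OF l(2)] ineq2 ineq that])
  show "wedge f g y = 0"
  proof (cases "y = 0")
    case True
    have "(f$j) 0 = 0" for j using fV V_iff by blast
    then show ?thesis using True by (simp add: wedge_def)
  next
    case False
    then show ?thesis using ww w0 by simp
  qed
  \<comment> \<open>the zero of \<open>F 1\<close>; it must be a zero of \<open>F 2\<close> or \<open>G 1\<close>, and it is not the zero that their multipliers prescribe\<close>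
  let ?y = "c 1 1 / x$k"
  have yn: "?y \<noteq> 0" using c_nz x_nz by simp
  have "F 1 ?y = 0" using degree1_zero[OF F(1)[of 1]] yn by simp
  then have "F 2 ?y = 0 \<or> G 1 ?y = 0" using w0[OF yn] by (simp add: w_def)
  then show "f$2 = (\<lambda>_. 0) \<or> g$1 = (\<lambda>_. 0)"
  proof
    assume v: "F 2 ?y = 0"
    have e: "- (- (c 1 2 / x$k)) / ?y = \<sigma>$1 / \<sigma>$2" using rho_nz sigma_nz x_nz by (simp add: field_simps)
    have "\<not> qtriv (- (- (c 1 2 / x$k)) / ?y)" unfolding e by (rule NR_sigma)
    then have "F 2 z = 0" if "z \<noteq> 0" for z
      using degree1_vanish[OF F(1)[of 2] _ yn v _ that] c_nz[of 1 2] x_nz[of k] by simp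
    then have "(f$2) z = 0" for z using F(2)[of z 2] fV[of 2] V_iff by (cases "z = 0") auto
    then show ?thesis by blast
  next
    assume v: "G 1 ?y = 0"
    have e: "- (- (c 2 1 / x$k)) / ?y = \<rho>$2 / \<rho>$1" using rho_nz sigma_nz x_nz by (simp add: field_simps)
    have "\<not> qtriv (- (- (c 2 1 / x$k)) / ?y)" unfolding e by (rule rho_inequiv) simp
    then have "G 1 z = 0" if "z \<noteq> 0" for z
      using degree1_vanish[OF G(1)[of 1] _ yn v _ that] c_nz[of 2 1] x_nz[of k] by simp
    then have "(g$1) z = 0" for z using G(2)[of z 1] gV[of 1] V_iff by (cases "z = 0") auto
    then show ?thesis by blast
  qed
qed

lemma no_product_zero:
  assumes m: "m \<in> V i j" "m \<noteq> (\<lambda>_. 0)" and n: "n \<in> V i' j'" "n \<noteq> (\<lambda>_. 0)"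
  shows "\<exists>k. m (x$k) \<noteq> 0 \<and> n (x$k) \<noteq> 0"
proof (rule ccontr)
  assume "\<not> ?thesis"
  then have z: "m (x$k) = 0 \<or> n (x$k) = 0" for k by blast
  have mm: "m (x$k) = 0 \<Longrightarrow> m (x$l) = 0 \<Longrightarrow> k = l" for k l using V_zero_unique[OF m] by blast
  have nn: "n (x$k) = 0 \<Longrightarrow> n (x$l) = 0 \<Longrightarrow> k = l" for k l using V_zero_unique[OF n] by blast
  show False using z[of 1] z[of 2] z[of 3] mm[of 1 2] mm[of 1 3] mm[of 2 3] nn[of 1 2] nn[of 1 3] nn[of 2 3] by auto
qed

text \<open>If an entry is zero, the determinant is up to sign a product of two entries and vanishes at four points, while each factor has at
  most one zero among them.\<close>

lemma entries_nonzero: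
  assumes fV: "\<And>j. f$j \<in> V 1 j" and gV: "\<And>j. g$j \<in> V 2 j" and z: "\<And>k. wedge f g (x$k) = 0"
    and nz: "wedge f g y \<noteq> 0"
  shows "f$j \<noteq> (\<lambda>_. 0)" "g$j \<noteq> (\<lambda>_. 0)"
proof -
  have 1: "(f$1 \<noteq> (\<lambda>_. 0) \<and> g$2 \<noteq> (\<lambda>_. 0)) \<or> (f$2 \<noteq> (\<lambda>_. 0) \<and> g$1 \<noteq> (\<lambda>_. 0))"
  proof (rule ccontr)
    assume "\<not> ?thesis"
    then have "(f$1) y * (g$2) y = 0" "(f$2) y * (g$1) y = 0" by (auto simp: fun_eq_iff)
    then show False using nz by (auto simp: wedge_def)
  qed
  have 2: "\<not> (f$1 = (\<lambda>_. 0) \<or> g$2 = (\<lambda>_. 0))"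
  proof
    assume a: "f$1 = (\<lambda>_. 0) \<or> g$2 = (\<lambda>_. 0)"
    then obtain k where "(f$2) (x$k) \<noteq> 0" "(g$1) (x$k) \<noteq> 0"
      using no_product_zero[OF fV[of 2] _ gV[of 1]] 1 by blast
    then show False using z[of k] a by (auto simp: wedge_def)
  qed
  have 3: "\<not> (f$2 = (\<lambda>_. 0) \<or> g$1 = (\<lambda>_. 0))"
  proof
    assume a: "f$2 = (\<lambda>_. 0) \<or> g$1 = (\<lambda>_. 0)"
    then obtain k where "(f$1) (x$k) \<noteq> 0" "(g$2) (x$k) \<noteq> 0"
      using no_product_zero[OF fV[of 1] _ gV[of 2]] 1 by blast
    then show False using z[of k] a by (auto simp: wedge_def)
  qed
  show "f$j \<noteq> (\<lambda>_. 0)" "g$j \<noteq> (\<lambda>_. 0)" using 2 3 exhaust_2[of j] by auto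
qed

lemma nonfixed_of_entries:
  assumes v: "valid X Y" and f: "sol i X Y f" "f$1 \<noteq> (\<lambda>_. 0)" "f$2 \<noteq> (\<lambda>_. 0)"
  shows "nonfixed X Y"
proof -
  have fV: "f$j \<in> V i j" for j using f(1) by (simp add: sol_def)
  obtain k where k: "(f$1) (x$k) \<noteq> 0" "(f$2) (x$k) \<noteq> 0"
    using no_product_zero[OF fV[of 1] f(2) fV[of 2] f(3)] by blast
  have "X$k * (f$1) (x$k) = Y$k * (f$2) (x$k)" using f(1) unfolding sol_def sol_at_def by blast
  moreover have "(X$k, Y$k) \<noteq> (0, 0)" using v by (simp add: valid_def)
  ultimately show ?thesis using k unfolding nonfixed_def by (intro exI[of _ k]) auto
qed

subsection \<open>Homogeneous coordinates of points\<close>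

definition represents :: "proj1^4 \<Rightarrow> complex^4 \<Rightarrow> complex^4 \<Rightarrow> bool" where
  "represents r X Y \<longleftrightarrow> valid X Y \<and> (\<forall>k. r$k = ratio (X$k) (Y$k))"

lemma represents_valid: "represents r X Y \<Longrightarrow> valid X Y"
  by (simp add: represents_def)

lemma represents_nonfixed:
  assumes "represents r X Y"
  shows "nonfixed X Y \<longleftrightarrow> r \<notin> Theta4"
proof -
  have "r$k = ratio (X$k) (Y$k)" "(X$k, Y$k) \<noteq> (0, 0)" for k
    using assms unfolding represents_def valid_def by blast+
  then have "r$k \<in> {Fin 0, Infty} \<longleftrightarrow> X$k = 0 \<or> Y$k = 0" for k by (auto simp: ratio_def)
  then show ?thesis unfolding nonfixed_def Theta4_def by blast
qed

lemma sol_represents: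
  assumes "represents r X Y" "represents r X' Y'" "sol i X Y f"
  shows "sol i X' Y' f"
proof -
  have "sol_at i X' Y' k f" for k
  proof -
    have nz: "(X$k, Y$k) \<noteq> (0, 0)" "(X'$k, Y'$k) \<noteq> (0, 0)" and "ratio (X$k) (Y$k) = ratio (X'$k) (Y'$k)"
      using assms unfolding represents_def valid_def by metis+
    then have e: "X$k * Y'$k = X'$k * Y$k" using ratio_eq_iff by blast
    have "X$k * (f$1) (x$k) = Y$k * (f$2) (x$k)" using assms(3) unfolding sol_def sol_at_def by blast
    then obtain s where s: "(f$1) (x$k) = s * Y$k" "(f$2) (x$k) = s * X$k" using proportional_pair[OF nz(1)] by metis
    then show ?thesis unfolding sol_at_def using e by (simp add: mult_ac)
  qed
  then show ?thesis using assms(3) unfolding sol_def by blast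
qed

lemma exists_represents: "\<exists>X Y. represents r X Y"
proof -
  have "\<exists>X Y. (X, Y) \<noteq> (0, 0) \<and> r$k = ratio X Y" for k
  proof (cases "r$k")
    case (Fin z)
    then show ?thesis by (intro exI[of _ z] exI[of _ 1]) (simp add: ratio_def)
  next
    case Infty
    then show ?thesis by (intro exI[of _ 1] exI[of _ 0]) (simp add: ratio_def)
  qed
  then obtain X Y where "\<And>k. (X k, Y k) \<noteq> (0, 0) \<and> r$k = ratio (X k) (Y k)" by metis
  then have "represents r (\<chi> k. X k) (\<chi> k. Y k)" by (simp add: represents_def valid_def)
  then show ?thesis by blast
qed

lemma A_coeffs_eq:
  "A_coeffs q \<rho> \<sigma> x = Phi_coeffs (\<chi> j. b1 1 j (x$3)) (\<chi> j. b2 1 j (x$3)) (\<chi> j. b1 1 j (x$4)) (\<chi> j. b2 1 j (x$4))"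
  unfolding A_coeffs_def Let_def interpolation_eq by simp

lemma Phi_hom_eq: "Phi_hom (A_coeffs q \<rho> \<sigma> x) X Y = Phi_i 1 X Y"
  unfolding A_coeffs_eq by (simp add: Phi_hom_def Phi_coeffs_def Phi_i_def lamform_def muform_def algebra_simps)

lemma S_hypersurface_iff:
  assumes "represents r X Y"
  shows "r \<in> S_hypersurface (A_coeffs q \<rho> \<sigma> x) \<longleftrightarrow> Phi_i 1 X Y = 0"
proof
  assume "r \<in> S_hypersurface (A_coeffs q \<rho> \<sigma> x)"
  then show "Phi_i 1 X Y = 0" using assms unfolding S_hypersurface_def Phi_hom_eq represents_def valid_def by blast
next
  assume P: "Phi_i 1 X Y = 0"
  have "Phi_i 1 X' Y' = 0" if "\<forall>k. (X'$k, Y'$k) \<noteq> (0, 0) \<and> r$k = ratio (X'$k) (Y'$k)" for X' Y'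
  proof -
    have r': "represents r X' Y'" using that by (simp add: represents_def valid_def)
    obtain f where "sol 1 X Y f" "f \<noteq> (\<chi> j. (\<lambda>z. 0))"
      using exists_sol_iff[OF represents_valid[OF assms]] P by blast
    then show ?thesis
      using exists_sol_iff[OF represents_valid[OF r']] sol_represents[OF assms r'] by blast
  qed
  then show "r \<in> S_hypersurface (A_coeffs q \<rho> \<sigma> x)" unfolding S_hypersurface_def Phi_hom_eq by blast
qed

subsection \<open>Kernel coordinates of a matrix\<close>

lemma rho_coord_eq:
  assumes v: "(X$k, Y$k) \<noteq> (0, 0)" and s: "sol_at i1 X Y k (M$1)" "sol_at i2 X Y k (M$2)"
    and nz: "\<exists>i j. (M$i$j) (x$k) \<noteq> 0"
  shows "rho_coord (x$k) M = ratio (X$k) (Y$k)"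
proof -
  let ?R = "\<lambda>i. at_point M (x$k) $ i"
  have R: "?R i $ j = (M$i$j) (x$k)" for i j by (simp add: at_point_def)
  have e: "X$k * ?R i $ 1 = Y$k * ?R i $ 2" for i
    using s exhaust_2[of i] unfolding R sol_at_def by auto
  have ratio: "ratio (?R i $ 2) (?R i $ 1) = ratio (X$k) (Y$k)" if "?R i \<noteq> 0" for i
  proof -
    have "(?R i $ 2, ?R i $ 1) \<noteq> (0, 0)" using that by (auto simp: vec_eq_iff forall_2)
    then show ?thesis using ratio_eq_iff[OF _ v] e[of i] by (simp add: mult.commute)
  qed
  obtain i j where "(M$i$j) (x$k) \<noteq> 0" using nz by blast
  then have i: "?R i \<noteq> 0" using R by (metis zero_index)
  show ?thesis unfolding rho_coord_def
  proof (rule the_equality)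
    show "\<forall>i. ?R i \<noteq> 0 \<longrightarrow> ratio (X$k) (Y$k) = ratio (?R i $ 2) (?R i $ 1)" using ratio by simp
    fix r assume "\<forall>i. ?R i \<noteq> 0 \<longrightarrow> r = ratio (?R i $ 2) (?R i $ 1)"
    then show "r = ratio (X$k) (Y$k)" using ratio[OF i] i by blast
  qed
qed

definition kernel_data :: "fn_matrix \<Rightarrow> complex^4 \<Rightarrow> complex^4 \<Rightarrow> bool" where
  "kernel_data M X Y \<longleftrightarrow> valid X Y \<and> sol 1 X Y (M$1) \<and> sol 2 X Y (M$2)"

lemma rho_map_kernel_data:
  assumes k: "kernel_data M X Y" and nz: "\<And>k. \<exists>i j. (M$i$j) (x$k) \<noteq> 0"
  shows "represents (rho_map x M) X Y"
proof -
  have "rho_coord (x$k) M = ratio (X$k) (Y$k)" for k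
    by (rule rho_coord_eq[OF _ _ _ nz, of _ _ _ 1 2]) (use k in \<open>simp_all add: kernel_data_def valid_def sol_def\<close>)
  then show ?thesis using k by (simp add: represents_def rho_map_def kernel_data_def)
qed

lemma exists_kernel_data:
  assumes V: "\<And>i j. M$i$j \<in> V i j" and z: "\<And>k. wedge (M$1) (M$2) (x$k) = 0"
    and nz: "\<And>k. \<exists>i j. (M$i$j) (x$k) \<noteq> 0"
  obtains X Y where "kernel_data M X Y"
proof -
  have "\<exists>X Y. (X, Y) \<noteq> (0, 0) \<and> (\<forall>i. X * (M$i$1) (x$k) = Y * (M$i$2) (x$k))" for k
  proof -
    obtain i j where ij: "(M$i$j) (x$k) \<noteq> 0" using nz by blast
    have d: "(M$1$1) (x$k) * (M$2$2) (x$k) = (M$1$2) (x$k) * (M$2$1) (x$k)" using z[of k] by (simp add: wedge_def)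
    have "(M$i$2) (x$k) * (M$i'$1) (x$k) = (M$i$1) (x$k) * (M$i'$2) (x$k)" for i'
      using d exhaust_2[of i] exhaust_2[of i'] by (auto simp: mult_ac)
    moreover have "((M$i$2) (x$k), (M$i$1) (x$k)) \<noteq> (0, 0)" using ij exhaust_2[of j] by auto
    ultimately show ?thesis by (intro exI[of _ "(M$i$2) (x$k)"] exI[of _ "(M$i$1) (x$k)"]) simp
  qed
  then obtain X Y where XY: "\<And>k. (X k, Y k) \<noteq> (0, 0) \<and> (\<forall>i. X k * (M$i$1) (x$k) = Y k * (M$i$2) (x$k))" by metis
  have "kernel_data M (\<chi> k. X k) (\<chi> k. Y k)"
    using XY V by (simp add: kernel_data_def valid_def sol_def sol_at_def)
  then show ?thesis by (rule that)
qed

lemma V_set_iff: "M \<in> V_set q \<rho> \<sigma> \<longleftrightarrow> (\<forall>i j. M$i$j \<in> V i j)"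
  by (simp add: V_set_def)

lemma V_star_iff: "M \<in> V_star q \<rho> \<sigma> \<longleftrightarrow> (\<forall>i j. M$i$j \<in> V i j \<and> M$i$j \<noteq> (\<lambda>_. 0))"
  by (auto simp: V_star_def V_set_iff)

lemma F_set_iff:
  "M \<in> F_set q \<rho> \<sigma> x \<longleftrightarrow> (\<forall>i j. M$i$j \<in> V i j) \<and> wedge (M$1) (M$2) x0 \<noteq> 0 \<and> (\<forall>k. wedge (M$1) (M$2) (x$k) = 0)"
  unfolding F_set_def V_set_iff det_wedge using wedge_total[of "M$1" "M$2"] x0(1) by auto

text \<open>Otherwise the determinant would be identically zero.\<close>

lemma F_nonvanishing:
  assumes "M \<in> F_set q \<rho> \<sigma> x"
  shows "\<exists>i j. (M$i$j) (x$k) \<noteq> 0"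
proof (rule ccontr)
  assume "\<not> ?thesis"
  then have z: "(M$i$j) (x$k) = 0" for i j by blast
  have V: "M$i$j \<in> V i j" and w: "wedge (M$1) (M$2) (x$l) = 0" and nz: "wedge (M$1) (M$2) x0 \<noteq> 0" for i j l
    using assms by (simp_all add: F_set_iff)
  have "wedge (M$1) (M$2) x0 = 0" by (rule common_zero_degenerate(1)[OF V V w z z])
  then show False using nz by simp
qed

lemma F_subset_V_star: "M \<in> F_set q \<rho> \<sigma> x \<Longrightarrow> M \<in> V_star q \<rho> \<sigma>"
proof -
  assume "M \<in> F_set q \<rho> \<sigma> x"
  then have V: "M$i$j \<in> V i j" and w: "wedge (M$1) (M$2) (x$l) = 0" and nz: "wedge (M$1) (M$2) x0 \<noteq> 0" for i j l
    by (simp_all add: F_set_iff)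
  have "M$1$j \<noteq> (\<lambda>_. 0)" "M$2$j \<noteq> (\<lambda>_. 0)" for j
    by (rule entries_nonzero(1)[OF V V w nz], rule entries_nonzero(2)[OF V V w nz])
  then show "M \<in> V_star q \<rho> \<sigma>" unfolding V_star_iff forall_2 using V by blast
qed

lemma F_kernel_data:
  assumes "M \<in> F_set q \<rho> \<sigma> x"
  obtains X Y where "kernel_data M X Y" "represents (rho_map x M) X Y" "nonfixed X Y"
proof -
  have V: "M$i$j \<in> V i j" for i j using assms by (simp add: F_set_iff)
  obtain X Y where k: "kernel_data M X Y"
    by (rule exists_kernel_data[OF V _ F_nonvanishing[OF assms]]) (use assms in \<open>simp_all add: F_set_iff\<close>)
  have r: "represents (rho_map x M) X Y" by (rule rho_map_kernel_data[OF k F_nonvanishing[OF assms]])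
  have "nonfixed X Y"
    by (rule nonfixed_of_entries[of X Y 1 "M$1"])
       (use k F_subset_V_star[OF assms] in \<open>simp_all add: kernel_data_def V_star_iff\<close>)
  with k r show ?thesis by (rule that)
qed

definition degenerate :: "fn_matrix set" where
  "degenerate = {M \<in> V_star q \<rho> \<sigma>. \<forall>z. z \<noteq> 0 \<longrightarrow> det (at_point M z) = 0}"

lemma degenerate_kernel_data:
  assumes "M \<in> degenerate"
  obtains X Y where "kernel_data M X Y" "represents (rho_map x M) X Y" "nonfixed X Y"
proof -
  have V: "M$i$j \<in> V i j" and ne: "M$i$j \<noteq> (\<lambda>_. 0)" for i j using assms by (simp_all add: degenerate_def V_star_iff)
  have z: "wedge (M$1) (M$2) (x$k) = 0" for k using assms x_nz by (simp add: degenerate_def det_wedge)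
  have nz: "\<exists>i j. (M$i$j) (x$k) \<noteq> 0" for k
    using common_zero_degenerate(2)[OF V V z, of k] ne by blast
  obtain X Y where k: "kernel_data M X Y" by (rule exists_kernel_data[OF V z nz])
  have r: "represents (rho_map x M) X Y" by (rule rho_map_kernel_data[OF k nz])
  have "nonfixed X Y"
    by (rule nonfixed_of_entries[of X Y 1 "M$1"]) (use k ne in \<open>simp_all add: kernel_data_def\<close>)
  with k r show ?thesis by (rule that)
qed

definition soldet :: "4 \<Rightarrow> 4 \<Rightarrow> complex^4 \<Rightarrow> complex^4 \<Rightarrow> complex" where
  "soldet k l X Y = wedge (solrow 1 k X Y) (solrow 2 l X Y) x0"

text \<open>The matrix with given kernel coordinates by explicit formulas. No choice of the indices \<open>k\<close>, \<open>l\<close> in \<open>{3, 4}\<close> works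
  everywhere, so the four matrices are used on the four open sets \<open>soldet k l \<noteq> 0\<close>.\<close>

definition solmat :: "4 \<Rightarrow> 4 \<Rightarrow> complex^4 \<Rightarrow> complex^4 \<Rightarrow> fn_matrix" where
  "solmat k l X Y = (\<chi> i. solrow i (if i = 1 then k else l) X Y)"

lemma solmat_nth: "solmat k l X Y $ 1 = solrow 1 k X Y" "solmat k l X Y $ 2 = solrow 2 l X Y"
  by (simp_all add: solmat_def)

lemma solmat_V: "solmat k l X Y $ i $ j \<in> V i j"
  by (simp add: solmat_def solrow_def row_V)

text \<open>The explicit formula inverts the kernel coordinates where its determinant at \<open>x0\<close> is not 0.\<close>

lemma solmat_in_F:
  assumes r: "represents r X Y" and P: "Phi_i 1 X Y = 0" and kl: "k \<in> {3, 4}" "l \<in> {3, 4}" and D: "soldet k l X Y \<noteq> 0"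
  shows "solmat k l X Y \<in> F_set q \<rho> \<sigma> x" "rho_map x (solmat k l X Y) = r" "kernel_data (solmat k l X Y) X Y"
proof -
  note v = represents_valid[OF r]
  have P2: "Phi_i 2 X Y = 0" by (rule Phi_transfer[OF v _ P]) simp
  have s: "sol 1 X Y (solrow 1 k X Y)" "sol 2 X Y (solrow 2 l X Y)" by (rule solrow_sol[OF P kl(1)], rule solrow_sol[OF P2 kl(2)])
  then show kd: "kernel_data (solmat k l X Y) X Y" using v by (simp add: kernel_data_def solmat_nth)
  have "wedge (solrow 1 k X Y) (solrow 2 l X Y) (x$m) = 0" for m
    by (rule wedge_sol_at[OF v, of 1 m _ 2]) (use s in \<open>simp_all add: sol_def\<close>)
  then show F: "solmat k l X Y \<in> F_set q \<rho> \<sigma> x"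
    using D solmat_V by (simp add: F_set_iff solmat_nth soldet_def)
  have "represents (rho_map x (solmat k l X Y)) X Y" by (rule rho_map_kernel_data[OF kd F_nonvanishing[OF F]])
  then show "rho_map x (solmat k l X Y) = r" using r by (simp add: represents_def vec_eq_iff)
qed

lemma F_has_soldet:
  assumes kd: "kernel_data M X Y" and nf: "nonfixed X Y" and M: "M \<in> F_set q \<rho> \<sigma> x"
  shows "Phi_i 1 X Y = 0" "\<exists>k\<in>{3, 4}. \<exists>l\<in>{3, 4}. soldet k l X Y \<noteq> 0"
proof -
  have v: "valid X Y" and s: "sol 1 X Y (M$1)" "sol 2 X Y (M$2)" using kd by (simp_all add: kernel_data_def)
  have "M$i$1 \<noteq> (\<lambda>z. 0)" for i using F_subset_V_star[OF M] by (simp add: V_star_iff)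
  then have ne: "M$i \<noteq> (\<chi> j. (\<lambda>z. 0))" for i by (auto simp: vec_eq_iff)
  show P: "Phi_i 1 X Y = 0" using exists_sol_iff[OF v, of 1] s(1) ne[of 1] by blast
  have P2: "Phi_i 2 X Y = 0" by (rule Phi_transfer[OF v _ P]) simp
  obtain k where k: "k \<in> {3, 4}" "solrow 1 k X Y \<noteq> (\<chi> j. (\<lambda>z. 0))" by (rule solrow_nonzero[OF v nf])
  obtain l where l: "l \<in> {3, 4}" "solrow 2 l X Y \<noteq> (\<chi> j. (\<lambda>z. 0))" by (rule solrow_nonzero[OF v nf])
  obtain a where a: "M$1 = (\<chi> j. (\<lambda>z. a * (solrow 1 k X Y $ j) z))" by (rule sol_unique[OF v nf solrow_sol[OF P k(1)] k(2) s(1)])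
  obtain b where b: "M$2 = (\<chi> j. (\<lambda>z. b * (solrow 2 l X Y $ j) z))" by (rule sol_unique[OF v nf solrow_sol[OF P2 l(1)] l(2) s(2)])
  have "wedge (M$1) (M$2) x0 = a * b * soldet k l X Y" unfolding a b soldet_def by (simp add: wedge_def algebra_simps)
  then have "soldet k l X Y \<noteq> 0" using M unfolding F_set_iff by auto
  then show "\<exists>k\<in>{3, 4}. \<exists>l\<in>{3, 4}. soldet k l X Y \<noteq> 0" using k(1) l(1) by blast
qed

text \<open>By uniqueness of solutions the rows of \<open>solmat k l X Y\<close> are multiples of the rows of \<open>M\<close>.\<close>

lemma degenerate_soldet_zero:
  assumes kd: "kernel_data M X Y" and nf: "nonfixed X Y" and M: "M \<in> degenerate" and kl: "k \<in> {3, 4}" "l \<in> {3, 4}"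
  shows "soldet k l X Y = 0"
proof -
  have v: "valid X Y" and s: "sol 1 X Y (M$1)" "sol 2 X Y (M$2)" using kd by (simp_all add: kernel_data_def)
  have "M$i$1 \<noteq> (\<lambda>z. 0)" for i using M by (simp add: degenerate_def V_star_iff)
  then have ne: "M$i \<noteq> (\<chi> j. (\<lambda>z. 0))" for i by (auto simp: vec_eq_iff)
  have P: "Phi_i 1 X Y = 0" using exists_sol_iff[OF v, of 1] s(1) ne[of 1] by blast
  have P2: "Phi_i 2 X Y = 0" by (rule Phi_transfer[OF v _ P]) simp
  obtain a where a: "solrow 1 k X Y = (\<chi> j. (\<lambda>z. a * (M$1 $ j) z))" by (rule sol_unique[OF v nf s(1) ne solrow_sol[OF P kl(1)]])
  obtain b where b: "solrow 2 l X Y = (\<chi> j. (\<lambda>z. b * (M$2 $ j) z))" by (rule sol_unique[OF v nf s(2) ne solrow_sol[OF P2 kl(2)]])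
  have "soldet k l X Y = a * b * wedge (M$1) (M$2) x0" unfolding a b soldet_def by (simp add: wedge_def algebra_simps)
  also have "wedge (M$1) (M$2) x0 = 0" using M x0(1) by (simp add: degenerate_def det_wedge)
  finally show ?thesis by simp
qed

end

context connection_setting
begin

subsection \<open>Polynomial dependence on chart coordinates\<close>

definition Xe :: "4 set \<Rightarrow> (nat \<Rightarrow> complex) \<Rightarrow> complex^4" where
  "Xe e z = (\<chi> l. if l \<in> e then 1 else z (idx l))"

definition Ye :: "4 set \<Rightarrow> (nat \<Rightarrow> complex) \<Rightarrow> complex^4" where
  "Ye e z = (\<chi> l. if l \<in> e then z (idx l) else 1)"

lemma represents_chart_pt: "represents (chart_pt e z) (Xe e z) (Ye e z)"
  by (auto simp: represents_def valid_def chart_pt_def Xe_def Ye_def ratio_def)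

lemma Xe_poly: "(\<lambda>z. Xe e z $ l) \<in> polynomial_functions 4"
  by (cases "l \<in> e") (simp_all add: Xe_def polynomial_const polynomial_coord)

lemma Ye_poly: "(\<lambda>z. Ye e z $ l) \<in> polynomial_functions 4"
  by (cases "l \<in> e") (simp_all add: Ye_def polynomial_const polynomial_coord)

lemma lamform_poly: "(\<lambda>z. lamform i k (Xe e z) (Ye e z)) \<in> polynomial_functions 4"
  unfolding lamform_def by (intro polynomial_diff polynomial_mult Xe_poly Ye_poly polynomial_const)

lemma muform_poly: "(\<lambda>z. muform i k (Xe e z) (Ye e z)) \<in> polynomial_functions 4"
  unfolding muform_def by (intro polynomial_diff polynomial_mult Xe_poly Ye_poly polynomial_const)

lemma Phi_poly: "(\<lambda>z. Phi_i i (Xe e z) (Ye e z)) \<in> polynomial_functions 4"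
  unfolding Phi_i_def by (intro polynomial_diff polynomial_mult lamform_poly muform_poly)

definition coef1 :: "2 \<Rightarrow> 4 \<Rightarrow> 2 \<Rightarrow> complex^4 \<Rightarrow> complex^4 \<Rightarrow> complex" where
  "coef1 i k j X Y = muform i k X Y * (if j = 1 then Y$1 else X$1)"

definition coef2 :: "2 \<Rightarrow> 4 \<Rightarrow> 2 \<Rightarrow> complex^4 \<Rightarrow> complex^4 \<Rightarrow> complex" where
  "coef2 i k j X Y = - lamform i k X Y * (if j = 1 then Y$2 else X$2)"

lemma coef_poly:
  "(\<lambda>z. coef1 i k j (Xe e z) (Ye e z)) \<in> polynomial_functions 4"
  "(\<lambda>z. coef2 i k j (Xe e z) (Ye e z)) \<in> polynomial_functions 4"
proof -
  have "(\<lambda>z. (- 1) * lamform i k (Xe e z) (Ye e z)) \<in> polynomial_functions 4"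
    by (intro polynomial_mult polynomial_const lamform_poly)
  then have m: "(\<lambda>z. - lamform i k (Xe e z) (Ye e z)) \<in> polynomial_functions 4" by simp
  show "(\<lambda>z. coef1 i k j (Xe e z) (Ye e z)) \<in> polynomial_functions 4"
    unfolding coef1_def by (cases "j = 1") (simp_all add: polynomial_mult muform_poly Xe_poly Ye_poly)
  show "(\<lambda>z. coef2 i k j (Xe e z) (Ye e z)) \<in> polynomial_functions 4"
    unfolding coef2_def by (cases "j = 1"; simp only: if_True if_False refl; intro polynomial_mult m Xe_poly Ye_poly)
qed

lemma solrow_nth: "solrow i k X Y $ j = (\<lambda>y. coef1 i k j X Y * b1 i j y + coef2 i k j X Y * b2 i j y)"
  unfolding solrow_def row_nth coef1_def coef2_def by simp

lemma solrow_poly: "(\<lambda>z. (solrow i k (Xe e z) (Ye e z) $ j) y) \<in> polynomial_functions 4"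
  unfolding solrow_nth by (intro polynomial_add polynomial_mult coef_poly polynomial_const)

lemma soldet_poly: "(\<lambda>z. soldet k l (Xe e z) (Ye e z)) \<in> polynomial_functions 4"
  unfolding soldet_def wedge_def by (intro polynomial_diff polynomial_mult solrow_poly)

lemma continuous_polynomial:
  assumes "h \<in> polynomial_functions n" "\<And>i. i < n \<Longrightarrow> isCont (\<lambda>s. w s i) s0"
  shows "isCont (\<lambda>s. h (w s)) s0"
  using assms(1) by (induction rule: polynomial_induct) (auto intro!: continuous_intros assms(2))

subsection \<open>The family avoids the exceptional locus\<close>

text \<open>In contrast to \<open>chart_coord\<close>, coordinates of the point itself and not of its orbit.\<close>

definition box_coord :: "4 set \<Rightarrow> proj1^4 \<Rightarrow> nat \<Rightarrow> complex" where
  "box_coord e r = (\<lambda>i. if i < 4 then (if xdi i \<in> e then inval (r$xdi i) else val (r$xdi i)) else 0)"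

lemma chart_pt_box_coord:
  assumes "r \<in> chart_box k e"
  shows "chart_pt e (box_coord e r) = r"
proof -
  have "chart_pt e (box_coord e r) $ l = r $ l" for l
  proof (cases "r$l")
    case (Fin u)
    then have "l \<in> e \<Longrightarrow> u \<noteq> 0" using chart_boxD(3)[OF assms] by metis
    then show ?thesis using Fin by (auto simp: chart_pt_def box_coord_def ratio_def)
  next
    case Infty
    then have "l \<in> e" using chart_boxD(4)[OF assms] by metis
    then show ?thesis using Infty by (simp add: chart_pt_def box_coord_def ratio_def)
  qed
  then show ?thesis by (simp add: vec_eq_iff)
qed

lemma open_soldet_nonzero:
  "openin (zariski P1_4) {r \<in> chart_box k e. soldet m n (Xe e (box_coord e r)) (Ye e (box_coord e r)) \<noteq> 0}"
proof -
  interpret P: ringed_space P1_4 by (rule ringed_P1_4)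
  have "regular P1_4 (chart_box k e) (\<lambda>r. soldet m n (Xe e (box_coord e r)) (Ye e (box_coord e r)))"
  proof (rule polynomial_pullback[OF ringed_P1_4 soldet_poly openin_chart_box])
    fix i :: nat assume i: "i < 4"
    show "regular P1_4 (chart_box k e) (\<lambda>r. box_coord e r i)"
    proof (cases "xdi i \<in> e")
      case True
      have "regular P1_4 (chart_box k e) (\<lambda>r. inval (r$xdi i))"
        by (rule P.restrict[OF regular_P1_4_inval openin_chart_box]) (use True chart_boxD(3) in blast)
      then show ?thesis using i True by (simp add: box_coord_def)
    next
      case False
      have "regular P1_4 (chart_box k e) (\<lambda>r. val (r$xdi i))"
        by (rule P.restrict[OF regular_P1_4_val openin_chart_box]) (use False chart_boxD(4) in blast)
      then show ?thesis using i False by (simp add: box_coord_def)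
    qed
  qed
  then show ?thesis by (rule P.nonzero_open)
qed

lemma X_closure_eq: "X_closure q \<rho> \<sigma> x = zariski P1_4 closure_of (rho_map x ` degenerate)"
  by (simp add: X_closure_def degenerate_def)

text \<open>One of the determinants \<open>soldet\<close> is nonzero at the point and hence on a neighbourhood, while all of them vanish on the
  kernel coordinates of degenerate matrices.\<close>

lemma F_not_in_closure:
  assumes M: "M \<in> F_set q \<rho> \<sigma> x"
  shows "rho_map x M \<notin> X_closure q \<rho> \<sigma> x"
proof
  let ?r = "rho_map x M"
  assume cl: "?r \<in> X_closure q \<rho> \<sigma> x"
  obtain X Y where k: "kernel_data M X Y" "represents ?r X Y" "nonfixed X Y" by (rule F_kernel_data[OF M])
  have "?r \<notin> Theta4" using represents_nonfixed[OF k(2)] k(3) by simp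
  from chart_box_cover[OF this] obtain k0 e where box: "?r \<in> chart_box k0 e" .
  let ?X = "\<lambda>r. Xe e (box_coord e r)" and ?Y = "\<lambda>r. Ye e (box_coord e r)"
  have rep: "represents r (?X r) (?Y r)" if "r \<in> chart_box k0 e" for r
    using represents_chart_pt[of e "box_coord e r"] unfolding chart_pt_box_coord[OF that] .
  have nf: "nonfixed (?X r) (?Y r)" if "r \<in> chart_box k0 e" for r
    using represents_nonfixed[OF rep[OF that]] chart_box_not_Theta4[OF that] by simp
  have transfer: "kernel_data N (?X r) (?Y r)" if "kernel_data N X' Y'" "represents r X' Y'" "r \<in> chart_box k0 e" for N r X' Y'
    using that(1) sol_represents[OF that(2) rep[OF that(3)]] represents_valid[OF rep[OF that(3)]]
    unfolding kernel_data_def by blast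
  obtain a b where ab: "a \<in> {3, 4}" "b \<in> {3, 4}" "soldet a b (?X ?r) (?Y ?r) \<noteq> 0"
    using F_has_soldet(2)[OF transfer[OF k(1,2) box] nf[OF box] M] by blast
  let ?O = "{r \<in> chart_box k0 e. soldet a b (?X r) (?Y r) \<noteq> 0}"
  have "?r \<in> ?O" using box ab by simp
  with cl obtain r where r: "r \<in> rho_map x ` degenerate" "r \<in> ?O"
    unfolding X_closure_eq in_closure_of using open_soldet_nonzero[of k0 e a b] by meson
  then obtain N where N: "N \<in> degenerate" "r = rho_map x N" by blast
  have rb: "r \<in> chart_box k0 e" using r(2) by simp
  obtain X' Y' where k': "kernel_data N X' Y'" "represents (rho_map x N) X' Y'" by (rule degenerate_kernel_data[OF N(1)])
  have k'': "kernel_data N (?X r) (?Y r)" by (rule transfer[OF k'(1) _ rb]) (simp add: N(2) k'(2))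
  have "soldet a b (?X r) (?Y r) = 0" by (rule degenerate_soldet_zero[OF k'' nf[OF rb] N(1) ab(1,2)])
  then show False using r(2) by simp
qed

subsection \<open>The degenerate matrices and their limits\<close>

definition psi :: "2 \<Rightarrow> complex \<Rightarrow> complex \<Rightarrow> complex" where
  "psi j s z = th (z / (s / \<sigma>$j))"

lemma psi_zero:
  assumes "s \<noteq> 0" "z \<noteq> 0"
  shows "psi j s z = 0 \<longleftrightarrow> qtriv (z * \<sigma>$j / s)"
  using th_ratio_zero[of z "s / \<sigma>$j"] assms sigma_nz[of j] by (simp add: psi_def)

lemma psi_not_both:
  assumes "s \<noteq> 0" "z \<noteq> 0" "j \<noteq> j'" "psi j s z = 0"
  shows "psi j' s z \<noteq> 0"
proof
  assume "psi j' s z = 0"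
  then have "qtriv (z * \<sigma>$j' / s)" "qtriv (z * \<sigma>$j / s)" using assms psi_zero[OF assms(1,2)] by blast+
  then have "qtriv ((z * \<sigma>$j / s) / (z * \<sigma>$j' / s))" by (metis qtriv_quotient)
  moreover have "(z * \<sigma>$j / s) / (z * \<sigma>$j' / s) = \<sigma>$j / \<sigma>$j'" using assms sigma_nz[of j'] by (simp add: field_simps)
  ultimately show False using sigma_inequiv[OF assms(3)] by simp
qed

text \<open>Degenerate matrices of rank one: the entry is the product of a factor depending on \<open>i\<close> and one depending on \<open>j\<close>.\<close>

definition family :: "complex \<Rightarrow> complex \<Rightarrow> fn_matrix" where
  "family s t = (\<chi> i j. (\<lambda>z. if z = 0 then 0 else (if j = 2 then t else 1) * (th (z / (\<rho>$i / s)) * psi j s z)))"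

lemma family_degenerate:
  assumes s: "s \<noteq> 0" and t: "t \<noteq> 0"
  shows "family s t \<in> degenerate"
    and "represents (rho_map x (family s t)) (\<chi> k. t * psi 2 s (x$k)) (\<chi> k. psi 1 s (x$k))"
proof -
  let ?M = "family s t"
  have nth: "?M$i$j = (\<lambda>z. if z = 0 then 0 else (if j = 2 then t else 1) * (th (z / (\<rho>$i / s)) * psi j s z))" for i j
    by (simp add: family_def)
  have val: "(?M$i$j) z = (if j = 2 then t else 1) * (th (z / (\<rho>$i / s)) * psi j s z)" if "z \<noteq> 0" for i j z
    using that by (simp add: nth)
  have V: "?M$i$j \<in> V i j" for i j
  proof -
    have n: "\<rho>$i / s \<noteq> 0" "s / \<sigma>$j \<noteq> 0" using s rho_nz[of i] sigma_nz[of j] by simp_all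
    have e: "- (\<rho>$i / s) * - (s / \<sigma>$j) = c i j" using s by simp
    have "quasi (c i j) (- 1 + - 1) (\<lambda>z. th (z / (\<rho>$i / s)) * psi j s z)"
      using quasi_mult[OF quasi_th[OF n(1)] quasi_th[OF n(2)]] unfolding e psi_def .
    then have 1: "quasi (c i j) (- 2) (\<lambda>z. th (z / (\<rho>$i / s)) * psi j s z)" by simp
    let ?a = "if j = 2 then t else 1"
    have "quasi (c i j) (- 2) (\<lambda>z. ?a * (th (z / (\<rho>$i / s)) * psi j s z) + 0 * (th (z / (\<rho>$i / s)) * psi j s z))"
      by (rule quasi_combination[OF 1 1])
    then have h: "(\<lambda>z. ?a * (th (z / (\<rho>$i / s)) * psi j s z)) holomorphic_on UNIV - {0}"
      "\<And>z. z \<noteq> 0 \<Longrightarrow> ?a * (th (q * z / (\<rho>$i / s)) * psi j s (q * z)) = c i j * z powi (- 2) * (?a * (th (z / (\<rho>$i / s)) * psi j s z))"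
      unfolding quasi_def by simp_all
    have "?M$i$j holomorphic_on UNIV - {0}"
      unfolding nth by (rule holomorphic_transform[OF h(1)]) simp
    moreover have "(?M$i$j) (q * z) = c i j * z powi (- 2) * (?M$i$j) z" if "z \<noteq> 0" for z
      using h(2)[OF that] val[OF that, of i j] val[of "q * z" i j] that q0 by simp
    ultimately have "quasi (c i j) (- 2) (?M$i$j)" unfolding quasi_def by blast
    then show ?thesis unfolding V_iff by (simp add: nth)
  qed
  have ne: "?M$i$j \<noteq> (\<lambda>_. 0)" for i j
  proof -
    obtain y where y: "y \<noteq> 0" "\<And>u. u \<in> {\<rho>$i / s, s / \<sigma>$j} \<Longrightarrow> \<not> qtriv (y / u)"
      by (rule exists_inequivalent[of "{\<rho>$i / s, s / \<sigma>$j}"]) simp_all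
    have "th (y / u) \<noteq> 0" if "u \<in> {\<rho>$i / s, s / \<sigma>$j}" for u
    proof -
      have "u \<noteq> 0" using that s rho_nz[of i] sigma_nz[of j] by auto
      then show ?thesis using th_ratio_zero[OF y(1)] y(2)[OF that] by simp
    qed
    then have "th (y / (\<rho>$i / s)) \<noteq> 0" "psi j s y \<noteq> 0" unfolding psi_def by blast+
    then have "(?M$i$j) y \<noteq> 0" using val[OF y(1), of i j] t by simp
    then show ?thesis by auto
  qed
  have w: "wedge (?M$1) (?M$2) z = 0" for z by (simp add: wedge_def nth)
  show deg: "?M \<in> degenerate"
    unfolding degenerate_def det_wedge using V ne w V_star_iff by simp
  have v: "valid (\<chi> k. t * psi 2 s (x$k)) (\<chi> k. psi 1 s (x$k))"
    unfolding valid_def using psi_not_both[OF s x_nz, of 1 2] t by auto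
  have kd: "kernel_data ?M (\<chi> k. t * psi 2 s (x$k)) (\<chi> k. psi 1 s (x$k))"
    unfolding kernel_data_def sol_def sol_at_def using v V val[OF x_nz] by simp
  have nz: "\<exists>i j. (?M$i$j) (x$k) \<noteq> 0" for k
    using common_zero_degenerate(2)[of "?M$1" "?M$2" k, OF V V w] ne by blast
  show "represents (rho_map x ?M) (\<chi> k. t * psi 2 s (x$k)) (\<chi> k. psi 1 s (x$k))"
    by (rule rho_map_kernel_data[OF kd nz])
qed

text \<open>As \<open>s\<close> tends to \<open>s0 = x\<^sub>l \<sigma>\<^sub>j\<close>, the \<open>l\<close>-th quotient tends to infinity and the others stay bounded. If \<open>\<mu>\<close> is chosen so
  that the \<open>l\<close>-th coordinate tends to \<open>t\<close>, the other coordinates tend to 0. A polynomial that does not vanish at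
  the limit does not vanish for \<open>s\<close> close to \<open>s0\<close> either.\<close>

lemma degenerate_limit:
  assumes j: "j \<noteq> j'" and t: "t \<noteq> 0" and h: "h \<in> polynomial_functions 4"
    and hv: "h (\<lambda>i. if i = idx l then t else 0) \<noteq> 0"
  obtains s \<mu> where "s \<noteq> 0" "\<mu> \<noteq> 0" "\<And>k. psi j s (x$k) \<noteq> 0"
    "h (\<lambda>i. if i < 4 then \<mu> * psi j' s (x$xdi i) / psi j s (x$xdi i) else 0) \<noteq> 0"
proof -
  \<comment> \<open>at \<open>s0\<close> the \<open>l\<close>-th denominator vanishes, and no other one\<close>
  define s0 where "s0 = x$l * \<sigma>$j"
  have s0: "s0 \<noteq> 0" using x_nz sigma_nz by (simp add: s0_def)
  have "psi j s0 (x$l) = 0"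
    using psi_zero[OF s0 x_nz] s0 unfolding s0_def qtriv_def by (metis divide_self power_int_0_right)
  then have pl: "psi j' s0 (x$l) \<noteq> 0" by (rule psi_not_both[OF s0 x_nz j])
  have pk: "psi j s0 (x$k) \<noteq> 0" if "k \<noteq> l" for k
  proof -
    have "x$k * \<sigma>$j / s0 = x$k / x$l" using sigma_nz[of j] by (simp add: s0_def)
    then show ?thesis using psi_zero[OF s0 x_nz] NR_x[OF that] by simp
  qed
  have cont: "isCont (\<lambda>s. psi m s (x$k)) s0" for m k
  proof -
    have "(\<lambda>s. psi m s (x$k)) holomorphic_on UNIV - {0}"
      unfolding psi_def
      by (rule th_holomorphic) (use x_nz[of k] sigma_nz[of m] in \<open>auto intro!: holomorphic_intros\<close>)
    then have "continuous_on (UNIV - {0}) (\<lambda>s. psi m s (x$k))" by (rule holomorphic_on_imp_continuous_on)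
    moreover have "open (UNIV - {0 :: complex})" by (simp add: open_delete)
    ultimately show ?thesis using s0 continuous_on_eq_continuous_at by blast
  qed
  define \<kappa> where "\<kappa> = t / psi j' s0 (x$l)"
  have \<kappa>: "\<kappa> \<noteq> 0" using t pl by (simp add: \<kappa>_def)
  \<comment> \<open>the rescaled coordinates, with the factor \<open>psi j s (x$l)\<close> cancelled in the \<open>l\<close>-th one, so that \<open>w\<close> is continuous at \<open>s0\<close>\<close>
  define w where "w = (\<lambda>s i. if i < 4 then if xdi i = l then \<kappa> * psi j' s (x$l)
    else \<kappa> * psi j s (x$l) * psi j' s (x$xdi i) / psi j s (x$xdi i) else 0)"
  have "isCont (\<lambda>s. w s i) s0" for i
  proof -
    consider "\<not> i < 4" | "i < 4" "xdi i = l" | "i < 4" "xdi i \<noteq> l" by blast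
    then show ?thesis
    proof cases
      case 3
      then show ?thesis unfolding w_def using cont pk[of "xdi i"]
        by (simp only: if_True if_False) (intro continuous_intros, simp_all)
    qed (simp_all add: w_def continuous_intros cont)
  qed
  then have hc: "isCont (\<lambda>s. h (w s)) s0" by (intro continuous_polynomial[OF h])
  have "w s0 = (\<lambda>i. if i = idx l then t else 0)"
  proof
    fix i
    have "\<kappa> * psi j' s0 (x$l) = t" using pl by (simp add: \<kappa>_def)
    then show "w s0 i = (if i = idx l then t else 0)"
      using \<open>psi j s0 (x$l) = 0\<close> idx_xdi[of i] by (auto simp: w_def)
  qed
  then have hw: "h (w s0) \<noteq> 0" using hv by simp
  have ev: "eventually (\<lambda>s. f s \<noteq> 0) (nhds s0)" if "isCont f s0" "f s0 \<noteq> 0" for f :: "complex \<Rightarrow> complex"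
  proof -
    have "eventually (\<lambda>s. f s \<noteq> 0) (at s0)"
      using tendsto_imp_eventually_ne[of f "f s0" "at s0" 0] that by (simp add: isCont_def)
    then show ?thesis using that(2) by (simp add: eventually_nhds_conv_at)
  qed
  have "eventually (\<lambda>s. \<forall>k\<in>UNIV - {l}. psi j s (x$k) \<noteq> 0) (nhds s0)"
    by (rule eventually_ball_finite) (use ev[OF cont] pk in auto)
  moreover have "eventually (\<lambda>s. s \<noteq> 0) (nhds s0)" by (rule ev) (use s0 in auto)
  moreover have "eventually (\<lambda>s. h (w s) \<noteq> 0) (nhds s0)" by (rule ev[OF hc hw])
  ultimately have "eventually (\<lambda>s. (\<forall>k\<in>UNIV - {l}. psi j s (x$k) \<noteq> 0) \<and> s \<noteq> 0 \<and> h (w s) \<noteq> 0) (nhds s0)"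
    by eventually_elim blast
  then obtain \<delta> where \<delta>: "\<delta> > 0" "\<And>s. dist s s0 < \<delta> \<Longrightarrow> (\<forall>k\<in>UNIV - {l}. psi j s (x$k) \<noteq> 0) \<and> s \<noteq> 0 \<and> h (w s) \<noteq> 0"
    unfolding eventually_nhds_metric by blast
  have "\<not> ball s0 \<delta> \<subseteq> {s. \<exists>m::int. s = s0 * q powi m}"
    using uncountable_ball[OF \<delta>(1)] countable_qtriv_multiples countable_subset by blast
  then obtain s where s: "s \<in> ball s0 \<delta>" "\<not> (\<exists>m::int. s = s0 * q powi m)" by blast
  have s': "\<forall>k\<in>UNIV - {l}. psi j s (x$k) \<noteq> 0" "s \<noteq> 0" "h (w s) \<noteq> 0" using \<delta>(2)[of s] s(1) by (simp_all add: dist_commute)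
  have "\<not> qtriv (s / s0)"
  proof
    assume "qtriv (s / s0)"
    then obtain m :: int where "s / s0 = q powi m" unfolding qtriv_def by blast
    then have "s = s0 * q powi m" using s0 by (simp add: field_simps)
    then show False using s(2) by blast
  qed
  then have psl: "psi j s (x$l) \<noteq> 0"
    using psi_zero[OF s'(2) x_nz, of j l] qtriv_divide_commute[of s s0] by (simp add: s0_def)
  show ?thesis
  proof (rule that[of s "\<kappa> * psi j s (x$l)"])
    show "psi j s (x$k) \<noteq> 0" for k using s'(1) psl by (cases "k = l") auto
    have "w s = (\<lambda>i. if i < 4 then \<kappa> * psi j s (x$l) * psi j' s (x$xdi i) / psi j s (x$xdi i) else 0)"
      using psl by (auto simp: w_def fun_eq_iff)
    then show "h (\<lambda>i. if i < 4 then \<kappa> * psi j s (x$l) * psi j' s (x$xdi i) / psi j s (x$xdi i) else 0) \<noteq> 0"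
      using s'(3) by simp
  qed (use s' psl \<kappa> in simp_all)
qed

text \<open>The Zariski topology of affine space has the principal open sets as a basis, so membership in a closure can be tested
  with one polynomial at a time.\<close>

lemma chart_pt_closure:
  assumes v: "\<And>i. i \<ge> 4 \<Longrightarrow> v i = 0"
    and approx: "\<And>h. h \<in> polynomial_functions 4 \<Longrightarrow> h v \<noteq> 0 \<Longrightarrow>
      \<exists>u. (\<forall>i\<ge>4. u i = 0) \<and> h u \<noteq> 0 \<and> chart_pt e u \<in> S"
  shows "chart_pt e v \<in> zariski P1_4 closure_of S"
  unfolding in_closure_of
proof (intro conjI allI impI)
  show "chart_pt e v \<in> topspace (zariski P1_4)" by (simp add: points_P1_4)
  fix T assume T: "chart_pt e v \<in> T \<and> openin (zariski P1_4) T"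
  let ?U = "{z \<in> points (affine_space 4). chart_pt e z \<in> T}"
  have "openin (zariski (affine_space 4)) ?U" using fn_space_morphism_open[OF chart_pt_morphism] T by blast
  moreover have "v \<in> ?U" using v T by (simp add: points_affine_space)
  ultimately obtain h where h: "h \<in> polynomial_functions 4" "h v \<noteq> 0"
    "\<forall>y\<in>{z. \<forall>i\<ge>4. z i = 0}. h y \<noteq> 0 \<longrightarrow> y \<in> ?U"
    unfolding affine_space_def polynomial_functions_def openin_algebra_space by blast
  from approx[OF h(1,2)] obtain u where u: "\<forall>i\<ge>4. u i = 0" "h u \<noteq> 0" "chart_pt e u \<in> S" by blast
  then have "u \<in> ?U" using h(3) by blast
  then show "\<exists>y. y \<in> S \<and> y \<in> T" using u(3) by blast
qed

text \<open>The kernel coordinates of \<open>family s \<mu>\<close> are \<open>\<mu> psi 2 s (x\<^sub>k) / psi 1 s (x\<^sub>k)\<close>. The points with all other coordinates 0 are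
  limits at a zero of \<open>psi 1\<close>; for those with all other coordinates infinite the columns exchange their roles.\<close>

lemma pattern_in_closure:
  assumes l: "r$l \<noteq> Fin 0" "r$l \<noteq> Infty" and p: "p \<in> {Fin 0, Infty}" and k: "\<And>k. k \<noteq> l \<Longrightarrow> r$k = p"
  shows "r \<in> X_closure q \<rho> \<sigma> x"
proof -
  obtain t where t: "r$l = Fin t" "t \<noteq> 0" using l by (cases "r$l") auto
  have img: "\<And>s \<mu>. s \<noteq> 0 \<Longrightarrow> \<mu> \<noteq> 0 \<Longrightarrow> (\<chi> k. ratio (\<mu> * psi 2 s (x$k)) (psi 1 s (x$k))) \<in> rho_map x ` degenerate"
  proof -
    fix s \<mu> :: complex assume "s \<noteq> 0" "\<mu> \<noteq> 0"
    note f = family_degenerate[OF this]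
    have "(\<chi> k. ratio (\<mu> * psi 2 s (x$k)) (psi 1 s (x$k))) = rho_map x (family s \<mu>)"
      using f(2) by (simp add: represents_def vec_eq_iff)
    then show "(\<chi> k. ratio (\<mu> * psi 2 s (x$k)) (psi 1 s (x$k))) \<in> rho_map x ` degenerate" using f(1) by blast
  qed
  show ?thesis
  proof (cases "p = Fin 0")
    case True
    let ?v = "\<lambda>i. if i = idx l then t else 0"
    have "r = chart_pt {} ?v"
      using t k True by (auto simp: chart_pt_def vec_eq_iff)
    moreover have "chart_pt {} ?v \<in> zariski P1_4 closure_of (rho_map x ` degenerate)"
    proof (rule chart_pt_closure)
      fix h assume h: "h \<in> polynomial_functions 4" "h ?v \<noteq> 0"
      obtain s \<mu> where s: "s \<noteq> 0" "\<mu> \<noteq> 0" "\<And>k. psi 1 s (x$k) \<noteq> 0"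
        "h (\<lambda>i. if i < 4 then \<mu> * psi 2 s (x$xdi i) / psi 1 s (x$xdi i) else 0) \<noteq> 0"
        by (rule degenerate_limit[OF _ t(2) h, of 1 2]) (simp, blast)
      let ?u = "\<lambda>i. if i < 4 then \<mu> * psi 2 s (x$xdi i) / psi 1 s (x$xdi i) else 0"
      have "chart_pt {} ?u = (\<chi> k. ratio (\<mu> * psi 2 s (x$k)) (psi 1 s (x$k)))"
        using s(3) by (simp add: chart_pt_def vec_eq_iff ratio_def)
      then have "chart_pt {} ?u \<in> rho_map x ` degenerate" using img[OF s(1,2)] by simp
      then show "\<exists>u. (\<forall>i\<ge>4. u i = 0) \<and> h u \<noteq> 0 \<and> chart_pt {} u \<in> rho_map x ` degenerate"
        using s(4) by (intro exI[of _ ?u] conjI) simp_all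
    next
      fix i :: nat assume "i \<ge> 4"
      then show "?v i = 0" using idx_less[of l] leD by fastforce
    qed
    ultimately show ?thesis unfolding X_closure_eq by simp
  next
    case False
    then have p: "p = Infty" using p by blast
    let ?v = "\<lambda>i. if i = idx l then 1 / t else 0"
    have "r = chart_pt UNIV ?v"
      using t k p by (auto simp: chart_pt_def vec_eq_iff ratio_def)
    moreover have "chart_pt UNIV ?v \<in> zariski P1_4 closure_of (rho_map x ` degenerate)"
    proof (rule chart_pt_closure)
      fix h assume h: "h \<in> polynomial_functions 4" "h ?v \<noteq> 0"
      have t': "1 / t \<noteq> 0" using t by simp
      obtain s \<mu> where s: "s \<noteq> 0" "\<mu> \<noteq> 0" "\<And>k. psi 2 s (x$k) \<noteq> 0"
        "h (\<lambda>i. if i < 4 then \<mu> * psi 1 s (x$xdi i) / psi 2 s (x$xdi i) else 0) \<noteq> 0"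
        by (rule degenerate_limit[OF _ t' h, of 2 1]) (simp, blast)
      let ?u = "\<lambda>i. if i < 4 then \<mu> * psi 1 s (x$xdi i) / psi 2 s (x$xdi i) else 0"
      have "ratio 1 (\<mu> * psi 1 s (x$k) / psi 2 s (x$k)) = ratio (1 / \<mu> * psi 2 s (x$k)) (psi 1 s (x$k))" for k
        using s(2) s(3)[of k] by (simp add: ratio_def)
      then have "chart_pt UNIV ?u = (\<chi> k. ratio (1 / \<mu> * psi 2 s (x$k)) (psi 1 s (x$k)))"
        by (simp add: chart_pt_def vec_eq_iff)
      then have "chart_pt UNIV ?u \<in> rho_map x ` degenerate" using img[OF s(1), of "1 / \<mu>"] s(2) by simp
      then show "\<exists>u. (\<forall>i\<ge>4. u i = 0) \<and> h u \<noteq> 0 \<and> chart_pt UNIV u \<in> rho_map x ` degenerate"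
        using s(4) by (intro exI[of _ ?u] conjI) simp_all
    next
      fix i :: nat assume "i \<ge> 4"
      then show "?v i = 0" using idx_less[of l] leD by fastforce
    qed
    ultimately show ?thesis unfolding X_closure_eq by simp
  qed
qed

text \<open>If one entry of the row is zero, the other one vanishes at every \<open>x\<^sub>k\<close> whose coordinate is not infinity (not 0,
  respectively), so there is just one such \<open>k\<close>.\<close>

lemma zero_entry_pattern:
  assumes r: "represents r X Y" and nf: "nonfixed X Y" and f: "sol i X Y f" "f \<noteq> (\<chi> j. (\<lambda>z. 0))" and j: "f$j = (\<lambda>_. 0)"
  shows "r \<in> X_closure q \<rho> \<sigma> x"
proof -
  have fV: "f$j \<in> V i j" for j using f by (simp add: sol_def)
  have e: "X$k * (f$1) (x$k) = Y$k * (f$2) (x$k)" for k using f(1) unfolding sol_def sol_at_def by blast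
  have rk: "r$k = ratio (X$k) (Y$k)" "(X$k, Y$k) \<noteq> (0, 0)" for k using r by (simp_all add: represents_def valid_def)
  have ne: "f$1 \<noteq> (\<lambda>_. 0) \<or> f$2 \<noteq> (\<lambda>_. 0)" using f(2) by (auto simp: vec_eq_iff forall_2)
  obtain l where l: "X$l \<noteq> 0" "Y$l \<noteq> 0" using nf unfolding nonfixed_def by blast
  have rl: "r$l \<noteq> Fin 0" "r$l \<noteq> Infty" using l rk(1)[of l] by (simp_all add: ratio_def)
  show ?thesis
  proof (cases "j = 1")
    case True
    then have f1: "f$1 = (\<lambda>_. 0)" using j by simp
    then have f2: "f$2 \<noteq> (\<lambda>_. 0)" using ne by blast
    have z: "Y$k * (f$2) (x$k) = 0" for k using e[of k] f1 by simp
    then have "(f$2) (x$l) = 0" using l by (metis mult_eq_0_iff)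
    then have "Y$k = 0" if "k \<noteq> l" for k using z[of k] V_zero_unique[OF fV f2] that by (metis mult_eq_0_iff)
    then have "r$k = Infty" if "k \<noteq> l" for k using rk(1)[of k] that by (simp add: ratio_def)
    then show ?thesis by (intro pattern_in_closure[OF rl, of Infty]) simp_all
  next
    case False
    then have f2: "f$2 = (\<lambda>_. 0)" using j exhaust_2[of j] by simp
    then have f1: "f$1 \<noteq> (\<lambda>_. 0)" using ne by blast
    have z: "X$k * (f$1) (x$k) = 0" for k using e[of k] f2 by simp
    then have "(f$1) (x$l) = 0" using l by (metis mult_eq_0_iff)
    then have X0: "X$k = 0" if "k \<noteq> l" for k using z[of k] V_zero_unique[OF fV f1] that by (metis mult_eq_0_iff)
    then have "r$k = Fin 0" if "k \<noteq> l" for k using rk[of k] X0[OF that] by (simp add: ratio_def)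
    then show ?thesis by (intro pattern_in_closure[OF rl, of "Fin 0"]) simp_all
  qed
qed

text \<open>Over a point of the hypersurface there is, up to scaling of rows, one matrix. If its determinant vanishes, the point
  lies in the closure: either the matrix is degenerate itself, or one of its entries is zero and the point has one
  of the special shapes that are limits of degenerate ones.\<close>

lemma in_closure_of_soldet_zero:
  assumes r: "represents r X Y" and nf: "nonfixed X Y" and P: "Phi_i 1 X Y = 0"
    and D: "\<And>k l. k \<in> {3, 4} \<Longrightarrow> l \<in> {3, 4} \<Longrightarrow> soldet k l X Y = 0"
  shows "r \<in> X_closure q \<rho> \<sigma> x"
proof -
  have v: "valid X Y" by (rule represents_valid[OF r])
  have P2: "Phi_i 2 X Y = 0" by (rule Phi_transfer[OF v _ P]) simp
  obtain k where k: "k \<in> {3, 4}" "solrow 1 k X Y \<noteq> (\<chi> j. (\<lambda>z. 0))" by (rule solrow_nonzero[OF v nf])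
  obtain l where l: "l \<in> {3, 4}" "solrow 2 l X Y \<noteq> (\<chi> j. (\<lambda>z. 0))" by (rule solrow_nonzero[OF v nf])
  let ?f = "solrow 1 k X Y" and ?g = "solrow 2 l X Y"
  have s: "sol 1 X Y ?f" "sol 2 X Y ?g" by (rule solrow_sol[OF P k(1)], rule solrow_sol[OF P2 l(1)])
  have fV: "?f$j \<in> V 1 j" and gV: "?g$j \<in> V 2 j" for j using s by (simp_all add: sol_def)
  show ?thesis
  proof (cases "\<exists>j. ?f$j = (\<lambda>_. 0) \<or> ?g$j = (\<lambda>_. 0)")
    case True
    then show ?thesis using zero_entry_pattern[OF r nf s(1) k(2)] zero_entry_pattern[OF r nf s(2) l(2)] by blast
  next
    case False
    let ?M = "solmat k l X Y"
    have ne: "?M$i$j \<noteq> (\<lambda>_. 0)" for i j using False solmat_nth exhaust_2[of i] by metis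
    have z: "wedge ?f ?g (x$m) = 0" for m
      by (rule wedge_sol_at[OF v, of 1 m _ 2]) (use s in \<open>simp_all add: sol_def\<close>)
    have w: "wedge ?f ?g y = 0" for y
      by (rule wedge_total[OF fV gV z]) (use D[OF k(1) l(1)] in \<open>simp add: soldet_def\<close>)
    have nz: "\<exists>i j. (?M$i$j) (x$m) \<noteq> 0" for m
      using common_zero_degenerate(2)[of ?f ?g m, OF fV gV z] False solmat_nth by metis
    have M: "?M \<in> degenerate" unfolding degenerate_def det_wedge V_star_iff using solmat_V ne w by (simp add: solmat_nth)
    have kd: "kernel_data ?M X Y" using s v by (simp add: kernel_data_def solmat_nth)
    have "represents (rho_map x ?M) X Y" by (rule rho_map_kernel_data[OF kd nz])
    then have "rho_map x ?M = r" using r by (simp add: represents_def vec_eq_iff)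
    then have "r \<in> rho_map x ` degenerate" using M by blast
    moreover have "rho_map x ` degenerate \<subseteq> X_closure q \<rho> \<sigma> x"
      unfolding X_closure_eq by (rule closure_of_subset) (simp add: points_P1_4)
    ultimately show ?thesis by blast
  qed
qed

text \<open>The complement of the exceptional locus in the hypersurface is described twice: as the image of the family, and
  by polynomial conditions on homogeneous coordinates.\<close>

lemma S_minus_X_iff:
  assumes r: "represents r X Y" and nf: "nonfixed X Y"
  shows "r \<in> S_hypersurface (A_coeffs q \<rho> \<sigma> x) \<and> r \<notin> X_closure q \<rho> \<sigma> x \<longleftrightarrow> (\<exists>M\<in>F_set q \<rho> \<sigma> x. rho_map x M = r)"
    and "(\<exists>M\<in>F_set q \<rho> \<sigma> x. rho_map x M = r) \<longleftrightarrow> Phi_i 1 X Y = 0 \<and> (\<exists>k\<in>{3, 4}. \<exists>l\<in>{3, 4}. soldet k l X Y \<noteq> 0)"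
proof -
  have 1: "Phi_i 1 X Y = 0 \<and> (\<exists>k\<in>{3, 4}. \<exists>l\<in>{3, 4}. soldet k l X Y \<noteq> 0)" if "M \<in> F_set q \<rho> \<sigma> x" "rho_map x M = r" for M
  proof -
    from that(1) obtain X' Y' where k: "kernel_data M X' Y'" "represents (rho_map x M) X' Y'" by (rule F_kernel_data)
    have "kernel_data M X Y"
      using k sol_represents[of r X' Y' X Y] r that(2) represents_valid[OF r] unfolding kernel_data_def by blast
    from F_has_soldet[OF this nf that(1)] show ?thesis by blast
  qed
  have 2: "\<exists>M\<in>F_set q \<rho> \<sigma> x. rho_map x M = r" if P: "Phi_i 1 X Y = 0" and D: "\<exists>k\<in>{3, 4}. \<exists>l\<in>{3, 4}. soldet k l X Y \<noteq> 0"
  proof -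
    from D obtain k l where "k \<in> {3, 4}" "l \<in> {3, 4}" "soldet k l X Y \<noteq> 0" by blast
    from solmat_in_F[OF r P this] show ?thesis by blast
  qed
  show "(\<exists>M\<in>F_set q \<rho> \<sigma> x. rho_map x M = r) \<longleftrightarrow> Phi_i 1 X Y = 0 \<and> (\<exists>k\<in>{3, 4}. \<exists>l\<in>{3, 4}. soldet k l X Y \<noteq> 0)"
    using 1 2 by blast
  show "r \<in> S_hypersurface (A_coeffs q \<rho> \<sigma> x) \<and> r \<notin> X_closure q \<rho> \<sigma> x \<longleftrightarrow> (\<exists>M\<in>F_set q \<rho> \<sigma> x. rho_map x M = r)"
  proof
    assume a: "r \<in> S_hypersurface (A_coeffs q \<rho> \<sigma> x) \<and> r \<notin> X_closure q \<rho> \<sigma> x"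
    then have P: "Phi_i 1 X Y = 0" using S_hypersurface_iff[OF r] by blast
    then show "\<exists>M\<in>F_set q \<rho> \<sigma> x. rho_map x M = r" using 2 in_closure_of_soldet_zero[OF r nf P] a by blast
  next
    assume "\<exists>M\<in>F_set q \<rho> \<sigma> x. rho_map x M = r"
    then obtain M where M: "M \<in> F_set q \<rho> \<sigma> x" "rho_map x M = r" by blast
    then show "r \<in> S_hypersurface (A_coeffs q \<rho> \<sigma> x) \<and> r \<notin> X_closure q \<rho> \<sigma> x"
      using 1[OF M] S_hypersurface_iff[OF r] F_not_in_closure[OF M(1)] by blast
  qed
qed

end

section \<open>The torus action on matrices\<close>

definition rescale :: "complex^2 \<Rightarrow> complex^2 \<Rightarrow> fn_matrix \<Rightarrow> fn_matrix" where
  "rescale \<gamma> \<delta> M = (\<chi> i j. (\<lambda>z. \<gamma>$i / \<delta>$j * (M$i$j) z))"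

lemma rescale_nth: "rescale \<gamma> \<delta> M $ i $ j = (\<lambda>z. \<gamma>$i / \<delta>$j * (M$i$j) z)"
  by (simp add: rescale_def)

definition units2 :: "(complex^2) set" where "units2 = {\<gamma>. \<forall>i. \<gamma>$i \<noteq> 0}"

lemma D2_iff: "\<Gamma> \<in> D2 \<longleftrightarrow> (\<forall>i j. i \<noteq> j \<longrightarrow> \<Gamma>$i$j = 0) \<and> (\<forall>i. \<Gamma>$i$i \<noteq> 0)"
  unfolding D2_def by (auto simp: invertible_det_nz det_2 forall_2)

lemma matrix_inv_D2:
  assumes "\<Delta> \<in> D2"
  shows "matrix_inv \<Delta> = (\<chi> i j. if i = j then 1 / \<Delta>$i$i else 0)"
proof -
  let ?B = "(\<chi> i j. if i = j then 1 / \<Delta>$i$i else 0) :: complex^2^2"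
  have d: "\<Delta>$1$2 = 0" "\<Delta>$2$1 = 0" "\<Delta>$1$1 \<noteq> 0" "\<Delta>$2$2 \<noteq> 0" using assms by (simp_all add: D2_iff)
  have 1: "\<Delta> ** ?B = mat 1" and 2: "?B ** \<Delta> = mat 1"
    using d by (simp_all add: vec_eq_iff forall_2 matrix_matrix_mult_def sum_2 mat_def)
  have "invertible \<Delta>" using assms by (simp add: D2_def)
  then have "matrix_inv \<Delta> ** \<Delta> = mat 1" unfolding invertible_def matrix_inv_def by (metis (mono_tags, lifting) someI_ex)
  then have "matrix_inv \<Delta> = matrix_inv \<Delta> ** (\<Delta> ** ?B)" using 1 by simp
  also have "\<dots> = ?B" using \<open>matrix_inv \<Delta> ** \<Delta> = mat 1\<close> by (simp add: matrix_mul_assoc)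
  finally show ?thesis .
qed

lemma H_action_eq:
  assumes "\<Gamma> \<in> D2" "\<Delta> \<in> D2"
  shows "H_action \<Gamma> \<Delta> M = rescale (\<chi> i. \<Gamma>$i$i) (\<chi> j. \<Delta>$j$j) M"
proof -
  have d: "\<Gamma>$1$2 = 0" "\<Gamma>$2$1 = 0" using assms by (simp_all add: D2_iff)
  show ?thesis unfolding H_action_def matrix_inv_D2[OF assms(2)] rescale_def
    using d by (simp add: vec_eq_iff forall_2 matrix_matrix_mult_def sum_2 at_point_def)
qed

lemma H_orbit_eq: "H_orbit M = {rescale \<gamma> \<delta> M | \<gamma> \<delta>. \<gamma> \<in> units2 \<and> \<delta> \<in> units2}"
proof (intro equalityI subsetI)
  fix N assume "N \<in> H_orbit M"
  then obtain \<Gamma> \<Delta> where "\<Gamma> \<in> D2" "\<Delta> \<in> D2" "N = H_action \<Gamma> \<Delta> M" unfolding H_orbit_def by blast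
  then have "N = rescale (\<chi> i. \<Gamma>$i$i) (\<chi> j. \<Delta>$j$j) M" "(\<chi> i. \<Gamma>$i$i) \<in> units2" "(\<chi> j. \<Delta>$j$j) \<in> units2"
    by (simp_all add: H_action_eq units2_def D2_iff)
  then show "N \<in> {rescale \<gamma> \<delta> M | \<gamma> \<delta>. \<gamma> \<in> units2 \<and> \<delta> \<in> units2}" by blast
next
  fix N assume "N \<in> {rescale \<gamma> \<delta> M | \<gamma> \<delta>. \<gamma> \<in> units2 \<and> \<delta> \<in> units2}"
  then obtain \<gamma> \<delta> where g: "\<gamma> \<in> units2" "\<delta> \<in> units2" "N = rescale \<gamma> \<delta> M" by blast
  let ?d = "\<lambda>\<gamma>. (\<chi> i j. if i = j then \<gamma>$i else 0) :: complex^2^2"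
  have d: "?d \<gamma> \<in> D2" "?d \<delta> \<in> D2" using g by (simp_all add: D2_iff units2_def)
  have "H_action (?d \<gamma>) (?d \<delta>) M = N" unfolding H_action_eq[OF d] g(3) by (simp add: rescale_def)
  then show "N \<in> H_orbit M" unfolding H_orbit_def using d by blast
qed

lemma rescale_rescale: "rescale \<gamma> \<delta> (rescale \<gamma>' \<delta>' M) = rescale (\<chi> i. \<gamma>$i * \<gamma>'$i) (\<chi> j. \<delta>$j * \<delta>'$j) M"
  by (simp add: rescale_def mult_ac)

lemma rescale_one: "rescale 1 1 M = M"
  by (simp add: rescale_def vec_eq_iff)

lemma units2_mult: "\<gamma> \<in> units2 \<Longrightarrow> \<gamma>' \<in> units2 \<Longrightarrow> (\<chi> i. \<gamma>$i * \<gamma>'$i) \<in> units2"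
  by (simp add: units2_def)

lemma H_orbit_self: "M \<in> H_orbit M"
proof -
  have "M = rescale 1 1 M" "1 \<in> units2" by (simp_all add: rescale_one units2_def)
  then show ?thesis unfolding H_orbit_eq by blast
qed

lemma H_orbit_rescale:
  assumes "\<gamma> \<in> units2" "\<delta> \<in> units2"
  shows "H_orbit (rescale \<gamma> \<delta> M) = H_orbit M"
proof (intro equalityI subsetI)
  fix N assume "N \<in> H_orbit (rescale \<gamma> \<delta> M)"
  then obtain \<gamma>' \<delta>' where "\<gamma>' \<in> units2" "\<delta>' \<in> units2" "N = rescale \<gamma>' \<delta>' (rescale \<gamma> \<delta> M)" unfolding H_orbit_eq by blast
  then show "N \<in> H_orbit M" unfolding H_orbit_eq rescale_rescale using units2_mult assms by blast
next
  fix N assume "N \<in> H_orbit M"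
  then obtain \<gamma>' \<delta>' where g: "\<gamma>' \<in> units2" "\<delta>' \<in> units2" "N = rescale \<gamma>' \<delta>' M" unfolding H_orbit_eq by blast
  let ?g = "\<chi> i. \<gamma>'$i / \<gamma>$i" and ?d = "\<chi> j. \<delta>'$j / \<delta>$j"
  have "N = rescale ?g ?d (rescale \<gamma> \<delta> M)" unfolding g(3) rescale_rescale using assms by (simp add: units2_def)
  moreover have "?g \<in> units2" "?d \<in> units2" using g assms by (simp_all add: units2_def)
  ultimately show "N \<in> H_orbit (rescale \<gamma> \<delta> M)" unfolding H_orbit_eq by blast
qed

lemma H_orbit_eqD:
  assumes "H_orbit M = H_orbit N"
  obtains \<gamma> \<delta> where "\<gamma> \<in> units2" "\<delta> \<in> units2" "N = rescale \<gamma> \<delta> M"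
proof -
  have "N \<in> H_orbit M" using H_orbit_self[of N] assms by simp
  then obtain \<gamma> \<delta> where "N = rescale \<gamma> \<delta> M" "\<gamma> \<in> units2" "\<delta> \<in> units2" unfolding H_orbit_eq by (elim CollectE exE conjE)
  then show thesis using that by simp
qed

lemma ratio_scale: "t \<noteq> 0 \<Longrightarrow> u \<noteq> 0 \<Longrightarrow> ratio (t * X) (u * Y) = scale (t / u) (ratio X Y)"
  by (simp add: ratio_def)

context connection_setting
begin

abbreviation F :: "fn_matrix set" where "F \<equiv> F_set q \<rho> \<sigma> x"

lemma rescale_V:
  assumes "M$i$j \<in> V i j"
  shows "rescale \<gamma> \<delta> M $ i $ j \<in> V i j"
  using V_combination[OF assms V_zero, of "\<gamma>$i / \<delta>$j" 0] by (simp add: rescale_nth)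

lemma rescale_V_star:
  assumes "M \<in> V_star q \<rho> \<sigma>" "\<gamma> \<in> units2" "\<delta> \<in> units2"
  shows "rescale \<gamma> \<delta> M \<in> V_star q \<rho> \<sigma>"
proof -
  have "rescale \<gamma> \<delta> M $ i $ j \<noteq> (\<lambda>_. 0)" for i j
  proof -
    have "M$i$j \<noteq> (\<lambda>_. 0)" using assms(1) by (simp add: V_star_iff)
    then obtain z where "(M$i$j) z \<noteq> 0" by blast
    then have "(rescale \<gamma> \<delta> M $ i $ j) z \<noteq> 0" using assms by (simp add: rescale_nth units2_def)
    then show ?thesis by auto
  qed
  then show ?thesis using assms(1) rescale_V unfolding V_star_iff by blast
qed

lemma wedge_rescale: "wedge (rescale \<gamma> \<delta> M $ 1) (rescale \<gamma> \<delta> M $ 2) z = \<gamma>$1 * \<gamma>$2 / (\<delta>$1 * \<delta>$2) * wedge (M$1) (M$2) z"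
  by (simp add: wedge_def rescale_nth algebra_simps)

lemma rescale_F:
  assumes "M \<in> F" "\<gamma> \<in> units2" "\<delta> \<in> units2"
  shows "rescale \<gamma> \<delta> M \<in> F"
  using assms rescale_V unfolding F_set_iff wedge_rescale by (simp add: units2_def)

lemma rho_map_rescale:
  assumes M: "M \<in> F" and g: "\<gamma> \<in> units2" "\<delta> \<in> units2"
  shows "rho_map x (rescale \<gamma> \<delta> M) = tscale (\<delta>$1 / \<delta>$2) (rho_map x M)"
proof -
  obtain X Y where k: "kernel_data M X Y" "represents (rho_map x M) X Y" by (rule F_kernel_data[OF M])
  let ?X = "\<chi> k. \<delta>$1 * X$k" and ?Y = "\<chi> k. \<delta>$2 * Y$k"
  have d: "\<delta>$1 \<noteq> 0" "\<delta>$2 \<noteq> 0" using g by (simp_all add: units2_def)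
  have "sol i ?X ?Y (rescale \<gamma> \<delta> M $ i)" if "sol i X Y (M$i)" for i
    using that d rescale_V unfolding sol_def sol_at_def rescale_nth by (simp add: mult_ac)
  moreover have "valid ?X ?Y" using k(1) d unfolding kernel_data_def valid_def by simp
  ultimately have "kernel_data (rescale \<gamma> \<delta> M) ?X ?Y" using k(1) unfolding kernel_data_def by blast
  then have "represents (rho_map x (rescale \<gamma> \<delta> M)) ?X ?Y"
    by (rule rho_map_kernel_data[OF _ F_nonvanishing[OF rescale_F[OF assms]]])
  then have "rho_map x (rescale \<gamma> \<delta> M) $ k = ratio (\<delta>$1 * X$k) (\<delta>$2 * Y$k)" for k by (simp add: represents_def)
  moreover have "rho_map x M $ k = ratio (X$k) (Y$k)" for k using k(2) by (simp add: represents_def)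
  ultimately show ?thesis using ratio_scale[OF d] by (simp add: vec_eq_iff)
qed

text \<open>Rescaling the columns moves the kernel coordinates along their orbit, so they may be assumed to be equal. Then the rows
  of both matrices solve the same linear systems, whose solution spaces are lines.\<close>

lemma rho_map_injective:
  assumes M: "M \<in> F" and N: "N \<in> F" and eq: "torus_orbit (rho_map x M) = torus_orbit (rho_map x N)"
  shows "H_orbit M = H_orbit N"
proof -
  obtain t where t: "t \<noteq> 0" "rho_map x N = tscale t (rho_map x M)" using torus_orbit_eqD[OF eq] by blast
  \<comment> \<open>scaling the first column by \<open>1 / t\<close> multiplies the kernel coordinates by \<open>t\<close>\<close>
  let ?d = "\<chi> j. if j = 1 then t else 1 :: complex^2"
  have u: "1 \<in> units2" "?d \<in> units2" using t by (simp_all add: units2_def)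
  let ?M = "rescale 1 ?d M"
  have M': "?M \<in> F" by (rule rescale_F[OF M u])
  have r: "rho_map x ?M = rho_map x N" using rho_map_rescale[OF M u] t(2) by simp
  obtain X Y where k: "kernel_data ?M X Y" "represents (rho_map x ?M) X Y" "nonfixed X Y" by (rule F_kernel_data[OF M'])
  obtain X' Y' where k': "kernel_data N X' Y'" "represents (rho_map x N) X' Y'" by (rule F_kernel_data[OF N])
  have v: "valid X Y" and s: "sol i X Y (?M$i)" for i using k(1) exhaust_2[of i] unfolding kernel_data_def by auto
  have s': "sol i X Y (N$i)" for i
  proof -
    have "sol i X' Y' (N$i)" using k'(1) exhaust_2[of i] unfolding kernel_data_def by auto
    then show ?thesis using sol_represents[OF k'(2)] k(2) r by metis
  qed
  have ne: "K$i \<noteq> (\<chi> j. (\<lambda>z. 0))" if "K \<in> F" for K i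
  proof -
    have "K$i$1 \<noteq> (\<lambda>z. 0)" using F_subset_V_star[OF that] by (simp add: V_star_iff)
    then show ?thesis by (auto simp: vec_eq_iff)
  qed
  have "\<exists>\<alpha>. \<alpha> \<noteq> 0 \<and> N$i = (\<chi> j. (\<lambda>z. \<alpha> * (?M$i$j) z))" for i
  proof -
    obtain \<alpha> where \<alpha>: "N$i = (\<chi> j. (\<lambda>z. \<alpha> * (?M$i$j) z))" by (rule sol_unique[OF v k(3) s[of i] ne[OF M'] s'[of i]])
    moreover have "\<alpha> \<noteq> 0" using ne[OF N, of i] \<alpha> by auto
    ultimately show ?thesis by blast
  qed
  then obtain \<alpha> where \<alpha>: "\<And>i. \<alpha> i \<noteq> 0" "\<And>i. N$i = (\<chi> j. (\<lambda>z. \<alpha> i * (?M$i$j) z))" by metis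
  have "N = rescale (\<chi> i. \<alpha> i) 1 ?M" using \<alpha>(2) by (simp add: vec_eq_iff rescale_def)
  moreover have "(\<chi> i. \<alpha> i) \<in> units2" using \<alpha>(1) by (simp add: units2_def)
  ultimately have "H_orbit N = H_orbit ?M" using H_orbit_rescale u(1) by metis
  also have "\<dots> = H_orbit M" by (rule H_orbit_rescale[OF u])
  finally show ?thesis ..
qed

lemma rho_map_well_defined:
  assumes "M \<in> F" "H_orbit M = H_orbit N"
  shows "torus_orbit (rho_map x N) = torus_orbit (rho_map x M)"
proof -
  obtain \<gamma> \<delta> where g: "\<gamma> \<in> units2" "\<delta> \<in> units2" "N = rescale \<gamma> \<delta> M" using H_orbit_eqD[OF assms(2)] by blast
  have "\<delta>$1 / \<delta>$2 \<noteq> 0" using g(2) by (simp add: units2_def)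
  then show ?thesis unfolding g(3) rho_map_rescale[OF assms(1) g(1,2)] by (rule torus_orbit_tscale)
qed

definition phi :: "fn_matrix set \<Rightarrow> (proj1^4) set" where
  "phi cl = torus_orbit (rho_map x (SOME M. M \<in> F \<and> H_orbit M = cl))"

lemma phi_eq:
  assumes "M \<in> F"
  shows "phi (H_orbit M) = torus_orbit (rho_map x M)"
proof -
  let ?N = "SOME N. N \<in> F \<and> H_orbit N = H_orbit M"
  have "?N \<in> F \<and> H_orbit ?N = H_orbit M" by (rule someI[of _ M]) (simp add: assms)
  then show ?thesis unfolding phi_def using rho_map_well_defined[OF assms, of ?N] by simp
qed

lemma F_not_Theta4: "M \<in> F \<Longrightarrow> rho_map x M \<notin> Theta4"
  by (metis F_kernel_data represents_nonfixed)

subsection \<open>The image of the kernel coordinates\<close>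

text \<open>The image of the family. It is shown to be the complement of the exceptional locus, which gives both surjectivity and a
  manageable description of the target.\<close>

definition Sstar :: "(proj1^4) set set" where
  "Sstar = (\<lambda>M. torus_orbit (rho_map x M)) ` F"

lemma Phi_i_scale: "Phi_i i (\<chi> k. t * X$k) Y = t^2 * Phi_i i X Y"
  by (simp add: Phi_i_def lamform_def muform_def algebra_simps power2_eq_square)

lemma S_hypersurface_tscale:
  assumes "t \<noteq> 0" "r \<in> S_hypersurface (A_coeffs q \<rho> \<sigma> x)"
  shows "tscale t r \<in> S_hypersurface (A_coeffs q \<rho> \<sigma> x)"
proof -
  obtain X Y where r: "represents r X Y" using exists_represents by blast
  have "scale t (ratio (X$k) (Y$k)) = ratio (t * X$k) (Y$k)" for k by (simp add: ratio_def)
  then have "represents (tscale t r) (\<chi> k. t * X$k) Y" using r assms(1) by (simp add: represents_def valid_def)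
  then show ?thesis using S_hypersurface_iff[OF r] S_hypersurface_iff assms(2) Phi_i_scale by simp
qed

lemma Sstar_orbit_iff:
  assumes "r \<notin> Theta4"
  shows "torus_orbit r \<in> Sstar \<longleftrightarrow> (\<exists>M\<in>F. rho_map x M = r)"
proof
  assume "torus_orbit r \<in> Sstar"
  then obtain M where M: "M \<in> F" "torus_orbit (rho_map x M) = torus_orbit r" unfolding Sstar_def by auto
  obtain t where t: "t \<noteq> 0" "r = tscale t (rho_map x M)" using torus_orbit_eqD[OF M(2)] by blast
  let ?d = "\<chi> j. if j = 1 then t else 1 :: complex^2"
  have u: "1 \<in> units2" "?d \<in> units2" using t by (simp_all add: units2_def)
  have "rescale 1 ?d M \<in> F" "rho_map x (rescale 1 ?d M) = r" using rescale_F[OF M(1) u] rho_map_rescale[OF M(1) u] t(2) by simp_all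
  then show "\<exists>M\<in>F. rho_map x M = r" by blast
qed (auto simp: Sstar_def)

lemma S_quotient_orbit_iff:
  assumes "r \<notin> Theta4"
  shows "torus_orbit r \<in> S_quotient q \<rho> \<sigma> x \<longleftrightarrow> r \<in> S_hypersurface (A_coeffs q \<rho> \<sigma> x)"
proof
  assume "torus_orbit r \<in> S_quotient q \<rho> \<sigma> x"
  then obtain s where s: "s \<in> S_hypersurface (A_coeffs q \<rho> \<sigma> x)" "torus_orbit s = torus_orbit r"
    unfolding S_quotient_def by auto
  obtain t where "t \<noteq> 0" "r = tscale t s" using torus_orbit_eqD[OF s(2)] by blast
  then show "r \<in> S_hypersurface (A_coeffs q \<rho> \<sigma> x)" using S_hypersurface_tscale s(1) by simp
qed (use assms in \<open>auto simp: S_quotient_def\<close>)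

lemma Sstar_eq: "S_quotient q \<rho> \<sigma> x - X_quotient q \<rho> \<sigma> x = Sstar"
proof (intro equalityI subsetI)
  fix c assume c: "c \<in> S_quotient q \<rho> \<sigma> x - X_quotient q \<rho> \<sigma> x"
  then obtain r where r: "r \<in> S_hypersurface (A_coeffs q \<rho> \<sigma> x)" "r \<notin> Theta4" "c = torus_orbit r"
    unfolding S_quotient_def by auto
  have "r \<notin> X_closure q \<rho> \<sigma> x" using c r unfolding X_quotient_def by blast
  obtain X Y where XY: "represents r X Y" using exists_represents by blast
  have "nonfixed X Y" using represents_nonfixed[OF XY] r(2) by simp
  from S_minus_X_iff(1)[OF XY this] have "\<exists>M\<in>F. rho_map x M = r" using r(1) \<open>r \<notin> X_closure q \<rho> \<sigma> x\<close> by blast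
  then show "c \<in> Sstar" using Sstar_orbit_iff[OF r(2)] r(3) by simp
next
  fix c assume "c \<in> Sstar"
  then obtain M where M: "M \<in> F" "c = torus_orbit (rho_map x M)" unfolding Sstar_def by auto
  let ?r = "rho_map x M"
  obtain X Y where XY: "represents ?r X Y" "nonfixed X Y" by (rule F_kernel_data[OF M(1)])
  have "?r \<in> S_hypersurface (A_coeffs q \<rho> \<sigma> x)" using S_minus_X_iff(1)[OF XY] M(1) by blast
  then have 1: "c \<in> S_quotient q \<rho> \<sigma> x" using S_quotient_orbit_iff[OF F_not_Theta4[OF M(1)]] M(2) by simp
  moreover have "c \<notin> X_quotient q \<rho> \<sigma> x"
  proof
    assume "c \<in> X_quotient q \<rho> \<sigma> x"
    then obtain s where s: "s \<in> X_closure q \<rho> \<sigma> x" "s \<notin> Theta4" "c = torus_orbit s" unfolding X_quotient_def by auto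
    have "torus_orbit s \<in> Sstar" using s(3) \<open>c \<in> Sstar\<close> by simp
    then obtain N where "N \<in> F" "rho_map x N = s" using Sstar_orbit_iff[OF s(2)] by blast
    then show False using F_not_in_closure s(1) by blast
  qed
  ultimately show "c \<in> S_quotient q \<rho> \<sigma> x - X_quotient q \<rho> \<sigma> x" by blast
qed

lemma Sstar_subset: "Sstar \<subseteq> points K4"
  unfolding Sstar_def points_K4 using F_not_Theta4 by blast

lemma S_star_variety_eq: "S_star_variety q \<rho> \<sigma> x = subspace_of K4 Sstar"
  by (simp add: S_star_variety_def Sstar_eq)

lemma points_S_star: "points (S_star_variety q \<rho> \<sigma> x) = Sstar"
  unfolding S_star_variety_eq points_subspace_of using Sstar_subset by blast

lemma chart_dom_not_Theta4: "z \<in> chart_dom k \<Longrightarrow> chart_pt e z \<notin> Theta4"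
  using chart_pt_box chart_box_not_Theta4 by blast

lemma chart_nonfixed: "z \<in> chart_dom k \<Longrightarrow> nonfixed (Xe e z) (Ye e z)"
  using represents_nonfixed[OF represents_chart_pt] chart_dom_not_Theta4 by blast

lemma chart_in_Sstar_iff:
  assumes "z \<in> chart_dom k"
  shows "chart e z \<in> Sstar \<longleftrightarrow> Phi_i 1 (Xe e z) (Ye e z) = 0 \<and> (\<exists>m\<in>{3, 4}. \<exists>n\<in>{3, 4}. soldet m n (Xe e z) (Ye e z) \<noteq> 0)"
  unfolding chart_def Sstar_orbit_iff[OF chart_dom_not_Theta4[OF assms]]
  by (rule S_minus_X_iff(2)[OF represents_chart_pt chart_nonfixed[OF assms]])

lemma algebraic_S_star: "algebraic_variety (S_star_variety q \<rho> \<sigma> x)"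
  unfolding S_star_variety_eq
proof (rule K4_subspace_algebraic[OF Sstar_subset, of "\<lambda>e. {\<lambda>z. Phi_i 1 (Xe e z) (Ye e z)}"
      "\<lambda>e. (\<lambda>(m, n) z. soldet m n (Xe e z) (Ye e z)) ` ({3, 4} \<times> {3, 4})"])
  fix e :: "4 set"
  show "{\<lambda>z. Phi_i 1 (Xe e z) (Ye e z)} \<subseteq> polynomial_functions 4"
    by (rule subsetI, erule singletonE) (simp only: Phi_poly)
  show "(\<lambda>(m, n) z. soldet m n (Xe e z) (Ye e z)) ` ({3, 4} \<times> {3, 4}) \<subseteq> polynomial_functions 4"
    by (rule image_subsetI) (simp only: split_beta soldet_poly)
  show "finite ((\<lambda>(m, n) z. soldet m n (Xe e z) (Ye e z)) ` ({3, 4} \<times> {3, 4}))" by simp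
next
  fix k e h z assume z: "z \<in> chart_dom k" and h: "h \<in> (\<lambda>(m, n) z. soldet m n (Xe e z) (Ye e z)) ` ({3, 4} \<times> {3, 4})" "h z \<noteq> 0"
  show "chart e z \<in> Sstar \<longleftrightarrow> (\<forall>P\<in>{\<lambda>z. Phi_i 1 (Xe e z) (Ye e z)}. P z = 0)"
  proof -
    obtain m n where "h = (\<lambda>z. soldet m n (Xe e z) (Ye e z))" "m \<in> {3, 4}" "n \<in> {3, 4}" using h(1) by (elim imageE SigmaE2 SigmaE) simp
    then show ?thesis unfolding chart_in_Sstar_iff[OF z] ball_simps using h(2) by blast
  qed
next
  fix k e z assume z: "z \<in> chart_dom k" and s: "chart e z \<in> Sstar"
  then obtain m n where mn: "m \<in> {3, 4}" "n \<in> {3, 4}" "soldet m n (Xe e z) (Ye e z) \<noteq> 0"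
    unfolding chart_in_Sstar_iff[OF z] by blast
  then have "(m, n) \<in> {3, 4} \<times> {3, 4}" by (intro SigmaI)
  then have "(\<lambda>(m, n) z. soldet m n (Xe e z) (Ye e z)) (m, n) \<in> (\<lambda>(m, n) z. soldet m n (Xe e z) (Ye e z)) ` ({3, 4} \<times> {3, 4})"
    by (rule imageI)
  then show "\<exists>h\<in>(\<lambda>(m, n) z. soldet m n (Xe e z) (Ye e z)) ` ({3, 4} \<times> {3, 4}). h z \<noteq> 0"
    by (rule bexI[rotated]) (simp only: prod.case, rule mn(3))
qed

lemma chart_in_S_iff:
  assumes "z \<in> chart_dom k"
  shows "chart e z \<in> S_quotient q \<rho> \<sigma> x \<longleftrightarrow> Phi_i 1 (Xe e z) (Ye e z) = 0"
  unfolding chart_def S_quotient_orbit_iff[OF chart_dom_not_Theta4[OF assms]]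
  by (rule S_hypersurface_iff[OF represents_chart_pt])

lemma algebraic_S: "algebraic_variety (S_variety q \<rho> \<sigma> x)"
  unfolding S_variety_def
proof (rule K4_subspace_algebraic[where E = "\<lambda>e. {\<lambda>z. Phi_i 1 (Xe e z) (Ye e z)}" and H = "\<lambda>e. {\<lambda>_. 1}"])
  show "S_quotient q \<rho> \<sigma> x \<subseteq> points K4" unfolding S_quotient_def points_K4 by blast
  fix k and e :: "4 set" and z and h :: "(nat \<Rightarrow> complex) \<Rightarrow> complex"
  show "{\<lambda>z. Phi_i 1 (Xe e z) (Ye e z)} \<subseteq> polynomial_functions 4"
    by (rule subsetI, erule singletonE) (simp only: Phi_poly)
  show "{\<lambda>_. 1} \<subseteq> polynomial_functions 4" using polynomial_const[of 1 4] by (rule insert_subsetI) (rule empty_subsetI)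
  show "finite {\<lambda>_::nat \<Rightarrow> complex. 1::complex}" by (rule finite.intros)+
  show "chart e z \<in> S_quotient q \<rho> \<sigma> x \<longleftrightarrow> (\<forall>P\<in>{\<lambda>z. Phi_i 1 (Xe e z) (Ye e z)}. P z = 0)" if "z \<in> chart_dom k"
    unfolding chart_in_S_iff[OF that] by (simp only: ball_simps simp_thms)
  show "\<exists>h\<in>{\<lambda>_::nat \<Rightarrow> complex. 1::complex}. h z \<noteq> 0" by (rule bexI[OF _ singletonI]) (rule one_neq_zero)
qed

end

section \<open>The family is isomorphic to its image\<close>

context connection_setting
begin

abbreviation Vsp :: "fn_matrix fn_space" where "Vsp \<equiv> V_space q \<rho> \<sigma>"
abbreviation Vst :: "fn_matrix fn_space" where "Vst \<equiv> subspace_of Vsp (V_star q \<rho> \<sigma>)"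
abbreviation VmodH :: "fn_matrix set fn_space" where "VmodH \<equiv> V_star_mod_H q \<rho> \<sigma>"

lemma ringed_V: "ringed_space Vsp"
  unfolding V_space_def by (rule ringed_algebra_space)

lemma points_V: "points Vsp = V_set q \<rho> \<sigma>"
  unfolding V_space_def by (rule points_algebra_space)

lemma ringed_Vst: "ringed_space Vst"
  by (rule ringed_space.ringed_subspace[OF ringed_V])

lemma V_star_subset: "V_star q \<rho> \<sigma> \<subseteq> V_set q \<rho> \<sigma>"
  by (auto simp: V_star_def)

lemma points_Vst: "points Vst = V_star q \<rho> \<sigma>"
  using V_star_subset by (auto simp: points_subspace_of points_V)

lemma ringed_VmodH: "ringed_space VmodH"
  unfolding V_star_mod_H_def by (rule ringed_space.ringed_quotient[OF ringed_Vst])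

lemma points_VmodH: "points VmodH = H_orbit ` V_star q \<rho> \<sigma>"
  unfolding V_star_mod_H_def ringed_space.points_quotient_space[OF ringed_Vst] points_Vst ..

lemma ringed_F: "ringed_space (F_variety q \<rho> \<sigma> x)"
  unfolding F_variety_def by (rule ringed_space.ringed_subspace[OF ringed_VmodH])

lemma points_F: "points (F_variety q \<rho> \<sigma> x) = H_orbit ` F"
  using F_subset_V_star unfolding F_variety_def points_subspace_of points_VmodH by blast

lemma ringed_S_star: "ringed_space (S_star_variety q \<rho> \<sigma> x)"
  unfolding S_star_variety_def by (rule ringed_space.ringed_subspace[OF ringed_K4])

lemma regular_entry: "regular Vst (V_star q \<rho> \<sigma>) (\<lambda>M. (M$i$j) z)"
proof -
  have "(\<lambda>M. (M$i$j) z) \<in> linear_functionals (V_set q \<rho> \<sigma>)" by (simp add: linear_functionals_def)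
  then have "regular Vsp (V_set q \<rho> \<sigma>) (\<lambda>M. (M$i$j) z)"
    unfolding V_space_def by (intro regular_algebra_space generated_algebra.gen)
  from ringed_space.regular_restrict_subspace[OF ringed_V this, of "V_star q \<rho> \<sigma>"]
  show ?thesis using V_star_subset by (simp add: Int_absorb1)
qed

text \<open>On matrices whose row \<open>I k\<close> does not vanish at \<open>x\<^sub>k\<close> the kernel coordinates are quotients of two entries of that row.
  The sets belonging to the various \<open>I\<close> are open and stable under the torus, and they cover the family.\<close>

definition row_defined :: "(4 \<Rightarrow> 2) \<Rightarrow> fn_matrix set" where
  "row_defined I = {M \<in> V_star q \<rho> \<sigma>. \<forall>k. ((M$I k$2) (x$k), (M$I k$1) (x$k)) \<noteq> (0, 0)}"

definition row_ratio :: "(4 \<Rightarrow> 2) \<Rightarrow> fn_matrix \<Rightarrow> proj1^4" where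
  "row_ratio I M = (\<chi> k. ratio ((M$I k$2) (x$k)) ((M$I k$1) (x$k)))"

definition row_free :: "(4 \<Rightarrow> 2) \<Rightarrow> fn_matrix set" where
  "row_free I = {M \<in> row_defined I. row_ratio I M \<notin> Theta4}"

lemma openin_row_defined: "openin (zariski Vst) (row_defined I)"
proof -
  have "openin (zariski Vst) ({M \<in> V_star q \<rho> \<sigma>. (M$I k$2) (x$k) \<noteq> 0} \<union> {M \<in> V_star q \<rho> \<sigma>. (M$I k$1) (x$k) \<noteq> 0})" for k
    by (intro openin_Un ringed_space.nonzero_open[OF ringed_Vst regular_entry])
  then have "openin (zariski Vst) (\<Inter>k\<in>UNIV. {M \<in> V_star q \<rho> \<sigma>. (M$I k$2) (x$k) \<noteq> 0} \<union> {M \<in> V_star q \<rho> \<sigma>. (M$I k$1) (x$k) \<noteq> 0})"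
    by (intro openin_INT2) simp_all
  moreover have "row_defined I = (\<Inter>k\<in>UNIV. {M \<in> V_star q \<rho> \<sigma>. (M$I k$2) (x$k) \<noteq> 0} \<union> {M \<in> V_star q \<rho> \<sigma>. (M$I k$1) (x$k) \<noteq> 0})"
    by (auto simp: row_defined_def)
  ultimately show ?thesis by simp
qed

lemma row_ratio_morphism: "fn_space_morphism (subspace_of Vst (row_defined I)) P1_4 (row_ratio I)"
  unfolding P1_4_def
proof (rule morphism_into_power_space[OF ringed_space.ringed_subspace[OF ringed_Vst] ringed_P1])
  fix k
  have pts: "points (subspace_of Vst (row_defined I)) = V_star q \<rho> \<sigma> \<inter> row_defined I"
    by (simp add: points_subspace_of[of Vst] points_Vst)
  have "fn_space_morphism (subspace_of Vst (row_defined I)) P1 (\<lambda>M. ratio ((M$I k$2) (x$k)) ((M$I k$1) (x$k)))"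
    by (rule morphism_into_P1[OF ringed_space.ringed_subspace[OF ringed_Vst]], unfold pts,
        (rule ringed_space.regular_restrict_subspace[OF ringed_Vst regular_entry])+) (simp add: row_defined_def)
  then show "fn_space_morphism (subspace_of Vst (row_defined I)) P1 (\<lambda>M. row_ratio I M $ k)" by (simp add: row_ratio_def)
qed

lemma openin_free: "openin (zariski P1_4) (UNIV - Theta4)"
proof (subst openin_subopen, intro ballI)
  fix r :: "proj1^4" assume "r \<in> UNIV - Theta4"
  then obtain k e where "r \<in> chart_box k e" using chart_box_cover by blast
  then show "\<exists>T. openin (zariski P1_4) T \<and> r \<in> T \<and> T \<subseteq> UNIV - Theta4"
    using openin_chart_box chart_box_not_Theta4 by (intro exI[of _ "chart_box k e"]) blast
qed

lemma openin_row_free: "openin (zariski Vst) (row_free I)"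
proof -
  have "row_defined I \<subseteq> V_star q \<rho> \<sigma>" by (auto simp: row_defined_def)
  then have "row_free I = {M \<in> points (subspace_of Vst (row_defined I)). row_ratio I M \<in> UNIV - Theta4}"
    by (auto simp: row_free_def points_subspace_of[of Vst] points_Vst)
  then have "openin (zariski (subspace_of Vst (row_defined I))) (row_free I)"
    using fn_space_morphism_open[OF row_ratio_morphism openin_free] by simp
  then show ?thesis using ringed_space.openin_open_subspace[OF ringed_Vst openin_row_defined] by blast
qed

lemma row_orbit_morphism: "fn_space_morphism (subspace_of Vst (row_free I)) K4 (\<lambda>M. torus_orbit (row_ratio I M))"
proof -
  have sub: "row_free I \<subseteq> row_defined I" by (auto simp: row_free_def)
  have "fn_space_morphism (subspace_of Vst (row_free I)) P1_4 (row_ratio I)"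
    using morphism_restrict[OF ringed_space.ringed_subspace[OF ringed_Vst] row_ratio_morphism[of I], of "row_free I"]
    by (simp add: ringed_space.subspace_of_subspace[OF ringed_Vst sub])
  then have "fn_space_morphism (subspace_of Vst (row_free I)) P1_4_free (row_ratio I)"
    by (rule morphism_into_subspace[OF ringed_P1_4 ringed_space.ringed_subspace[OF ringed_Vst]])
       (simp add: points_subspace_of[of Vst] row_free_def)
  then show ?thesis unfolding K4_def
    by (rule fn_space_morphism_compose[OF _ ringed_space.quotient_projection[OF ringed_P1_4_free]])
qed

lemma row_ratio_rescale:
  assumes "\<gamma> \<in> units2" "\<delta> \<in> units2"
  shows "row_ratio I (rescale \<gamma> \<delta> M) = tscale (\<delta>$1 / \<delta>$2) (row_ratio I M)"
proof -
  have "ratio (\<gamma>$I k / \<delta>$2 * a) (\<gamma>$I k / \<delta>$1 * b') = scale (\<delta>$1 / \<delta>$2) (ratio a b')" for k a b'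
    using ratio_scale[of "\<gamma>$I k / \<delta>$2" "\<gamma>$I k / \<delta>$1" a b'] assms by (simp add: units2_def)
  then show ?thesis by (simp add: row_ratio_def vec_eq_iff rescale_nth)
qed

lemma row_free_rescale:
  assumes "M \<in> row_free I" "\<gamma> \<in> units2" "\<delta> \<in> units2"
  shows "rescale \<gamma> \<delta> M \<in> row_free I"
proof -
  have "\<delta>$1 / \<delta>$2 \<noteq> 0" using assms(3) by (simp add: units2_def)
  moreover have "rescale \<gamma> \<delta> M \<in> V_star q \<rho> \<sigma>" using assms by (intro rescale_V_star) (simp_all add: row_free_def row_defined_def)
  moreover have "((rescale \<gamma> \<delta> M$I k$2) (x$k), (rescale \<gamma> \<delta> M$I k$1) (x$k)) \<noteq> (0, 0)" for k
    using assms by (auto simp: row_free_def row_defined_def units2_def rescale_nth)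
  ultimately show ?thesis using assms(1) unfolding row_free_def row_defined_def
    by (simp add: row_ratio_rescale[OF assms(2,3)] tscale_Theta4)
qed

lemma row_free_orbit:
  assumes "M \<in> row_free I" "H_orbit M = H_orbit N"
  shows "N \<in> row_free I" "torus_orbit (row_ratio I N) = torus_orbit (row_ratio I M)"
proof -
  obtain \<gamma> \<delta> where g: "\<gamma> \<in> units2" "\<delta> \<in> units2" "N = rescale \<gamma> \<delta> M" by (rule H_orbit_eqD[OF assms(2)])
  then show "N \<in> row_free I" using row_free_rescale assms(1) by simp
  have "\<delta>$1 / \<delta>$2 \<noteq> 0" using g(2) by (simp add: units2_def)
  then show "torus_orbit (row_ratio I N) = torus_orbit (row_ratio I M)"
    unfolding g(3) row_ratio_rescale[OF g(1,2)] by (rule torus_orbit_tscale)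
qed

lemma row_ratio_eq_rho_map:
  assumes "M \<in> F" "M \<in> row_defined I"
  shows "row_ratio I M = rho_map x M"
proof -
  obtain X Y where k: "kernel_data M X Y" "represents (rho_map x M) X Y" by (rule F_kernel_data[OF assms(1)])
  have s: "sol i X Y (M$i)" for i using k(1) exhaust_2[of i] unfolding kernel_data_def by auto
  have "ratio ((M$I k$2) (x$k)) ((M$I k$1) (x$k)) = ratio (X$k) (Y$k)" for k
  proof -
    have 1: "X$k * (M$I k$1) (x$k) = Y$k * (M$I k$2) (x$k)" using s[of "I k"] by (simp add: sol_def sol_at_def)
    have 2: "((M$I k$2) (x$k), (M$I k$1) (x$k)) \<noteq> (0, 0)" using assms(2) by (simp add: row_defined_def)
    have 3: "(X$k, Y$k) \<noteq> (0, 0)" using represents_valid[OF k(2)] by (simp add: valid_def)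
    show ?thesis using 1 2 3 by (auto simp: ratio_def field_simps)
  qed
  then show ?thesis using k(2) by (simp add: represents_def row_ratio_def vec_eq_iff)
qed

lemma F_row_free:
  assumes "M \<in> F"
  obtains I where "M \<in> row_free I"
proof -
  have "\<exists>i. ((M$i$2) (x$k), (M$i$1) (x$k)) \<noteq> (0, 0)" for k
  proof -
    obtain i j where "(M$i$j) (x$k) \<noteq> 0" using F_nonvanishing[OF assms, of k] by blast
    then show ?thesis using exhaust_2[of j] by (intro exI[of _ i]) auto
  qed
  then obtain I where "\<And>k. ((M$I k$2) (x$k), (M$I k$1) (x$k)) \<noteq> (0, 0)" by metis
  then have "M \<in> row_defined I" using F_subset_V_star[OF assms] by (simp add: row_defined_def)
  then have "M \<in> row_free I" using row_ratio_eq_rho_map[OF assms] F_not_Theta4[OF assms] by (simp add: row_free_def)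
  then show ?thesis by (rule that)
qed

text \<open>The kernel coordinates descend to the open part of the quotient where they are read off fixed rows.\<close>

lemma row_quotient_morphism:
  shows "openin (zariski VmodH) (H_orbit ` row_free I)"
    and "fn_space_morphism (subspace_of VmodH (H_orbit ` row_free I)) K4
           (\<lambda>cl. torus_orbit (row_ratio I (SOME M. M \<in> row_free I \<and> H_orbit M = cl)))"
proof -
  have sub: "row_free I \<subseteq> V_star q \<rho> \<sigma>" by (auto simp: row_free_def row_defined_def)
  have pre: "{M \<in> points Vst. H_orbit M \<in> H_orbit ` row_free I} = row_free I"
    unfolding points_Vst
  proof (intro equalityI subsetI)
    fix N assume "N \<in> {M \<in> V_star q \<rho> \<sigma>. H_orbit M \<in> H_orbit ` row_free I}"
    then obtain M where "M \<in> row_free I" "H_orbit M = H_orbit N" by force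
    then show "N \<in> row_free I" by (rule row_free_orbit(1))
  qed (use sub in auto)
  show op: "openin (zariski VmodH) (H_orbit ` row_free I)"
    unfolding V_star_mod_H_def openin_quotient_space pre using openin_row_free sub
    by (simp only: points_Vst image_mono simp_thms)
  let ?\<psi> = "\<lambda>cl. torus_orbit (row_ratio I (SOME M. M \<in> row_free I \<and> H_orbit M = cl))"
  have val: "?\<psi> (H_orbit M) = torus_orbit (row_ratio I M)" if "M \<in> row_free I" for M
  proof -
    let ?N = "SOME N. N \<in> row_free I \<and> H_orbit N = H_orbit M"
    have "?N \<in> row_free I \<and> H_orbit ?N = H_orbit M" by (rule someI[of _ M]) (simp add: that)
    then show ?thesis using row_free_orbit(2)[OF that, of ?N] by simp
  qed
  have pts: "points (subspace_of Vst (row_free I)) = row_free I"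
    using sub by (auto simp: points_subspace_of[of Vst] points_Vst)
  have m: "fn_space_morphism (subspace_of Vst (row_free I)) K4 (\<lambda>M. ?\<psi> (H_orbit M))"
    by (rule fn_space_morphism_cong[OF ringed_space.ringed_subspace[OF ringed_Vst] row_orbit_morphism])
       (simp only: pts val)
  show "fn_space_morphism (subspace_of VmodH (H_orbit ` row_free I)) K4 ?\<psi>"
    unfolding V_star_mod_H_def
    by (rule ringed_space.morphism_from_quotient[OF ringed_Vst op[unfolded V_star_mod_H_def]], unfold pre) (rule m)
qed

lemma phi_morphism_K4: "fn_space_morphism (F_variety q \<rho> \<sigma> x) K4 phi"
proof (rule morphism_local[OF ringed_F ringed_K4])
  fix cl assume "cl \<in> points (F_variety q \<rho> \<sigma> x)"
  then obtain M0 where M0: "M0 \<in> F" "cl = H_orbit M0" unfolding points_F by blast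
  obtain I where I: "M0 \<in> row_free I" by (rule F_row_free[OF M0(1)])
  let ?O = "H_orbit ` row_free I" and ?W = "H_orbit ` row_free I \<inter> H_orbit ` F"
  let ?\<psi> = "\<lambda>cl. torus_orbit (row_ratio I (SOME M. M \<in> row_free I \<and> H_orbit M = cl))"
  have eq1: "subspace_of (F_variety q \<rho> \<sigma> x) ?W = subspace_of VmodH ?W"
    unfolding F_variety_def by (rule ringed_space.subspace_of_subspace[OF ringed_VmodH]) blast
  have eq2: "subspace_of (subspace_of VmodH ?O) ?W = subspace_of VmodH ?W"
    by (rule ringed_space.subspace_of_subspace[OF ringed_VmodH]) blast
  have m: "fn_space_morphism (subspace_of VmodH ?W) K4 ?\<psi>"
    using morphism_restrict[OF ringed_space.ringed_subspace[OF ringed_VmodH] row_quotient_morphism(2)[of I], of ?W]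
    unfolding eq2 .
  have val: "?\<psi> cl = phi cl" if "cl \<in> ?W" for cl
  proof -
    obtain M where M: "M \<in> F" "cl = H_orbit M" using \<open>cl \<in> ?W\<close> by blast
    let ?N = "SOME M. M \<in> row_free I \<and> H_orbit M = cl"
    have "\<exists>N. N \<in> row_free I \<and> H_orbit N = cl" using \<open>cl \<in> ?W\<close> by blast
    then have N: "?N \<in> row_free I \<and> H_orbit ?N = cl" by (rule someI_ex)
    then have "M \<in> row_free I" "torus_orbit (row_ratio I M) = ?\<psi> cl" using row_free_orbit[of ?N I M] M(2) by simp_all
    then show ?thesis using row_ratio_eq_rho_map[OF M(1)] phi_eq[OF M(1)] M(2) by (simp add: row_free_def)
  qed
  have m': "fn_space_morphism (subspace_of VmodH ?W) K4 phi"
    by (rule fn_space_morphism_cong[OF ringed_space.ringed_subspace[OF ringed_VmodH] m])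
       (simp only: points_subspace_of[of VmodH] val IntD2)
  have "openin (zariski (F_variety q \<rho> \<sigma> x)) ?W"
    unfolding F_variety_def openin_subspace_of using row_quotient_morphism(1) by blast
  moreover have "cl \<in> ?W" using I M0 by blast
  ultimately show "\<exists>W. openin (zariski (F_variety q \<rho> \<sigma> x)) W \<and> cl \<in> W \<and>
      fn_space_morphism (subspace_of (F_variety q \<rho> \<sigma> x) W) K4 phi"
    using m' eq1 by (intro exI[of _ ?W]) simp
qed

lemma phi_into_Sstar: "cl \<in> points (F_variety q \<rho> \<sigma> x) \<Longrightarrow> phi cl \<in> Sstar"
  unfolding points_F Sstar_def using phi_eq by auto

lemma phi_morphism_S_star: "fn_space_morphism (F_variety q \<rho> \<sigma> x) (S_star_variety q \<rho> \<sigma> x) phi"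
  unfolding S_star_variety_eq
  by (rule morphism_into_subspace[OF ringed_K4 ringed_F phi_morphism_K4]) (rule phi_into_Sstar)

lemma phi_morphism_S: "fn_space_morphism (F_variety q \<rho> \<sigma> x) (S_variety q \<rho> \<sigma> x) phi"
  unfolding S_variety_def
  by (rule morphism_into_subspace[OF ringed_K4 ringed_F phi_morphism_K4])
     (use phi_into_Sstar Sstar_eq in blast)

lemma phi_inj: "inj_on phi (points (F_variety q \<rho> \<sigma> x))"
  unfolding points_F
proof (rule inj_onI, elim imageE)
  fix cl cl' M N assume *: "phi cl = phi cl'" "cl = H_orbit M" "M \<in> F" "cl' = H_orbit N" "N \<in> F"
  have "torus_orbit (rho_map x M) = torus_orbit (rho_map x N)" using * by (simp add: phi_eq)
  then have "H_orbit M = H_orbit N" by (rule rho_map_injective[OF *(3,5)])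
  then show "cl = cl'" using * by simp
qed

lemma phi_image: "phi ` points (F_variety q \<rho> \<sigma> x) = Sstar"
  unfolding points_F Sstar_def by (simp add: image_image phi_eq)

end

section \<open>The inverse of the kernel coordinate map\<close>

context connection_setting
begin

text \<open>The part of the image seen in one chart where one of the four explicit inverses is defined.\<close>

definition piece :: "4 \<Rightarrow> 4 set \<Rightarrow> 4 \<Rightarrow> 4 \<Rightarrow> (nat \<Rightarrow> complex) set" where
  "piece k e m n = {z \<in> chart_dom k. chart e z \<in> Sstar \<and> soldet m n (Xe e z) (Ye e z) \<noteq> 0}"

definition mat_at :: "4 set \<Rightarrow> 4 \<Rightarrow> 4 \<Rightarrow> (nat \<Rightarrow> complex) \<Rightarrow> fn_matrix" where
  "mat_at e m n z = solmat m n (Xe e z) (Ye e z)"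

lemma piece_open: "openin (zariski (S_star_variety q \<rho> \<sigma> x)) (chart e ` piece k e m n)"
  unfolding S_star_variety_eq piece_def by (rule chart_piece(1)[OF soldet_poly])

lemma piece_iso:
  "inverse_isomorphisms (subspace_of (S_star_variety q \<rho> \<sigma> x) (chart e ` piece k e m n))
     (subspace_of (affine_space 4) (piece k e m n)) (chart_inv k e) (chart e)"
proof -
  have "chart e ` piece k e m n \<subseteq> Sstar" by (auto simp: piece_def)
  then have "subspace_of (S_star_variety q \<rho> \<sigma> x) (chart e ` piece k e m n) = subspace_of K4 (chart e ` piece k e m n)"
    unfolding S_star_variety_eq by (rule ringed_space.subspace_of_subspace[OF ringed_K4])
  then show ?thesis using chart_piece(2)[OF soldet_poly, where k = k and e = e and T = Sstar] by (simp only: piece_def)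
qed

lemma piece_cover:
  assumes "p \<in> Sstar"
  obtains k e m n z where "m \<in> {3, 4}" "n \<in> {3, 4}" "z \<in> piece k e m n" "p = chart e z"
proof -
  obtain M where M: "M \<in> F" "p = torus_orbit (rho_map x M)" using assms unfolding Sstar_def by blast
  obtain k e where "rho_map x M \<in> chart_box k e" by (rule chart_box_cover[OF F_not_Theta4[OF M(1)]])
  then have "p \<in> torus_orbit ` chart_box k e" using M(2) by blast
  then have z: "chart_inv k e p \<in> chart_dom k" "chart e (chart_inv k e p) = p" by (rule chart_chart_inv)+
  have "chart e (chart_inv k e p) \<in> Sstar" using z(2) assms by simp
  then obtain m n where mn: "m \<in> {3, 4}" "n \<in> {3, 4}" "soldet m n (Xe e (chart_inv k e p)) (Ye e (chart_inv k e p)) \<noteq> 0"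
    unfolding chart_in_Sstar_iff[OF z(1)] by blast
  then have "chart_inv k e p \<in> piece k e m n" using z assms by (simp add: piece_def)
  then show ?thesis using that mn(1,2) z(2) by metis
qed

lemma piece_Phi: "z \<in> piece k e m n \<Longrightarrow> Phi_i 1 (Xe e z) (Ye e z) = 0"
  using chart_in_Sstar_iff unfolding piece_def by blast

lemma mat_at_F:
  assumes "z \<in> piece k e m n" "m \<in> {3, 4}" "n \<in> {3, 4}"
  shows "mat_at e m n z \<in> F" "torus_orbit (rho_map x (mat_at e m n z)) = chart e z"
    "kernel_data (mat_at e m n z) (Xe e z) (Ye e z)"
proof -
  have D: "soldet m n (Xe e z) (Ye e z) \<noteq> 0" using assms(1) by (simp add: piece_def)
  note solmat = solmat_in_F[OF represents_chart_pt piece_Phi[OF assms(1)] assms(2,3) D]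
  show "mat_at e m n z \<in> F" "torus_orbit (rho_map x (mat_at e m n z)) = chart e z"
    "kernel_data (mat_at e m n z) (Xe e z) (Ye e z)"
    unfolding mat_at_def chart_def by (simp_all only: solmat)
qed

definition Emat :: "2 \<Rightarrow> 2 \<Rightarrow> (complex \<Rightarrow> complex) \<Rightarrow> fn_matrix" where
  "Emat i j m = (\<chi> i' j'. if i' = i \<and> j' = j then m else (\<lambda>_. 0))"

lemma Emat_V: "m \<in> V i j \<Longrightarrow> Emat i j m \<in> V_set q \<rho> \<sigma>"
  unfolding V_set_iff Emat_def using V_zero by auto

text \<open>The regular functions on the space of matrices are given by abstract linear functionals; in the basis of interpolation
  functions each of them becomes a linear polynomial in the coordinates, which is what regularity of a map into this
  space requires.\<close>

lemma linear_functional_expand: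
  assumes l: "l \<in> linear_functionals (V_set q \<rho> \<sigma>)"
  shows "l (\<chi> i j. (\<lambda>y. \<alpha> i j * b1 i j y + \<beta> i j * b2 i j y)) =
    (\<Sum>i\<in>UNIV. \<Sum>j\<in>UNIV. \<alpha> i j * l (Emat i j (b1 i j)) + \<beta> i j * l (Emat i j (b2 i j)))"
proof -
  let ?k = "\<lambda>i j y. \<alpha> i j * b1 i j y + \<beta> i j * b2 i j y"
  let ?E = "\<lambda>i j. Emat i j (?k i j)"
  let ?cb = "\<lambda>s M t N. (\<chi> i j. (\<lambda>y. s * (M$i$j) y + t * (N$i$j) y)) :: fn_matrix"
  have lin: "l (?cb s M t N) = s * l M + t * l N" if "M \<in> V_set q \<rho> \<sigma>" "N \<in> V_set q \<rho> \<sigma>" for s t M N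
    using l that unfolding linear_functionals_def by blast
  have cbV: "?cb s M t N \<in> V_set q \<rho> \<sigma>" if "M \<in> V_set q \<rho> \<sigma>" "N \<in> V_set q \<rho> \<sigma>" for s t M N
    using that V_combination unfolding V_set_iff by simp
  have kV: "?E i j \<in> V_set q \<rho> \<sigma>" for i j by (intro Emat_V V_combination b12)
  have eE: "?E i j = ?cb (\<alpha> i j) (Emat i j (b1 i j)) (\<beta> i j) (Emat i j (b2 i j))" for i j
    by (simp add: vec_eq_iff Emat_def)
  have lE: "l (?E i j) = \<alpha> i j * l (Emat i j (b1 i j)) + \<beta> i j * l (Emat i j (b2 i j))" for i j
    unfolding eE by (intro lin Emat_V b12)
  have eK: "(\<chi> i j. (\<lambda>y. ?k i j y)) = ?cb 1 (?cb 1 (?E 1 1) 1 (?E 1 2)) 1 (?cb 1 (?E 2 1) 1 (?E 2 2))"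
    by (simp add: vec_eq_iff forall_2 Emat_def)
  have "l (\<chi> i j. (\<lambda>y. ?k i j y)) = (1 * (1 * l (?E 1 1) + 1 * l (?E 1 2))) + (1 * (1 * l (?E 2 1) + 1 * l (?E 2 2)))"
    unfolding eK lin[OF cbV[OF kV kV] cbV[OF kV kV]] lin[OF kV kV] ..
  then show ?thesis unfolding sum_2 lE by simp
qed

lemma mat_at_morphism: "fn_space_morphism (affine_space 4) Vsp (mat_at e m n)"
  unfolding V_space_def
proof (rule morphism_into_algebra_space[OF ringed_affine_space])
  show "mat_at e m n z \<in> V_set q \<rho> \<sigma>" for z by (simp add: V_set_iff mat_at_def solmat_V)
  fix l assume l: "l \<in> linear_functionals (V_set q \<rho> \<sigma>)"
  let ?\<alpha> = "\<lambda>z i j. coef1 i (if i = 1 then m else n) j (Xe e z) (Ye e z)"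
  let ?\<beta> = "\<lambda>z i j. coef2 i (if i = 1 then m else n) j (Xe e z) (Ye e z)"
  have eq: "mat_at e m n z = (\<chi> i j. (\<lambda>y. ?\<alpha> z i j * b1 i j y + ?\<beta> z i j * b2 i j y))" for z
    by (simp add: vec_eq_iff mat_at_def solmat_def solrow_nth)
  have "(\<lambda>z. \<Sum>i\<in>UNIV. \<Sum>j\<in>UNIV. ?\<alpha> z i j * l (Emat i j (b1 i j)) + ?\<beta> z i j * l (Emat i j (b2 i j))) \<in> polynomial_functions 4"
    unfolding sum_2 by (intro polynomial_add polynomial_mult coef_poly polynomial_const)
  then show "regular (affine_space 4) (points (affine_space 4)) (\<lambda>z. l (mat_at e m n z))"
    unfolding eq linear_functional_expand[OF l] by (rule polynomial_regular)
qed

definition phi_inv :: "(proj1^4) set \<Rightarrow> fn_matrix set" where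
  "phi_inv p = H_orbit (SOME M. M \<in> F \<and> torus_orbit (rho_map x M) = p)"

lemma phi_inv_eq:
  assumes "M \<in> F"
  shows "phi_inv (torus_orbit (rho_map x M)) = H_orbit M"
proof -
  let ?N = "SOME N. N \<in> F \<and> torus_orbit (rho_map x N) = torus_orbit (rho_map x M)"
  have "?N \<in> F \<and> torus_orbit (rho_map x ?N) = torus_orbit (rho_map x M)" by (rule someI[of _ M]) (simp add: assms)
  then show ?thesis unfolding phi_inv_def using rho_map_injective[OF _ assms, of ?N] by simp
qed

lemma points_piece: "points (subspace_of (affine_space 4) (piece k e m n)) = piece k e m n"
  by (auto simp: points_subspace_of points_affine_space piece_def chart_dom_def)

lemma mat_at_orbit_morphism:
  assumes "m \<in> {3, 4}" "n \<in> {3, 4}"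
  shows "fn_space_morphism (subspace_of (affine_space 4) (piece k e m n)) (F_variety q \<rho> \<sigma> x) (\<lambda>z. H_orbit (mat_at e m n z))"
proof -
  let ?W = "subspace_of (affine_space 4) (piece k e m n)"
  note rW = ringed_space.ringed_subspace[OF ringed_affine_space, of 4 "piece k e m n"]
  have "fn_space_morphism ?W Vst (mat_at e m n)"
    by (rule morphism_into_subspace[OF ringed_V rW morphism_restrict[OF ringed_affine_space mat_at_morphism]])
       (simp only: points_piece mat_at_F(1)[OF _ assms] F_subset_V_star)
  then have "fn_space_morphism ?W VmodH (\<lambda>z. H_orbit (mat_at e m n z))"
    unfolding V_star_mod_H_def
    by (rule fn_space_morphism_compose[OF _ ringed_space.quotient_projection[OF ringed_Vst]])
  then show ?thesis unfolding F_variety_def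
    by (rule morphism_into_subspace[OF ringed_VmodH rW])
       (simp only: points_piece, rule imageI, rule mat_at_F(1)[OF _ assms])
qed

text \<open>On each piece the inverse is the class of the explicit matrix, which depends polynomially on the chart coordinates.\<close>

lemma phi_inv_morphism: "fn_space_morphism (S_star_variety q \<rho> \<sigma> x) (F_variety q \<rho> \<sigma> x) phi_inv"
proof (rule morphism_local[OF ringed_S_star ringed_F])
  fix p assume "p \<in> points (S_star_variety q \<rho> \<sigma> x)"
  then have "p \<in> Sstar" by (simp add: points_S_star)
  then obtain k e m n z where mn: "m \<in> {3, 4}" "n \<in> {3, 4}" and z: "z \<in> piece k e m n" "p = chart e z" by (rule piece_cover)
  let ?U = "chart e ` piece k e m n"
  let ?S = "subspace_of (S_star_variety q \<rho> \<sigma> x) ?U"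
  have i: "fn_space_morphism ?S (subspace_of (affine_space 4) (piece k e m n)) (chart_inv k e)"
    using piece_iso unfolding inverse_isomorphisms_def by blast
  have m: "fn_space_morphism ?S (F_variety q \<rho> \<sigma> x) (\<lambda>p. H_orbit (mat_at e m n (chart_inv k e p)))"
    by (rule fn_space_morphism_compose[OF i mat_at_orbit_morphism[OF mn]])
  have val: "H_orbit (mat_at e m n (chart_inv k e p)) = phi_inv p" if "p \<in> points ?S" for p
  proof -
    from that obtain z where z: "z \<in> piece k e m n" "p = chart e z" unfolding points_subspace_of by blast
    have "z \<in> chart_dom k" using z(1) by (simp add: piece_def)
    then have "chart_inv k e p = z" unfolding z(2) by (rule chart_inv_chart)
    then show ?thesis using phi_inv_eq[OF mat_at_F(1)[OF z(1) mn]] unfolding mat_at_F(2)[OF z(1) mn] z(2) by simp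
  qed
  have "fn_space_morphism ?S (F_variety q \<rho> \<sigma> x) phi_inv"
    by (rule fn_space_morphism_cong[OF ringed_space.ringed_subspace[OF ringed_S_star] m val])
  then show "\<exists>W. openin (zariski (S_star_variety q \<rho> \<sigma> x)) W \<and> p \<in> W \<and>
      fn_space_morphism (subspace_of (S_star_variety q \<rho> \<sigma> x) W) (F_variety q \<rho> \<sigma> x) phi_inv"
    using piece_open z by (intro exI[of _ ?U] conjI) simp_all
qed

lemma phi_iso: "inverse_isomorphisms (F_variety q \<rho> \<sigma> x) (S_star_variety q \<rho> \<sigma> x) phi phi_inv"
  unfolding inverse_isomorphisms_def
proof (intro conjI ballI phi_morphism_S_star phi_inv_morphism)
  show "phi_inv (phi cl) = cl" if "cl \<in> points (F_variety q \<rho> \<sigma> x)" for cl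
    using that unfolding points_F by (elim imageE) (simp add: phi_eq phi_inv_eq)
  show "phi (phi_inv p) = p" if "p \<in> points (S_star_variety q \<rho> \<sigma> x)" for p
    using that unfolding points_S_star Sstar_def by (elim imageE) (simp add: phi_eq phi_inv_eq)
qed

lemma algebraic_F: "algebraic_variety (F_variety q \<rho> \<sigma> x)"
  by (rule algebraic_variety_iso[OF ringed_F ringed_S_star phi_iso algebraic_S_star])

section \<open>Smoothness\<close>

text \<open>A multihomogeneous form of degree 1 in each pair is affine in each affine coordinate, whichever of the two
  affine charts is used; hence a partial derivative of it is the difference of two values.\<close>

lemma Phi_hom_affine:
  assumes "\<And>k. k \<noteq> l \<Longrightarrow> X'$k = X$k \<and> Y'$k = Y$k \<and> X''$k = X$k \<and> Y''$k = Y$k"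
    and "X$l = (1 - t) * X'$l + t * X''$l" "Y$l = (1 - t) * Y'$l + t * Y''$l"
  shows "Phi_hom A X Y = (1 - t) * Phi_hom A X' Y' + t * Phi_hom A X'' Y''"
proof -
  consider "l = 1" | "l = 2" | "l = 3" | "l = 4" using exhaust_4 by blast
  then show ?thesis
  proof cases
    case 1 then show ?thesis using assms(1)[of 2] assms(1)[of 3] assms(1)[of 4] assms(2,3)
      by (simp add: Phi_hom_def) (simp add: algebra_simps)
  next
    case 2 then show ?thesis using assms(1)[of 1] assms(1)[of 3] assms(1)[of 4] assms(2,3)
      by (simp add: Phi_hom_def) (simp add: algebra_simps)
  next
    case 3 then show ?thesis using assms(1)[of 1] assms(1)[of 2] assms(1)[of 4] assms(2,3)
      by (simp add: Phi_hom_def) (simp add: algebra_simps)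
  next
    case 4 then show ?thesis using assms(1)[of 1] assms(1)[of 2] assms(1)[of 3] assms(2,3)
      by (simp add: Phi_hom_def) (simp add: algebra_simps)
  qed
qed

abbreviation Phi_at :: "4 set \<Rightarrow> (nat \<Rightarrow> complex) \<Rightarrow> complex" where
  "Phi_at e z \<equiv> Phi_i 1 (Xe e z) (Ye e z)"

lemma Xe_upd: "k \<noteq> l \<Longrightarrow> Xe e (z(idx l := t)) $ k = Xe e z $ k" "k \<noteq> l \<Longrightarrow> Ye e (z(idx l := t)) $ k = Ye e z $ k"
  by (simp_all add: Xe_def Ye_def)

lemma Phi_at_affine: "Phi_at e (z(idx l := t)) = (1 - t) * Phi_at e (z(idx l := 0)) + t * Phi_at e (z(idx l := 1))"
  unfolding Phi_hom_eq[symmetric]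
  by (rule Phi_hom_affine[of l]) (simp_all add: Xe_def Ye_def)

lemma Phi_at_deriv: "deriv (\<lambda>t. Phi_at e (z(idx l := t))) s = Phi_at e (z(idx l := 1)) - Phi_at e (z(idx l := 0))"
proof -
  let ?a = "Phi_at e (z(idx l := 0))" and ?b = "Phi_at e (z(idx l := 1))"
  have "((\<lambda>t. (1 - t) * ?a + t * ?b) has_field_derivative (?b - ?a)) (at s)"
    by (auto intro!: derivative_eq_intros)
  moreover have "(\<lambda>t. Phi_at e (z(idx l := t))) = (\<lambda>t. (1 - t) * ?a + t * ?b)" by (rule ext) (rule Phi_at_affine)
  ultimately show ?thesis by (simp only: DERIV_imp_deriv)
qed

text \<open>Each of the two rows of the matrix vanishes at no more than one of the four points, so among the three indices
  \<open>l \<noteq> k\<close> there is one for which neither row vanishes at \<open>x\<^sub>l\<close>. The line in that direction is not contained in the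
  hypersurface, and as \<open>\<Phi>\<close> is affine on the line, its derivative there is not 0.\<close>

lemma transversal_direction:
  assumes z: "z \<in> piece k e m n" and mn: "m \<in> {3, 4}" "n \<in> {3, 4}"
  obtains l where "l \<noteq> k" "deriv (\<lambda>t. Phi_at e (z(idx l := t))) (z (idx l)) \<noteq> 0"
proof -
  let ?M = "mat_at e m n z" and ?X = "Xe e z" and ?Y = "Ye e z"
  have M: "?M \<in> F" "kernel_data ?M ?X ?Y" by (rule mat_at_F[OF z mn])+
  have v: "valid ?X ?Y" and s: "sol 1 ?X ?Y (?M$1)" "sol 2 ?X ?Y (?M$2)" using M(2) by (simp_all add: kernel_data_def)
  have zk: "z \<in> chart_dom k" using z by (simp add: piece_def)
  have MV: "?M$i$j \<in> V i j" for i j using M(1) by (simp add: F_set_iff)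
  have ne: "?M$i \<noteq> (\<chi> j. (\<lambda>z. 0))" for i
  proof -
    have "?M$i$1 \<noteq> (\<lambda>z. 0)" using F_subset_V_star[OF M(1)] by (simp add: V_star_iff)
    then show ?thesis by (auto simp: vec_eq_iff)
  qed
  let ?bad = "\<lambda>i l. (?M$i$1) (x$l) = 0 \<and> (?M$i$2) (x$l) = 0"
  have uniq: "l = l'" if "?bad i l" "?bad i l'" for i l l'
    by (rule row_zero_unique[where f = "?M$i" and i = i, OF MV ne]) (use that in simp_all)
  have "\<exists>l. l \<noteq> k \<and> \<not> ?bad 1 l \<and> \<not> ?bad 2 l"
  proof (rule ccontr)
    assume "\<not> ?thesis"
    then have all: "l = k \<or> ?bad 1 l \<or> ?bad 2 l" for l by blast
    \<comment> \<open>by \<open>uniq\<close> the excluded indices are \<open>k\<close> and at most one for each row, so at most three of the four\<close>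
    define B where "B i = {l. ?bad i l}" for i :: 2
    have B: "card (B i) \<le> 1" for i unfolding card_le_Suc0_iff_eq[OF finite] One_nat_def B_def using uniq by blast
    have "UNIV \<subseteq> {k} \<union> (B 1 \<union> B 2)" using all unfolding B_def by blast
    then have "card (UNIV :: 4 set) \<le> card ({k} \<union> (B 1 \<union> B 2))" by (rule card_mono[OF finite])
    also have "\<dots> \<le> card {k} + (card (B 1) + card (B 2))"
      by (rule order_trans[OF card_Un_le]) (intro add_left_mono card_Un_le)
    also have "\<dots> \<le> 3" using B[of 1] B[of 2] by simp
    finally show False by simp
  qed
  then obtain l where l: "l \<noteq> k" "\<not> ?bad 1 l" "\<not> ?bad 2 l" by blast
  have "Phi_at e (z(idx l := 1)) - Phi_at e (z(idx l := 0)) \<noteq> 0"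
  proof
    assume eq: "Phi_at e (z(idx l := 1)) - Phi_at e (z(idx l := 0)) = 0"
    have const: "Phi_at e (z(idx l := t)) = Phi_at e (z(idx l := 0))" for t
      using Phi_at_affine[of e z l t] eq by (simp add: algebra_simps)
    have "Phi_at e z = 0" by (rule piece_Phi[OF z])
    moreover have "z(idx l := z (idx l)) = z" by simp
    ultimately have zero: "Phi_at e (z(idx l := t)) = 0" for t using const[of t] const[of "z (idx l)"] by simp
    \<comment> \<open>any other point of the line would do\<close>
    let ?t = "z (idx l) + 1"
    let ?X' = "Xe e (z(idx l := ?t))" and ?Y' = "Ye e (z(idx l := ?t))"
    have v': "valid ?X' ?Y'" using represents_valid[OF represents_chart_pt] .
    have "?X'$l * ?Y$l = ?X$l * ?Y'$l"
      by (rule line_not_in_hypersurface[OF v chart_nonfixed[OF zk] s(1) ne s(2) _ _ v' _ zero])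
         (use l in \<open>auto simp: Xe_upd\<close>)
    then show False by (cases "l \<in> e") (simp_all add: Xe_def Ye_def)
  qed
  then have "deriv (\<lambda>t. Phi_at e (z(idx l := t))) (z (idx l)) \<noteq> 0" unfolding Phi_at_deriv .
  then show ?thesis by (rule that[OF l(1)])
qed

text \<open>A piece is given in affine four-space by the two equations \<open>z\<^sub>k = 1\<close> and \<open>\<Phi> = 0\<close>. The first differential is the
  \<open>k\<close>-th coordinate; the second has a nonzero component in a direction \<open>l \<noteq> k\<close>.\<close>

lemma smooth_S_star_point:
  assumes "p \<in> Sstar"
  shows "smooth_at_point (S_star_variety q \<rho> \<sigma> x) p"
proof -
  from assms obtain k e m n z where mn: "m \<in> {3, 4}" "n \<in> {3, 4}" and z: "z \<in> piece k e m n" "p = chart e z" by (rule piece_cover)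
  let ?f = "\<lambda>i::nat. if i = 0 then (\<lambda>z. z (idx k) - 1) else (\<lambda>z. Phi_at e z)"
  let ?W = "{z \<in> points (affine_space 4). soldet m n (Xe e z) (Ye e z) \<noteq> 0}"
  let ?U = "chart e ` piece k e m n"
  have zk: "z \<in> chart_dom k" using z by (simp add: piece_def)
  have W: "{z \<in> ?W. \<forall>i<2. ?f i z = 0} = piece k e m n"
  proof (intro equalityI subsetI)
    fix w assume w: "w \<in> {z \<in> ?W. \<forall>i<2. ?f i z = 0}"
    then have f: "?f i w = 0" if "i < 2" for i using that by blast
    have d: "w \<in> chart_dom k" using w f[of 0] by (simp add: chart_dom_def points_affine_space)
    have P: "Phi_at e w = 0" using f[of 1] by simp
    have "soldet m n (Xe e w) (Ye e w) \<noteq> 0" using w by simp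
    then show "w \<in> piece k e m n" unfolding piece_def mem_Collect_eq chart_in_Sstar_iff[OF d] using d P mn by blast
  next
    fix w assume w: "w \<in> piece k e m n"
    then show "w \<in> {z \<in> ?W. \<forall>i<2. ?f i z = 0}" using piece_Phi[OF w] by (simp add: piece_def chart_dom_def points_affine_space)
  qed
  have \<phi>: "chart_inv k e p = z" unfolding z(2) by (rule chart_inv_chart[OF zk])
  obtain l where l: "l \<noteq> k" "deriv (\<lambda>t. Phi_at e (z(idx l := t))) (z (idx l)) \<noteq> 0" by (rule transversal_direction[OF z(1) mn])
  have jac: "\<forall>i<2. a i = 0"
    if a: "\<forall>j<4. (\<Sum>i<2. a i * deriv (\<lambda>t. ?f i (z(j := t))) (z j)) = 0" for a :: "nat \<Rightarrow> complex"
  proof -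
    have s: "a 0 * deriv (\<lambda>t. (z(j := t)) (idx k) - 1) (z j) + a 1 * deriv (\<lambda>t. Phi_at e (z(j := t))) (z j) = 0" if "j < 4" for j
      using a[rule_format, OF that] by (simp add: numeral_2_eq_2)
    have dl: "deriv (\<lambda>t. (z(idx l := t)) (idx k) - 1) (z (idx l)) = 0" using l(1) by simp
    have dk: "deriv (\<lambda>t. (z(idx k := t)) (idx k) - 1) (z (idx k)) = 1"
      by (rule DERIV_imp_deriv) (auto intro!: derivative_eq_intros)
    have "a 1 = 0" using s[of "idx l"] dl l(2) by simp
    moreover have "a 0 = 0" using s[of "idx k"] dk \<open>a 1 = 0\<close> by simp
    ultimately show ?thesis by (auto simp: less_2_cases_iff)
  qed
  show ?thesis unfolding smooth_at_point_def
  proof (rule exI[of _ ?U], rule exI[of _ 4], rule exI[of _ 2], rule exI[of _ ?W], rule exI[of _ ?f], rule exI[of _ "chart_inv k e"],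
      intro conjI piece_open)
    show "p \<in> ?U" using z by blast
    show "openin (zariski (affine_space 4)) ?W" by (rule openin_polynomial_nonzero[OF soldet_poly])
    show "\<forall>i<2. ?f i \<in> polynomial_functions 4"
      by (simp add: Phi_poly polynomial_diff polynomial_coord polynomial_const)
    show "fn_space_isomorphism (subspace_of (S_star_variety q \<rho> \<sigma> x) ?U)
        (subspace_of (affine_space 4) {z \<in> ?W. \<forall>i<2. ?f i z = 0}) (chart_inv k e)"
      unfolding W fn_space_isomorphism_iff by (rule exI, rule piece_iso)
    show "\<forall>a :: nat \<Rightarrow> complex. (\<forall>j<4. (\<Sum>i<2. a i * deriv (\<lambda>t. ?f i ((chart_inv k e p)(j := t))) (chart_inv k e p j)) = 0)
        \<longrightarrow> (\<forall>i<2. a i = 0)"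
      unfolding \<phi> by (rule allI, rule impI, rule jac)
  qed
qed

lemma smooth_F: "smooth_variety (F_variety q \<rho> \<sigma> x)"
  unfolding smooth_variety_def
proof (intro conjI ballI algebraic_F)
  fix cl assume cl: "cl \<in> points (F_variety q \<rho> \<sigma> x)"
  show "smooth_at_point (F_variety q \<rho> \<sigma> x) cl"
    by (rule smooth_at_point_iso[OF ringed_F ringed_S_star phi_iso cl smooth_S_star_point[OF phi_into_Sstar[OF cl]]])
qed

end

section \<open>Separatedness\<close>

text \<open>Corresponding entries of two matrices in one orbit are proportional, with factors \<open>c\<^sub>i\<^sub>j\<close> of the form
  \<open>\<gamma>\<^sub>i / \<delta>\<^sub>j\<close>, that is, \<open>c\<^sub>1\<^sub>1 c\<^sub>2\<^sub>2 = c\<^sub>1\<^sub>2 c\<^sub>2\<^sub>1\<close>. Both properties can be tested by functions that are polynomial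
  in values of entries, so that they define closed sets; this is the source of separatedness.\<close>

inductive_set orbit_tests :: "(fn_matrix \<Rightarrow> fn_matrix \<Rightarrow> complex) set" where
  minor: "(\<lambda>M N. (M$i$j) y * (N$i$j) y' - (M$i$j) y' * (N$i$j) y) \<in> orbit_tests"
| cross: "(\<lambda>M N. (N$1$1) y1 * (N$2$2) y2 * ((M$1$2) y3 * (M$2$1) y4) - (M$1$1) y1 * (M$2$2) y2 * ((N$1$2) y3 * (N$2$1) y4)) \<in> orbit_tests"

lemma orbit_tests_vanish:
  assumes "h \<in> orbit_tests" "H_orbit M = H_orbit N"
  shows "h M N = 0"
proof -
  obtain \<gamma> \<delta> where g: "\<gamma> \<in> units2" "\<delta> \<in> units2" "N = rescale \<gamma> \<delta> M" by (rule H_orbit_eqD[OF assms(2)])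
  from assms(1) show ?thesis unfolding g(3) by cases (simp_all add: rescale_nth)
qed

lemma orbit_tests_complete:
  assumes nz: "\<And>i j. M$i$j \<noteq> (\<lambda>_. 0)" "\<And>i j. N$i$j \<noteq> (\<lambda>_. 0)"
    and tests: "\<And>h. h \<in> orbit_tests \<Longrightarrow> h M N = 0"
  shows "H_orbit M = H_orbit N"
proof -
  have "\<exists>y. (M$i$j) y \<noteq> 0" for i j using nz(1)[of i j] by auto
  then obtain y where y: "\<And>i j. (M$i$j) (y i j) \<noteq> 0" by metis
  \<comment> \<open>the proportionality factors\<close>
  define r where "r i j = (N$i$j) (y i j) / (M$i$j) (y i j)" for i j
  have N: "(N$i$j) z = r i j * (M$i$j) z" for i j z
    using tests[OF orbit_tests.minor[of i j "y i j" z]] y[of i j] by (simp add: r_def field_simps)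
  have r: "r i j \<noteq> 0" for i j
  proof
    assume "r i j = 0"
    then have "N$i$j = (\<lambda>_. 0)" using N by auto
    then show False using nz(2) by blast
  qed
  have "r 1 1 * r 2 2 = r 1 2 * r 2 1"
    using tests[OF orbit_tests.cross[of "y 1 1" "y 2 2" "y 1 2" "y 2 1"]] y unfolding N by (simp add: mult_ac)
  then have "N = rescale (\<chi> i. r i 1) (\<chi> j. if j = 1 then 1 else r 1 1 / r 1 2) M"
    using r by (simp add: vec_eq_iff forall_2 fun_eq_iff N rescale_nth field_simps)
  moreover have "(\<chi> i. r i 1) \<in> units2" "(\<chi> j. if j = 1 then 1 else r 1 1 / r 1 2) \<in> units2"
    using r by (simp_all add: units2_def)
  ultimately show ?thesis using H_orbit_rescale by metis
qed

lemma generated_algebra_diff: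
  assumes "f \<in> generated_algebra G" "g \<in> generated_algebra G"
  shows "(\<lambda>x. f x - g x) \<in> generated_algebra G"
  using generated_algebra.add[OF assms(1) generated_algebra.mult[OF generated_algebra.const[of "- 1"] assms(2)]] by simp

lemma orbit_tests_box_function:
  fixes A B :: "'a \<Rightarrow> fn_matrix" and U :: "2 \<Rightarrow> 'a set"
  assumes "h \<in> orbit_tests" and A: "\<And>i j y. regular X (U 1) (\<lambda>p. (A p$i$j) y)" and B: "\<And>i j y. regular X (U 2) (\<lambda>p. (B p$i$j) y)"
  shows "(\<lambda>d. h (A (d$1)) (B (d$2))) \<in> box_functions X U"
proof -
  have a: "(\<lambda>d. (A (d$1)$i$j) y) \<in> generated_algebra {(\<lambda>x. f (x$i)) | i f. regular X (U i) f}" for i j y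
    by (rule generated_algebra.gen, rule CollectI, rule exI[of _ 1], rule exI[of _ "\<lambda>p. (A p$i$j) y"]) (simp add: A)
  have b: "(\<lambda>d. (B (d$2)$i$j) y) \<in> generated_algebra {(\<lambda>x. f (x$i)) | i f. regular X (U i) f}" for i j y
    by (rule generated_algebra.gen, rule CollectI, rule exI[of _ 2], rule exI[of _ "\<lambda>p. (B p$i$j) y"]) (simp add: B)
  from assms(1) show ?thesis unfolding box_functions_def
    by cases (simp_all only:, (intro generated_algebra_diff generated_algebra.mult a b)+)
qed

context connection_setting
begin

lemma piece_subset: "chart e ` piece k e m n \<subseteq> Sstar"
  by (auto simp: piece_def)

lemma regular_lift:
  "regular (S_star_variety q \<rho> \<sigma> x) (chart e ` piece k e m n) (\<lambda>p. (mat_at e m n (chart_inv k e p) $ i $ j) y)"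
proof -
  let ?U = "chart e ` piece k e m n" and ?D = "piece k e m n"
  have "(\<lambda>z. (mat_at e m n z $ i $ j) y) \<in> polynomial_functions 4"
    by (simp add: mat_at_def solmat_def solrow_poly)
  then have "regular (subspace_of (affine_space 4) ?D) (points (affine_space 4) \<inter> ?D) (\<lambda>z. (mat_at e m n z $ i $ j) y)"
    by (intro ringed_space.regular_restrict_subspace[OF ringed_affine_space] polynomial_regular)
  then have r: "regular (subspace_of (affine_space 4) ?D) ?D (\<lambda>z. (mat_at e m n z $ i $ j) y)"
    using points_piece[of k e m n] by (simp add: points_subspace_of)
  have i: "fn_space_morphism (subspace_of (S_star_variety q \<rho> \<sigma> x) ?U) (subspace_of (affine_space 4) ?D) (chart_inv k e)"
    using piece_iso unfolding inverse_isomorphisms_def by blast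
  have pts: "points (subspace_of (S_star_variety q \<rho> \<sigma> x) ?U) = ?U"
    using piece_subset[of e k m n] unfolding points_subspace_of points_S_star by blast
  have "chart_inv k e p \<in> ?D" if "p \<in> ?U" for p
    using fn_space_morphism_into[OF i, of p] that unfolding pts points_piece by blast
  then have "{p \<in> points (subspace_of (S_star_variety q \<rho> \<sigma> x) ?U). chart_inv k e p \<in> ?D} = ?U" unfolding pts by blast
  then have "regular (subspace_of (S_star_variety q \<rho> \<sigma> x) ?U) ?U (\<lambda>p. (mat_at e m n (chart_inv k e p) $ i $ j) y)"
    using fn_space_morphism_regular[OF i r] by simp
  then show ?thesis unfolding ringed_space.regular_open_subspace[OF ringed_S_star piece_open] by blast
qed

lemma lift_F:
  assumes "p \<in> chart e ` piece k e m n" "m \<in> {3, 4}" "n \<in> {3, 4}"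
  shows "mat_at e m n (chart_inv k e p) \<in> F" "torus_orbit (rho_map x (mat_at e m n (chart_inv k e p))) = p"
proof -
  obtain z where z: "z \<in> piece k e m n" "p = chart e z" using assms(1) by blast
  have "chart_inv k e p = z" unfolding z(2) by (rule chart_inv_chart[of z k]) (use z(1) in \<open>simp add: piece_def\<close>)
  then show "mat_at e m n (chart_inv k e p) \<in> F" "torus_orbit (rho_map x (mat_at e m n (chart_inv k e p))) = p"
    using mat_at_F(1,2)[OF z(1) assms(2,3)] z(2) by simp_all
qed

text \<open>Two distinct points are lifted to explicit matrices on open pieces. The matrices lie in different orbits, so some test
  separates them; it gives a regular function on the product of the pieces that is not 0 at the given pair and vanishes
  on the diagonal.\<close>

lemma separated_S_star: "separated_variety (S_star_variety q \<rho> \<sigma> x)"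
proof -
  let ?S = "S_star_variety q \<rho> \<sigma> x"
  let ?P = "power_space ?S :: ((proj1^4) set ^2) fn_space"
  let ?\<Delta> = "{d :: (proj1^4) set ^2. d$1 \<in> points ?S \<and> d$2 = d$1}"
  have pts: "points ?P = {d. \<forall>i. d$i \<in> Sstar}" unfolding points_power_space[OF ringed_S_star] points_S_star ..
  have rP: "ringed_space ?P" by (rule ringed_power_space[OF ringed_S_star])
  have "openin (zariski ?P) (points ?P - ?\<Delta>)"
  proof (subst openin_subopen, intro ballI)
    fix d assume d: "d \<in> points ?P - ?\<Delta>"
    then have dS: "d$1 \<in> Sstar" "d$2 \<in> Sstar" and ne: "d$1 \<noteq> d$2" unfolding pts points_S_star by auto
    obtain k e m n z where 1: "m \<in> {3, 4}" "n \<in> {3, 4}" "z \<in> piece k e m n" "d$1 = chart e z" by (rule piece_cover[OF dS(1)])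
    obtain k' e' m' n' z' where 2: "m' \<in> {3, 4}" "n' \<in> {3, 4}" "z' \<in> piece k' e' m' n'" "d$2 = chart e' z'" by (rule piece_cover[OF dS(2)])
    let ?U = "\<lambda>i::2. if i = 1 then chart e ` piece k e m n else chart e' ` piece k' e' m' n'"
    let ?A = "\<lambda>p. mat_at e m n (chart_inv k e p)" and ?B = "\<lambda>p. mat_at e' m' n' (chart_inv k' e' p)"
    have dU: "d$1 \<in> ?U 1" "d$2 \<in> ?U 2" using 1 2 by auto
    have A: "?A p \<in> F" "torus_orbit (rho_map x (?A p)) = p" if "p \<in> ?U 1" for p
      using lift_F[OF _ 1(1,2), of p e k] that by simp_all
    have B: "?B p \<in> F" "torus_orbit (rho_map x (?B p)) = p" if "p \<in> ?U 2" for p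
      using lift_F[OF _ 2(1,2), of p e' k'] that by simp_all
    have orb: "H_orbit (?A (d$1)) \<noteq> H_orbit (?B (d$2))"
      using rho_map_well_defined[OF A(1)[OF dU(1)]] A(2)[OF dU(1)] B(2)[OF dU(2)] ne by metis
    have star: "?A (d$1) $ i $ j \<noteq> (\<lambda>_. 0)" "?B (d$2) $ i $ j \<noteq> (\<lambda>_. 0)" for i j
      using F_subset_V_star[OF A(1)[OF dU(1)]] F_subset_V_star[OF B(1)[OF dU(2)]] by (simp_all add: V_star_iff)
    have "\<exists>h. h \<in> orbit_tests \<and> h (?A (d$1)) (?B (d$2)) \<noteq> 0"
    proof (rule ccontr)
      assume "\<not> ?thesis"
      then have "h (?A (d$1)) (?B (d$2)) = 0" if "h \<in> orbit_tests" for h using that by blast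
      then show False using orbit_tests_complete[OF star] orb by blast
    qed
    then obtain h where h: "h \<in> orbit_tests" "h (?A (d$1)) (?B (d$2)) \<noteq> 0" by (elim exE conjE)
    let ?h = "\<lambda>d :: (proj1^4) set ^2. h (?A (d$1)) (?B (d$2))"
    have box: "?h \<in> box_functions ?S ?U"
      by (rule orbit_tests_box_function[OF h(1)]) (simp_all add: regular_lift)
    have oU: "openin (zariski ?S) (?U i)" for i by (simp add: piece_open)
    let ?T = "{d \<in> {d. \<forall>i. d$i \<in> ?U i}. ?h d \<noteq> 0}"
    have T: "openin (zariski ?P) ?T"
      by (rule ringed_space.nonzero_open[OF rP regular_box_function[OF ringed_S_star oU box]])
    have "d \<in> ?T" using dU h(2) by (simp add: forall_2)
    moreover have "?T \<subseteq> points ?P - ?\<Delta>"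
    proof
      fix d' assume d': "d' \<in> ?T"
      have "d' \<in> points ?P" using openin_subset[OF T] d' by blast
      moreover have "d' \<notin> ?\<Delta>"
      proof
        assume "d' \<in> ?\<Delta>"
        then have eq: "d'$2 = d'$1" by simp
        have all: "d'$i \<in> ?U i" for i using d' by blast
        have u: "d'$1 \<in> ?U 1" "d'$1 \<in> ?U 2" using all[of 1] all[of 2] unfolding eq .
        have "torus_orbit (rho_map x (?A (d'$1))) = torus_orbit (rho_map x (?B (d'$1)))"
          unfolding A(2)[OF u(1)] B(2)[OF u(2)] ..
        then have "H_orbit (?A (d'$1)) = H_orbit (?B (d'$1))" by (rule rho_map_injective[OF A(1)[OF u(1)] B(1)[OF u(2)]])
        then have "?h d' = 0" unfolding eq by (rule orbit_tests_vanish[OF h(1)])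
        then show False using d' by blast
      qed
      ultimately show "d' \<in> points ?P - ?\<Delta>" by blast
    qed
    ultimately show "\<exists>T. openin (zariski ?P) T \<and> d \<in> T \<and> T \<subseteq> points ?P - ?\<Delta>" using T by (intro exI[of _ ?T] conjI)
  qed
  moreover have "?\<Delta> \<subseteq> points ?P" unfolding pts points_S_star by (auto simp: forall_2)
  ultimately show ?thesis unfolding separated_variety_def closedin_def using algebraic_S_star by blast
qed

end

theorem theorem5p5:
  fixes q :: complex and \<rho> \<sigma> :: "complex^2" and x :: "complex^4"
  assumes q: "q \<noteq> 0" "cmod q < 1"
    and nonzero: "\<And>i. \<rho>$i \<noteq> 0" "\<And>j. \<sigma>$j \<noteq> 0" "\<And>k. x$k \<noteq> 0"
    and FR: "x$1 * x$2 * x$3 * x$4 = (\<rho>$1 * \<rho>$2) / (\<sigma>$1 * \<sigma>$2)"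
    and NR: "\<not> q_equiv q (\<rho>$1) (\<rho>$2)" "\<not> q_equiv q (\<sigma>$1) (\<sigma>$2)"
      "\<And>k l. k \<noteq> l \<Longrightarrow> \<not> q_equiv q (x$k) (x$l)"
    and NS: "\<And>i j k l. k \<noteq> l \<Longrightarrow> \<not> q_equiv q (\<rho>$i / \<sigma>$j) (x$k * x$l)"
  shows "(\<exists>\<phi>. (\<forall>M\<in>F_set q \<rho> \<sigma> x. \<phi> (H_orbit M) = torus_orbit (rho_map x M)) \<and>
            variety_morphism (F_variety q \<rho> \<sigma> x) (S_variety q \<rho> \<sigma> x) \<phi> \<and>
            inj_on \<phi> (points (F_variety q \<rho> \<sigma> x)) \<and>
            bij_betw \<phi> (points (F_variety q \<rho> \<sigma> x)) (points (S_star_variety q \<rho> \<sigma> x)) \<and>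
            variety_isomorphism (F_variety q \<rho> \<sigma> x) (S_star_variety q \<rho> \<sigma> x) \<phi>) \<and>
         smooth_variety (F_variety q \<rho> \<sigma> x) \<and>
         separated_variety (S_star_variety q \<rho> \<sigma> x)"
proof -
  have th: "theta q" using q by (simp add: theta_def)
  have eqv: "q_equiv q s t \<longleftrightarrow> theta.qtriv q (s / t)" for s t
    by (simp add: q_equiv_def theta.qtriv_def[OF th])
  interpret connection_setting q \<rho> \<sigma> x
    using th nonzero FR NR NS unfolding eqv by (intro connection_setting.intro connection_setting_axioms.intro)
  have iso: "variety_isomorphism (F_variety q \<rho> \<sigma> x) (S_star_variety q \<rho> \<sigma> x) phi"
    unfolding variety_isomorphism_def fn_space_isomorphism_iff using algebraic_F algebraic_S_star phi_iso by blast
  have mor: "variety_morphism (F_variety q \<rho> \<sigma> x) (S_variety q \<rho> \<sigma> x) phi"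
    unfolding variety_morphism_def using algebraic_F algebraic_S phi_morphism_S by blast
  have bij: "bij_betw phi (points (F_variety q \<rho> \<sigma> x)) (points (S_star_variety q \<rho> \<sigma> x))"
    unfolding points_S_star by (rule bij_betw_imageI[OF phi_inj phi_image])
  show ?thesis
    by (intro conjI exI[of _ phi] ballI phi_eq mor phi_inj bij iso smooth_F separated_S_star)
qed

end
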